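(* Let $n\geq 2$, let $c_0,c_1\in\operatorname{Graph}^n$, and let ${\mathcal{A}}\in\{0,1\}^{2K\times 2K}$ be the adjacency matrix of $c_0$. Let $\bar G^n$ be the scale invariant metric on $\operatorname{Graph}^n({\mathcal{A}})$, and assume the reproducing kernel Hilbert space $\mathcal{H}$ defining the varifold norm $\|\cdot\|_{\mathcal{V}}$ is continuously embedded into $C_0^1(\mathbb{R}^d\times S^{d-1})$. Let $\lambda>0$. Then the infimum \[ \inf\left\{\int_0^1 \bar G^n_{c(t)}(\partial_t c(t),\partial_t c(t))\,dt+\lambda\|\mu_{c(1)}-\mu_{c_1}\|_{\mathcal{V}}^2\right\}, \] taken over all paths $c(\cdot)\in H^1([0,1],\operatorname{Graph}^n({\mathcal{A}}))$ with $c(0)=c_0$, is achieved by some path $c(\cdot)\in H^1([0,1],\operatorname{Graph}^n({\mathcal{A}}))$.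
   Context: For $r>3/2$, $\operatorname{Imm}^r([0,1],\mathbb{R}^d)$ is the set of $c\in H^r([0,1],\mathbb{R}^d)$ with $\partial_\theta c(\theta)\neq0$ for all $\theta$. For such $c$: $ds=|\partial_\theta c|\,d\theta$, $\partial_s=|\partial_\theta c|^{-1}\partial_\theta$, $\ell_c=\int_0^1 ds$. Scale invariant Sobolev metric of order $n$ on curves: $G^n_c(h,h)=\sum_{i=0}^n a_i\ell_c^{2i-3}\int_0^1\langle\partial_s^ih,\partial_s^ih\rangle ds$, fixed $a_i>0$. Shape graphs: given $K\ge1$ and ${\mathcal{A}}\in\{0,1\}^{2K\times2K}$, $\operatorname{Graph}^r({\mathcal{A}})$ is the set of $c=(c^1,\dots,c^K)\in\prod_{k=1}^K\operatorname{Imm}^r([0,1],\mathbb{R}^d)$ with $c^k(0)=c^l(0)$ whenever ${\mathcal{A}}_{2k-1,2l-1}=1$, $c^k(1)=c^l(1)$ whenever ${\mathcal{A}}_{2k,2l}=1$, $c^k(0)=c^l(1)$ whenever ${\mathcal{A}}_{2k-1,2l}=1$; its tangent spaces consist of $h\in\prod_k H^r([0,1],\mathbb{R}^d)$ with the same linear constraints. $\operatorname{Graph}^r$ is the union of $\operatorname{Graph}^r({\mathcal{A}})$ over all $K$ and ${\mathcal{A}}$; "the adjacency matrix of $c_0$" refers to the ${\mathcal{A}}$ with $c_0\in\operatorname{Graph}^n({\mathcal{A}})$ encoding its component structure. The metric on $\operatorname{Graph}^n({\mathcal{A}})$ is $\bar G^n_c(h,h)=\sum_{k=1}^K G^n_{c^k}(h^k,h^k)$.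 $H^1([0,1],\operatorname{Graph}^n({\mathcal{A}}))$ denotes paths in $\prod_k H^1([0,1],H^n([0,1],\mathbb{R}^d))$ taking values in $\operatorname{Graph}^n({\mathcal{A}})$. Varifolds: let $\mathcal{K}$ be a positive definite kernel on $\mathbb{R}^d\times S^{d-1}$ with RKHS $\mathcal{H}$, and $C_0^1(\mathbb{R}^d\times S^{d-1})$ the space of $C^1$ functions vanishing at infinity with their first derivatives, normed by $\|\omega\|_{1,\infty}=\|\omega\|_\infty+\|d\omega\|_\infty$. For a finite signed Radon measure $\mu$ on $\mathbb{R}^d\times S^{d-1}$, $\|\mu\|_{\mathcal{V}}=\sup_{\omega\in\mathcal{H},\|\omega\|_{\mathcal{H}}\le1}(\mu|\omega)$, where $(\mu|\omega)=\int\omega\,d\mu$. For a shape graph $c=(c^1,\dots,c^K)$ (any number of components), $\mu_c$ is the measure with $(\mu_c|\omega)=\sum_{k=1}^K\int_0^1\omega\big(c^k(\theta),\partial_\theta c^k(\theta)/|\partial_\theta c^k(\theta)|\big)|\partial_\theta c^k(\theta)|\,d\theta$. *)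

theory Defs
  imports "HOL-Analysis.Analysis"
begin

text \<open>D is a chain of (weak) derivatives: D 0 = f on [0,1], each D k (k<n) is the
  indefinite integral of D (Suc k), and D n is square integrable.  This is H^n = W^{n,2}.\<close>
definition hn_chain :: "nat \<Rightarrow> (real \<Rightarrow> 'a::euclidean_space) \<Rightarrow> (nat \<Rightarrow> real \<Rightarrow> 'a) \<Rightarrow> bool" where
  "hn_chain n f D \<longleftrightarrow>
     (\<forall>\<theta>\<in>{0..1}. D 0 \<theta> = f \<theta>) \<and>
     (\<forall>k<n. set_integrable lborel {0..1} (D (Suc k)) \<and>
        (\<forall>\<theta>\<in>{0..1}. D k \<theta> = D k 0 + set_lebesgue_integral lborel {0..\<theta>} (D (Suc k)))) \<and>
     set_integrable lborel {0..1} (\<lambda>s. (norm (D n s))\<^sup>2)"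

definition sobolev :: "nat \<Rightarrow> (real \<Rightarrow> 'a::euclidean_space) \<Rightarrow> bool" where
  "sobolev n f \<longleftrightarrow> (\<exists>D. hn_chain n f D)"

definition imm :: "nat \<Rightarrow> (real \<Rightarrow> 'a::euclidean_space) \<Rightarrow> bool" where
  "imm n f \<longleftrightarrow> (\<exists>D. hn_chain n f D \<and> (\<forall>\<theta>\<in>{0..1}. D 1 \<theta> \<noteq> 0))"

definition dtheta :: "(real \<Rightarrow> 'a::euclidean_space) \<Rightarrow> real \<Rightarrow> 'a" where
  "dtheta f \<theta> = vector_derivative f (at \<theta> within {0..1})"

text \<open>Components are indexed by k in {1..K}; the adjacency matrix A (0/1 entries rendered
  as booleans) is indexed by {1..2K} as in the paper.\<close>
definition graph :: "nat \<Rightarrow> nat \<Rightarrow> (nat \<Rightarrow> nat \<Rightarrow> bool) \<Rightarrow> (nat \<Rightarrow> real \<Rightarrow> 'a::euclidean_space) \<Rightarrow> bool" where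
  "graph n K A c \<longleftrightarrow>
     (\<forall>k\<in>{1..K}. imm n (c k)) \<and>
     (\<forall>k\<in>{1..K}. \<forall>l\<in>{1..K}.
        (A (2*k-1) (2*l-1) \<longrightarrow> c k 0 = c l 0) \<and>
        (A (2*k) (2*l) \<longrightarrow> c k 1 = c l 1) \<and>
        (A (2*k-1) (2*l) \<longrightarrow> c k 0 = c l 1))"

definition curve_length :: "(real \<Rightarrow> 'a::euclidean_space) \<Rightarrow> real" where
  "curve_length c = set_lebesgue_integral lborel {0..1} (\<lambda>\<theta>. norm (dtheta c \<theta>))"

text \<open>E i = \<partial>_s^i h (arc length derivatives w.r.t. c): E (Suc i) |c'| is the derivative of E i.\<close>
definition arc_chain :: "nat \<Rightarrow> (real \<Rightarrow> 'a::euclidean_space) \<Rightarrow> (real \<Rightarrow> 'a) \<Rightarrow> (nat \<Rightarrow> real \<Rightarrow> 'a) \<Rightarrow> bool" where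
  "arc_chain n c h E \<longleftrightarrow>
     (\<forall>\<theta>\<in>{0..1}. E 0 \<theta> = h \<theta>) \<and>
     (\<forall>i<n. set_integrable lborel {0..1} (\<lambda>s. norm (dtheta c s) *\<^sub>R E (Suc i) s) \<and>
        (\<forall>\<theta>\<in>{0..1}. E i \<theta> = E i 0 +
            set_lebesgue_integral lborel {0..\<theta>} (\<lambda>s. norm (dtheta c s) *\<^sub>R E (Suc i) s)))"

definition metricG :: "nat \<Rightarrow> (nat \<Rightarrow> real) \<Rightarrow> (real \<Rightarrow> 'a::euclidean_space) \<Rightarrow> (real \<Rightarrow> 'a) \<Rightarrow> ennreal" where
  "metricG n a c h =
    (let E = (SOME E. arc_chain n c h E) in
     \<Sum>i\<le>n. ennreal (a i * curve_length c powi (2 * int i - 3)) *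
        (\<integral>\<^sup>+\<theta>. indicator {0..1} \<theta> * ennreal ((norm (E i \<theta>))\<^sup>2 * norm (dtheta c \<theta>)) \<partial>lborel))"

text \<open>f t \<theta> is the path; W k s \<theta> = \<partial>_\<theta>^k \<partial>_t f.  The velocity W 0 lies in
  L^2([0,1], H^n) (jointly measurable, square integrable derivatives, H^n chain for a.e. s)
  and f t = f 0 + int_0^t W 0 s ds.\<close>
definition h1_with :: "nat \<Rightarrow> (real \<Rightarrow> real \<Rightarrow> 'a::euclidean_space) \<Rightarrow> (nat \<Rightarrow> real \<Rightarrow> real \<Rightarrow> 'a) \<Rightarrow> bool" where
  "h1_with n f W \<longleftrightarrow>
     (\<forall>k\<le>n. (\<lambda>p. W k (fst p) (snd p)) \<in> borel_measurable lborel) \<and>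
     (\<forall>k\<le>n. set_integrable lborel ({0..1} \<times> {0..1}) (\<lambda>p. (norm (W k (fst p) (snd p)))\<^sup>2)) \<and>
     (AE s in lborel. s \<in> {0..1} \<longrightarrow> hn_chain n (W 0 s) (\<lambda>k. W k s)) \<and>
     (\<forall>t\<in>{0..1}. \<forall>\<theta>\<in>{0..1}. f t \<theta> = f 0 \<theta> + set_lebesgue_integral lborel {0..t} (\<lambda>s. W 0 s \<theta>))"

definition h1_path :: "nat \<Rightarrow> (real \<Rightarrow> real \<Rightarrow> 'a::euclidean_space) \<Rightarrow> bool" where
  "h1_path n f \<longleftrightarrow> (\<exists>W. h1_with n f W)"

definition path_vel :: "nat \<Rightarrow> (real \<Rightarrow> real \<Rightarrow> 'a::euclidean_space) \<Rightarrow> real \<Rightarrow> real \<Rightarrow> 'a" where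
  "path_vel n f = (SOME W. h1_with n f W) 0"

definition h1_graph_paths :: "nat \<Rightarrow> nat \<Rightarrow> (nat \<Rightarrow> nat \<Rightarrow> bool) \<Rightarrow> (nat \<Rightarrow> real \<Rightarrow> real \<Rightarrow> 'a::euclidean_space) set" where
  "h1_graph_paths n K A = {c. (\<forall>k\<in>{1..K}. h1_path n (c k)) \<and> (\<forall>t\<in>{0..1}. graph n K A (\<lambda>k. c k t))}"

definition path_energy :: "nat \<Rightarrow> (nat \<Rightarrow> real) \<Rightarrow> nat \<Rightarrow> (nat \<Rightarrow> real \<Rightarrow> real \<Rightarrow> 'a::euclidean_space) \<Rightarrow> ennreal" where
  "path_energy n a K c = (\<integral>\<^sup>+t. indicator {0..1} t *
      (\<Sum>k\<in>{1..K}. metricG n a (c k t) (path_vel n (c k) t)) \<partial>lborel)"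

definition VS :: "('a::euclidean_space \<times> 'a) set" where
  "VS = UNIV \<times> sphere 0 1"

definition pos_def_kernel :: "('a::euclidean_space \<times> 'a \<Rightarrow> 'a \<times> 'a \<Rightarrow> real) \<Rightarrow> bool" where
  "pos_def_kernel ker \<longleftrightarrow>
     (\<forall>p\<in>VS. \<forall>q\<in>VS. ker p q = ker q p) \<and>
     (\<forall>m (x :: nat \<Rightarrow> 'a \<times> 'a) (\<alpha> :: nat \<Rightarrow> real). (\<forall>i<m. x i \<in> VS) \<longrightarrow>
        0 \<le> (\<Sum>i<m. \<Sum>j<m. \<alpha> i * \<alpha> j * ker (x i) (x j)))"

text \<open>RKHS of ker (Aronszajn): \<omega> \<in> H with norm \<le> C iff C^2 ker - \<omega> \<otimes> \<omega> is positive semidefinite.\<close>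
definition rkhs_bound :: "('a::euclidean_space \<times> 'a \<Rightarrow> 'a \<times> 'a \<Rightarrow> real) \<Rightarrow> ('a \<times> 'a \<Rightarrow> real) \<Rightarrow> real \<Rightarrow> bool" where
  "rkhs_bound ker \<omega> C \<longleftrightarrow>
     (\<forall>m (x :: nat \<Rightarrow> 'a \<times> 'a) (\<alpha> :: nat \<Rightarrow> real). (\<forall>i<m. x i \<in> VS) \<longrightarrow>
        (\<Sum>i<m. \<alpha> i * \<omega> (x i))\<^sup>2 \<le> C\<^sup>2 * (\<Sum>i<m. \<Sum>j<m. \<alpha> i * \<alpha> j * ker (x i) (x j)))"

definition in_rkhs :: "('a::euclidean_space \<times> 'a \<Rightarrow> 'a \<times> 'a \<Rightarrow> real) \<Rightarrow> ('a \<times> 'a \<Rightarrow> real) \<Rightarrow> bool" where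
  "in_rkhs ker \<omega> \<longleftrightarrow> (\<exists>C. rkhs_bound ker \<omega> C)"

definition rkhs_norm :: "('a::euclidean_space \<times> 'a \<Rightarrow> 'a \<times> 'a \<Rightarrow> real) \<Rightarrow> ('a \<times> 'a \<Rightarrow> real) \<Rightarrow> real" where
  "rkhs_norm ker \<omega> = Inf {C. 0 \<le> C \<and> rkhs_bound ker \<omega> C}"

definition tangent_VS :: "'a::euclidean_space \<times> 'a \<Rightarrow> ('a \<times> 'a) set" where
  "tangent_VS p = {v. snd v \<bullet> snd p = 0}"

text \<open>\<omega> \<in> C_0^1(R^d x S^{d-1}) with differential D (any continuous ambient extension of the
  differential on the submanifold).\<close>
definition C01_with :: "('a::euclidean_space \<times> 'a \<Rightarrow> real) \<Rightarrow> ('a \<times> 'a \<Rightarrow> ('a \<times> 'a) \<Rightarrow>\<^sub>L real) \<Rightarrow> bool" where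
  "C01_with \<omega> D \<longleftrightarrow>
     (\<forall>p\<in>VS. (\<omega> has_derivative blinfun_apply (D p)) (at p within VS)) \<and>
     continuous_on VS D \<and>
     (\<forall>\<epsilon>>0. \<exists>R. \<forall>p\<in>VS. R \<le> norm p \<longrightarrow>
         \<bar>\<omega> p\<bar> \<le> \<epsilon> \<and> (\<forall>v\<in>tangent_VS p. norm v \<le> 1 \<longrightarrow> \<bar>blinfun_apply (D p) v\<bar> \<le> \<epsilon>))"

definition norm_1inf :: "('a::euclidean_space \<times> 'a \<Rightarrow> real) \<Rightarrow> ('a \<times> 'a \<Rightarrow> ('a \<times> 'a) \<Rightarrow>\<^sub>L real) \<Rightarrow> real" where
  "norm_1inf \<omega> D = Sup ((\<lambda>p. \<bar>\<omega> p\<bar>) ` VS) +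
      Sup {\<bar>blinfun_apply (D p) v\<bar> | p v. p \<in> VS \<and> v \<in> tangent_VS p \<and> norm v \<le> 1}"

definition rkhs_embeds_C01 :: "('a::euclidean_space \<times> 'a \<Rightarrow> 'a \<times> 'a \<Rightarrow> real) \<Rightarrow> bool" where
  "rkhs_embeds_C01 ker \<longleftrightarrow>
     (\<exists>C. \<forall>\<omega>. in_rkhs ker \<omega> \<longrightarrow> (\<exists>D. C01_with \<omega> D \<and> norm_1inf \<omega> D \<le> C * rkhs_norm ker \<omega>))"

definition varifold_pair :: "nat \<Rightarrow> (nat \<Rightarrow> real \<Rightarrow> 'a::euclidean_space) \<Rightarrow> ('a \<times> 'a \<Rightarrow> real) \<Rightarrow> real" where
  "varifold_pair K c \<omega> = (\<Sum>k\<in>{1..K}. set_lebesgue_integral lborel {0..1}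
      (\<lambda>\<theta>. \<omega> (c k \<theta>, dtheta (c k) \<theta> /\<^sub>R norm (dtheta (c k) \<theta>)) * norm (dtheta (c k) \<theta>)))"

text \<open>\<parallel>\<mu>\<parallel>_V for a measure given by its pairing functional.\<close>
definition varifold_norm :: "('a::euclidean_space \<times> 'a \<Rightarrow> 'a \<times> 'a \<Rightarrow> real) \<Rightarrow> (('a \<times> 'a \<Rightarrow> real) \<Rightarrow> real) \<Rightarrow> real" where
  "varifold_norm ker \<mu> = Sup {\<mu> \<omega> | \<omega>. in_rkhs ker \<omega> \<and> rkhs_norm ker \<omega> \<le> 1}"

definition matching_functional ::
  "nat \<Rightarrow> (nat \<Rightarrow> real) \<Rightarrow> ('a::euclidean_space \<times> 'a \<Rightarrow> 'a \<times> 'a \<Rightarrow> real) \<Rightarrow> real \<Rightarrow> nat \<Rightarrow>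
   nat \<Rightarrow> (nat \<Rightarrow> real \<Rightarrow> 'a) \<Rightarrow> (nat \<Rightarrow> real \<Rightarrow> real \<Rightarrow> 'a) \<Rightarrow> ennreal" where
  "matching_functional n a ker lam K K1 c1 c =
     path_energy n a K c +
     ennreal (lam * (varifold_norm ker (\<lambda>\<omega>. varifold_pair K (\<lambda>k. c k 1) \<omega> - varifold_pair K1 c1 \<omega>))\<^sup>2)"

end

theory Submission
  imports Defs "HOL-Probability.Probability" "HOL-Complex_Analysis.Great_Picard"
begin

text \<open>The direct method. Write a path of curves in arc length coordinates: \<open>q = \<partial>\<^sub>\<theta> c\<close> and
  \<open>E i = \<partial>\<^sub>s\<^sup>i \<partial>\<^sub>t c\<close>, so that \<open>\<partial>\<^sub>\<theta> (E i) = |q| E (i+1)\<close> and \<open>\<partial>\<^sub>t q = |q| E 1\<close>. By a scale invariant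
  Sobolev inequality the energy controls \<open>sup |E 1|\<close>, and Gronwall's lemma bounds \<open>|q|\<close> from above and away from
  zero on sets of bounded energy. There the energy is equivalent to the \<open>L\<^sup>2\<close> norms of the \<open>E i\<close>, and \<open>(c, q)\<close> is
  equicontinuous. A minimising sequence therefore has a subsequence along which \<open>(c, q)\<close> converges uniformly, and
  convex combinations of the \<open>E i\<close> converge strongly in \<open>L\<^sup>2\<close> (this replaces weak compactness). The two equations
  pass to the limit, and the energy is lower semicontinuous because its weights depend only on \<open>q\<close>. The limit is a
  path of \<open>H\<^sup>n\<close> curves since \<open>\<partial>\<^sub>t (q, |q|)\<close> is linear in \<open>(q, |q|)\<close> with coefficient \<open>E 1\<close>, so that the
  regularity of \<open>q\<close> and of the \<open>E i\<close> bootstrap from that of \<open>c\<^sub>0\<close>. The varifold term is a supremum of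
  functionals that are continuous under uniform convergence of \<open>(c, q)\<close>.\<close>

section \<open>Indefinite integrals on the unit interval\<close>

text \<open>The obstacle is that the metric depends on the foot point. In the coordinate \<theta>
  its coefficients contain higher derivatives of the curve, for which a minimising sequence offers
  weak convergence at best. With the \<open>E i\<close> as unknowns, every nonlinearity is a product
  of \<open>norm q\<close> with one \<open>E i\<close>, and uniform convergence of \<open>q\<close>
  is strong enough for such products. The condition n \<ge> 2 gives \<open>E 1\<close> a square
  integrable derivative \<open>E 2\<close>, without which it need not be bounded in space. The price
  is that the limit comes with no bound on its \<theta>-derivatives, so membership in H^n is proved
  afterwards. A second obstacle is that the definitions speak of pointwise values, of
  \<open>vector_derivative\<close> and of \<open>SOME\<close>, while compactness yields classes
  modulo null sets. Absolute continuity is therefore an identity \<open>f x = f 0 + prim g x\<close>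
  at every point, and almost everywhere equalities of continuous functions are upgraded. Existence,
  uniqueness and Gronwall estimates share one device: the weight \<open>exp (2 * prim g t)\<close>,
  which turns integration against \<open>g\<close> into a contraction by 1/2.\<close>

definition leb01 :: "real measure" where
  "leb01 = restrict_space lborel {0..1}"

lemma space_leb01 [simp]: "space leb01 = {0..1}"
  by (simp add: leb01_def space_restrict_space)

lemma sets_leb01 [measurable_cong]: "sets leb01 = sets (restrict_space borel {0..1})"
  by (simp add: leb01_def sets_restrict_space)

lemma prob_space_leb01: "prob_space leb01"
  by (rule prob_spaceI) (simp add: leb01_def emeasure_restrict_space space_restrict_space)

interpretation leb01: prob_space leb01
  by (rule prob_space_leb01)

lemma measure_leb01_Icc [simp]: "measure leb01 {0..1} = 1"
  using leb01.prob_space by simp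

interpretation leb01_pair: pair_prob_space leb01 leb01 ..

abbreviation leb01sq :: "(real \<times> real) measure" where
  "leb01sq \<equiv> leb01 \<Otimes>\<^sub>M leb01"

lemma measurable_leb01_ident [measurable]: "(\<lambda>x. x) \<in> leb01 \<rightarrow>\<^sub>M borel"
  by (simp add: sets_leb01 measurable_restrict_space1 cong: measurable_cong_sets)

lemma borel_measurable_leb01I: "f \<in> borel_measurable borel \<Longrightarrow> f \<in> borel_measurable leb01"
  using measurable_compose[OF measurable_leb01_ident] by blast

lemma sets_leb01I: "A \<in> sets borel \<Longrightarrow> A \<inter> {0..1} \<in> sets leb01"
  by (auto simp: sets_leb01 sets_restrict_space)

lemma continuous_measurable_leb01:
  "continuous_on {0..1} f \<Longrightarrow> f \<in> borel_measurable leb01"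
  using borel_measurable_continuous_on_restrict[of "{0..1}" f]
  by (simp add: sets_leb01 cong: measurable_cong_sets)

lemma bounded_integrable_leb01:
  fixes f :: "real \<Rightarrow> 'a::euclidean_space"
  assumes "f \<in> borel_measurable leb01" "\<And>x. x \<in> {0..1} \<Longrightarrow> norm (f x) \<le> C"
  shows "integrable leb01 f"
  using assms by (intro leb01.integrable_const_bound[where B=C]) auto

lemma continuous_integrable_leb01:
  fixes f :: "real \<Rightarrow> 'a::euclidean_space"
  assumes "continuous_on {0..1} f"
  shows "integrable leb01 f"
proof -
  have "bounded (f ` {0..1})"
    using assms compact_continuous_image compact_imp_bounded by blast
  then obtain C where "\<And>x. x \<in> {0..1} \<Longrightarrow> norm (f x) \<le> C"
    unfolding bounded_iff by (metis imageI)
  then show ?thesis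
    using bounded_integrable_leb01 continuous_measurable_leb01[OF assms] by blast
qed

lemma AE_leb01_iff: "(AE x in leb01. P x) \<longleftrightarrow> (AE x in lborel. x \<in> {0..1} \<longrightarrow> P x)"
  unfolding leb01_def by (subst AE_restrict_space_iff) auto

lemma integrable_leb01_iff:
  fixes f :: "real \<Rightarrow> 'a::euclidean_space"
  shows "integrable leb01 f \<longleftrightarrow> set_integrable lborel {0..1} f"
  by (simp add: leb01_def integrable_restrict_space set_integrable_def)

text \<open>Integrating an indicator over the fixed space \<open>leb01\<close> keeps the linearity
  and comparison rules free of conditions on \<open>t\<close>: integrability of \<open>f\<close> on
  [0,1] is enough for every real upper limit.\<close>

definition prim :: "(real \<Rightarrow> 'a::euclidean_space) \<Rightarrow> real \<Rightarrow> 'a" where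
  "prim f t = (\<integral>x. indicator {0..t} x *\<^sub>R f x \<partial>leb01)"

lemma set_lebesgue_integral_eq_prim:
  fixes f :: "real \<Rightarrow> 'a::euclidean_space"
  assumes "t \<in> {0..1}"
  shows "set_lebesgue_integral lborel {0..t} f = prim f t"
proof -
  have "indicator {0..1} x *\<^sub>R indicator {0..t} x *\<^sub>R f x = indicator {0..t} x *\<^sub>R f x" for x
    using assms by (auto simp: indicator_def)
  then show ?thesis
    unfolding prim_def leb01_def set_lebesgue_integral_def
    by (subst integral_restrict_space) (simp_all del: scaleR_scaleR)
qed

lemma set_lebesgue_integral_eq_leb01:
  fixes f :: "real \<Rightarrow> 'a::euclidean_space"
  shows "set_lebesgue_integral lborel {0..1} f = integral\<^sup>L leb01 f"
  by (simp add: leb01_def integral_restrict_space set_lebesgue_integral_def)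

lemma nn_integral_leb01:
  "(\<integral>\<^sup>+x. f x \<partial>leb01) = (\<integral>\<^sup>+x. indicator {0..1} x * f x \<partial>lborel)"
  by (simp add: leb01_def nn_integral_restrict_space mult.commute)

lemma prim_1: "prim f 1 = integral\<^sup>L leb01 f"
  unfolding prim_def by (rule Bochner_Integration.integral_cong) auto

lemma indicator_Icc_measurable_leb01 [measurable]:
  "(indicator {a..b} :: real \<Rightarrow> real) \<in> borel_measurable leb01"
  by (rule borel_measurable_leb01I) simp

lemma integrable_indicator_leb01:
  fixes f :: "real \<Rightarrow> 'a::euclidean_space"
  assumes "integrable leb01 f" "A \<in> sets borel"
  shows "integrable leb01 (\<lambda>x. indicator A x *\<^sub>R f x)"
proof (rule Bochner_Integration.integrable_bound[OF assms(1)])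
  have "(indicator A :: real \<Rightarrow> real) \<in> borel_measurable leb01"
    by (rule borel_measurable_leb01I) (use assms in measurable)
  then show "(\<lambda>x. indicator A x *\<^sub>R f x) \<in> borel_measurable leb01"
    using assms(1) by measurable
qed (auto simp: indicator_def)

lemma prim_0 [simp]: "prim f 0 = 0"
proof -
  have "AE x in lborel. x \<noteq> (0::real)"
    by (rule AE_lborel_singleton)
  then have "AE x in leb01. indicator {0..0} x *\<^sub>R f x = 0"
    unfolding AE_leb01_iff by eventually_elim auto
  then show ?thesis
    unfolding prim_def by (simp add: integral_eq_zero_AE)
qed

lemma prim_add:
  "integrable leb01 f \<Longrightarrow> integrable leb01 g \<Longrightarrow> prim (\<lambda>x. f x + g x) t = prim f t + prim g t"
  unfolding prim_def by (simp add: scaleR_add_right integrable_indicator_leb01)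

lemma prim_diff:
  "integrable leb01 f \<Longrightarrow> integrable leb01 g \<Longrightarrow> prim (\<lambda>x. f x - g x) t = prim f t - prim g t"
  unfolding prim_def by (simp add: scaleR_diff_right integrable_indicator_leb01)

lemma prim_sum:
  "(\<And>i. i \<in> I \<Longrightarrow> integrable leb01 (f i)) \<Longrightarrow> prim (\<lambda>x. \<Sum>i\<in>I. f i x) t = (\<Sum>i\<in>I. prim (f i) t)"
  unfolding prim_def
  by (simp add: scaleR_sum_right integrable_indicator_leb01 Bochner_Integration.integral_sum)

lemma prim_scaleR: "prim (\<lambda>x. r *\<^sub>R f x) t = r *\<^sub>R prim f t"
  unfolding prim_def scaleR_left_commute[of _ r] by (rule integral_scaleR_right)

lemma prim_cmult: "prim (\<lambda>x. r * f x) t = r * prim f t" for f :: "real \<Rightarrow> real"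
  using prim_scaleR[of r f t] by simp

lemma prim_cong_AE:
  assumes "AE x in leb01. f x = g x" "f \<in> borel_measurable leb01" "g \<in> borel_measurable leb01"
  shows "prim f t = prim g t"
  unfolding prim_def
  by (rule integral_cong_AE) (use assms in \<open>auto elim!: eventually_mono\<close>)

lemma prim_cong: "(\<And>x. x \<in> {0..1} \<Longrightarrow> f x = g x) \<Longrightarrow> prim f t = prim g t"
  unfolding prim_def by (rule Bochner_Integration.integral_cong) auto

lemma norm_prim_le: "integrable leb01 f \<Longrightarrow> norm (prim f t) \<le> prim (\<lambda>x. norm (f x)) t"
  unfolding prim_def
  by (rule order_trans[OF integral_norm_bound])
     (simp add: integrable_indicator_leb01 abs_of_nonneg)

lemma prim_mono_AE:
  fixes f g :: "real \<Rightarrow> real"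
  assumes "integrable leb01 f" "integrable leb01 g" "AE x in leb01. f x \<le> g x"
  shows "prim f t \<le> prim g t"
  unfolding prim_def
  using assms(3) integrable_indicator_leb01[OF assms(1), of "{0..t}"]
    integrable_indicator_leb01[OF assms(2), of "{0..t}"]
  by (intro integral_mono_AE) (auto elim!: eventually_mono simp: indicator_def)

lemma prim_nonneg:
  fixes f :: "real \<Rightarrow> real"
  assumes "AE x in leb01. 0 \<le> f x"
  shows "0 \<le> prim f t"
  unfolding prim_def
  by (rule integral_nonneg_AE) (use assms in \<open>auto elim!: eventually_mono\<close>)

lemma prim_le_integral:
  fixes f :: "real \<Rightarrow> real"
  assumes "integrable leb01 f" "AE x in leb01. 0 \<le> f x"
  shows "prim f t \<le> integral\<^sup>L leb01 f"
  unfolding prim_def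
  using assms(2) assms(1) integrable_indicator_leb01[OF assms(1), of "{0..t}"]
  by (intro integral_mono_AE) (auto elim!: eventually_mono simp: indicator_def)

lemma norm_prim_le_integral:
  "integrable leb01 f \<Longrightarrow> norm (prim f t) \<le> (\<integral>x. norm (f x) \<partial>leb01)"
  using norm_prim_le[of f t] prim_le_integral[of "\<lambda>x. norm (f x)" t] by force

text \<open>Half-open intervals make increments of \<open>prim\<close> exact: \<open>{0..b}\<close>
  minus \<open>{0..a}\<close> is \<open>{a<..b}\<close>, so adjacent pieces add up without a
  discussion of endpoints.\<close>

definition seg :: "(real \<Rightarrow> 'a::euclidean_space) \<Rightarrow> real \<Rightarrow> real \<Rightarrow> 'a" where
  "seg f a b = (\<integral>x. indicator {a<..b} x *\<^sub>R f x \<partial>leb01)"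

lemma prim_diff_eq_seg:
  assumes "integrable leb01 f" "0 \<le> a" "a \<le> b"
  shows "prim f b - prim f a = seg f a b"
proof -
  have "(indicator {0..b} x - indicator {0..a} x) *\<^sub>R f x = indicator {a<..b} x *\<^sub>R f x" for x
    using assms by (auto simp: indicator_def)
  then show ?thesis
    unfolding prim_def seg_def using assms(1)
    by (subst Bochner_Integration.integral_diff[symmetric])
       (simp_all only: integrable_indicator_leb01 scaleR_diff_left[symmetric]
         sets.sets_into_space atLeastAtMost_borel)
qed

lemma norm_seg_le:
  assumes "integrable leb01 f" "integrable leb01 g" 
    and "AE x in leb01. a < x \<longrightarrow> x \<le> b \<longrightarrow> norm (f x) \<le> g x"
  shows "norm (seg f a b) \<le> seg g a b"
proof -
  have "norm (seg f a b) \<le> (\<integral>x. norm (indicator {a<..b} x *\<^sub>R f x) \<partial>leb01)"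
    unfolding seg_def by (rule integral_norm_bound)
  also have "\<dots> \<le> seg g a b"
    unfolding seg_def
  proof (rule integral_mono_AE)
    show "integrable leb01 (\<lambda>x. norm (indicator {a<..b} x *\<^sub>R f x))"
      using integrable_indicator_leb01[OF assms(1), of "{a<..b}"] by (intro integrable_norm) simp
    show "integrable leb01 (\<lambda>x. indicator {a<..b} x *\<^sub>R g x)"
      using integrable_indicator_leb01[OF assms(2), of "{a<..b}"] by simp
    show "AE x in leb01. norm (indicator {a<..b} x *\<^sub>R f x) \<le> indicator {a<..b} x *\<^sub>R g x"
      using assms(3) by eventually_elim (auto simp: indicator_def)
  qed
  finally show ?thesis .
qed

lemma norm_prim_diff_le:
  assumes "integrable leb01 f" "0 \<le> a" "a \<le> b"
  shows "norm (prim f b - prim f a) \<le> prim (\<lambda>x. norm (f x)) b - prim (\<lambda>x. norm (f x)) a"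
  using assms norm_seg_le[of f "\<lambda>x. norm (f x)" a b]
  by (simp add: prim_diff_eq_seg)

lemma seg_const: "0 \<le> a \<Longrightarrow> a \<le> b \<Longrightarrow> b \<le> 1 \<Longrightarrow> seg (\<lambda>x. c) a b = (b - a) *\<^sub>R c"
proof -
  assume ab: "0 \<le> a" "a \<le> b" "b \<le> 1"
  have "measure leb01 {a<..b} = b - a"
    unfolding leb01_def by (subst measure_restrict_space) (use ab in auto)
  moreover have "{a<..b} \<in> sets leb01"
    using sets_leb01I[of "{a<..b}"] ab by (simp add: Int_absorb2 subset_iff)
  ultimately show ?thesis
    unfolding seg_def using sets.sets_into_space[of "{a<..b}" leb01]
    by (simp add: leb01.emeasure_eq_measure Int_absorb2)
qed

lemma prim_const: "t \<in> {0..1} \<Longrightarrow> prim (\<lambda>x. c) t = t *\<^sub>R c"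
  using prim_diff_eq_seg[of "\<lambda>x. c" 0 t] seg_const[of 0 t c] by simp

lemma continuous_on_prim:
  fixes f :: "real \<Rightarrow> 'a::euclidean_space"
  assumes "integrable leb01 f"
  shows "continuous_on {0..1} (prim f)"
proof -
  have "set_integrable lborel {0..1} f"
    using assms by (simp add: integrable_leb01_iff)
  then have "f integrable_on {0..1}"
    by (rule set_borel_integral_eq_integral(1))
  then have "continuous_on {0..1} (\<lambda>x. integral {0..x} f)"
    by (rule indefinite_integral_continuous_1)
  moreover have "prim f x = integral {0..x} f" if "x \<in> {0..1}" for x
    using set_lebesgue_integral_eq_prim[OF that, of f] set_borel_integral_eq_integral(2)[of "{0..x}" f]
      set_integrable_subset[OF \<open>set_integrable lborel {0..1} f\<close>, of "{0..x}"] that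
    by auto
  ultimately show ?thesis
    by (metis (no_types, lifting) continuous_on_cong)
qed

text \<open>Telescoping over a fine partition: this replaces the Lebesgue differentiation theorem in the
  product and chain rules for absolutely continuous functions.\<close>
lemma prim_eqI_approx:
  fixes g :: "real \<Rightarrow> 'a::euclidean_space"
  assumes \<gamma>: "integrable leb01 \<gamma>" and h: "integrable leb01 h"
    and approx: "\<And>e. 0 < e \<Longrightarrow> \<exists>d>0. \<forall>a b. 0 \<le> a \<and> a \<le> b \<and> b \<le> 1 \<and> b - a < d \<longrightarrow>
         norm (g b - g a - seg \<gamma> a b) \<le> e * seg h a b"
    and t: "t \<in> {0..1}"
  shows "g t = g 0 + prim \<gamma> t"
proof -
  define H where "H s = g s - prim \<gamma> s" for s
  have "norm (H t - H 0) \<le> e * prim h t" if e: "0 < e" for e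
  proof -
    obtain d where "d > 0" and d: "\<And>a b. 0 \<le> a \<Longrightarrow> a \<le> b \<Longrightarrow> b \<le> 1 \<Longrightarrow> b - a < d \<Longrightarrow>
         norm (g b - g a - seg \<gamma> a b) \<le> e * seg h a b"
      using approx[OF e] by blast
    obtain N :: nat where N: "1 / d < real N"
      using reals_Archimedean2 by blast
    then have "0 < N"
      using \<open>d > 0\<close> by (cases N) (auto simp: divide_less_0_iff)
    have step: "t / N < d"
    proof -
      have "t / N \<le> 1 / N" using t by (auto simp: divide_right_mono)
      also have "\<dots> < d" using N \<open>d > 0\<close> \<open>0 < N\<close> by (simp add: field_simps)
      finally show ?thesis .
    qed
    have loc: "norm (H b - H a) \<le> e * (prim h b - prim h a)"
      if "0 \<le> a" "a \<le> b" "b \<le> 1" "b - a < d" for a b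
    proof -
      have "H b - H a = g b - g a - seg \<gamma> a b"
        using prim_diff_eq_seg[OF \<gamma> that(1,2)] by (simp add: H_def algebra_simps)
      then show ?thesis
        using d[OF that] prim_diff_eq_seg[OF h that(1,2)] by simp
    qed
    \<comment> \<open>The local error is \<open>e\<close> times an increment of
      \<open>prim h\<close>, hence additive: the sum over all pieces is \<open>e * prim h t\<close>,
      whatever N is.\<close>
    have "norm (H (i * t / N) - H 0) \<le> e * prim h (i * t / N)" if "i \<le> N" for i :: nat
      using that
    proof (induction i)
      case (Suc i)
      have "real (Suc i) * t / N \<le> 1 * 1"
      proof -
        have "real (Suc i) / N \<le> 1" using Suc.prems \<open>0 < N\<close> by simp
        then show ?thesis using mult_mono[of "real (Suc i) / N" 1 t 1] t by auto
      qed
      moreover have "real (Suc i) * t / N - real i * t / N = t / N"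
        by (simp add: field_simps add_divide_distrib)
      moreover have "real i * t / N \<le> real (Suc i) * t / N"
        using t by (simp add: divide_right_mono algebra_simps)
      moreover have "0 \<le> real i * t / N"
        using t by simp
      ultimately have "norm (H (real (Suc i) * t / N) - H (real i * t / N))
          \<le> e * (prim h (real (Suc i) * t / N) - prim h (real i * t / N))"
        using loc step by simp
      moreover have "norm (H (i * t / N) - H 0) \<le> e * prim h (i * t / N)"
        using Suc by simp
      ultimately show ?case
        using norm_triangle_ineq[of "H (real (Suc i) * t / N) - H (real i * t / N)" "H (i * t / N) - H 0"]
        by (simp add: right_diff_distrib)
    qed simp
    from this[of N] show ?thesis using \<open>0 < N\<close> by simp
  qed
  then have "norm (H t - H 0) \<le> 0"
  proof -
    have "((\<lambda>e. e * prim h t) \<longlongrightarrow> 0 * prim h t) (at_right 0)"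
      by (intro tendsto_intros)
    moreover have "eventually (\<lambda>e. norm (H t - H 0) \<le> e * prim h t) (at_right 0)"
      using \<open>\<And>e. 0 < e \<Longrightarrow> norm (H t - H 0) \<le> e * prim h t\<close>
      by (auto simp: eventually_at_right_field intro: exI[of _ 1])
    ultimately show ?thesis
      using tendsto_lowerbound[of "\<lambda>e. e * prim h t" "0" "at_right 0" "norm (H t - H 0)"] by simp
  qed
  then show ?thesis
    by (simp add: H_def algebra_simps)
qed

lemma continuous_of_prim:
  assumes "integrable leb01 f" "\<And>t. t \<in> {0..1} \<Longrightarrow> F t = F 0 + prim f t"
  shows "continuous_on {0..1} F"
proof -
  have "continuous_on {0..1} (\<lambda>t. F 0 + prim f t)"
    by (intro continuous_intros continuous_on_prim assms)
  then show ?thesis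
    by (subst continuous_on_cong[OF refl assms(2)])
qed

lemma bounded_on_unit:
  fixes F :: "real \<Rightarrow> 'a::euclidean_space"
  assumes "continuous_on {0..1} F"
  obtains C where "0 \<le> C" "\<And>t. t \<in> {0..1} \<Longrightarrow> norm (F t) \<le> C"
proof -
  have "bounded (F ` {0..1})"
    using assms compact_continuous_image compact_imp_bounded by blast
  then show ?thesis
    using that unfolding bounded_pos by (metis imageI less_imp_le)
qed

lemma uniformly_continuous_unit:
  fixes F :: "real \<Rightarrow> 'a::euclidean_space"
  assumes "continuous_on {0..1} F" "0 < e"
  obtains d where "0 < d" 
    "\<And>x y. x \<in> {0..1} \<Longrightarrow> y \<in> {0..1} \<Longrightarrow> \<bar>x - y\<bar> < d \<Longrightarrow> norm (F x - F y) \<le> e"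
proof -
  have "uniformly_continuous_on {0..1} F"
    by (rule compact_uniformly_continuous[OF assms(1)]) simp
  then obtain d where "0 < d" "\<forall>x\<in>{0..1}. \<forall>y\<in>{0..1}. dist y x < d \<longrightarrow> dist (F y) (F x) < e"
    unfolding uniformly_continuous_on_def using assms(2) by metis
  then show ?thesis
    using that[of d] by (force simp: dist_norm norm_minus_commute intro: less_imp_le)
qed

section \<open>Product and chain rules for indefinite integrals\<close>

lemma integrable_bilinear_bounded:
  fixes f :: "real \<Rightarrow> 'a::euclidean_space" and G :: "real \<Rightarrow> 'b::euclidean_space"
    and B :: "'a \<Rightarrow> 'b \<Rightarrow> 'c::euclidean_space"
  assumes "bounded_bilinear B" "integrable leb01 f" "G \<in> borel_measurable leb01"
    and "\<And>t. t \<in> {0..1} \<Longrightarrow> norm (G t) \<le> C"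
  shows "integrable leb01 (\<lambda>s. B (f s) (G s))"
proof -
  interpret bounded_bilinear B by fact
  obtain K where K: "0 \<le> K" "\<And>a b. norm (B a b) \<le> norm a * norm b * K"
    using nonneg_bounded by blast
  show "integrable leb01 (\<lambda>s. B (f s) (G s))"
  proof (rule Bochner_Integration.integrable_bound)
    show "integrable leb01 (\<lambda>s. norm (f s) * (C * K))"
      using assms(2) by simp
    show "(\<lambda>s. B (f s) (G s)) \<in> borel_measurable leb01"
      by (rule borel_measurable_continuous_Pair[OF _ assms(3)])
         (use assms(2) in \<open>auto intro!: continuous_intros assms(1) bounded_bilinear.continuous_on[OF assms(1)]\<close>)
    show "AE s in leb01. norm (B (f s) (G s)) \<le> norm (norm (f s) * (C * K))"
    proof (rule AE_I2)
      fix s assume "s \<in> space leb01"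
      then have *: "norm (G s) \<le> C" using assms(4) by simp
      then have "0 \<le> C" using norm_ge_zero order_trans by blast
      have "norm (B (f s) (G s)) \<le> norm (f s) * norm (G s) * K" by (rule K)
      also have "\<dots> \<le> norm (f s) * C * K"
        by (intro mult_right_mono mult_left_mono * K) auto
      finally show "norm (B (f s) (G s)) \<le> norm (norm (f s) * (C * K))"
        using \<open>0 \<le> C\<close> K(1) by (simp add: abs_mult mult.assoc)
    qed
  qed
qed

lemma prim_bilinear:
  fixes F :: "real \<Rightarrow> 'a::euclidean_space" and G :: "real \<Rightarrow> 'b::euclidean_space"
    and B :: "'a \<Rightarrow> 'b \<Rightarrow> 'c::euclidean_space"
  assumes B: "bounded_bilinear B" and f: "integrable leb01 f" and g: "integrable leb01 g"
    and F: "\<And>t. t \<in> {0..1} \<Longrightarrow> F t = F 0 + prim f t"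
    and G: "\<And>t. t \<in> {0..1} \<Longrightarrow> G t = G 0 + prim g t"
  shows "integrable leb01 (\<lambda>s. B (f s) (G s) + B (F s) (g s))" (is "integrable leb01 ?\<gamma>")
    and "t \<in> {0..1} \<Longrightarrow> B (F t) (G t) = B (F 0) (G 0) + prim (\<lambda>s. B (f s) (G s) + B (F s) (g s)) t"
proof -
  interpret B: bounded_bilinear B by fact
  have cF: "continuous_on {0..1} F" and cG: "continuous_on {0..1} G"
    using continuous_of_prim[OF f F] continuous_of_prim[OF g G] by auto
  obtain CF where CF: "\<And>t. t \<in> {0..1} \<Longrightarrow> norm (F t) \<le> CF"
    using bounded_on_unit[OF cF] by metis
  obtain CG where CG: "\<And>t. t \<in> {0..1} \<Longrightarrow> norm (G t) \<le> CG"
    using bounded_on_unit[OF cG] by metis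
  have i1: "integrable leb01 (\<lambda>s. B (f s) (G s))"
    by (rule integrable_bilinear_bounded[OF B f continuous_measurable_leb01[OF cG] CG])
  have i2: "integrable leb01 (\<lambda>s. B (F s) (g s))"
    using integrable_bilinear_bounded[OF B.flip g continuous_measurable_leb01[OF cF] CF] .
  show i: "integrable leb01 ?\<gamma>"
    using i1 i2 by simp
  obtain K where K: "0 < K" "\<And>a b. norm (B a b) \<le> norm a * norm b * K"
    using B.pos_bounded by blast
  have ic: "integrable leb01 (\<lambda>s. B (f s) c)" for c
    by (rule integrable_bilinear_bounded[OF B f, where C="norm c"]) auto
  have ic': "integrable leb01 (\<lambda>s. B c (g s))" for c
    by (rule integrable_bilinear_bounded[OF B.flip g, where C="norm c"]) auto
  have h: "integrable leb01 (\<lambda>s. norm (f s) + norm (g s))"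
    using f g by simp
  assume t: "t \<in> {0..1}"
  show "B (F t) (G t) = B (F 0) (G 0) + prim ?\<gamma> t"
  proof (rule prim_eqI_approx[OF i h _ t, where g = "\<lambda>t. B (F t) (G t)"])
    fix e :: real assume "0 < e"
    \<comment> \<open>Dividing by the bound K of \<open>B\<close> makes the two error terms add up
      to at most e times |f| + |g|.\<close>
    then have eK: "0 < e / K" using K by simp
    obtain d1 where d1: "0 < d1" "\<And>x y. x \<in> {0..1} \<Longrightarrow> y \<in> {0..1} \<Longrightarrow> \<bar>x - y\<bar> < d1 \<Longrightarrow> norm (F x - F y) \<le> e / K"
      using uniformly_continuous_unit[OF cF eK] by metis
    obtain d2 where d2: "0 < d2" "\<And>x y. x \<in> {0..1} \<Longrightarrow> y \<in> {0..1} \<Longrightarrow> \<bar>x - y\<bar> < d2 \<Longrightarrow> norm (G x - G y) \<le> e / K"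
      using uniformly_continuous_unit[OF cG eK] by metis
    show "\<exists>d>0. \<forall>a b. 0 \<le> a \<and> a \<le> b \<and> b \<le> 1 \<and> b - a < d \<longrightarrow>
       norm (B (F b) (G b) - B (F a) (G a) - seg ?\<gamma> a b) \<le> e * seg (\<lambda>s. norm (f s) + norm (g s)) a b"
    proof (intro exI[of _ "min d1 d2"] conjI allI impI)
      fix a b :: real assume ab: "0 \<le> a \<and> a \<le> b \<and> b \<le> 1 \<and> b - a < min d1 d2"
      have Fab: "F b - F a = seg f a b" and Gab: "G b - G a = seg g a b"
        using prim_diff_eq_seg[OF f, of a b] prim_diff_eq_seg[OF g, of a b] ab F[of a] F[of b] G[of a] G[of b]
        by auto
      have "B (F b) (G b) - B (F a) (G a) = B (seg f a b) (G b) + B (F a) (seg g a b)"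
        by (simp add: Fab[symmetric] Gab[symmetric] B.diff_left B.diff_right)
      also have "B (seg f a b) (G b) = seg (\<lambda>s. B (f s) (G b)) a b"
        unfolding seg_def
        using integral_bounded_linear[OF B.bounded_linear_left integrable_indicator_leb01[OF f, of "{a<..b}"], of "G b"]
        by (simp add: B.scaleR_left)
      also have "B (F a) (seg g a b) = seg (\<lambda>s. B (F a) (g s)) a b"
        unfolding seg_def
        using integral_bounded_linear[OF B.bounded_linear_right integrable_indicator_leb01[OF g, of "{a<..b}"], of "F a"]
        by (simp add: B.scaleR_right)
      also have "seg (\<lambda>s. B (f s) (G b)) a b + seg (\<lambda>s. B (F a) (g s)) a b - seg ?\<gamma> a b
          = seg (\<lambda>s. B (f s) (G b) + B (F a) (g s) - ?\<gamma> s) a b"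
        using ab ic[of "G b"] ic'[of "F a"] i
        by (simp add: prim_diff_eq_seg[symmetric] prim_diff prim_add)
      finally have *: "B (F b) (G b) - B (F a) (G a) - seg ?\<gamma> a b = 
         seg (\<lambda>s. B (f s) (G b) + B (F a) (g s) - ?\<gamma> s) a b" .
      have "norm (seg (\<lambda>s. B (f s) (G b) + B (F a) (g s) - ?\<gamma> s) a b)
          \<le> seg (\<lambda>s. e * (norm (f s) + norm (g s))) a b"
      proof (rule norm_seg_le)
        show "integrable leb01 (\<lambda>s. B (f s) (G b) + B (F a) (g s) - ?\<gamma> s)"
          using ic[of "G b"] ic'[of "F a"] i by simp
        show "integrable leb01 (\<lambda>s. e * (norm (f s) + norm (g s)))"
          using h by simp
        show "AE x in leb01. a < x \<longrightarrow> x \<le> b \<longrightarrow> norm (B (f x) (G b) + B (F a) (g x) - ?\<gamma> x)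
               \<le> e * (norm (f x) + norm (g x))"
        proof (intro AE_I2 impI)
          fix x assume x: "a < x" "x \<le> b"
          have eq: "B (f x) (G b) + B (F a) (g x) - ?\<gamma> x = B (f x) (G b - G x) + B (F a - F x) (g x)"
            by (simp add: B.diff_left B.diff_right)
          have "norm (G b - G x) \<le> e / K" "norm (F a - F x) \<le> e / K"
            using d1(2)[of a x] d2(2)[of b x] ab x by auto
          then have "norm (B (f x) (G b - G x)) \<le> norm (f x) * (e / K) * K"
               "norm (B (F a - F x) (g x)) \<le> (e / K) * norm (g x) * K"
            using less_imp_le[OF K(1)]
            by (intro order_trans[OF K(2)] mult_right_mono mult_left_mono; simp)+
          then show "norm (B (f x) (G b) + B (F a) (g x) - ?\<gamma> x) \<le> e * (norm (f x) + norm (g x))"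
            unfolding eq using K(1) by (intro order_trans[OF norm_triangle_ineq]) (simp add: algebra_simps)
        qed
      qed
      also have "\<dots> = e * seg (\<lambda>s. norm (f s) + norm (g s)) a b"
        unfolding seg_def by (simp add: mult.left_commute[of _ e])
      finally show "norm (B (F b) (G b) - B (F a) (G a) - seg ?\<gamma> a b)
          \<le> e * seg (\<lambda>s. norm (f s) + norm (g s)) a b"
        unfolding * .
    qed (use d1 d2 in auto)
  qed
qed

text \<open>The function \<phi> is differentiated only on the image of \<open>p\<close>, since it
  will be a square root, its inverse or a logarithm, used away from 0. Each increment is \<phi>' at
  an attained value \<open>p s\<close> times an increment of \<open>p\<close>; uniform continuity of
  \<phi>' along \<open>p\<close> then gives the error form of
  \<open>prim_eqI_approx\<close>.\<close>

lemma prim_chain: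
  fixes p f \<phi> \<phi>' :: "real \<Rightarrow> real"
  assumes f: "integrable leb01 f" and p: "\<And>t. t \<in> {0..1} \<Longrightarrow> p t = p 0 + prim f t"
    and der: "\<And>x. x \<in> p ` {0..1} \<Longrightarrow> (\<phi> has_real_derivative \<phi>' x) (at x)"
    and cont: "continuous_on (p ` {0..1}) \<phi>'"
  shows "integrable leb01 (\<lambda>s. \<phi>' (p s) * f s)"
    and "t \<in> {0..1} \<Longrightarrow> \<phi> (p t) = \<phi> (p 0) + prim (\<lambda>s. \<phi>' (p s) * f s) t"
proof -
  have cp: "continuous_on {0..1} p"
    by (rule continuous_of_prim[OF f p])
  have c: "continuous_on {0..1} (\<lambda>s. \<phi>' (p s))"
    by (rule continuous_on_compose2[OF cont cp]) auto
  obtain C where C: "\<And>t. t \<in> {0..1} \<Longrightarrow> norm (\<phi>' (p t)) \<le> C"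
    using bounded_on_unit[OF c] by metis
  show i: "integrable leb01 (\<lambda>s. \<phi>' (p s) * f s)"
    using integrable_bilinear_bounded[OF bounded_bilinear_mult f continuous_measurable_leb01[OF c] C]
    by (simp add: mult.commute)
  have h: "integrable leb01 (\<lambda>s. \<bar>f s\<bar>)"
    using f by simp
  assume t: "t \<in> {0..1}"
  show "\<phi> (p t) = \<phi> (p 0) + prim (\<lambda>s. \<phi>' (p s) * f s) t"
  proof (rule prim_eqI_approx[OF i h _ t, where g = "\<lambda>t. \<phi> (p t)"])
    fix e :: real assume "0 < e"
    obtain d where d: "0 < d" "\<And>x y. x \<in> {0..1} \<Longrightarrow> y \<in> {0..1} \<Longrightarrow> \<bar>x - y\<bar> < d \<Longrightarrow> norm (\<phi>' (p x) - \<phi>' (p y)) \<le> e"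
      using uniformly_continuous_unit[OF c \<open>0 < e\<close>] by metis
    show "\<exists>d>0. \<forall>a b. 0 \<le> a \<and> a \<le> b \<and> b \<le> 1 \<and> b - a < d \<longrightarrow>
       norm (\<phi> (p b) - \<phi> (p a) - seg (\<lambda>s. \<phi>' (p s) * f s) a b) \<le> e * seg (\<lambda>s. \<bar>f s\<bar>) a b"
    proof (intro exI[of _ d] conjI allI impI)
      fix a b :: real assume ab: "0 \<le> a \<and> a \<le> b \<and> b \<le> 1 \<and> b - a < d"
      have pab: "p b - p a = seg f a b"
        using prim_diff_eq_seg[OF f, of a b] ab p[of a] p[of b] by auto
      have conn: "connected (p ` {a..b})"
        using ab by (intro connected_continuous_image continuous_on_subset[OF cp]) auto
      text \<open>The intermediate point of the mean value theorem is itself a value of \<open>p\<close> on \<open>[a,b]\<close>.\<close>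
      have "\<exists>s\<in>{a..b}. \<phi> (p b) - \<phi> (p a) = \<phi>' (p s) * (p b - p a)"
      proof -
        have mvt: "\<exists>s\<in>{a..b}. \<phi> y - \<phi> x = \<phi>' (p s) * (y - x)"
          if "x < y" "x \<in> p ` {a..b}" "y \<in> p ` {a..b}" for x y
        proof -
          have sub: "{x..y} \<subseteq> p ` {a..b}"
            using connected_contains_Icc[OF conn that(2,3)] .
          have "\<exists>z. x < z \<and> z < y \<and> \<phi> y - \<phi> x = (y - x) * \<phi>' z"
          proof (rule MVT2[OF that(1)])
            fix z assume "x \<le> z" "z \<le> y"
            then have "z \<in> p ` {a..b}" using sub by auto
            then have "z \<in> p ` {0..1}" using ab by fastforce
            then show "(\<phi> has_real_derivative \<phi>' z) (at z)" by (rule der)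
          qed
          then obtain z where z: "x < z" "z < y" "\<phi> y - \<phi> x = (y - x) * \<phi>' z"
            by blast
          then have "z \<in> p ` {a..b}" using sub by auto
          then show ?thesis
            using z(3) by (auto simp: mult.commute)
        qed
        have "a \<in> {a..b}" using ab by auto
        show ?thesis
        proof (cases "p a" "p b" rule: linorder_cases)
          case less
          then show ?thesis using mvt[of "p a" "p b"] ab by auto
        next
          case greater
          then obtain s where "s \<in> {a..b}" "\<phi> (p a) - \<phi> (p b) = \<phi>' (p s) * (p a - p b)"
            using mvt[of "p b" "p a"] ab by auto
          then show ?thesis by (auto intro!: bexI[of _ s] simp: algebra_simps)
        qed (use ab in auto)
      qed
      then obtain s where s: "s \<in> {a..b}" "\<phi> (p b) - \<phi> (p a) = \<phi>' (p s) * seg f a b"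
        unfolding pab by blast
      have i': "integrable leb01 (\<lambda>x. \<phi>' (p s) * f x)"
        using f by simp
      have "\<phi>' (p s) * seg f a b = seg (\<lambda>x. \<phi>' (p s) * f x) a b"
        unfolding seg_def by (simp add: mult.left_commute)
      then have *: "\<phi> (p b) - \<phi> (p a) - seg (\<lambda>s. \<phi>' (p s) * f s) a b
          = seg (\<lambda>x. \<phi>' (p s) * f x - \<phi>' (p x) * f x) a b"
        using s(2) ab i i' by (simp add: prim_diff_eq_seg[symmetric] prim_diff)
      have "norm (seg (\<lambda>x. \<phi>' (p s) * f x - \<phi>' (p x) * f x) a b) \<le> seg (\<lambda>x. e * \<bar>f x\<bar>) a b"
      proof (rule norm_seg_le)
        show "integrable leb01 (\<lambda>x. \<phi>' (p s) * f x - \<phi>' (p x) * f x)" using i i' by simp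
        show "integrable leb01 (\<lambda>x. e * \<bar>f x\<bar>)" using f by simp
        show "AE x in leb01. a < x \<longrightarrow> x \<le> b \<longrightarrow> norm (\<phi>' (p s) * f x - \<phi>' (p x) * f x) \<le> e * \<bar>f x\<bar>"
        proof (intro AE_I2 impI)
          fix x assume x: "a < x" "x \<le> b"
          have "norm (\<phi>' (p s) - \<phi>' (p x)) \<le> e"
            using d(2)[of s x] ab x s by auto
          then show "norm (\<phi>' (p s) * f x - \<phi>' (p x) * f x) \<le> e * \<bar>f x\<bar>"
            by (simp add: left_diff_distrib[symmetric] abs_mult mult_right_mono)
        qed
      qed
      also have "\<dots> = e * seg (\<lambda>x. \<bar>f x\<bar>) a b"
        unfolding seg_def by (simp add: mult.left_commute[of _ e])
      finally show "norm (\<phi> (p b) - \<phi> (p a) - seg (\<lambda>s. \<phi>' (p s) * f s) a b) \<le> e * seg (\<lambda>s. \<bar>f s\<bar>) a b"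
        unfolding * .
    qed (use d in auto)
  qed
qed

text \<open>The derivative of \<open>exp (2 * prim a t) / 2\<close> is the integrand, so integration
  against \<open>a\<close> reduces the weight to at most its half. This is why the Picard,
  uniqueness and Gronwall iterations below contract by 1/2, with no smallness condition on
  \<open>a\<close>.\<close>

lemma prim_exp_weight:
  fixes a :: "real \<Rightarrow> real"
  assumes a: "integrable leb01 a" and t: "t \<in> {0..1}"
  shows "integrable leb01 (\<lambda>s. a s * exp (2 * prim a s))"
    and "prim (\<lambda>s. a s * exp (2 * prim a s)) t \<le> exp (2 * prim a t) / 2"
proof -
  have p: "prim a t = prim a 0 + prim a t" for t by simp
  have der: "((\<lambda>x. exp (2 * x) / 2) has_real_derivative exp (2 * x)) (at x)" for x :: real
    by (auto intro!: derivative_eq_intros)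
  note ch = prim_chain[OF a p der, simplified mult.commute[of "exp _"]]
  show "integrable leb01 (\<lambda>s. a s * exp (2 * prim a s))"
    by (rule ch) (auto intro!: continuous_intros)
  have "exp (2 * prim a t) / 2 = exp (2 * prim a 0) / 2 + prim (\<lambda>s. a s * exp (2 * prim a s)) t"
    by (rule ch) (use t in \<open>auto intro!: continuous_intros\<close>)
  then show "prim (\<lambda>s. a s * exp (2 * prim a s)) t \<le> exp (2 * prim a t) / 2"
    by simp
qed

text \<open>The Borel sets over which \<open>f\<close> integrates to zero contain all half-lines and
  are closed under complements and countable disjoint unions; half-lines form an intersection stable
  generator.\<close>

lemma prim_zero_imp_AE_zero:
  fixes f :: "real \<Rightarrow> 'a::euclidean_space"
  assumes f: "integrable leb01 f" and 0: "\<And>t. t \<in> {0..1} \<Longrightarrow> prim f t = 0"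
  shows "AE x in leb01. f x = 0"
proof (rule leb01.density_zero[OF f])
  have borel0: "(\<integral>x. indicator A x *\<^sub>R f x \<partial>leb01) = 0" if "A \<in> sets borel" for A
  proof -
    have gen: "sets borel = sigma_sets UNIV (range (\<lambda>a::real. {..a}))"
      by (subst borel_eq_atMost) simp
    have "Int_stable (range (\<lambda>a::real. {..a}))"
      by (auto simp: Int_stable_def)
    moreover have "range (\<lambda>a::real. {..a}) \<subseteq> Pow UNIV" by simp
    moreover have "A \<in> sigma_sets UNIV (range (\<lambda>a::real. {..a}))"
      using that gen by simp
    ultimately show ?thesis
    proof (induction rule: sigma_sets_induct_disjoint)
      case (basic A)
      then obtain a where A: "A = {..a}" by auto
      \<comment> \<open>Half-lines with a negative end miss [0,1], and beyond 1 the integral no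
        longer changes, so the values of \<open>prim f\<close> on [0,1] decide all cases.\<close>
      have "indicator A x *\<^sub>R f x = (if 0 \<le> a then indicator {0..min a 1} x *\<^sub>R f x else 0)"
        if "x \<in> {0..1}" for x
        using that by (auto simp: A indicator_def)
      then have "(\<integral>x. indicator A x *\<^sub>R f x \<partial>leb01) = (if 0 \<le> a then prim f (min a 1) else 0)"
        unfolding prim_def by (auto intro!: integral_eq_zero_AE Bochner_Integration.integral_cong)
      then show ?case
        using 0[of "min a 1"] by auto
    next
      case (compl A)
      then have A: "A \<in> sets borel" unfolding gen by simp
      have "(\<integral>x. indicator (UNIV - A) x *\<^sub>R f x \<partial>leb01) = (\<integral>x. f x - indicator A x *\<^sub>R f x \<partial>leb01)"
        by (rule Bochner_Integration.integral_cong) (auto simp: indicator_def)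
      also have "\<dots> = integral\<^sup>L leb01 f - (\<integral>x. indicator A x *\<^sub>R f x \<partial>leb01)"
        by (rule Bochner_Integration.integral_diff[OF f integrable_indicator_leb01[OF f A]])
      also have "\<dots> = 0"
        using 0[of 1] compl.IH by (simp add: prim_1)
      finally show ?case .
    next
      case (union A)
      then have A: "A i \<in> sets borel" for i unfolding gen by auto
      have "(\<lambda>n. \<Sum>i<n. \<integral>x. indicator (A i) x *\<^sub>R f x \<partial>leb01) \<longlonglongrightarrow> 
            (\<integral>x. indicator (\<Union>i. A i) x *\<^sub>R f x \<partial>leb01)"
      proof -
        have eq: "(\<Sum>i<n. \<integral>x. indicator (A i) x *\<^sub>R f x \<partial>leb01) = (\<integral>x. indicator (\<Union>i<n. A i) x *\<^sub>R f x \<partial>leb01)" for n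
        proof -
          have "(\<Sum>i<n. indicator (A i) x) = (indicator (\<Union>i<n. A i) x :: real)" for x
            using union(1) by (subst indicator_UN_disjoint) (auto simp: disjoint_family_on_def)
          then show ?thesis
            using integrable_indicator_leb01[OF f A]
            by (subst Bochner_Integration.integral_sum[symmetric]) (auto simp: scaleR_sum_left[symmetric])
        qed
        show ?thesis unfolding eq
        proof (rule integral_dominated_convergence[where w="\<lambda>x. norm (f x)"])
          show "(\<lambda>x. indicator (\<Union>i. A i) x *\<^sub>R f x) \<in> borel_measurable leb01"
            using integrable_indicator_leb01[OF f, of "\<Union>i. A i"] A by auto
          show "(\<lambda>x. indicator (\<Union>i<n. A i) x *\<^sub>R f x) \<in> borel_measurable leb01" for n
            using integrable_indicator_leb01[OF f, of "\<Union>i<n. A i"] A by auto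
          show "AE x in leb01. (\<lambda>n. indicator (\<Union>i<n. A i) x *\<^sub>R f x) \<longlonglongrightarrow> indicator (\<Union>i. A i) x *\<^sub>R f x"
            by (intro AE_I2 tendsto_intros LIMSEQ_indicator_UN)
        qed (use f in \<open>auto simp: indicator_def\<close>)
      qed
      then show ?case
        using union(3) by (simp add: LIMSEQ_const_iff)
    qed (auto)
  qed
  fix A assume "A \<in> sets leb01"
  then obtain A' where "A' \<in> sets borel" "A = {0..1} \<inter> A'"
    by (auto simp: sets_leb01 sets_restrict_space)
  then show "set_lebesgue_integral leb01 A f = 0"
    using borel0[of A] unfolding set_lebesgue_integral_def by auto
qed

lemma prim_eq_imp_AE_eq:
  fixes f g :: "real \<Rightarrow> 'a::euclidean_space"
  assumes "integrable leb01 f" "integrable leb01 g" "\<And>t. t \<in> {0..1} \<Longrightarrow> prim f t = prim g t"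
  shows "AE x in leb01. f x = g x"
  using prim_zero_imp_AE_zero[of "\<lambda>x. f x - g x"] assms by (simp add: prim_diff)

text \<open>A gap at one point persists on a nondegenerate interval, which has positive measure. The
  lemma turns almost everywhere identities, coming from Fubini or from uniqueness of weak
  derivatives, into identities at every \<theta>.\<close>

lemma AE_eq_continuous_imp_eq:
  fixes f g :: "real \<Rightarrow> 'a::euclidean_space"
  assumes ae: "AE x in leb01. f x = g x"
    and f: "continuous_on {0..1} f" and g: "continuous_on {0..1} g" and x: "x \<in> {0..1}"
  shows "f x = g x"
proof (rule ccontr)
  assume neq: "f x \<noteq> g x"
  define e where "e = norm (f x - g x) / 2"
  have e: "0 < e" using neq by (simp add: e_def)
  have "continuous_on {0..1} (\<lambda>x. f x - g x)" by (rule continuous_on_diff[OF f g])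
  then obtain d where d: "0 < d" "\<And>x y. x \<in> {0..1} \<Longrightarrow> y \<in> {0..1} \<Longrightarrow> \<bar>x - y\<bar> < d \<Longrightarrow> norm ((f x - g x) - (f y - g y)) \<le> e"
    by (rule uniformly_continuous_unit[OF _ e]) blast
  \<comment> \<open>Clipping to [0,1] leaves an interval of positive length even if \<open>x\<close>
    is an endpoint.\<close>
  define a b where "a = max 0 (x - d/2)" and "b = min 1 (x + d/2)"
  have ab: "0 \<le> a" "a < b" "b \<le> 1" "x - d/2 \<le> a" "b \<le> x + d/2"
    using x d(1) by (auto simp: a_def b_def max_def min_def)
  have ne: "f y \<noteq> g y" if "y \<in> {a<..b}" for y
  proof
    assume "f y = g y"
    moreover have "y \<in> {0..1}" using that ab by simp
    moreover have "\<bar>x - y\<bar> < d" using that ab d(1) unfolding greaterThanAtMost_iff by linarith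
    ultimately have "norm (f x - g x) \<le> e" using d(2)[OF x, of y] by simp
    then show False using e unfolding e_def by simp
  qed
  have "AE y in leb01. y \<notin> {a<..b}"
    using ae ne by (auto elim!: eventually_mono)
  then have "AE y in leb01. indicator {a<..b} y *\<^sub>R (1::real) = 0"
    by eventually_elim simp
  then have "seg (\<lambda>x. 1::real) a b = 0"
    unfolding seg_def by (rule integral_eq_zero_AE)
  then show False
    using seg_const[of a b "1::real"] ab by simp
qed

section \<open>Joint measurability of indefinite integrals and exchange of their order\<close>

lemma measurable_prim:
  fixes f :: "'p \<Rightarrow> real \<Rightarrow> 'a::euclidean_space"
  assumes [measurable]: "case_prod f \<in> borel_measurable (N \<Otimes>\<^sub>M leb01)" "g \<in> borel_measurable N"
  shows "(\<lambda>p. prim (f p) (g p)) \<in> borel_measurable N"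
proof -
  have eq: "prim (f p) (g p) = (\<integral>x. (if 0 \<le> x \<and> x \<le> g p then f p x else 0) \<partial>leb01)" for p
    unfolding prim_def by (rule Bochner_Integration.integral_cong) (auto simp: indicator_def)
  show ?thesis
    unfolding eq by measurable
qed

lemma measurable_leb01sq_fst [measurable]: "fst \<in> borel_measurable leb01sq"
  and measurable_leb01sq_snd [measurable]: "snd \<in> borel_measurable leb01sq"
  using measurable_compose[OF measurable_fst measurable_leb01_ident]
    measurable_compose[OF measurable_snd measurable_leb01_ident] by auto

lemma measurable_prim_space:
  fixes f :: "real \<Rightarrow> real \<Rightarrow> 'a::euclidean_space"
  assumes [measurable]: "case_prod f \<in> borel_measurable leb01sq"
  shows "(\<lambda>(t, \<theta>). prim (f t) \<theta>) \<in> borel_measurable leb01sq"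
  unfolding case_prod_beta by (rule measurable_prim) measurable

lemma measurable_prim_time:
  fixes f :: "real \<Rightarrow> real \<Rightarrow> 'a::euclidean_space"
  assumes [measurable]: "case_prod f \<in> borel_measurable leb01sq"
  shows "(\<lambda>(t, \<theta>). prim (\<lambda>s. f s \<theta>) t) \<in> borel_measurable leb01sq"
  unfolding case_prod_beta by (rule measurable_prim) measurable

text \<open>Both upper limits are encoded as indicators over fixed spaces, so this is Fubini for a
  single function on the square.\<close>

lemma prim_swap:
  fixes f :: "real \<Rightarrow> real \<Rightarrow> 'a::euclidean_space"
  assumes f: "integrable leb01sq (case_prod f)"
  shows "prim (\<lambda>s. prim (f s) \<theta>) t = prim (\<lambda>x. prim (\<lambda>s. f s x) t) \<theta>"
proof -
  have [measurable]: "case_prod f \<in> borel_measurable leb01sq"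
    using f by auto
  have "integrable leb01sq (\<lambda>(s, x). indicator {0..t} s *\<^sub>R indicator {0..\<theta>} x *\<^sub>R f s x)"
    by (rule Bochner_Integration.integrable_bound[OF f]) (auto simp: indicator_def)
  from leb01_pair.Fubini_integral[OF this]
  have "(\<integral>x. \<integral>s. indicator {0..t} s *\<^sub>R indicator {0..\<theta>} x *\<^sub>R f s x \<partial>leb01 \<partial>leb01)
      = (\<integral>s. \<integral>x. indicator {0..t} s *\<^sub>R indicator {0..\<theta>} x *\<^sub>R f s x \<partial>leb01 \<partial>leb01)" .
  moreover have "(\<integral>s. indicator {0..t} s *\<^sub>R indicator {0..\<theta>} x *\<^sub>R f s x \<partial>leb01)
      = indicator {0..\<theta>} x *\<^sub>R prim (\<lambda>s. f s x) t" for x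
    unfolding prim_def scaleR_left_commute[of _ "indicator {0..\<theta>} x"] by (rule integral_scaleR_right)
  moreover have "(\<integral>x. indicator {0..t} s *\<^sub>R indicator {0..\<theta>} x *\<^sub>R f s x \<partial>leb01)
      = indicator {0..t} s *\<^sub>R prim (f s) \<theta>" for s
    unfolding prim_def by (rule integral_scaleR_right)
  ultimately show ?thesis
    unfolding prim_def by simp
qed

section \<open>Square integrable functions\<close>

text \<open>Measurability is part of the definition because integrability of the squared norm says
  nothing about measurability of \<open>f\<close> itself. Members are representatives; no quotient
  is taken.\<close>

definition l2 :: "'p measure \<Rightarrow> ('p \<Rightarrow> 'a::euclidean_space) \<Rightarrow> bool" where
  "l2 M f \<longleftrightarrow> f \<in> borel_measurable M \<and> integrable M (\<lambda>x. (norm (f x))\<^sup>2)"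

lemma l2_measurable: "l2 M f \<Longrightarrow> f \<in> borel_measurable M"
  by (simp add: l2_def)

lemma l2_integrable_norm2: "l2 M f \<Longrightarrow> integrable M (\<lambda>x. (norm (f x))\<^sup>2)"
  by (simp add: l2_def)

lemma l2_bound:
  assumes "l2 M g" "f \<in> borel_measurable M" "AE x in M. norm (f x) \<le> C * norm (g x)" 
  shows "l2 M f"
  unfolding l2_def
proof (rule conjI[OF assms(2)], rule Bochner_Integration.integrable_bound)
  show "integrable M (\<lambda>x. C\<^sup>2 * (norm (g x))\<^sup>2)"
    using assms(1) by (simp add: l2_def)
  show "(\<lambda>x. (norm (f x))\<^sup>2) \<in> borel_measurable M" using assms(2) by measurable
  show "AE x in M. norm ((norm (f x))\<^sup>2) \<le> norm (C\<^sup>2 * (norm (g x))\<^sup>2)"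
    using assms(3)
  proof eventually_elim
    case (elim x)
    then have "(norm (f x))\<^sup>2 \<le> (C * norm (g x))\<^sup>2" by (rule power_mono) simp
    then show ?case by (simp add: power_mult_distrib abs_mult)
  qed
qed

lemma (in finite_measure) l2_imp_integrable:
  assumes "l2 M f"
  shows "integrable M f"
proof (rule Bochner_Integration.integrable_bound[where f="\<lambda>x. 1 + (norm (f x))\<^sup>2"])
  show "integrable M (\<lambda>x. 1 + (norm (f x))\<^sup>2)" using assms by (simp add: l2_def)
  have "r \<le> 1 + r\<^sup>2" if "0 \<le> r" for r :: real
    using zero_le_power2[of "r - 1/2"] by (simp add: power2_eq_square algebra_simps)
  then show "AE x in M. norm (f x) \<le> norm (1 + (norm (f x))\<^sup>2)"
    by (intro AE_I2) (simp add: abs_of_nonneg)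
qed (use assms in \<open>simp add: l2_def\<close>)

lemma norm_add_power2_le: "(norm (x + y))\<^sup>2 \<le> 2 * (norm x)\<^sup>2 + 2 * (norm y)\<^sup>2"
proof -
  have "(norm (x + y))\<^sup>2 \<le> (norm x + norm y)\<^sup>2"
    by (intro power_mono norm_triangle_ineq) simp
  also have "\<dots> \<le> 2 * (norm x)\<^sup>2 + 2 * (norm y)\<^sup>2"
    using zero_le_power2[of "norm x - norm y"] by (simp add: power2_eq_square algebra_simps)
  finally show ?thesis .
qed

lemma l2_add:
  assumes "l2 M f" "l2 M g"
  shows "l2 M (\<lambda>x. f x + g x)"
  unfolding l2_def
proof (intro conjI)
  show m: "(\<lambda>x. f x + g x) \<in> borel_measurable M"
    using assms unfolding l2_def by (intro borel_measurable_add) auto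
  show "integrable M (\<lambda>x. (norm (f x + g x))\<^sup>2)"
  proof (rule Bochner_Integration.integrable_bound[where f="\<lambda>x. 2 * (norm (f x))\<^sup>2 + 2 * (norm (g x))\<^sup>2"])
    show "integrable M (\<lambda>x. 2 * (norm (f x))\<^sup>2 + 2 * (norm (g x))\<^sup>2)"
      using assms by (simp add: l2_def)
  qed (use m norm_add_power2_le in \<open>auto simp: abs_of_nonneg\<close>)
qed

lemma l2_scaleR: "l2 M f \<Longrightarrow> l2 M (\<lambda>x. r *\<^sub>R f x)"
  by (rule l2_bound[where g=f and C="\<bar>r\<bar>"]) (auto simp: l2_def)

lemma l2_zero [simp]: "l2 M (\<lambda>x. 0)"
  by (simp add: l2_def)

lemma l2_diff:
  assumes "l2 M f" "l2 M g"
  shows "l2 M (\<lambda>x. f x - g x)"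
  using l2_add[OF assms(1) l2_scaleR[OF assms(2), of "-1"]] by simp

lemma l2_sum: "(\<And>i. i \<in> I \<Longrightarrow> l2 M (f i)) \<Longrightarrow> l2 M (\<lambda>x. \<Sum>i\<in>I. f i x)"
  by (induction I rule: infinite_finite_induct) (auto intro: l2_add)

lemma l2_norm: "l2 M f \<Longrightarrow> l2 M (\<lambda>x. norm (f x))"
  unfolding l2_def by (auto intro: borel_measurable_norm)

lemma l2_const: "finite_measure M \<Longrightarrow> l2 M (\<lambda>x. c)"
  by (simp add: l2_def finite_measure.integrable_const)

text \<open>This is nonnegativity of the variance of \<open>norm (f x)\<close> about its mean
  \<open>m\<close>.\<close>

lemma (in prob_space) l2_norm_integral_le:
  assumes "l2 M f"
  shows "(\<integral>x. norm (f x) \<partial>M)\<^sup>2 \<le> (\<integral>x. (norm (f x))\<^sup>2 \<partial>M)"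
proof -
  define m where "m = (\<integral>x. norm (f x) \<partial>M)"
  have i: "integrable M (\<lambda>x. norm (f x))" "integrable M (\<lambda>x. (norm (f x))\<^sup>2)"
    using l2_imp_integrable[OF assms] assms by (auto simp: l2_def)
  have "0 \<le> (\<integral>x. (norm (f x) - m)\<^sup>2 \<partial>M)"
    by simp
  also have "(\<integral>x. (norm (f x) - m)\<^sup>2 \<partial>M) = (\<integral>x. (norm (f x))\<^sup>2 - 2 * m * norm (f x) + m\<^sup>2 \<partial>M)"
    by (rule Bochner_Integration.integral_cong) (auto simp: power2_diff)
  also have "\<dots> = (\<integral>x. (norm (f x))\<^sup>2 \<partial>M) - 2 * m * m + m\<^sup>2"
    using i by (simp add: m_def prob_space)
  finally show ?thesis
    by (simp add: m_def power2_eq_square)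
qed

lemma borel_measurable_bilinear:
  fixes f :: "'p \<Rightarrow> 'a::euclidean_space" and g :: "'p \<Rightarrow> 'b::euclidean_space"
    and B :: "'a \<Rightarrow> 'b \<Rightarrow> 'c::euclidean_space"
  assumes "bounded_bilinear B" "f \<in> borel_measurable M" "g \<in> borel_measurable M"
  shows "(\<lambda>x. B (f x) (g x)) \<in> borel_measurable M"
  by (rule borel_measurable_continuous_Pair[OF assms(2,3)])
     (auto intro!: continuous_intros bounded_bilinear.continuous_on[OF assms(1)])

lemma l2_bilinear:
  fixes f :: "'p \<Rightarrow> 'a::euclidean_space" and g :: "'p \<Rightarrow> 'b::euclidean_space"
    and B :: "'a \<Rightarrow> 'b \<Rightarrow> 'c::euclidean_space"
  assumes "bounded_bilinear B" "l2 M f" "g \<in> borel_measurable M" "AE x in M. norm (g x) \<le> C"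
  shows "l2 M (\<lambda>x. B (f x) (g x))"
proof -
  interpret bounded_bilinear B by fact
  obtain K where K: "0 \<le> K" "\<And>a b. norm (B a b) \<le> norm a * norm b * K"
    using nonneg_bounded by blast
  show ?thesis
  proof (rule l2_bound[OF assms(2)])
    show "AE x in M. norm (B (f x) (g x)) \<le> (C * K) * norm (f x)"
      using assms(4)
    proof eventually_elim
      case (elim x)
      have "norm (B (f x) (g x)) \<le> norm (f x) * norm (g x) * K" by (rule K)
      also have "\<dots> \<le> norm (f x) * C * K"
        by (intro mult_right_mono mult_left_mono elim K) auto
      finally show ?case by (simp add: mult_ac)
    qed
    show "(\<lambda>x. B (f x) (g x)) \<in> borel_measurable M"
      by (rule borel_measurable_bilinear[OF assms(1) l2_measurable[OF assms(2)] assms(3)])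
  qed
qed

lemma l2_continuous_leb01: "continuous_on {0..1} f \<Longrightarrow> l2 leb01 f"
  unfolding l2_def
  by (intro conjI continuous_measurable_leb01 continuous_integrable_leb01 continuous_intros)

section \<open>Absolutely continuous functions on the unit interval\<close>

text \<open>Absolute continuity in integral form. The values of \<open>f\<close> are prescribed at
  every point of [0,1], whereas \<open>g\<close> matters only up to null sets;
  \<open>has_prim_cong_AE\<close> reflects this asymmetry.\<close>

definition has_prim :: "(real \<Rightarrow> 'a::euclidean_space) \<Rightarrow> (real \<Rightarrow> 'a) \<Rightarrow> bool" where
  "has_prim f g \<longleftrightarrow> integrable leb01 g \<and> (\<forall>x\<in>{0..1}. f x = f 0 + prim g x)"

lemma has_primI:
  "integrable leb01 g \<Longrightarrow> (\<And>x. x \<in> {0..1} \<Longrightarrow> f x = f 0 + prim g x) \<Longrightarrow> has_prim f g"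
  unfolding has_prim_def by blast

lemma has_prim_integrable: "has_prim f g \<Longrightarrow> integrable leb01 g"
  unfolding has_prim_def by blast

lemma has_primD: "has_prim f g \<Longrightarrow> x \<in> {0..1} \<Longrightarrow> f x = f 0 + prim g x"
  unfolding has_prim_def by blast

lemma has_prim_prim: "integrable leb01 g \<Longrightarrow> has_prim (\<lambda>x. c + prim g x) g"
  by (rule has_primI) auto

lemma has_prim_continuous: "has_prim f g \<Longrightarrow> continuous_on {0..1} f"
  by (rule continuous_of_prim[of g]) (auto intro: has_prim_integrable has_primD)

lemma has_prim_cong_AE:
  assumes "has_prim f g" "\<And>x. x \<in> {0..1} \<Longrightarrow> f' x = f x" "AE x in leb01. g' x = g x"
    "g' \<in> borel_measurable leb01"
  shows "has_prim f' g'"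
proof (rule has_primI)
  have g: "integrable leb01 g" by (rule has_prim_integrable[OF assms(1)])
  show "integrable leb01 g'"
    using integrable_cong_AE[OF assms(4) _ assms(3)] g by auto
  fix x :: real assume x: "x \<in> {0..1}"
  have "prim g' x = prim g x"
    by (rule prim_cong_AE[OF assms(3,4)]) (use g in auto)
  then show "f' x = f' 0 + prim g' x"
    using has_primD[OF assms(1) x] assms(2)[OF x] assms(2)[of 0] by simp
qed

lemma has_prim_cong:
  assumes "\<And>x. x \<in> {0..1} \<Longrightarrow> f' x = f x" "\<And>x. x \<in> {0..1} \<Longrightarrow> g' x = g x"
  shows "has_prim f' g' \<longleftrightarrow> has_prim f g"
proof -
  have "integrable leb01 g' \<longleftrightarrow> integrable leb01 g"
    by (rule Bochner_Integration.integrable_cong) (use assms(2) in auto)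
  moreover have "prim g' x = prim g x" for x
    by (rule prim_cong) (use assms(2) in auto)
  moreover have "f' 0 = f 0" by (rule assms(1)) simp
  ultimately show ?thesis
    unfolding has_prim_def by (simp add: assms(1) del: atLeastAtMost_iff)
qed

lemma has_prim_unique:
  assumes f: "has_prim f g" and f': "has_prim f' g'" and eq: "\<And>x. x \<in> {0..1} \<Longrightarrow> f x = f' x"
  shows "AE x in leb01. g x = g' x"
proof (rule prim_eq_imp_AE_eq)
  show "prim g x = prim g' x" if "x \<in> {0..1}" for x
    using has_primD[OF f that] has_primD[OF f' that] eq[OF that] eq[of 0] by simp
qed (use assms has_prim_integrable in auto)

lemma has_prim_add: "has_prim f g \<Longrightarrow> has_prim f' g' \<Longrightarrow> has_prim (\<lambda>x. f x + f' x) (\<lambda>x. g x + g' x)"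
proof (rule has_primI)
  assume *: "has_prim f g" "has_prim f' g'"
  show "integrable leb01 (\<lambda>x. g x + g' x)" using *[THEN has_prim_integrable] by simp
  show "f x + f' x = f 0 + f' 0 + prim (\<lambda>x. g x + g' x) x" if "x \<in> {0..1}" for x
    using has_primD[OF *(1) that] has_primD[OF *(2) that] prim_add[OF *[THEN has_prim_integrable]] by simp
qed

lemma has_prim_linear:
  assumes L: "bounded_linear L" and f: "has_prim f g"
  shows "has_prim (\<lambda>x. L (f x)) (\<lambda>x. L (g x))"
proof (rule has_primI)
  interpret L: bounded_linear L by fact
  note g = has_prim_integrable[OF f]
  show "integrable leb01 (\<lambda>x. L (g x))" by (rule integrable_bounded_linear[OF L g])
  fix x :: real assume x: "x \<in> {0..1}"
  have "prim (\<lambda>x. L (g x)) x = L (prim g x)"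
    unfolding prim_def
    using integral_bounded_linear[OF L integrable_indicator_leb01[OF g, of "{0..x}"]]
    by (simp add: L.scaleR)
  then show "L (f x) = L (f 0) + prim (\<lambda>x. L (g x)) x"
    using has_primD[OF f x] by (metis L.add)
qed

lemma has_prim_bilinear:
  assumes B: "bounded_bilinear B" and F: "has_prim F f" and G: "has_prim G g"
  shows "has_prim (\<lambda>x. B (F x) (G x)) (\<lambda>x. B (f x) (G x) + B (F x) (g x))"
proof (rule has_primI)
  note * = B has_prim_integrable[OF F] has_prim_integrable[OF G] has_primD[OF F] has_primD[OF G]
  show "integrable leb01 (\<lambda>x. B (f x) (G x) + B (F x) (g x))" by (rule prim_bilinear(1)[OF *])
  show "B (F x) (G x) = B (F 0) (G 0) + prim (\<lambda>x. B (f x) (G x) + B (F x) (g x)) x" if "x \<in> {0..1}" for x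
    by (rule prim_bilinear(2)[OF * that])
qed

lemma has_prim_chain:
  fixes p f \<phi> \<phi>' :: "real \<Rightarrow> real"
  assumes p: "has_prim p f" and der: "\<And>x. x \<in> p ` {0..1} \<Longrightarrow> (\<phi> has_real_derivative \<phi>' x) (at x)"
    and cont: "continuous_on (p ` {0..1}) \<phi>'"
  shows "has_prim (\<lambda>t. \<phi> (p t)) (\<lambda>s. \<phi>' (p s) * f s)"
proof (rule has_primI)
  note * = has_prim_integrable[OF p] has_primD[OF p] der cont
  show "integrable leb01 (\<lambda>s. \<phi>' (p s) * f s)" by (rule prim_chain(1)[OF *])
  show "\<phi> (p x) = \<phi> (p 0) + prim (\<lambda>s. \<phi>' (p s) * f s) x" if "x \<in> {0..1}" for x
    by (rule prim_chain(2)[OF * that])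
qed

lemma has_prim_norm_diff_le:
  assumes f: "has_prim f g" and ab: "a \<in> {0..1}" "b \<in> {0..1}" "a \<le> b"
  shows "norm (f b - f a) \<le> prim (\<lambda>x. norm (g x)) b - prim (\<lambda>x. norm (g x)) a"
  using norm_prim_diff_le[OF has_prim_integrable[OF f], of a b] has_primD[OF f ab(1)] has_primD[OF f ab(2)] ab
  by simp

text \<open>The embedding of W(1,1) into bounded functions: |f(y)| is at most |f(x)| plus the
  integral of |g|, and this is averaged over all x in [0,1].\<close>

lemma sup_le_integrals:
  fixes f g :: "real \<Rightarrow> 'a::euclidean_space"
  assumes f: "has_prim f g" and y: "y \<in> {0..1}"
  shows "norm (f y) \<le> (\<integral>x. norm (f x) \<partial>leb01) + (\<integral>x. norm (g x) \<partial>leb01)"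
proof -
  note g = has_prim_integrable[OF f]
  have i: "integrable leb01 f" by (rule continuous_integrable_leb01[OF has_prim_continuous[OF f]])
  have *: "norm (f y) \<le> norm (f x) + (\<integral>x. norm (g x) \<partial>leb01)" if x: "x \<in> {0..1}" for x
  proof -
    have "norm (f b - f a) \<le> (\<integral>x. norm (g x) \<partial>leb01)" if "a \<in> {0..1}" "b \<in> {0..1}" "a \<le> b" for a b
    proof -
      have "norm (f b - f a) \<le> prim (\<lambda>x. norm (g x)) b - prim (\<lambda>x. norm (g x)) a"
        by (rule has_prim_norm_diff_le[OF f that])
      also have "\<dots> \<le> (\<integral>x. norm (g x) \<partial>leb01)"
        using prim_le_integral[of "\<lambda>x. norm (g x)" b] prim_nonneg[of "\<lambda>x. norm (g x)" a] g by simp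
      finally show ?thesis .
    qed
    from this[of x y] this[of y x] have "norm (f y - f x) \<le> (\<integral>x. norm (g x) \<partial>leb01)"
      using x y by (cases "x \<le> y") (auto simp: norm_minus_commute[of "f x"])
    then show ?thesis
      using norm_triangle_ineq[of "f x" "f y - f x"] by simp
  qed
  have "(\<integral>x. norm (f y) \<partial>leb01) \<le> (\<integral>x. norm (f x) + (\<integral>x. norm (g x) \<partial>leb01) \<partial>leb01)"
    using i by (intro integral_mono) (auto simp: *)
  then show ?thesis
    using i by (simp add: leb01.prob_space)
qed

section \<open>Parametric Sobolev classes\<close>

text \<open>\<open>psob F Z k f\<close>: for \<open>F\<close>-almost every \<open>t\<close>, the function \<open>f t\<close> has \<open>k\<close> weak derivatives; the regularity
  of the derivatives with respect to both variables is prescribed by \<open>Z\<close>.\<close>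
primrec psob :: "real filter \<Rightarrow> ((real \<Rightarrow> real \<Rightarrow> 'a::euclidean_space) \<Rightarrow> bool) \<Rightarrow> nat \<Rightarrow>
    (real \<Rightarrow> real \<Rightarrow> 'a) \<Rightarrow> bool" where
  "psob F Z 0 f = Z f"
| "psob F Z (Suc k) f = (Z f \<and> (\<exists>g. psob F Z k g \<and> (\<forall>\<^sub>F t in F. has_prim (f t) (g t))))"

lemma psob_SucI:
  "Z f \<Longrightarrow> psob F Z k g \<Longrightarrow> \<forall>\<^sub>F t in F. has_prim (f t) (g t) \<Longrightarrow> psob F Z (Suc k) f"
  by auto

lemma psob_SucE:
  assumes "psob F Z (Suc k) f"
  obtains g where "psob F Z k g" "\<forall>\<^sub>F t in F. has_prim (f t) (g t)" "Z f"
  using assms by auto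

lemma psob_imp_base: "psob F Z k f \<Longrightarrow> Z f"
  by (cases k) auto

lemma psob_SucD: "psob F Z (Suc k) f \<Longrightarrow> psob F Z k f"
  by (induction k arbitrary: f) auto

lemma psob_antimono: "psob F Z k f \<Longrightarrow> j \<le> k \<Longrightarrow> psob F Z j f"
  by (induction k) (use psob_SucD in \<open>auto simp: le_Suc_eq simp del: psob.simps(2)\<close>)

lemma psob_weaken:
  assumes "psob F Z k f" "F' \<le> F" "\<And>f. Z f \<Longrightarrow> Z' f"
  shows "psob F' Z' k f"
  using assms(1)
proof (induction k arbitrary: f)
  case (Suc k)
  then obtain g where "Z f" "psob F Z k g" "\<forall>\<^sub>F t in F. has_prim (f t) (g t)"
    by auto
  then show ?case
    using Suc.IH[of g] assms(3)[of f] filter_leD[OF assms(2)] by auto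
qed (use assms(3) in auto)

text \<open>The recursive form suits inductions on the order; unrolled into one sequence of
  derivatives it matches the chains in \<open>hn_chain\<close> and
  \<open>chain_path\<close>.\<close>

lemma psob_chain:
  assumes "psob F Z k f"
  obtains D where "D 0 = f" "\<And>i. i \<le> k \<Longrightarrow> Z (D i)"
    "\<And>i. i < k \<Longrightarrow> \<forall>\<^sub>F t in F. has_prim (D i t) (D (Suc i) t)"
proof -
  have "\<exists>D. D 0 = f \<and> (\<forall>i\<le>k. Z (D i)) \<and> (\<forall>i<k. \<forall>\<^sub>F t in F. has_prim (D i t) (D (Suc i) t))"
    using assms
  proof (induction k arbitrary: f)
    case 0
    then show ?case by auto
  next
    case (Suc k)
    then obtain g where g: "psob F Z k g" "Z f" "\<forall>\<^sub>F t in F. has_prim (f t) (g t)"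
      by auto
    obtain D where D: "D 0 = g" "\<forall>i\<le>k. Z (D i)"
      "\<forall>i<k. \<forall>\<^sub>F t in F. has_prim (D i t) (D (Suc i) t)"
      using Suc.IH[OF g(1)] by blast
    show ?case
    proof (intro exI[of _ "case_nat f D"] conjI allI impI)
      fix i assume "i \<le> Suc k"
      then show "Z (case i of 0 \<Rightarrow> f | Suc j \<Rightarrow> D j)" using g D by (auto split: nat.split)
    next
      fix i assume "i < Suc k"
      then show "\<forall>\<^sub>F t in F. has_prim ((case i of 0 \<Rightarrow> f | Suc j \<Rightarrow> D j) t)
          ((case Suc i of 0 \<Rightarrow> f | Suc j \<Rightarrow> D j) t)"
        using g D by (auto split: nat.split)
    qed simp
  qed
  then show ?thesis using that by blast
qed

lemma psob_of_chain:
  assumes "\<And>i. i \<le> k \<Longrightarrow> Z (D i)" "\<And>i. i < k \<Longrightarrow> \<forall>\<^sub>F t in F. has_prim (D i t) (D (Suc i) t)"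
  shows "psob F Z k (D 0)"
  using assms
proof (induction k arbitrary: D)
  case (Suc k)
  have "psob F Z k (D (Suc 0))"
    by (rule Suc.IH[of "\<lambda>i. D (Suc i)"]) (use Suc.prems in auto)
  then show ?case using Suc.prems[of 0] by auto
qed auto

lemma psob_linear:
  assumes L: "bounded_linear L" and f: "psob F Z k f"
    and Z: "\<And>f. Z f \<Longrightarrow> Z' (\<lambda>t \<theta>. L (f t \<theta>))"
  shows "psob F Z' k (\<lambda>t \<theta>. L (f t \<theta>))"
  using f
proof (induction k arbitrary: f)
  case (Suc k)
  obtain g where g: "psob F Z k g" "Z f" "\<forall>\<^sub>F t in F. has_prim (f t) (g t)"
    using Suc.prems by auto
  have "\<forall>\<^sub>F t in F. has_prim (\<lambda>\<theta>. L (f t \<theta>)) (\<lambda>\<theta>. L (g t \<theta>))"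
    using g(3) by eventually_elim (rule has_prim_linear[OF L])
  then show ?case using Suc.IH[OF g(1)] g(2) Z by auto
qed (use Z in auto)

lemma psob_add:
  assumes f: "psob F Z k f" and g: "psob F Z k g"
    and Z: "\<And>f g. Z f \<Longrightarrow> Z g \<Longrightarrow> Z (\<lambda>t \<theta>. f t \<theta> + g t \<theta>)"
  shows "psob F Z k (\<lambda>t \<theta>. f t \<theta> + g t \<theta>)"
  using f g
proof (induction k arbitrary: f g)
  case (Suc k)
  obtain f' where f': "psob F Z k f'" "Z f" "\<forall>\<^sub>F t in F. has_prim (f t) (f' t)"
    using Suc.prems by auto
  obtain g' where g': "psob F Z k g'" "Z g" "\<forall>\<^sub>F t in F. has_prim (g t) (g' t)"
    using Suc.prems by auto
  have "\<forall>\<^sub>F t in F. has_prim (\<lambda>\<theta>. f t \<theta> + g t \<theta>) (\<lambda>\<theta>. f' t \<theta> + g' t \<theta>)"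
    using f'(3) g'(3) by eventually_elim (rule has_prim_add)
  then show ?case using Suc.IH[OF f'(1) g'(1)] Z f'(2) g'(2) by auto
qed (use Z in auto)

text \<open>Leibniz rule. Differentiating a product spends a derivative of either factor, so the
  left and right versions at level k are proved together. The assumptions \<open>b1\<close> and
  \<open>b2\<close> ask for products of order zero only when one factor has a derivative in reserve,
  which in one dimension makes that factor bounded in space.\<close>

lemma psob_bilinear:
  fixes B :: "'a::euclidean_space \<Rightarrow> 'b::euclidean_space \<Rightarrow> 'c::euclidean_space"
  assumes B: "bounded_bilinear B"
    and b1: "\<And>f g. Z1 f \<Longrightarrow> psob F Z2 1 g \<Longrightarrow> Z3 (\<lambda>t \<theta>. B (f t \<theta>) (g t \<theta>))"
    and b2: "\<And>f g. psob F Z1 1 f \<Longrightarrow> Z2 g \<Longrightarrow> Z3 (\<lambda>t \<theta>. B (f t \<theta>) (g t \<theta>))"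
    and add: "\<And>f g. Z3 f \<Longrightarrow> Z3 g \<Longrightarrow> Z3 (\<lambda>t \<theta>. f t \<theta> + g t \<theta>)"
  shows psob_bilinear_left: "psob F Z1 k f \<Longrightarrow> psob F Z2 (Suc k) g \<Longrightarrow> psob F Z3 k (\<lambda>t \<theta>. B (f t \<theta>) (g t \<theta>))"
    and psob_bilinear_right: "psob F Z1 (Suc k) f \<Longrightarrow> psob F Z2 k g \<Longrightarrow> psob F Z3 k (\<lambda>t \<theta>. B (f t \<theta>) (g t \<theta>))"
    and psob_bilinear_Suc: "psob F Z1 (Suc k) f \<Longrightarrow> psob F Z2 (Suc k) g \<Longrightarrow> psob F Z3 (Suc k) (\<lambda>t \<theta>. B (f t \<theta>) (g t \<theta>))"
proof -
  have step: "psob F Z3 (Suc k) (\<lambda>t \<theta>. B (f t \<theta>) (g t \<theta>))"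
    if IH1: "\<And>f g. psob F Z1 k f \<Longrightarrow> psob F Z2 (Suc k) g \<Longrightarrow> psob F Z3 k (\<lambda>t \<theta>. B (f t \<theta>) (g t \<theta>))"
      and IH2: "\<And>f g. psob F Z1 (Suc k) f \<Longrightarrow> psob F Z2 k g \<Longrightarrow> psob F Z3 k (\<lambda>t \<theta>. B (f t \<theta>) (g t \<theta>))"
      and f: "psob F Z1 (Suc k) f" and g: "psob F Z2 (Suc k) g" for k f g
  proof -
    obtain f' where f': "psob F Z1 k f'" "\<forall>\<^sub>F t in F. has_prim (f t) (f' t)" "Z1 f"
      using f by (rule psob_SucE)
    obtain g' where g': "psob F Z2 k g'" "\<forall>\<^sub>F t in F. has_prim (g t) (g' t)" "Z2 g"
      using g by (rule psob_SucE)
    have "psob F Z3 k (\<lambda>t \<theta>. B (f' t \<theta>) (g t \<theta>) + B (f t \<theta>) (g' t \<theta>))"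
      using IH1[OF f'(1) g] IH2[OF f g'(1)] by (rule psob_add) (rule add)
    moreover have "\<forall>\<^sub>F t in F. has_prim (\<lambda>\<theta>. B (f t \<theta>) (g t \<theta>)) (\<lambda>\<theta>. B (f' t \<theta>) (g t \<theta>) + B (f t \<theta>) (g' t \<theta>))"
      using f'(2) g'(2) by eventually_elim (rule has_prim_bilinear[OF B])
    moreover have "Z3 (\<lambda>t \<theta>. B (f t \<theta>) (g t \<theta>))"
      using b1[OF f'(3), of g] psob_antimono[OF g, of 1] by simp
    ultimately show ?thesis by auto
  qed
  have "(\<forall>f g. psob F Z1 k f \<longrightarrow> psob F Z2 (Suc k) g \<longrightarrow> psob F Z3 k (\<lambda>t \<theta>. B (f t \<theta>) (g t \<theta>))) \<and>
    (\<forall>f g. psob F Z1 (Suc k) f \<longrightarrow> psob F Z2 k g \<longrightarrow> psob F Z3 k (\<lambda>t \<theta>. B (f t \<theta>) (g t \<theta>)))" for k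
  proof (induction k)
    case 0
    then show ?case using b1 b2 by (auto simp del: One_nat_def simp: One_nat_def[symmetric])
  next
    case (Suc k)
    have "psob F Z3 (Suc k) (\<lambda>t \<theta>. B (f t \<theta>) (g t \<theta>))" 
      if "psob F Z1 (Suc k) f" "psob F Z2 (Suc k) g" for f g
      using step[of k f g] Suc that by blast
    then show ?case
      using psob_SucD[of F Z1 "Suc k"] psob_SucD[of F Z2 "Suc k"] by blast
  qed
  then show 1: "psob F Z1 k f \<Longrightarrow> psob F Z2 (Suc k) g \<Longrightarrow> psob F Z3 k (\<lambda>t \<theta>. B (f t \<theta>) (g t \<theta>))"
    and 2: "psob F Z1 (Suc k) f \<Longrightarrow> psob F Z2 k g \<Longrightarrow> psob F Z3 k (\<lambda>t \<theta>. B (f t \<theta>) (g t \<theta>))" for k f g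
    by blast+
  show "psob F Z1 (Suc k) f \<Longrightarrow> psob F Z2 (Suc k) g \<Longrightarrow> psob F Z3 (Suc k) (\<lambda>t \<theta>. B (f t \<theta>) (g t \<theta>))"
    using step[of k f g] 1 2 by blast
qed

text \<open>Beyond measurability nothing is said about the dependence on \<open>t\<close>: this
  class serves to construct the \<open>E i\<close> of a single path, and their integrability in time
  is obtained later from the energy.\<close>

definition ae_l2 :: "(real \<Rightarrow> real \<Rightarrow> 'a::euclidean_space) \<Rightarrow> bool" where
  "ae_l2 f \<longleftrightarrow> case_prod f \<in> borel_measurable leb01sq \<and> (AE t in leb01. l2 leb01 (f t))"

abbreviation msob :: "nat \<Rightarrow> (real \<Rightarrow> real \<Rightarrow> 'a::euclidean_space) \<Rightarrow> bool" where
  "msob \<equiv> psob (ae_filter leb01) ae_l2"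

lemma msob_1_AE_continuous: "msob (Suc k) f \<Longrightarrow> AE t in leb01. continuous_on {0..1} (f t)"
proof -
  assume "msob (Suc k) f"
  then obtain g where "AE t in leb01. has_prim (f t) (g t)"
    by auto
  then show ?thesis
    by eventually_elim (rule has_prim_continuous)
qed

lemma ae_l2_bilinear:
  fixes B :: "'a::euclidean_space \<Rightarrow> 'b::euclidean_space \<Rightarrow> 'c::euclidean_space"
  assumes B: "bounded_bilinear B" and f: "ae_l2 f" and g: "case_prod g \<in> borel_measurable leb01sq"
    and cont: "AE t in leb01. continuous_on {0..1} (g t)"
  shows "ae_l2 (\<lambda>t \<theta>. B (f t \<theta>) (g t \<theta>))"
  unfolding ae_l2_def
proof
  have [measurable]: "case_prod f \<in> borel_measurable leb01sq" using f by (simp add: ae_l2_def)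
  show "(\<lambda>(t, \<theta>). B (f t \<theta>) (g t \<theta>)) \<in> borel_measurable leb01sq"
    using borel_measurable_bilinear[OF B, of "case_prod f" leb01sq "case_prod g"] f g
    by (simp add: ae_l2_def case_prod_beta)
  show "AE t in leb01. l2 leb01 (\<lambda>\<theta>. B (f t \<theta>) (g t \<theta>))"
    using f[unfolded ae_l2_def, THEN conjunct2] cont
  proof eventually_elim
    case (elim t)
    obtain C where "\<And>\<theta>. \<theta> \<in> {0..1} \<Longrightarrow> norm (g t \<theta>) \<le> C"
      using bounded_on_unit[OF elim(2)] by metis
    then show ?case
      by (intro l2_bilinear[OF B elim(1) continuous_measurable_leb01[OF elim(2)], where C=C]) auto
  qed
qed

lemma ae_l2_add: "ae_l2 f \<Longrightarrow> ae_l2 g \<Longrightarrow> ae_l2 (\<lambda>t \<theta>. f t \<theta> + g t \<theta>)"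
  unfolding ae_l2_def case_prod_beta
  by (auto elim!: eventually_elim2 intro: l2_add)

lemma msob_bilinear:
  fixes B :: "'a::euclidean_space \<Rightarrow> 'b::euclidean_space \<Rightarrow> 'c::euclidean_space"
  assumes B: "bounded_bilinear B"
  shows msob_bilinear_left: "msob k f \<Longrightarrow> msob (Suc k) g \<Longrightarrow> msob k (\<lambda>t \<theta>. B (f t \<theta>) (g t \<theta>))"
    and msob_bilinear_Suc: "msob (Suc k) f \<Longrightarrow> msob (Suc k) g \<Longrightarrow> msob (Suc k) (\<lambda>t \<theta>. B (f t \<theta>) (g t \<theta>))"
proof -
  have m: "case_prod f \<in> borel_measurable leb01sq" if "msob k f" for k and f :: "real \<Rightarrow> real \<Rightarrow> 'e::euclidean_space"
    using psob_imp_base[OF that] by (simp add: ae_l2_def)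
  have b1: "ae_l2 (\<lambda>t \<theta>. B (f t \<theta>) (g t \<theta>))" if "ae_l2 f" "msob 1 g" for f g
    using that msob_1_AE_continuous[of 0 g] m[OF that(2)] by (intro ae_l2_bilinear[OF B]) auto
  have b2: "ae_l2 (\<lambda>t \<theta>. B (f t \<theta>) (g t \<theta>))" if "msob 1 f" "ae_l2 g" for f g
    using that msob_1_AE_continuous[of 0 f] m[OF that(1)]
    by (intro ae_l2_bilinear[OF bounded_bilinear.flip[OF B]]) auto
  note * = B b1 b2 ae_l2_add
  show "msob k f \<Longrightarrow> msob (Suc k) g \<Longrightarrow> msob k (\<lambda>t \<theta>. B (f t \<theta>) (g t \<theta>))"
    by (rule psob_bilinear_left[OF *])
  show "msob (Suc k) f \<Longrightarrow> msob (Suc k) g \<Longrightarrow> msob (Suc k) (\<lambda>t \<theta>. B (f t \<theta>) (g t \<theta>))"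
    by (rule psob_bilinear_Suc[OF *])
qed

lemma msob_uminus: "msob k f \<Longrightarrow> msob k (\<lambda>t \<theta>. - f t \<theta>)"
proof (rule psob_linear[where L = "\<lambda>x. - x"])
  show "ae_l2 (\<lambda>t \<theta>. - f t \<theta>)" if "ae_l2 f" for f :: "real \<Rightarrow> real \<Rightarrow> 'a"
    using that by (auto simp: ae_l2_def case_prod_beta l2_def)
qed (auto intro: bounded_linear_minus bounded_linear_ident)

text \<open>The chain rule is applied to 1 / sqrt(x) at the square of |q|, which stays positive. The
  derivative is written as a product of copies of \<open>inverse (norm q)\<close> and an inner
  product, so that the product rules apply to it in \<open>msob_inverse_norm\<close>.\<close>

lemma has_prim_inverse_norm:
  fixes q q' :: "real \<Rightarrow> 'a::euclidean_space"
  assumes q: "has_prim q q'" and nz: "\<And>t. t \<in> {0..1} \<Longrightarrow> q t \<noteq> 0"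
  shows "has_prim (\<lambda>t. inverse (norm (q t)))
      (\<lambda>s. (inverse (norm (q s)) * inverse (norm (q s)) * inverse (norm (q s))) * (- (q s \<bullet> q' s)))"
proof -
  have p: "has_prim (\<lambda>t. q t \<bullet> q t) (\<lambda>s. q' s \<bullet> q s + q s \<bullet> q' s)"
    by (rule has_prim_bilinear[OF bounded_bilinear_inner q q])
  define \<phi>' where "\<phi>' x = - (inverse (sqrt x) * inverse (sqrt x) * inverse (sqrt x)) / 2" for x
  have pos: "0 < x" if "x \<in> (\<lambda>t. q t \<bullet> q t) ` {0..1}" for x
    using that nz by auto
  have der: "((\<lambda>x. inverse (sqrt x)) has_real_derivative \<phi>' x) (at x)" if "x \<in> (\<lambda>t. q t \<bullet> q t) ` {0..1}" for x
    using pos[OF that] unfolding \<phi>'_def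
    by (auto intro!: derivative_eq_intros simp: field_simps)
  have cont: "continuous_on ((\<lambda>t. q t \<bullet> q t) ` {0..1}) \<phi>'"
    unfolding \<phi>'_def using pos by (intro continuous_intros) force+
  have "has_prim (\<lambda>t. inverse (sqrt (q t \<bullet> q t))) (\<lambda>s. \<phi>' (q s \<bullet> q s) * (q' s \<bullet> q s + q s \<bullet> q' s))"
    by (rule has_prim_chain[OF p der cont])
  moreover have "\<phi>' (q s \<bullet> q s) * (q' s \<bullet> q s + q s \<bullet> q' s) =
      (inverse (norm (q s)) * inverse (norm (q s)) * inverse (norm (q s))) * (- (q s \<bullet> q' s))" for s
    by (simp add: \<phi>'_def norm_eq_sqrt_inner inner_commute)
  ultimately show ?thesis
    by (simp add: norm_eq_sqrt_inner)
qed

text \<open>Bootstrap: the derivative of 1/|q| is a polynomial in 1/|q|, \<open>q\<close> and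
  \<open>q'\<close>, so the regularity of 1/|q| rises by one order at a time. In the base case
  \<open>q'\<close> is merely square integrable and the other factors are controlled by their
  continuity in \<theta>.\<close>

lemma msob_inverse_norm:
  assumes "msob (Suc k) q" and nz: "AE t in leb01. \<forall>\<theta>\<in>{0..1}. q t \<theta> \<noteq> 0"
  shows "msob (Suc k) (\<lambda>t \<theta>. inverse (norm (q t \<theta>)))"
  using assms(1)
proof (induction k)
  case 0
  let ?\<sigma> = "\<lambda>t \<theta>. inverse (norm (q t \<theta>))"
  obtain q' where q': "ae_l2 q'" "AE t in leb01. has_prim (q t) (q' t)" and q: "ae_l2 q"
    using 0 by auto
  have [measurable]: "case_prod q \<in> borel_measurable leb01sq" using q by (simp add: ae_l2_def)
  have m\<sigma>: "case_prod ?\<sigma> \<in> borel_measurable leb01sq" by (simp add: case_prod_beta)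
  have cq: "AE t in leb01. continuous_on {0..1} (q t)" by (rule msob_1_AE_continuous[OF 0])
  then have c\<sigma>: "AE t in leb01. continuous_on {0..1} (?\<sigma> t)"
    using nz by eventually_elim (intro continuous_on_inverse continuous_on_norm; simp)
  then have "ae_l2 ?\<sigma>"
    using m\<sigma> unfolding ae_l2_def by (auto elim!: eventually_mono intro: l2_continuous_leb01)
  moreover have "ae_l2 (\<lambda>t \<theta>. (?\<sigma> t \<theta> * ?\<sigma> t \<theta> * ?\<sigma> t \<theta>) * (- (q t \<theta> \<bullet> q' t \<theta>)))"
  proof -
    have 1: "ae_l2 (\<lambda>t \<theta>. - (q t \<theta> \<bullet> q' t \<theta>))"
      using ae_l2_bilinear[OF bounded_bilinear.flip[OF bounded_bilinear_inner] q'(1) _ cq]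
        msob_uminus[of 0] by simp
    have 2: "AE t in leb01. continuous_on {0..1} (\<lambda>\<theta>. ?\<sigma> t \<theta> * ?\<sigma> t \<theta> * ?\<sigma> t \<theta>)"
      using c\<sigma> by eventually_elim (intro continuous_on_mult; assumption)
    have "(\<lambda>(t, \<theta>). ?\<sigma> t \<theta> * ?\<sigma> t \<theta> * ?\<sigma> t \<theta>) \<in> borel_measurable leb01sq" by (simp add: case_prod_beta)
    then show ?thesis
      by (rule ae_l2_bilinear[OF bounded_bilinear.flip[OF bounded_bilinear_mult] 1 _ 2])
  qed
  moreover have "AE t in leb01. has_prim (?\<sigma> t) (\<lambda>\<theta>. (?\<sigma> t \<theta> * ?\<sigma> t \<theta> * ?\<sigma> t \<theta>) * (- (q t \<theta> \<bullet> q' t \<theta>)))"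
    using q'(2) nz by eventually_elim (rule has_prim_inverse_norm; blast)
  ultimately show ?case by (intro psob_SucI) (simp_all only: psob.simps(1))
next
  case (Suc k)
  let ?\<sigma> = "\<lambda>t \<theta>. inverse (norm (q t \<theta>))"
  obtain q' where q': "msob (Suc k) q'" "AE t in leb01. has_prim (q t) (q' t)"
    using Suc.prems by auto
  have q: "msob (Suc k) q" by (rule psob_SucD[OF Suc.prems])
  have \<sigma>: "msob (Suc k) ?\<sigma>" by (rule Suc.IH[OF q])
  have "msob (Suc k) (\<lambda>t \<theta>. (?\<sigma> t \<theta> * ?\<sigma> t \<theta> * ?\<sigma> t \<theta>) * (- (q t \<theta> \<bullet> q' t \<theta>)))"
    by (intro msob_bilinear_Suc[OF bounded_bilinear_mult] msob_bilinear_Suc[OF bounded_bilinear_inner]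
        msob_uminus \<sigma> q q')
  moreover have "AE t in leb01. has_prim (?\<sigma> t) (\<lambda>\<theta>. (?\<sigma> t \<theta> * ?\<sigma> t \<theta> * ?\<sigma> t \<theta>) * (- (q t \<theta> \<bullet> q' t \<theta>)))"
    using q'(2) nz by eventually_elim (rule has_prim_inverse_norm; blast)
  ultimately show ?case by (rule psob_SucI[where f = ?\<sigma> and Z = ae_l2, OF psob_imp_base[OF \<sigma>]])
qed

text \<open>Writing |q| as its square times 1/|q| avoids a second bootstrap.\<close>

lemma msob_norm:
  assumes q: "msob (Suc k) q" and nz: "AE t in leb01. \<forall>\<theta>\<in>{0..1}. q t \<theta> \<noteq> 0"
  shows "msob (Suc k) (\<lambda>t \<theta>. norm (q t \<theta>))"
proof -
  have "msob (Suc k) (\<lambda>t \<theta>. (q t \<theta> \<bullet> q t \<theta>) * inverse (norm (q t \<theta>)))"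
    by (intro msob_bilinear_Suc[OF bounded_bilinear_mult] msob_bilinear_Suc[OF bounded_bilinear_inner]
        msob_inverse_norm assms)
  \<comment> \<open>At zeros of \<open>q\<close> both sides vanish because
    \<open>inverse 0 = 0\<close>.\<close>
  moreover have "(q t \<theta> \<bullet> q t \<theta>) * inverse (norm (q t \<theta>)) = norm (q t \<theta>)" for t \<theta>
    by (cases "q t \<theta> = 0") (simp_all add: power2_norm_eq_inner[symmetric] power2_eq_square)
  ultimately show ?thesis by simp
qed

text \<open>Each arc length derivative is a \<theta>-derivative divided by |q| and costs one order.
  The bound k \<le> m + 2 fits a velocity \<open>h\<close> of order n = m + 2 together with
  \<open>q\<close> of order n - 1: the factor 1/|q| never runs out of derivatives before
  \<open>h\<close> does.\<close>

lemma msob_arc_chain: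
  fixes q h :: "real \<Rightarrow> real \<Rightarrow> 'a::euclidean_space"
  assumes q: "msob (Suc m) q" and nz: "AE t in leb01. \<forall>\<theta>\<in>{0..1}. q t \<theta> \<noteq> 0"
    and h: "msob k h" and k: "k \<le> Suc (Suc m)"
  shows "\<exists>E. E 0 = h \<and> (\<forall>i\<le>k. msob (k - i) (E i)) \<and>
    (\<forall>i<k. AE t in leb01. has_prim (E i t) (\<lambda>x. norm (q t x) *\<^sub>R E (Suc i) t x))"
  using h k
proof (induction k arbitrary: h)
  case 0
  then show ?case by (intro exI[of _ "\<lambda>_. h"]) auto
next
  case (Suc k)
  obtain g where g: "msob k g" "AE t in leb01. has_prim (h t) (g t)"
    using Suc.prems by auto
  define e where "e t \<theta> = inverse (norm (q t \<theta>)) *\<^sub>R g t \<theta>" for t \<theta>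
  note \<sigma> = msob_inverse_norm[OF q nz]
  have "msob k e"
  proof (cases k)
    \<comment> \<open>The last derivative is only square integrable, so here 1/|q| has to act as a
      bounded multiplier.\<close>
    case 0
    have "msob 0 e"
      unfolding e_def using g(1) 0 psob_antimono[OF \<sigma>, of "Suc 0"]
      by (intro msob_bilinear_left[OF bounded_bilinear.flip[OF bounded_bilinear_scaleR]]) auto
    then show ?thesis using 0 by simp
  next
    case Suc': (Suc k')
    then have "msob (Suc k') (\<lambda>t \<theta>. inverse (norm (q t \<theta>)))" "msob (Suc k') g"
      using psob_antimono[OF \<sigma>, of "Suc k'"] Suc.prems(2) g(1) Suc' by (simp_all del: psob.simps)
    then show ?thesis
      unfolding e_def Suc' by (rule msob_bilinear_Suc[OF bounded_bilinear_scaleR])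
  qed
  then obtain E where E: "E 0 = e" "\<forall>i\<le>k. msob (k - i) (E i)"
    "\<forall>i<k. AE t in leb01. has_prim (E i t) (\<lambda>x. norm (q t x) *\<^sub>R E (Suc i) t x)"
    using Suc.IH[of e] Suc.prems by auto
  have rel: "AE t in leb01. has_prim (h t) (\<lambda>x. norm (q t x) *\<^sub>R e t x)"
    using g(2) nz
  proof eventually_elim
    case (elim t)
    have "has_prim (h t) (\<lambda>x. norm (q t x) *\<^sub>R e t x) \<longleftrightarrow> has_prim (h t) (g t)"
      by (rule has_prim_cong) (use elim(2) in \<open>auto simp: e_def\<close>)
    then show ?case using elim(1) by blast
  qed
  show ?case
  proof (intro exI[of _ "case_nat h E"] conjI allI impI)
    fix i assume "i \<le> Suc k"
    then show "msob (Suc k - i) (case i of 0 \<Rightarrow> h | Suc j \<Rightarrow> E j)"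
      using Suc.prems E(2) by (auto split: nat.split simp del: psob.simps)
  next
    fix i assume "i < Suc k"
    then show "AE t in leb01. has_prim ((case i of 0 \<Rightarrow> h | Suc j \<Rightarrow> E j) t)
        (\<lambda>x. norm (q t x) *\<^sub>R (case Suc i of 0 \<Rightarrow> h | Suc j \<Rightarrow> E j) t x)"
      using rel E(1,3) by (cases i) auto
  qed simp
qed

section \<open>Immersed Sobolev curves and the metric\<close>

lemma hn_chain_iff:
  "hn_chain n f D \<longleftrightarrow> (\<forall>\<theta>\<in>{0..1}. D 0 \<theta> = f \<theta>) \<and>
     (\<forall>k<n. has_prim (D k) (D (Suc k))) \<and> integrable leb01 (\<lambda>s. (norm (D n s))\<^sup>2)"
  unfolding hn_chain_def has_prim_def integrable_leb01_iff by (simp add: set_lebesgue_integral_eq_prim del: atLeastAtMost_iff)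

lemma arc_chain_iff:
  "arc_chain n c h E \<longleftrightarrow> (\<forall>\<theta>\<in>{0..1}. E 0 \<theta> = h \<theta>) \<and>
     (\<forall>i<n. has_prim (E i) (\<lambda>s. norm (dtheta c s) *\<^sub>R E (Suc i) s))"
  unfolding arc_chain_def has_prim_def integrable_leb01_iff by (simp add: set_lebesgue_integral_eq_prim del: atLeastAtMost_iff)

lemma curve_length_eq: "curve_length c = (\<integral>\<theta>. norm (dtheta c \<theta>) \<partial>leb01)"
  unfolding curve_length_def by (rule set_lebesgue_integral_eq_leb01)

text \<open>For a continuous integrand the fundamental theorem of calculus holds at every point,
  one-sided at 0 and 1. This is the bridge from \<open>vector_derivative\<close> to derivatives in
  integral form.\<close>

lemma dtheta_eq:
  fixes f g :: "real \<Rightarrow> 'a::euclidean_space"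
  assumes f: "has_prim f g" and g: "continuous_on {0..1} g" and \<theta>: "\<theta> \<in> {0..1}"
  shows "dtheta f \<theta> = g \<theta>"
proof -
  have gi: "set_integrable lborel {0..1} g"
    using continuous_integrable_leb01[OF g] by (simp add: integrable_leb01_iff)
  have eq: "f 0 + integral {0..x} g = f x" if "x \<in> {0..1}" for x
  proof -
    have "set_integrable lborel {0..x} g"
      by (rule set_integrable_subset[OF gi]) (use that in auto)
    then have "prim g x = integral {0..x} g"
      using set_lebesgue_integral_eq_prim[OF that, of g] set_borel_integral_eq_integral(2) by metis
    then show ?thesis
      using has_primD[OF f that] by argo
  qed
  have "((\<lambda>u. integral {0..u} g) has_vector_derivative g \<theta>) (at \<theta> within {0..1})"
    by (rule integral_has_vector_derivative[OF g \<theta>])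
  then have "((\<lambda>u. f 0 + integral {0..u} g) has_vector_derivative g \<theta>) (at \<theta> within {0..1})"
    using has_vector_derivative_add[OF has_vector_derivative_const, of "\<lambda>u. integral {0..u} g" "g \<theta>" _ "f 0"] by simp
  then have "(f has_vector_derivative g \<theta>) (at \<theta> within {0..1})"
    by (rule has_vector_derivative_transform[OF \<theta> eq[symmetric], rotated])
  then show ?thesis
    unfolding dtheta_def using \<theta> by (intro vector_derivative_within_closed_interval) auto
qed

lemma hn_chain_D:
  assumes "hn_chain n f D"
  shows hn_chain_0: "\<theta> \<in> {0..1} \<Longrightarrow> D 0 \<theta> = f \<theta>"
    and hn_chain_rel: "k < n \<Longrightarrow> has_prim (D k) (D (Suc k))"
    and hn_chain_l2: "1 \<le> n \<Longrightarrow> k \<le> n \<Longrightarrow> l2 leb01 (D k)"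
proof -
  show "\<theta> \<in> {0..1} \<Longrightarrow> D 0 \<theta> = f \<theta>" using assms unfolding hn_chain_iff by blast
  show r: "has_prim (D k) (D (Suc k))" if "k < n" for k using assms that unfolding hn_chain_iff by blast
  show "l2 leb01 (D k)" if "1 \<le> n" "k \<le> n"
  proof (cases "k = n")
    case True
    \<comment> \<open>At the top order \<open>hn_chain\<close> constrains the squared norm;
      measurability of the derivative itself is inherited from its role as integrand for the
      derivative below it.\<close>
    then have "k - 1 < n" "D k = D (Suc (k - 1))" using that by auto
    then have "integrable leb01 (D k)" using has_prim_integrable[OF r, of "k - 1"] by simp
    moreover have "integrable leb01 (\<lambda>s. (norm (D k s))\<^sup>2)"
      using assms True unfolding hn_chain_iff by blast
    ultimately show ?thesis unfolding l2_def using borel_measurable_integrable by blast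
  qed (use r[of k, THEN has_prim_continuous] that l2_continuous_leb01[of "D k"] in auto)
qed

lemma imm_dtheta:
  fixes f :: "real \<Rightarrow> 'a::euclidean_space"
  assumes "imm n f" "2 \<le> n"
  obtains D where "hn_chain n f D" "\<And>\<theta>. \<theta> \<in> {0..1} \<Longrightarrow> dtheta f \<theta> = D 1 \<theta>"
    "\<And>\<theta>. \<theta> \<in> {0..1} \<Longrightarrow> dtheta f \<theta> \<noteq> 0" "continuous_on {0..1} (dtheta f)" "has_prim f (dtheta f)"
proof -
  obtain D where D: "hn_chain n f D" "\<And>\<theta>. \<theta> \<in> {0..1} \<Longrightarrow> D 1 \<theta> \<noteq> 0"
    using assms by (auto simp: imm_def)
  have c1: "continuous_on {0..1} (D 1)" using hn_chain_rel[OF D(1), of 1] assms by (auto intro: has_prim_continuous)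
  have "has_prim (D 0) (D 1)" using hn_chain_rel[OF D(1), of 0] assms by simp
  moreover have "has_prim f (D 1) \<longleftrightarrow> has_prim (D 0) (D 1)"
    by (rule has_prim_cong) (use hn_chain_0[OF D(1)] in auto)
  ultimately have f: "has_prim f (D 1)" by blast
  have eq: "dtheta f \<theta> = D 1 \<theta>" if "\<theta> \<in> {0..1}" for \<theta>
    by (rule dtheta_eq[OF f c1 that])
  show ?thesis
  proof (rule that[OF D(1) eq])
    show "dtheta f \<theta> \<noteq> 0" if "\<theta> \<in> {0..1}" for \<theta> using D(2)[OF that] eq[OF that] by simp
    show "continuous_on {0..1} (dtheta f)"
      by (subst continuous_on_cong[OF refl eq]) (use c1 in auto)
    have "has_prim f (dtheta f) \<longleftrightarrow> has_prim f (D 1)" by (rule has_prim_cong) (use eq in auto)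
    then show "has_prim f (dtheta f)" using f by blast
  qed
qed

text \<open>Level by level: equal absolutely continuous functions have almost everywhere equal
  derivatives, and |c'| can be divided out. Hence the \<open>SOME\<close> in \<open>metricG\<close>
  may be replaced by any chain at hand.\<close>

lemma arc_chain_unique:
  fixes c h :: "real \<Rightarrow> 'a::euclidean_space"
  assumes E: "arc_chain n c h E" and E': "arc_chain n c h E'"
    and nz: "\<And>\<theta>. \<theta> \<in> {0..1} \<Longrightarrow> dtheta c \<theta> \<noteq> 0" and i: "i \<le> n"
  shows "AE \<theta> in leb01. E i \<theta> = E' i \<theta>"
  using i
proof (induction i)
  case 0
  then show ?case using E E' by (intro AE_I2) (simp add: arc_chain_iff)
next
  case (Suc i)
  let ?g = "\<lambda>E s. norm (dtheta c s) *\<^sub>R E (Suc i) s"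
  have rel: "has_prim (E i) (?g E)" "has_prim (E' i) (?g E')"
    using Suc.prems E E' unfolding arc_chain_iff by auto
  have "AE \<theta> in leb01. E i \<theta> = E' i \<theta>" using Suc by simp
  note AE_eq_continuous_imp_eq[OF this rel[THEN has_prim_continuous]]
  from has_prim_unique[OF rel this] have "AE s in leb01. ?g E s = ?g E' s" .
  then show ?case
    using AE_space by eventually_elim (use nz in auto)
qed

lemma metricG_eq:
  assumes E: "arc_chain n c h E" and nz: "\<And>\<theta>. \<theta> \<in> {0..1} \<Longrightarrow> dtheta c \<theta> \<noteq> 0"
  shows "metricG n a c h = (\<Sum>i\<le>n. ennreal (a i * (\<integral>\<theta>. norm (dtheta c \<theta>) \<partial>leb01) powi (2 * int i - 3)) *
    (\<integral>\<^sup>+\<theta>. ennreal ((norm (E i \<theta>))\<^sup>2 * norm (dtheta c \<theta>)) \<partial>leb01))"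
proof -
  define E' where "E' = (SOME E. arc_chain n c h E)"
  have E': "arc_chain n c h E'"
    unfolding E'_def by (rule someI[of "arc_chain n c h", OF E])
  have "(\<integral>\<^sup>+\<theta>. indicator {0..1} \<theta> * ennreal ((norm (E' i \<theta>))\<^sup>2 * norm (dtheta c \<theta>)) \<partial>lborel)
      = (\<integral>\<^sup>+\<theta>. ennreal ((norm (E i \<theta>))\<^sup>2 * norm (dtheta c \<theta>)) \<partial>leb01)" if "i \<le> n" for i
  proof -
    have "AE \<theta> in leb01. E' i \<theta> = E i \<theta>"
      by (rule arc_chain_unique[OF E' E nz that])
    then show ?thesis
      unfolding nn_integral_leb01[symmetric] by (intro nn_integral_cong_AE) (auto elim!: eventually_mono)
  qed
  then show ?thesis
    unfolding metricG_def E'_def[symmetric] Let_def curve_length_eq by simp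
qed

section \<open>Square integrable functions of time and space\<close>

lemma section_measurable:
  assumes "case_prod f \<in> borel_measurable leb01sq"
  shows "t \<in> {0..1} \<Longrightarrow> f t \<in> borel_measurable leb01"
    and "x \<in> {0..1} \<Longrightarrow> (\<lambda>s. f s x) \<in> borel_measurable leb01"
  using measurable_compose[OF measurable_Pair1'[of t leb01] assms]
    measurable_compose[OF measurable_Pair2'[of x leb01] assms] by auto

lemma l2_swap:
  assumes "l2 leb01sq (case_prod f)"
  shows "l2 leb01sq (\<lambda>(x, s). f s x)"
proof -
  have m: "case_prod f \<in> borel_measurable leb01sq" using assms by (simp add: l2_def)
  show ?thesis
    using leb01_pair.integrable_product_swap[of "\<lambda>p. (norm (case_prod f p))\<^sup>2"] assms
      measurable_pair_swap[OF m]
    by (simp add: l2_def case_prod_beta')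
qed

lemma l2_marginal:
  fixes f :: "real \<Rightarrow> real \<Rightarrow> 'a::euclidean_space"
  assumes "l2 leb01sq (case_prod f)"
  shows l2_AE_section: "AE t in leb01. l2 leb01 (f t)"
    and l2_integral_section: "l2 leb01 (\<lambda>t. \<integral>x. norm (f t x) \<partial>leb01)"
proof -
  have m[measurable]: "case_prod f \<in> borel_measurable leb01sq" using assms by (simp add: l2_def)
  have i: "integrable leb01sq (\<lambda>p. (norm (case_prod f p))\<^sup>2)" using assms by (simp add: l2_def)
  have "AE t in leb01. integrable leb01 (\<lambda>x. (norm (f t x))\<^sup>2)"
    using leb01_pair.AE_integrable_fst'[OF i] by simp
  then show ae: "AE t in leb01. l2 leb01 (f t)"
    using AE_space unfolding l2_def by eventually_elim (use section_measurable(1)[OF m] in auto)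
  show "l2 leb01 (\<lambda>t. \<integral>x. norm (f t x) \<partial>leb01)"
    unfolding l2_def
  proof
    show mm: "(\<lambda>t. \<integral>x. norm (f t x) \<partial>leb01) \<in> borel_measurable leb01"
      by (rule leb01.borel_measurable_lebesgue_integral) simp
    show "integrable leb01 (\<lambda>t. (norm (\<integral>x. norm (f t x) \<partial>leb01))\<^sup>2)"
    proof (rule Bochner_Integration.integrable_bound)
      show "integrable leb01 (\<lambda>t. \<integral>x. (norm (f t x))\<^sup>2 \<partial>leb01)"
        using leb01_pair.integrable_fst'[OF i] by simp
      show "(\<lambda>t. (norm (\<integral>x. norm (f t x) \<partial>leb01))\<^sup>2) \<in> borel_measurable leb01"
        using mm by simp
      show "AE t in leb01. norm ((norm (\<integral>x. norm (f t x) \<partial>leb01))\<^sup>2) \<le> norm (\<integral>x. (norm (f t x))\<^sup>2 \<partial>leb01)"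
        using ae by eventually_elim (use leb01.l2_norm_integral_le in force)
    qed
  qed
qed

lemma l2_marginal_space:
  fixes f :: "real \<Rightarrow> real \<Rightarrow> 'a::euclidean_space"
  assumes "l2 leb01sq (case_prod f)"
  shows l2_AE_section_space: "AE x in leb01. l2 leb01 (\<lambda>t. f t x)"
    and l2_integral_section_space: "l2 leb01 (\<lambda>x. \<integral>t. norm (f t x) \<partial>leb01)"
  using l2_marginal[of "\<lambda>x s. f s x"] l2_swap[OF assms] by auto

lemma l2sq_integrable: "l2 leb01sq f \<Longrightarrow> integrable leb01sq f"
  by (rule leb01_pair.P.l2_imp_integrable)

text \<open>At almost every time \<open>sup_le_integrals\<close> applies, and both space averages
  are square integrable in time by Jensen's inequality. The resulting \<open>b\<close> dominates all
  \<theta> at once.\<close>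

lemma l2_sup_bound:
  fixes f g :: "real \<Rightarrow> real \<Rightarrow> 'a::euclidean_space"
  assumes f: "l2 leb01sq (case_prod f)" and g: "l2 leb01sq (case_prod g)"
    and rel: "AE t in leb01. has_prim (f t) (g t)"
  obtains b where "l2 leb01 b" "\<And>t. 0 \<le> b t" "AE t in leb01. \<forall>\<theta>\<in>{0..1}. norm (f t \<theta>) \<le> b t"
proof
  show "l2 leb01 (\<lambda>t. (\<integral>x. norm (f t x) \<partial>leb01) + (\<integral>x. norm (g t x) \<partial>leb01))"
    by (intro l2_add l2_integral_section f g)
  show "0 \<le> (\<integral>x. norm (f t x) \<partial>leb01) + (\<integral>x. norm (g t x) \<partial>leb01)" for t by simp
  show "AE t in leb01. \<forall>\<theta>\<in>{0..1}. norm (f t \<theta>) \<le> (\<integral>x. norm (f t x) \<partial>leb01) + (\<integral>x. norm (g t x) \<partial>leb01)"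
    using rel by eventually_elim (blast intro: sup_le_integrals)
qed

text \<open>Fubini would give this for almost every \<theta> only; the bound on the supremum in
  space gives it for each fixed \<theta>.\<close>

lemma integrable_time_section:
  fixes f g :: "real \<Rightarrow> real \<Rightarrow> 'a::euclidean_space"
  assumes f: "l2 leb01sq (case_prod f)" and g: "l2 leb01sq (case_prod g)"
    and rel: "AE t in leb01. has_prim (f t) (g t)" and \<theta>: "\<theta> \<in> {0..1}"
  shows "integrable leb01 (\<lambda>s. f s \<theta>)"
proof -
  obtain b where b: "l2 leb01 b" "AE t in leb01. \<forall>\<theta>\<in>{0..1}. norm (f t \<theta>) \<le> b t"
    by (rule l2_sup_bound[OF f g rel]) blast
  show ?thesis
  proof (rule Bochner_Integration.integrable_bound[OF leb01.l2_imp_integrable[OF b(1)]])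
    show "(\<lambda>s. f s \<theta>) \<in> borel_measurable leb01"
      using section_measurable(2)[OF _ \<theta>, of f] f by (simp add: l2_def)
    show "AE s in leb01. norm (f s \<theta>) \<le> norm (b s)"
      using b(2) by eventually_elim (use \<theta> in force)
  qed
qed

lemma prim_time_l2:
  fixes f :: "real \<Rightarrow> real \<Rightarrow> 'a::euclidean_space"
  assumes f: "l2 leb01sq (case_prod f)" and t: "t \<in> {0..1}"
  shows "l2 leb01 (\<lambda>x. prim (\<lambda>s. f s x) t)"
proof (rule l2_bound[OF l2_integral_section_space[OF f], where C=1])
  show "(\<lambda>x. prim (\<lambda>s. f s x) t) \<in> borel_measurable leb01"
    using section_measurable(1)[OF measurable_prim_time t, of f] f by (simp add: l2_def)
  show "AE x in leb01. norm (prim (\<lambda>s. f s x) t) \<le> 1 * norm (\<integral>t. norm (f t x) \<partial>leb01)"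
    using l2_AE_section_space[OF f]
    by eventually_elim (use norm_prim_le_integral leb01.l2_imp_integrable in force)
qed

text \<open>Integrating the relation between \<open>f\<close> and \<open>g\<close> over time and
  exchanging the integrals shows that time integration commutes with the weak derivative in
  \<theta>.\<close>

lemma prim_time_rel:
  fixes f g :: "real \<Rightarrow> real \<Rightarrow> 'a::euclidean_space"
  assumes f: "l2 leb01sq (case_prod f)" and g: "l2 leb01sq (case_prod g)"
    and rel: "AE t in leb01. has_prim (f t) (g t)" and \<theta>: "\<theta> \<in> {0..1}"
  shows "prim (\<lambda>s. f s \<theta>) t = prim (\<lambda>s. f s 0) t + prim (\<lambda>x. prim (\<lambda>s. g s x) t) \<theta>"
proof -
  have i: "integrable leb01 (\<lambda>s. f s \<theta>)" "integrable leb01 (\<lambda>s. f s 0)"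
    using integrable_time_section[OF f g rel] \<theta> by auto
  have m: "case_prod g \<in> borel_measurable leb01sq" using g by (simp add: l2_def)
  have "prim (\<lambda>s. f s \<theta>) t - prim (\<lambda>s. f s 0) t = prim (\<lambda>s. f s \<theta> - f s 0) t"
    by (rule prim_diff[symmetric, OF i])
  also have "\<dots> = prim (\<lambda>s. prim (g s) \<theta>) t"
  proof (rule prim_cong_AE)
    show "AE s in leb01. f s \<theta> - f s 0 = prim (g s) \<theta>"
      using rel
    proof eventually_elim
      case (elim s)
      from has_primD[OF this \<theta>] show ?case by simp
    qed
    show "(\<lambda>s. f s \<theta> - f s 0) \<in> borel_measurable leb01" using i by simp
    show "(\<lambda>s. prim (g s) \<theta>) \<in> borel_measurable leb01"
      using section_measurable(2)[OF measurable_prim_space[OF m] \<theta>] by simp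
  qed
  also have "\<dots> = prim (\<lambda>x. prim (\<lambda>s. g s x) t) \<theta>"
    by (rule prim_swap[OF l2sq_integrable[OF g]])
  finally show ?thesis by (simp add: algebra_simps)
qed

section \<open>Paths of Sobolev curves\<close>

text \<open>This is \<open>h1_with\<close> read on the unit square: measurability is required only
  there, and the null set of times may depend on the order \<open>k\<close>.\<close>

definition chain_path :: "nat \<Rightarrow> (real \<Rightarrow> real \<Rightarrow> 'a::euclidean_space) \<Rightarrow> (nat \<Rightarrow> real \<Rightarrow> real \<Rightarrow> 'a) \<Rightarrow> bool" where
  "chain_path n f W \<longleftrightarrow> (\<forall>k\<le>n. l2 leb01sq (case_prod (W k))) \<and>
     (\<forall>k<n. AE s in leb01. has_prim (W k s) (W (Suc k) s)) \<and>
     (\<forall>t\<in>{0..1}. \<forall>\<theta>\<in>{0..1}. f t \<theta> = f 0 \<theta> + prim (\<lambda>s. W 0 s \<theta>) t)"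

lemma measurable_leb01sq_borel: "g \<in> borel_measurable borel \<Longrightarrow> g \<in> borel_measurable leb01sq"
  for g :: "real \<times> real \<Rightarrow> 'a::euclidean_space"
proof -
  assume g: "g \<in> borel_measurable borel"
  have "(\<lambda>p. (fst p, snd p)) \<in> leb01sq \<rightarrow>\<^sub>M borel \<Otimes>\<^sub>M borel"
    by (rule measurable_Pair) simp_all
  then have "(\<lambda>p. p) \<in> leb01sq \<rightarrow>\<^sub>M borel" by (simp add: borel_prod)
  from measurable_compose[OF this g] show ?thesis .
qed

lemma nn_integral_leb01sq:
  fixes g :: "real \<times> real \<Rightarrow> ennreal"
  assumes g[measurable]: "g \<in> borel_measurable borel"
  shows "(\<integral>\<^sup>+p. g p \<partial>leb01sq) = (\<integral>\<^sup>+p. indicator ({0..1} \<times> {0..1}) p * g p \<partial>lborel)"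
proof -
  have g'[measurable]: "g \<in> borel_measurable (lborel \<Otimes>\<^sub>M lborel)"
    using g by (simp add: lborel_prod)
  have gl: "g \<in> borel_measurable leb01sq"
  proof -
    have "(\<lambda>p. (fst p, snd p)) \<in> leb01sq \<rightarrow>\<^sub>M borel \<Otimes>\<^sub>M borel"
      by (rule measurable_Pair) simp_all
    then have "(\<lambda>p. p) \<in> leb01sq \<rightarrow>\<^sub>M borel" by (simp add: borel_prod)
    from measurable_compose[OF this g] show ?thesis .
  qed
  have "(\<integral>\<^sup>+p. g p \<partial>leb01sq) = (\<integral>\<^sup>+t. \<integral>\<^sup>+x. g (t, x) \<partial>leb01 \<partial>leb01)"
    by (rule leb01.nn_integral_fst[symmetric, OF gl])
  also have "\<dots> = (\<integral>\<^sup>+t. \<integral>\<^sup>+x. indicator ({0..1} \<times> {0..1}) (t, x) * g (t, x) \<partial>lborel \<partial>lborel)"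
    unfolding nn_integral_leb01
    by (intro nn_integral_cong) (auto simp: indicator_def)
  also have "\<dots> = (\<integral>\<^sup>+p. indicator ({0..1} \<times> {0..1}) p * g p \<partial>(lborel \<Otimes>\<^sub>M lborel))"
    by (rule lborel.nn_integral_fst) measurable
  finally show ?thesis by (simp add: lborel_prod)
qed

lemma l2_leb01sq_iff:
  fixes g :: "real \<times> real \<Rightarrow> 'a::euclidean_space"
  assumes [measurable]: "g \<in> borel_measurable borel"
  shows "l2 leb01sq g \<longleftrightarrow> set_integrable lborel ({0..1} \<times> {0..1}) (\<lambda>p. (norm (g p))\<^sup>2)"
proof -
  have m: "g \<in> borel_measurable leb01sq" by (rule measurable_leb01sq_borel) fact
  have *: "indicator ({0..1} \<times> {0..1}) p * ennreal ((norm (g p))\<^sup>2) = ennreal (norm (indicator ({0..1} \<times> {0..1}) p *\<^sub>R (norm (g p))\<^sup>2))" for p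
    by (auto simp: indicator_def)
  have "({0..1} \<times> {0..1} :: (real \<times> real) set) \<in> sets borel"
    by (intro borel_closed closed_Times closed_atLeastAtMost)
  then have "set_integrable lborel ({0..1} \<times> {0..1}) (\<lambda>p. (norm (g p))\<^sup>2) \<longleftrightarrow>
      (\<integral>\<^sup>+p. indicator ({0..1} \<times> {0..1}) p * ennreal ((norm (g p))\<^sup>2) \<partial>lborel) < \<infinity>"
    unfolding set_integrable_def integrable_iff_bounded * by simp
  moreover have "integrable leb01sq (\<lambda>p. (norm (g p))\<^sup>2) \<longleftrightarrow> (\<integral>\<^sup>+p. ennreal ((norm (g p))\<^sup>2) \<partial>leb01sq) < \<infinity>"
    unfolding integrable_iff_bounded using m by simp
  ultimately show ?thesis
    using m by (simp add: l2_def nn_integral_leb01sq)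
qed

lemma h1_with_imp_chain_path:
  assumes W: "h1_with n f W" and n: "1 \<le> n"
  shows "chain_path n f W"
proof -
  have "l2 leb01sq (case_prod (W k))" if "k \<le> n" for k
  proof -
    have "(\<lambda>p. W k (fst p) (snd p)) \<in> borel_measurable borel"
      using W that by (simp add: h1_with_def)
    then show ?thesis
      using l2_leb01sq_iff[of "\<lambda>p. W k (fst p) (snd p)"] W that by (simp add: h1_with_def case_prod_beta')
  qed
  moreover have "AE s in leb01. hn_chain n (W 0 s) (\<lambda>k. W k s)"
    using W by (simp add: h1_with_def AE_leb01_iff)
  then have "AE s in leb01. has_prim (W k s) (W (Suc k) s)" if "k < n" for k
    by eventually_elim (use that in \<open>unfold hn_chain_iff, blast\<close>)
  moreover have "f t \<theta> = f 0 \<theta> + prim (\<lambda>s. W 0 s \<theta>) t" if "t \<in> {0..1}" "\<theta> \<in> {0..1}" for t \<theta>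
    using W that set_lebesgue_integral_eq_prim[OF that(1)] unfolding h1_with_def by metis
  ultimately show ?thesis
    unfolding chain_path_def by blast
qed

text \<open>Since \<open>h1_with\<close> asks for Borel measurability on the whole plane, both
  variables are first projected onto [0,1]; this extends the data from the square without changing
  them there.\<close>

lemma chain_path_imp_h1_with:
  fixes W :: "nat \<Rightarrow> real \<Rightarrow> real \<Rightarrow> 'a::euclidean_space"
  assumes W: "chain_path n f W"
  shows "\<exists>W'. h1_with n f W' \<and> (\<forall>k. \<forall>s\<in>{0..1}. \<forall>\<theta>\<in>{0..1}. W' k s \<theta> = W k s \<theta>)"
proof -
  define cl :: "real \<Rightarrow> real" where "cl x = max 0 (min 1 x)" for x
  have cl: "cl x = x" if "x \<in> {0..1}" for x using that by (auto simp: cl_def)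
  have cl01: "cl x \<in> {0..1}" for x by (auto simp: cl_def)
  define W' where "W' k s \<theta> = W k (cl s) (cl \<theta>)" for k s \<theta>
  have eq: "W' k s \<theta> = W k s \<theta>" if "s \<in> {0..1}" "\<theta> \<in> {0..1}" for k s \<theta>
    using that by (simp add: W'_def cl)
  have mcl: "cl \<in> borel \<rightarrow>\<^sub>M leb01"
  proof -
    have "cl \<in> borel_measurable borel" unfolding cl_def by measurable
    then have "cl \<in> borel \<rightarrow>\<^sub>M restrict_space borel {0..1}"
      using cl01 by (intro measurable_restrict_space2) auto
    then show ?thesis by (simp add: measurable_cong_sets[OF refl sets_leb01])
  qed
  have mW: "(\<lambda>p. W' k (fst p) (snd p)) \<in> borel_measurable borel" if "k \<le> n" for k
  proof -
    have "(\<lambda>p. (cl (fst p), cl (snd p))) \<in> borel \<Otimes>\<^sub>M borel \<rightarrow>\<^sub>M leb01sq"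
      by (intro measurable_Pair measurable_compose[OF measurable_fst mcl] measurable_compose[OF measurable_snd mcl])
    moreover have "case_prod (W k) \<in> borel_measurable leb01sq"
      using W that by (simp add: chain_path_def l2_def)
    ultimately show ?thesis
      using measurable_compose[of "\<lambda>p. (cl (fst p), cl (snd p))" "borel \<Otimes>\<^sub>M borel" leb01sq "case_prod (W k)" borel]
      by (simp add: W'_def borel_prod)
  qed
  have l2W: "l2 leb01sq (case_prod (W' k))" if "k \<le> n" for k
  proof -
    have "l2 leb01sq (case_prod (W k))" using W that by (simp add: chain_path_def)
    then show ?thesis
    proof (rule l2_bound[where C=1])
      show "case_prod (W' k) \<in> borel_measurable leb01sq"
        using measurable_leb01sq_borel[OF mW[OF that]] by (simp add: case_prod_beta')
    qed (auto simp: space_pair_measure eq)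
  qed
  have "h1_with n f W'"
    unfolding h1_with_def
  proof (intro conjI allI impI ballI)
    fix k assume k: "k \<le> n"
    show "(\<lambda>p. W' k (fst p) (snd p)) \<in> borel_measurable lborel" using mW[OF k] by simp
    show "set_integrable lborel ({0..1} \<times> {0..1}) (\<lambda>p. (norm (W' k (fst p) (snd p)))\<^sup>2)"
      using l2_leb01sq_iff[OF mW[OF k]] l2W[OF k] by (simp add: case_prod_beta')
  next
    have "AE s in leb01. \<forall>k\<in>{..n}. l2 leb01 (W' k s)"
      using l2_AE_section[OF l2W] by (intro AE_finite_allI) auto
    moreover have "AE s in leb01. \<forall>k\<in>{..<n}. has_prim (W k s) (W (Suc k) s)"
      using W unfolding chain_path_def by (intro AE_finite_allI) auto
    ultimately have "AE s in leb01. hn_chain n (W' 0 s) (\<lambda>k. W' k s)"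
      using AE_space
    proof eventually_elim
      case (elim s)
      have "has_prim (W' k s) (W' (Suc k) s) \<longleftrightarrow> has_prim (W k s) (W (Suc k) s)" for k
        by (rule has_prim_cong) (use eq elim(3) in auto)
      moreover have "integrable leb01 (\<lambda>x. (norm (W' n s x))\<^sup>2)"
        using elim(1) by (auto simp: l2_def)
      ultimately show ?case
        unfolding hn_chain_iff using elim(2) by auto
    qed
    then show "AE s in lborel. s \<in> {0..1} \<longrightarrow> hn_chain n (W' 0 s) (\<lambda>k. W' k s)"
      by (simp add: AE_leb01_iff)
  next
    fix t \<theta> :: real assume *: "t \<in> {0..1}" "\<theta> \<in> {0..1}"
    have "prim (\<lambda>s. W' 0 s \<theta>) t = prim (\<lambda>s. W 0 s \<theta>) t"
      by (rule prim_cong) (use * eq in auto)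
    then show "f t \<theta> = f 0 \<theta> + set_lebesgue_integral lborel {0..t} (\<lambda>s. W' 0 s \<theta>)"
      using W * set_lebesgue_integral_eq_prim[OF *(1)] unfolding chain_path_def by metis
  qed
  then show ?thesis using eq by blast
qed

text \<open>For fixed \<theta> the velocities agree at almost every time. Fubini moves the
  exceptional set into time and leaves an almost every \<theta>, which continuity in \<theta>
  removes. So the \<open>SOME\<close> in \<open>path_vel\<close> is harmless.\<close>

lemma chain_path_velocity_unique:
  fixes f :: "real \<Rightarrow> real \<Rightarrow> 'a::euclidean_space"
  assumes W: "chain_path n f W" and V: "chain_path n f V" and n: "1 \<le> n"
  shows "AE t in leb01. \<forall>\<theta>\<in>{0..1}. V 0 t \<theta> = W 0 t \<theta>"
proof -
  have l2: "l2 leb01sq (case_prod (W 0))" "l2 leb01sq (case_prod (W (Suc 0)))"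
    "l2 leb01sq (case_prod (V 0))" "l2 leb01sq (case_prod (V (Suc 0)))"
    using W V n unfolding chain_path_def by (metis One_nat_def le0)+
  have rel: "AE s in leb01. has_prim (W 0 s) (W (Suc 0) s)" "AE s in leb01. has_prim (V 0 s) (V (Suc 0) s)"
    using W V n unfolding chain_path_def by (metis One_nat_def less_eq_Suc_le)+
  have m: "case_prod (W 0) \<in> borel_measurable leb01sq" "case_prod (V 0) \<in> borel_measurable leb01sq"
    using l2 by (auto simp: l2_def)
  have "AE t in leb01. V 0 t \<theta> = W 0 t \<theta>" if \<theta>: "\<theta> \<in> {0..1}" for \<theta>
  proof (rule prim_eq_imp_AE_eq)
    show "integrable leb01 (\<lambda>t. V 0 t \<theta>)" "integrable leb01 (\<lambda>t. W 0 t \<theta>)"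
      using integrable_time_section[OF l2(3,4) rel(2) \<theta>] integrable_time_section[OF l2(1,2) rel(1) \<theta>] by auto
    show "prim (\<lambda>t. V 0 t \<theta>) t = prim (\<lambda>t. W 0 t \<theta>) t" if "t \<in> {0..1}" for t
      using W V that \<theta> unfolding chain_path_def by (metis add_left_cancel)
  qed
  then have "AE \<theta> in leb01. AE t in leb01. V 0 t \<theta> = W 0 t \<theta>"
    by (rule AE_I2) simp
  then have "AE t in leb01. AE \<theta> in leb01. V 0 t \<theta> = W 0 t \<theta>"
  proof (subst leb01_pair.AE_commute)
    have "{p \<in> space leb01sq. case_prod (V 0) p = case_prod (W 0) p} \<in> sets leb01sq"
      using m by measurable
    then show "{x \<in> space leb01sq. V 0 (fst x) (snd x) = W 0 (fst x) (snd x)} \<in> sets leb01sq"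
      by (simp add: case_prod_beta')
  qed
  then show ?thesis
    using rel
  proof eventually_elim
    case (elim t)
    then show ?case using AE_eq_continuous_imp_eq[OF elim(1)] has_prim_continuous by blast
  qed
qed

lemma path_vel_eq:
  fixes f :: "real \<Rightarrow> real \<Rightarrow> 'a::euclidean_space"
  assumes W: "chain_path n f W" and n: "1 \<le> n"
  shows "AE t in leb01. \<forall>\<theta>\<in>{0..1}. path_vel n f t \<theta> = W 0 t \<theta>"
proof -
  obtain W' where "h1_with n f W'" using chain_path_imp_h1_with[OF W] by blast
  then have "h1_with n f (SOME W. h1_with n f W)" by (rule someI[of "h1_with n f"])
  then have "chain_path n f (SOME W. h1_with n f W)" by (rule h1_with_imp_chain_path[OF _ n])
  from chain_path_velocity_unique[OF W this n] show ?thesis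
    unfolding path_vel_def .
qed

section \<open>Paths in arc length coordinates\<close>

text \<open>\<open>q = \<partial>\<^sub>\<theta> c\<close> and \<open>E i = \<partial>\<^sub>s\<^sup>i \<partial>\<^sub>t c\<close>; the evolution equation is \<open>\<partial>\<^sub>t q = |q| E 1\<close>.\<close>
definition arc_path :: "nat \<Rightarrow> (real \<Rightarrow> real \<Rightarrow> 'a::euclidean_space) \<Rightarrow> (real \<Rightarrow> real \<Rightarrow> 'a) \<Rightarrow>
    (nat \<Rightarrow> real \<Rightarrow> real \<Rightarrow> 'a) \<Rightarrow> bool" where
  "arc_path n c q E \<longleftrightarrow>
     case_prod q \<in> borel_measurable leb01sq \<and> (\<forall>i\<le>n. case_prod (E i) \<in> borel_measurable leb01sq) \<and>
     (\<forall>t\<in>{0..1}. continuous_on {0..1} (q t) \<and> has_prim (c t) (q t)) \<and>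
     (\<forall>t\<in>{0..1}. \<forall>\<theta>\<in>{0..1}. q t \<theta> \<noteq> 0) \<and>
     (\<forall>i<n. AE t in leb01. has_prim (E i t) (\<lambda>x. norm (q t x) *\<^sub>R E (Suc i) t x)) \<and>
     (\<forall>\<theta>\<in>{0..1}. has_prim (\<lambda>t. q t \<theta>) (\<lambda>t. norm (q t \<theta>) *\<^sub>R E 1 t \<theta>) \<and>
        has_prim (\<lambda>t. c t \<theta>) (\<lambda>t. E 0 t \<theta>))"

lemma arc_pathD:
  assumes "arc_path n c q E"
  shows "case_prod q \<in> borel_measurable leb01sq"
    and "i \<le> n \<Longrightarrow> case_prod (E i) \<in> borel_measurable leb01sq"
    and "t \<in> {0..1} \<Longrightarrow> continuous_on {0..1} (q t)"
    and "t \<in> {0..1} \<Longrightarrow> has_prim (c t) (q t)"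
    and "t \<in> {0..1} \<Longrightarrow> \<theta> \<in> {0..1} \<Longrightarrow> q t \<theta> \<noteq> 0"
    and "i < n \<Longrightarrow> AE t in leb01. has_prim (E i t) (\<lambda>x. norm (q t x) *\<^sub>R E (Suc i) t x)"
    and "\<theta> \<in> {0..1} \<Longrightarrow> has_prim (\<lambda>t. q t \<theta>) (\<lambda>t. norm (q t \<theta>) *\<^sub>R E 1 t \<theta>)"
    and "\<theta> \<in> {0..1} \<Longrightarrow> has_prim (\<lambda>t. c t \<theta>) (\<lambda>t. E 0 t \<theta>)"
  using assms unfolding arc_path_def by blast+

definition arc_energy :: "nat \<Rightarrow> (nat \<Rightarrow> real) \<Rightarrow> (real \<Rightarrow> real \<Rightarrow> 'a::euclidean_space) \<Rightarrow>
    (nat \<Rightarrow> real \<Rightarrow> real \<Rightarrow> 'a) \<Rightarrow> real \<Rightarrow> ennreal" where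
  "arc_energy n a q E t = (\<Sum>i\<le>n. ennreal (a i * (\<integral>\<theta>. norm (q t \<theta>) \<partial>leb01) powi (2 * int i - 3)) *
    (\<integral>\<^sup>+\<theta>. ennreal ((norm (E i t \<theta>))\<^sup>2 * norm (q t \<theta>)) \<partial>leb01))"

lemma arc_path_dtheta:
  assumes "arc_path n c q E" "t \<in> {0..1}" "\<theta> \<in> {0..1}"
  shows "dtheta (c t) \<theta> = q t \<theta>"
  by (rule dtheta_eq[OF arc_pathD(4,3)[OF assms(1,2)] assms(3)])

text \<open>Both choices, in the metric and in the velocity, are resolved here, so that the energy
  density becomes an explicit expression in \<open>q\<close> and \<open>E\<close>.\<close>

lemma arc_path_metricG:
  assumes ap: "arc_path n c q E" and W: "chain_path n c W" and n: "1 \<le> n"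
    and WE: "AE t in leb01. \<forall>\<theta>\<in>{0..1}. W 0 t \<theta> = E 0 t \<theta>"
  shows "AE t in leb01. metricG n a (c t) (path_vel n c t) = arc_energy n a q E t"
proof -
  have "AE t in leb01. \<forall>i\<in>{..<n}. has_prim (E i t) (\<lambda>x. norm (q t x) *\<^sub>R E (Suc i) t x)"
    using arc_pathD(6)[OF ap] by (intro AE_finite_allI) auto
  then show ?thesis
    using WE path_vel_eq[OF W n] AE_space
  proof eventually_elim
    case (elim t)
    then have t: "t \<in> {0..1}" by simp
    have d: "dtheta (c t) \<theta> = q t \<theta>" if "\<theta> \<in> {0..1}" for \<theta>
      by (rule arc_path_dtheta[OF ap t that])
    have nz: "dtheta (c t) \<theta> \<noteq> 0" if "\<theta> \<in> {0..1}" for \<theta>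
      using arc_pathD(5)[OF ap t that] d[OF that] by simp
    have "arc_chain n (c t) (path_vel n c t) (\<lambda>i. E i t)"
      unfolding arc_chain_iff
    proof (intro conjI ballI allI impI)
      fix i assume i: "i < n"
      have "has_prim (E i t) (\<lambda>s. norm (dtheta (c t) s) *\<^sub>R E (Suc i) t s) \<longleftrightarrow>
          has_prim (E i t) (\<lambda>x. norm (q t x) *\<^sub>R E (Suc i) t x)"
        by (rule has_prim_cong) (simp_all add: d)
      then show "has_prim (E i t) (\<lambda>s. norm (dtheta (c t) s) *\<^sub>R E (Suc i) t s)"
        using elim(1) i by blast
    qed (use elim in auto)
    note metric = metricG_eq[OF this nz, of a]
    show ?case
    proof -
      have "(\<integral>\<theta>. norm (dtheta (c t) \<theta>) \<partial>leb01) = (\<integral>\<theta>. norm (q t \<theta>) \<partial>leb01)"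
        by (rule Bochner_Integration.integral_cong) (auto simp: d)
      moreover have "(\<integral>\<^sup>+\<theta>. ennreal ((norm (E i t \<theta>))\<^sup>2 * norm (dtheta (c t) \<theta>)) \<partial>leb01)
          = (\<integral>\<^sup>+\<theta>. ennreal ((norm (E i t \<theta>))\<^sup>2 * norm (q t \<theta>)) \<partial>leb01)" for i
        by (rule nn_integral_cong) (auto simp: d)
      ultimately show ?thesis
        using metric unfolding arc_energy_def by simp
    qed
  qed
qed

text \<open>All \<theta>-derivatives of the path are rebuilt as those of \<open>f 0\<close> plus
  time integrals of the \<theta>-derivatives of the velocity. Defined this way, \<open>q\<close> is
  absolutely continuous in time at every \<theta> by construction.\<close>

lemma chain_path_imp_arc_path:
  fixes f :: "real \<Rightarrow> real \<Rightarrow> 'a::euclidean_space"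
  assumes W: "chain_path n f W" and n: "2 \<le> n" and imm: "\<And>t. t \<in> {0..1} \<Longrightarrow> imm n (f t)"
  obtains q E where "arc_path n f q E" "E 0 = W 0"
proof -
  obtain m where m: "n = Suc (Suc m)" using n by (metis add_2_eq_Suc le_Suc_ex)
  have l2W: "l2 leb01sq (case_prod (W k))" if "k \<le> n" for k
    using W that unfolding chain_path_def by blast
  have relW: "AE s in leb01. has_prim (W k s) (W (Suc k) s)" if "k < n" for k
    using W that unfolding chain_path_def by blast
  have f: "f t \<theta> = f 0 \<theta> + prim (\<lambda>s. W 0 s \<theta>) t" if "t \<in> {0..1}" "\<theta> \<in> {0..1}" for t \<theta>
    using W that unfolding chain_path_def by blast
  obtain D where D: "hn_chain n (f 0) D"
    using imm[of 0] by (auto simp: imm_def)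
  note l2D = hn_chain_l2[OF D]
  define Q where "Q k t \<theta> = D k \<theta> + prim (\<lambda>s. W k s \<theta>) t" for k t \<theta>
  define q where "q = Q 1"
  have l2Q: "l2 leb01 (Q k t)" if "k \<le> n" "t \<in> {0..1}" for k t
    unfolding Q_def using that n by (intro l2_add l2D prim_time_l2 l2W) auto
  have rel: "has_prim (Q k t) (Q (Suc k) t)" if k: "k < n" and t: "t \<in> {0..1}" for k t
  proof (rule has_primI)
    show i: "integrable leb01 (Q (Suc k) t)"
      using l2Q[of "Suc k"] that leb01.l2_imp_integrable by auto
    fix \<theta> :: real assume \<theta>: "\<theta> \<in> {0..1}"
    have "prim (Q (Suc k) t) \<theta> = prim (D (Suc k)) \<theta> + prim (\<lambda>x. prim (\<lambda>s. W (Suc k) s x) t) \<theta>"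
      unfolding Q_def
      by (intro prim_add has_prim_integrable[OF hn_chain_rel[OF D k]] leb01.l2_imp_integrable prim_time_l2 l2W)
        (use k t in auto)
    moreover have "prim (\<lambda>s. W k s \<theta>) t = prim (\<lambda>s. W k s 0) t + prim (\<lambda>x. prim (\<lambda>s. W (Suc k) s x) t) \<theta>"
      using k \<theta> by (intro prim_time_rel l2W relW) auto
    ultimately show "Q k t \<theta> = Q k t 0 + prim (Q (Suc k) t) \<theta>"
      using has_primD[OF hn_chain_rel[OF D k] \<theta>] unfolding Q_def by simp
  qed
  have relf: "has_prim (f t) (q t)" if t: "t \<in> {0..1}" for t
  proof -
    have "has_prim (f t) (q t) \<longleftrightarrow> has_prim (Q 0 t) (Q 1 t)"
    proof (rule has_prim_cong)
      show "f t \<theta> = Q 0 t \<theta>" if "\<theta> \<in> {0..1}" for \<theta>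
        using f[OF t that] hn_chain_0[OF D that] unfolding Q_def by simp
    qed (simp add: q_def)
    then show ?thesis using rel[of 0 t] t n by simp
  qed
  have cont: "continuous_on {0..1} (q t)" if "t \<in> {0..1}" for t
    unfolding q_def using has_prim_continuous[OF rel[of 1 t]] that n by simp
  have nz: "q t \<theta> \<noteq> 0" if t: "t \<in> {0..1}" and \<theta>: "\<theta> \<in> {0..1}" for t \<theta>
  proof -
    have "dtheta (f t) \<theta> = q t \<theta>" by (rule dtheta_eq[OF relf[OF t] cont[OF t] \<theta>])
    moreover have "dtheta (f t) \<theta> \<noteq> 0" using imm_dtheta[OF imm[OF t] n] \<theta> by blast
    ultimately show ?thesis by simp
  qed
  have mQ: "case_prod (Q k) \<in> borel_measurable leb01sq" if "k \<le> n" for k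
  proof -
    have "D k \<in> borel_measurable leb01" using l2D[of k] n that by (simp add: l2_def)
    then have "(\<lambda>p. D k (snd p)) \<in> borel_measurable leb01sq" by (rule measurable_compose[OF measurable_snd])
    moreover have "(\<lambda>(t, \<theta>). prim (\<lambda>s. W k s \<theta>) t) \<in> borel_measurable leb01sq"
      using l2W[OF that] by (intro measurable_prim_time) (simp add: l2_def)
    ultimately show ?thesis unfolding Q_def case_prod_beta' by (rule borel_measurable_add)
  qed
  have aeQ: "ae_l2 (Q k)" if "k \<le> n" for k
    unfolding ae_l2_def using mQ[OF that] l2Q[OF that] by (auto intro!: AE_I2)
  have "msob (Suc m) ((\<lambda>k. Q (Suc k)) 0)"
  proof (rule psob_of_chain)
    show "ae_l2 (Q (Suc i))" if "i \<le> Suc m" for i using aeQ[of "Suc i"] that m by simp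
    show "AE t in leb01. has_prim (Q (Suc i) t) (Q (Suc (Suc i)) t)" if "i < Suc m" for i
      using rel[of "Suc i"] that m by (intro AE_I2) auto
  qed
  then have msq: "msob (Suc m) q" unfolding q_def One_nat_def .
  have msW: "msob n (W 0)"
  proof (rule psob_of_chain)
    show "ae_l2 (W i)" if "i \<le> n" for i
      using l2W[OF that] l2_AE_section[OF l2W[OF that]] unfolding ae_l2_def l2_def by blast
  qed (rule relW)
  have "AE t in leb01. \<forall>\<theta>\<in>{0..1}. q t \<theta> \<noteq> 0" using nz by (intro AE_I2) auto
  from msob_arc_chain[OF msq this msW] obtain E where E: "E 0 = W 0" "\<forall>i\<le>n. msob (n - i) (E i)"
    "\<forall>i<n. AE t in leb01. has_prim (E i t) (\<lambda>x. norm (q t x) *\<^sub>R E (Suc i) t x)"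
    using m by blast
  have mE: "case_prod (E i) \<in> borel_measurable leb01sq" if "i \<le> n" for i
    using E(2) that psob_imp_base unfolding ae_l2_def by blast
  have mq: "case_prod q \<in> borel_measurable leb01sq" using mQ[of 1] n by (simp add: q_def)
  text \<open>The first arc length derivative of the velocity is determined by \<open>\<partial>\<^sub>\<theta> \<partial>\<^sub>t c\<close>.\<close>
  have E1: "AE t in leb01. \<forall>\<theta>\<in>{0..1}. norm (q t \<theta>) *\<^sub>R E 1 t \<theta> = W 1 t \<theta>"
  proof -
    have "AE t in leb01. has_prim (W 0 t) (\<lambda>x. norm (q t x) *\<^sub>R E 1 t x)"
      using E(3)[rule_format, of 0] unfolding E(1) One_nat_def using n by simp
    moreover have "AE t in leb01. has_prim (W 0 t) (W 1 t)"
      using relW[of 0] n by simp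
    moreover have "AE t in leb01. has_prim (W 1 t) (W 2 t)"
      using relW[of 1] n by (simp add: numeral_2_eq_2)
    moreover have "AE t in leb01. has_prim (E 1 t) (\<lambda>x. norm (q t x) *\<^sub>R E 2 t x)"
      using E(3)[rule_format, of 1] n by (simp add: numeral_2_eq_2)
    ultimately show ?thesis
      using AE_space
    proof eventually_elim
      case (elim t)
      have ae: "AE x in leb01. norm (q t x) *\<^sub>R E 1 t x = W 1 t x"
        by (rule has_prim_unique[OF elim(1,2) refl])
      have c1: "continuous_on {0..1} (\<lambda>x. norm (q t x) *\<^sub>R E 1 t x)"
        using elim(5) cont has_prim_continuous[OF elim(4)] by (intro continuous_on_scaleR continuous_on_norm) auto
      show ?case
        using AE_eq_continuous_imp_eq[OF ae c1 has_prim_continuous[OF elim(3)]] by blast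
    qed
  qed
  have iW: "integrable leb01 (\<lambda>s. W k s \<theta>)" if "k < n" "\<theta> \<in> {0..1}" for k \<theta>
    using that by (intro integrable_time_section[OF l2W l2W relW]) auto
  have time: "has_prim (\<lambda>t. q t \<theta>) (\<lambda>t. norm (q t \<theta>) *\<^sub>R E 1 t \<theta>) \<and>
      has_prim (\<lambda>t. f t \<theta>) (\<lambda>t. E 0 t \<theta>)" if \<theta>: "\<theta> \<in> {0..1}" for \<theta>
  proof
    have W1: "has_prim (\<lambda>t. q t \<theta>) (\<lambda>s. W 1 s \<theta>)"
      unfolding q_def Q_def using iW[of 1] \<theta> n by (intro has_prim_prim) auto
    then show "has_prim (\<lambda>t. q t \<theta>) (\<lambda>t. norm (q t \<theta>) *\<^sub>R E 1 t \<theta>)"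
    proof (rule has_prim_cong_AE)
      show "AE s in leb01. norm (q s \<theta>) *\<^sub>R E 1 s \<theta> = W 1 s \<theta>"
        using E1 by eventually_elim (use \<theta> in blast)
      show "(\<lambda>s. norm (q s \<theta>) *\<^sub>R E 1 s \<theta>) \<in> borel_measurable leb01"
        using section_measurable(2)[OF mq \<theta>] section_measurable(2)[OF mE \<theta>, of 1] n by simp
    qed simp
    show "has_prim (\<lambda>t. f t \<theta>) (\<lambda>t. E 0 t \<theta>)"
      unfolding E(1)
    proof (rule has_primI)
      show "integrable leb01 (\<lambda>t. W 0 t \<theta>)" by (rule iW[OF _ \<theta>]) (use n in simp)
    qed (rule f[OF _ \<theta>])
  qed
  have "arc_path n f q E"
    unfolding arc_path_def
  proof (intro conjI allI impI)
    show "\<forall>t\<in>{0..1}. continuous_on {0..1} (q t) \<and> has_prim (f t) (q t)" using cont relf by blast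
    show "\<forall>t\<in>{0..1}. \<forall>\<theta>\<in>{0..1}. q t \<theta> \<noteq> 0" using nz by blast
    show "\<forall>\<theta>\<in>{0..1}. has_prim (\<lambda>t. q t \<theta>) (\<lambda>t. norm (q t \<theta>) *\<^sub>R E 1 t \<theta>) \<and>
      has_prim (\<lambda>t. f t \<theta>) (\<lambda>t. E 0 t \<theta>)" by (rule ballI) (rule time)
    show "AE t in leb01. has_prim (E i t) (\<lambda>x. norm (q t x) *\<^sub>R E (Suc i) t x)" if "i < n" for i
      using E(3) that by blast
  qed (fact mq mE)+
  then show ?thesis using that E(1) by blast
qed

section \<open>Regularity for a linear evolution equation with parameters\<close>

lemma prim_dominated_convergence:
  fixes f :: "nat \<Rightarrow> real \<Rightarrow> 'a::euclidean_space"
  assumes "\<And>m. f m \<in> borel_measurable leb01" "g \<in> borel_measurable leb01" "integrable leb01 w"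
    and "AE x in leb01. (\<lambda>m. f m x) \<longlonglongrightarrow> g x" "\<And>m. AE x in leb01. norm (f m x) \<le> w x"
  shows "(\<lambda>m. prim (f m) t) \<longlonglongrightarrow> prim g t"
  unfolding prim_def
proof (rule integral_dominated_convergence[OF _ _ assms(3)])
  have [measurable]: "(indicator {0..t} :: real \<Rightarrow> real) \<in> borel_measurable leb01" by simp
  show "(\<lambda>x. indicator {0..t} x *\<^sub>R g x) \<in> borel_measurable leb01"
    using assms(2) by measurable
  show "(\<lambda>x. indicator {0..t} x *\<^sub>R f m x) \<in> borel_measurable leb01" for m
    using assms(1)[of m] by measurable
  show "AE x in leb01. (\<lambda>m. indicator {0..t} x *\<^sub>R f m x) \<longlonglongrightarrow> indicator {0..t} x *\<^sub>R g x"
    using assms(4) by eventually_elim (rule tendsto_scaleR[OF tendsto_const])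
  show "AE x in leb01. norm (indicator {0..t} x *\<^sub>R f m x) \<le> w x" for m
    using assms(5)[of m]
  proof eventually_elim
    case (elim x)
    have "norm (indicator {0..t} x *\<^sub>R f m x) \<le> norm (f m x)" by (auto simp: indicator_def)
    then show ?case using elim by linarith
  qed
qed

text \<open>Models the linear equation v' = B(e, v) + f with a time dependent coefficient
  \<open>e\<close>. With constant 1 in the norm bound, the growth of solutions is governed by the
  integral of |e| alone.\<close>

locale contractive_bilinear = bounded_bilinear B
  for B :: "'a::euclidean_space \<Rightarrow> 'b::euclidean_space \<Rightarrow> 'b" +
  assumes norm_B: "norm (B x y) \<le> norm x * norm y"
begin

text \<open>The iterates are explicit so that their joint measurability in time and in a space
  parameter follows by induction and survives the limit, see \<open>picard_measurable\<close>. A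
  bare existence theorem would not supply it.\<close>

primrec picard_iter :: "(real \<Rightarrow> 'a) \<Rightarrow> (real \<Rightarrow> 'b) \<Rightarrow> 'b \<Rightarrow> nat \<Rightarrow> real \<Rightarrow> 'b" where
  "picard_iter e f v 0 t = 0"
| "picard_iter e f v (Suc m) t = v + prim (\<lambda>s. B (e s) (picard_iter e f v m s) + f s) t"

definition picard :: "(real \<Rightarrow> 'a) \<Rightarrow> (real \<Rightarrow> 'b) \<Rightarrow> 'b \<Rightarrow> real \<Rightarrow> 'b" where
  "picard e f v t = lim (\<lambda>m. picard_iter e f v m t)"

text \<open>Successive iterates differ by at most b / 2^m relative to the weight
  \<open>exp (2 * prim g t)\<close>. Here \<open>b\<close> bounds the first iterate, and the factor
  2 in the estimate is the sum of the geometric series.\<close>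

lemma picard_solution:
  fixes v :: 'b
  assumes e: "e \<in> borel_measurable leb01" and g: "integrable leb01 g" "\<And>s. 0 \<le> g s"
    and eg: "AE s in leb01. norm (e s) \<le> g s" and f: "integrable leb01 f"
  defines "b \<equiv> norm v + (\<integral>s. norm (f s) \<partial>leb01)"
  shows "\<And>t. t \<in> {0..1} \<Longrightarrow> norm (picard e f v t) \<le> 2 * exp (2 * integral\<^sup>L leb01 g) * b"
    and "has_prim (picard e f v) (\<lambda>s. B (e s) (picard e f v s) + f s)"
proof -
  define P where "P = picard_iter e f v"
  define w where "w t = exp (2 * prim g t)" for t
  have ei: "integrable leb01 e"
    by (rule Bochner_Integration.integrable_bound[OF g(1) e]) (use eg g(2) in auto)
  have b0: "0 \<le> b" unfolding b_def by simp
  have w1: "1 \<le> w t" and wle: "w t \<le> exp (2 * integral\<^sup>L leb01 g)" for t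
    unfolding w_def using prim_nonneg[of g t] prim_le_integral[OF g(1), of t] g(2) by auto
  have wi: "integrable leb01 (\<lambda>s. g s * w s)"
    unfolding w_def by (rule prim_exp_weight(1)[OF g(1), of 0]) simp
  have wp: "t \<in> {0..1} \<Longrightarrow> prim (\<lambda>s. g s * w s) t \<le> w t / 2" for t
    unfolding w_def by (rule prim_exp_weight(2)[OF g(1)])
  have cont: "continuous_on {0..1} (P m)" for m
  proof (induction m)
    case (Suc m)
    obtain C where C: "\<And>t. t \<in> {0..1} \<Longrightarrow> norm (P m t) \<le> C" using bounded_on_unit[OF Suc] by blast
    have "integrable leb01 (\<lambda>s. B (e s) (P m s) + f s)"
      using integrable_bilinear_bounded[OF bounded_bilinear_axioms ei continuous_measurable_leb01[OF Suc] C] f by simp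
    then have "continuous_on {0..1} (\<lambda>t. v + prim (\<lambda>s. B (e s) (P m s) + f s) t)"
      by (intro continuous_on_add continuous_on_const continuous_on_prim)
    then show ?case by (simp add: P_def)
  qed (simp add: P_def)
  note mP = continuous_measurable_leb01[OF cont]
  have Bi: "integrable leb01 (\<lambda>s. B (e s) (V s))"
    if "V \<in> borel_measurable leb01" "\<And>t. t \<in> {0..1} \<Longrightarrow> norm (V t) \<le> C" for V C
    by (rule integrable_bilinear_bounded[OF bounded_bilinear_axioms ei that])
  have BiP: "integrable leb01 (\<lambda>s. B (e s) (P m s))" for m
  proof -
    obtain C where "\<And>t. t \<in> {0..1} \<Longrightarrow> norm (P m t) \<le> C" using bounded_on_unit[OF cont] by blast
    from Bi[OF mP this] show ?thesis .
  qed
  have diff: "norm (P (Suc m) t - P m t) \<le> b * (1/2) ^ m * w t" if "t \<in> {0..1}" for m t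
    using that
  proof (induction m arbitrary: t)
    case 0
    have "norm (v + prim f t) \<le> b"
      unfolding b_def using norm_triangle_ineq[of v "prim f t"] norm_prim_le_integral[OF f, of t] by linarith
    also have "b \<le> b * w t" using b0 w1 mult_left_mono[of 1 "w t" b] by simp
    finally show ?case by (simp add: P_def zero_right)
  next
    case (Suc m)
    have "P (Suc (Suc m)) t - P (Suc m) t = prim (\<lambda>s. (B (e s) (P (Suc m) s) + f s) - (B (e s) (P m s) + f s)) t"
      using BiP[of m] BiP[of "Suc m"] f by (subst prim_diff) (auto simp: P_def)
    also have "\<dots> = prim (\<lambda>s. B (e s) (P (Suc m) s - P m s)) t"
      by (simp add: diff_right)
    finally have eq: "P (Suc (Suc m)) t - P (Suc m) t = prim (\<lambda>s. B (e s) (P (Suc m) s - P m s)) t" .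
    have i: "integrable leb01 (\<lambda>s. B (e s) (P (Suc m) s - P m s))"
      using BiP[of "Suc m"] BiP[of m] by (simp add: diff_right)
    have "norm (prim (\<lambda>s. B (e s) (P (Suc m) s - P m s)) t) \<le> prim (\<lambda>s. norm (B (e s) (P (Suc m) s - P m s))) t"
      by (rule norm_prim_le[OF i])
    also have "\<dots> \<le> prim (\<lambda>s. (b * (1/2) ^ m) * (g s * w s)) t"
    proof (rule prim_mono_AE)
      show "AE s in leb01. norm (B (e s) (P (Suc m) s - P m s)) \<le> (b * (1/2) ^ m) * (g s * w s)"
        using eg AE_space
      proof eventually_elim
        case (elim s)
        have "norm (B (e s) (P (Suc m) s - P m s)) \<le> norm (e s) * norm (P (Suc m) s - P m s)" by (rule norm_B)
        also have "\<dots> \<le> g s * (b * (1/2) ^ m * w s)"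
          using elim Suc.IH[of s] g(2)[of s] by (intro mult_mono) auto
        finally show ?case by (simp add: mult_ac)
      qed
    qed (use i wi in auto)
    also have "\<dots> \<le> (b * (1/2) ^ m) * (w t / 2)"
      unfolding prim_cmult using wp[OF Suc.prems] b0 by (intro mult_left_mono) auto
    finally show ?case unfolding eq by simp
  qed
  have lims: "(\<lambda>m. P m t) \<longlonglongrightarrow> picard e f v t" and bnd: "norm (P m t) \<le> 2 * exp (2 * integral\<^sup>L leb01 g) * b"
    if t: "t \<in> {0..1}" for t m
  proof -
    have tel: "P m t = (\<Sum>i<m. P (Suc i) t - P i t)" for m
      by (subst sum_lessThan_telescope) (simp add: P_def)
    have geo: "summable (\<lambda>i. b * w t * (1/2) ^ i)" by (intro summable_mult summable_geometric) simp
    have le: "norm (P (Suc i) t - P i t) \<le> b * w t * (1/2) ^ i" for i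
      using diff[OF t, of i] by (simp add: mult_ac)
    have "summable (\<lambda>i. P (Suc i) t - P i t)"
      by (rule summable_comparison_test'[OF geo]) (rule le)
    then have "(\<lambda>m. \<Sum>i<m. P (Suc i) t - P i t) \<longlonglongrightarrow> (\<Sum>i. P (Suc i) t - P i t)"
      by (rule summable_LIMSEQ)
    then have "(\<lambda>m. P m t) \<longlonglongrightarrow> (\<Sum>i. P (Suc i) t - P i t)"
      unfolding tel[symmetric] .
    then have "convergent (\<lambda>m. P m t)" by (auto simp: convergent_def)
    then show "(\<lambda>m. P m t) \<longlonglongrightarrow> picard e f v t"
      unfolding picard_def P_def by (simp add: convergent_LIMSEQ_iff)
    have "norm (P m t) \<le> (\<Sum>i<m. b * w t * (1/2) ^ i)"
      by (subst tel, rule order_trans[OF norm_sum sum_mono]) (rule le)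
    also have "\<dots> \<le> (\<Sum>i. b * w t * (1/2) ^ i)"
      using b0 w1[of t] by (intro sum_le_suminf geo) auto
    also have "\<dots> = b * w t * 2"
      by (subst suminf_mult) (auto simp: suminf_geometric)
    also have "\<dots> \<le> b * exp (2 * integral\<^sup>L leb01 g) * 2"
      using wle[of t] b0 by (intro mult_right_mono mult_left_mono) auto
    finally show "norm (P m t) \<le> 2 * exp (2 * integral\<^sup>L leb01 g) * b" by (simp add: mult_ac)
  qed
  show vb: "norm (picard e f v t) \<le> 2 * exp (2 * integral\<^sup>L leb01 g) * b" if "t \<in> {0..1}" for t
    using bnd[OF that] by (intro LIMSEQ_le_const2[OF tendsto_norm[OF lims[OF that]]]) auto
  have mV: "picard e f v \<in> borel_measurable leb01"
    by (rule borel_measurable_LIMSEQ_metric[where f = P, OF mP]) (use lims in auto)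
  have iV: "integrable leb01 (\<lambda>s. B (e s) (picard e f v s))" by (rule Bi[OF mV vb])
  show "has_prim (picard e f v) (\<lambda>s. B (e s) (picard e f v s) + f s)"
  proof -
    have eq: "picard e f v t = v + prim (\<lambda>s. B (e s) (picard e f v s) + f s) t" if t: "t \<in> {0..1}" for t
    proof (rule LIMSEQ_unique)
      show "(\<lambda>m. P (Suc m) t) \<longlonglongrightarrow> picard e f v t"
        using lims[OF t] by (rule LIMSEQ_Suc)
      have "(\<lambda>m. prim (\<lambda>s. B (e s) (P m s) + f s) t) \<longlonglongrightarrow> prim (\<lambda>s. B (e s) (picard e f v s) + f s) t"
      proof (rule prim_dominated_convergence)
        let ?C = "2 * exp (2 * integral\<^sup>L leb01 g) * b"
        show "(\<lambda>s. B (e s) (P m s) + f s) \<in> borel_measurable leb01" for m using BiP[of m] f by simp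
        show "(\<lambda>s. B (e s) (picard e f v s) + f s) \<in> borel_measurable leb01" using iV f by simp
        show "integrable leb01 (\<lambda>s. g s * ?C + norm (f s))" using g f by simp
        show "AE s in leb01. (\<lambda>m. B (e s) (P m s) + f s) \<longlonglongrightarrow> B (e s) (picard e f v s) + f s"
          by (rule AE_I2) (use lims in \<open>auto intro!: tendsto_intros tendsto\<close>)
        show "AE s in leb01. norm (B (e s) (P m s) + f s) \<le> g s * ?C + norm (f s)" for m
          using eg AE_space
        proof eventually_elim
          case (elim s)
          have "norm (B (e s) (P m s)) \<le> norm (e s) * norm (P m s)" by (rule norm_B)
          also have "\<dots> \<le> g s * ?C" using elim bnd[of s m] g(2)[of s] by (intro mult_mono) auto
          finally show ?case by (intro order_trans[OF norm_triangle_ineq]) simp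
        qed
      qed
      then show "(\<lambda>m. P (Suc m) t) \<longlonglongrightarrow> v + prim (\<lambda>s. B (e s) (picard e f v s) + f s) t"
        unfolding P_def picard_iter.simps by (intro tendsto_intros)
    qed
    show ?thesis
    proof (rule has_primI)
      show "integrable leb01 (\<lambda>s. B (e s) (picard e f v s) + f s)" using iV f by simp
      show "picard e f v t = picard e f v 0 + prim (\<lambda>s. B (e s) (picard e f v s) + f s) t" if "t \<in> {0..1}" for t
        using eq[OF that] eq[of 0] by simp
    qed
  qed
qed

lemma picard_0: "picard e f v 0 = v"
proof -
  have "(\<lambda>m. picard_iter e f v (Suc m) 0) \<longlonglongrightarrow> v" by simp
  then have "(\<lambda>m. picard_iter e f v m 0) \<longlonglongrightarrow> v" by (rule LIMSEQ_imp_Suc)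
  then show ?thesis unfolding picard_def by (rule limI)
qed

lemma picard_measurable:
  assumes e: "case_prod e \<in> borel_measurable leb01sq" and f: "case_prod f \<in> borel_measurable leb01sq"
    and v: "v \<in> borel_measurable leb01"
  shows "(\<lambda>(t, \<theta>). picard (\<lambda>s. e s \<theta>) (\<lambda>s. f s \<theta>) (v \<theta>) t) \<in> borel_measurable leb01sq"
proof -
  have "(\<lambda>(t, \<theta>). picard_iter (\<lambda>s. e s \<theta>) (\<lambda>s. f s \<theta>) (v \<theta>) m t) \<in> borel_measurable leb01sq" for m
  proof (induction m)
    case (Suc m)
    have "(\<lambda>(s, \<theta>). B (e s \<theta>) (picard_iter (\<lambda>s. e s \<theta>) (\<lambda>s. f s \<theta>) (v \<theta>) m s) + f s \<theta>) \<in> borel_measurable leb01sq"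
      using borel_measurable_add[OF borel_measurable_bilinear[OF bounded_bilinear_axioms e Suc] f]
      by (simp add: case_prod_beta')
    from measurable_prim_time[OF this]
    have "(\<lambda>p. prim (\<lambda>s. B (e s (snd p)) (picard_iter (\<lambda>s. e s (snd p)) (\<lambda>s. f s (snd p)) (v (snd p)) m s) + f s (snd p)) (fst p))
        \<in> borel_measurable leb01sq" by (simp add: case_prod_beta')
    moreover have "(\<lambda>p. v (snd p)) \<in> borel_measurable leb01sq" by (rule measurable_compose[OF measurable_snd v])
    ultimately show ?case by (simp add: case_prod_beta')
  qed simp
  then show ?thesis
    unfolding picard_def case_prod_beta' by (intro borel_measurable_lim_metric) simp
qed

end

section \<open>Function classes for coefficients and for solutions\<close>

definition dom_l2 :: "(real \<Rightarrow> real \<Rightarrow> 'a::euclidean_space) \<Rightarrow> bool" where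
  "dom_l2 f \<longleftrightarrow> case_prod f \<in> borel_measurable leb01sq \<and>
     (\<exists>b. l2 leb01 b \<and> (\<forall>t\<in>{0..1}. \<forall>\<theta>\<in>{0..1}. norm (f t \<theta>) \<le> b \<theta>))"

abbreviation sobA :: "nat \<Rightarrow> (real \<Rightarrow> real \<Rightarrow> 'a::euclidean_space) \<Rightarrow> bool" where
  "sobA \<equiv> psob (ae_filter leb01) (\<lambda>f. l2 leb01sq (case_prod f))"

text \<open>Solutions are controlled at every time and dominated by a function of \<theta> alone;
  coefficients, in \<open>sobA\<close>, only in the square integral over time and space. The two
  classes fit together because a coefficient with a derivative in reserve is bounded in \<theta> by
  some square integrable h(t), and h(t) b(\<theta>) is square integrable on the square.\<close>

abbreviation sobB :: "nat \<Rightarrow> (real \<Rightarrow> real \<Rightarrow> 'a::euclidean_space) \<Rightarrow> bool" where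
  "sobB \<equiv> psob (principal {0..1}) dom_l2"

primrec ssob :: "nat \<Rightarrow> (real \<Rightarrow> 'a::euclidean_space) \<Rightarrow> bool" where
  "ssob 0 f = l2 leb01 f"
| "ssob (Suc k) f = (\<exists>g. ssob k g \<and> has_prim f g)"

lemma ssob_l2: "ssob k f \<Longrightarrow> l2 leb01 f"
  by (cases k) (auto intro: l2_continuous_leb01 has_prim_continuous)

lemma ssob_SucD: "ssob (Suc k) f \<Longrightarrow> ssob k f"
proof (induction k arbitrary: f)
  case 0
  then obtain g where "has_prim f g" by auto
  then show ?case by (auto intro: l2_continuous_leb01 has_prim_continuous)
next
  case (Suc k)
  then show ?case by (metis ssob.simps(2))
qed

lemma dom_l2_section: "dom_l2 f \<Longrightarrow> t \<in> {0..1} \<Longrightarrow> l2 leb01 (f t)"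
proof -
  assume f: "dom_l2 f" and t: "t \<in> {0..1}"
  obtain b where b: "l2 leb01 b" "\<forall>t\<in>{0..1}. \<forall>\<theta>\<in>{0..1}. norm (f t \<theta>) \<le> b \<theta>"
    using f unfolding dom_l2_def by blast
  have m: "f t \<in> borel_measurable leb01"
    using f t section_measurable(1) unfolding dom_l2_def by blast
  have "norm (f t \<theta>) \<le> 1 * norm (b \<theta>)" if "\<theta> \<in> {0..1}" for \<theta>
    using b(2)[rule_format, OF t that] by simp
  then show ?thesis
    by (intro l2_bound[OF b(1) m, where C=1] AE_I2) auto
qed

lemma sobB_imp_ssob: "sobB k f \<Longrightarrow> t \<in> {0..1} \<Longrightarrow> ssob k (f t)"
proof (induction k arbitrary: f)
  case (Suc k)
  obtain g where g: "sobB k g" "\<forall>\<^sub>F t in principal {0..1}. has_prim (f t) (g t)"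
    using Suc.prems(1) by (rule psob_SucE)
  then have "ssob k (g t)" "has_prim (f t) (g t)"
    using Suc.IH[of g] Suc.prems(2) by (auto simp: eventually_principal)
  then show ?case by auto
qed (simp add: dom_l2_section)

lemma ae_le_principal_unit: "ae_filter leb01 \<le> principal {0..1}"
  using AE_space[of leb01] by (simp add: le_principal)

lemma AE_leb01sq_leI:
  fixes f k :: "real \<Rightarrow> real \<Rightarrow> real"
  assumes "case_prod f \<in> borel_measurable leb01sq" "case_prod k \<in> borel_measurable leb01sq"
    and "AE t in leb01. \<forall>\<theta>\<in>{0..1}. f t \<theta> \<le> k t \<theta>"
  shows "AE p in leb01sq. case_prod f p \<le> case_prod k p"
proof (rule leb01_pair.AE_pair_measure)
  show "{p \<in> space leb01sq. case_prod f p \<le> case_prod k p} \<in> sets leb01sq"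
    using assms(1,2) by measurable
  show "AE t in leb01. AE \<theta> in leb01. case_prod f (t, \<theta>) \<le> case_prod k (t, \<theta>)"
    using assms(3) by eventually_elim (rule AE_I2, simp)
qed

lemma measurable_fst_leb01sq: "g \<in> borel_measurable leb01 \<Longrightarrow> (\<lambda>p. g (fst p)) \<in> borel_measurable leb01sq"
  and measurable_snd_leb01sq: "g \<in> borel_measurable leb01 \<Longrightarrow> (\<lambda>p. g (snd p)) \<in> borel_measurable leb01sq"
  by (rule measurable_compose[OF measurable_fst], assumption) (rule measurable_compose[OF measurable_snd], assumption)

lemma integrable_product_leb01sq:
  fixes g b :: "real \<Rightarrow> real"
  assumes g: "integrable leb01 g" and b: "integrable leb01 b"
  shows "integrable leb01sq (\<lambda>(t, x). g t * b x)"
proof (rule leb01_pair.Fubini_integrable)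
  show "(\<lambda>(t, x). g t * b x) \<in> borel_measurable leb01sq"
    unfolding case_prod_beta'
    using measurable_fst_leb01sq[of g] measurable_snd_leb01sq[of b] g b by simp
  show "integrable leb01 (\<lambda>t. \<integral>x. norm (case (t, x) of (t, x) \<Rightarrow> g t * b x) \<partial>leb01)"
    using g by (simp add: abs_mult)
qed (use b in simp)

lemma l2_product_leb01sq:
  fixes g b :: "real \<Rightarrow> real"
  assumes g: "l2 leb01 g" and b: "l2 leb01 b"
  shows "l2 leb01sq (\<lambda>(t, x). g t * b x)"
  unfolding l2_def
proof
  show "(\<lambda>(t, x). g t * b x) \<in> borel_measurable leb01sq"
    unfolding case_prod_beta'
    by (intro borel_measurable_times measurable_fst_leb01sq measurable_snd_leb01sq l2_measurable[OF g] l2_measurable[OF b])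
  have "integrable leb01sq (\<lambda>(t, x). (g t)\<^sup>2 * (b x)\<^sup>2)"
    using g b by (intro integrable_product_leb01sq) (auto simp: l2_def)
  then show "integrable leb01sq (\<lambda>p. (norm (case p of (t, x) \<Rightarrow> g t * b x))\<^sup>2)"
    by (simp add: case_prod_beta' power_mult_distrib)
qed

lemma l2_bilinear_time_space:
  fixes B :: "'a::euclidean_space \<Rightarrow> 'b::euclidean_space \<Rightarrow> 'c::euclidean_space"
  assumes B: "bounded_bilinear B" and f: "case_prod f \<in> borel_measurable leb01sq" and g: "dom_l2 g"
    and h: "l2 leb01 h" "AE t in leb01. \<forall>\<theta>\<in>{0..1}. norm (f t \<theta>) \<le> h t"
  shows "l2 leb01sq (\<lambda>(t, \<theta>). B (f t \<theta>) (g t \<theta>))"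
proof -
  interpret bounded_bilinear B by fact
  obtain K where K: "0 \<le> K" "\<And>a b. norm (B a b) \<le> norm a * norm b * K"
    using nonneg_bounded by blast
  obtain b where b: "l2 leb01 b" "\<forall>t\<in>{0..1}. \<forall>\<theta>\<in>{0..1}. norm (g t \<theta>) \<le> b \<theta>"
    using g unfolding dom_l2_def by blast
  have m: "(\<lambda>(t, \<theta>). B (f t \<theta>) (g t \<theta>)) \<in> borel_measurable leb01sq"
    using borel_measurable_bilinear[OF B f, of "case_prod g"] g by (simp add: dom_l2_def case_prod_beta')
  have hb: "l2 leb01sq (\<lambda>(t, x). h t * b x)" by (rule l2_product_leb01sq[OF h(1) b(1)])
  show ?thesis
  proof (rule l2_bound[OF hb m])
    have "AE p in leb01sq. (case p of (t, \<theta>) \<Rightarrow> norm (B (f t \<theta>) (g t \<theta>))) \<le> (case p of (t, \<theta>) \<Rightarrow> K * norm (h t * b \<theta>))"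
    proof (rule AE_leb01sq_leI)
      show "(\<lambda>(t, \<theta>). norm (B (f t \<theta>) (g t \<theta>))) \<in> borel_measurable leb01sq"
        using measurable_compose[OF m borel_measurable_norm] by (simp add: case_prod_beta')
      show "(\<lambda>(t, \<theta>). K * norm (h t * b \<theta>)) \<in> borel_measurable leb01sq"
        using borel_measurable_times[OF borel_measurable_const[of K] measurable_compose[OF l2_measurable[OF hb] borel_measurable_norm]]
        by (simp add: case_prod_beta')
      show "AE t in leb01. \<forall>\<theta>\<in>{0..1}. norm (B (f t \<theta>) (g t \<theta>)) \<le> K * norm (h t * b \<theta>)"
        using h(2) AE_space
      proof eventually_elim
        case (elim t)
        show ?case
        proof
          fix \<theta> :: real assume \<theta>: "\<theta> \<in> {0..1}"
          have "norm (f t \<theta>) \<le> h t" "norm (g t \<theta>) \<le> b \<theta>"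
            using elim \<theta> b(2) by auto
          then have "norm (f t \<theta>) * norm (g t \<theta>) \<le> h t * b \<theta>"
            by (intro mult_mono) (auto intro: order_trans[OF norm_ge_zero])
          then have "norm (f t \<theta>) * norm (g t \<theta>) * K \<le> norm (h t * b \<theta>) * K"
            using K(1) by (intro mult_right_mono) auto
          then show "norm (B (f t \<theta>) (g t \<theta>)) \<le> K * norm (h t * b \<theta>)"
            using K(2)[of "f t \<theta>" "g t \<theta>"] by (simp add: mult.commute)
        qed
      qed
    qed
    then show "AE p in leb01sq. norm (case p of (t, \<theta>) \<Rightarrow> B (f t \<theta>) (g t \<theta>)) \<le> K * norm (case p of (t, x) \<Rightarrow> h t * b x)"
      by eventually_elim (simp add: case_prod_beta')
  qed
qed

text \<open>One more derivative upgrades domination by a function of \<theta> to a constant bound: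
  both space averages in \<open>sup_le_integrals\<close> are bounded uniformly in time.\<close>

lemma psob_dom_l2_bounded:
  assumes "psob (ae_filter leb01) dom_l2 (Suc k) g"
  obtains C where "AE t in leb01. \<forall>\<theta>\<in>{0..1}. norm (g t \<theta>) \<le> C"
proof -
  obtain g' where g': "psob (ae_filter leb01) dom_l2 k g'" "AE t in leb01. has_prim (g t) (g' t)" "dom_l2 g"
    using assms by (rule psob_SucE)
  obtain b where b: "l2 leb01 b" "\<forall>t\<in>{0..1}. \<forall>\<theta>\<in>{0..1}. norm (g t \<theta>) \<le> b \<theta>"
    using g'(3) unfolding dom_l2_def by blast
  have d': "dom_l2 g'" by (rule psob_imp_base[OF g'(1)])
  then obtain b' where b': "l2 leb01 b'" "\<forall>t\<in>{0..1}. \<forall>\<theta>\<in>{0..1}. norm (g' t \<theta>) \<le> b' \<theta>"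
    unfolding dom_l2_def by blast
  have "AE t in leb01. \<forall>\<theta>\<in>{0..1}. norm (g t \<theta>) \<le> integral\<^sup>L leb01 b + integral\<^sup>L leb01 b'"
    using g'(2) AE_space
  proof eventually_elim
    case (elim t)
    then have t: "t \<in> {0..1}" by simp
    have "(\<integral>x. norm (g t x) \<partial>leb01) \<le> integral\<^sup>L leb01 b"
      using b t leb01.l2_imp_integrable[OF dom_l2_section[OF g'(3) t]] leb01.l2_imp_integrable[OF b(1)]
      by (intro integral_mono) auto
    moreover have "(\<integral>x. norm (g' t x) \<partial>leb01) \<le> integral\<^sup>L leb01 b'"
      using b' t leb01.l2_imp_integrable[OF dom_l2_section[OF d' t]] leb01.l2_imp_integrable[OF b'(1)]
      by (intro integral_mono) auto
    ultimately show ?case using sup_le_integrals[OF elim(1)] by (meson add_mono order_trans)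
  qed
  then show ?thesis by (rule that)
qed

lemma l2sq_add: "l2 leb01sq (case_prod f) \<Longrightarrow> l2 leb01sq (case_prod g) \<Longrightarrow> l2 leb01sq (\<lambda>(t, \<theta>). f t \<theta> + g t \<theta>)"
  using l2_add[of leb01sq "case_prod f" "case_prod g"] by (simp add: case_prod_beta')

lemma l2sq_bilinear:
  fixes B :: "'a::euclidean_space \<Rightarrow> 'b::euclidean_space \<Rightarrow> 'c::euclidean_space"
  assumes B: "bounded_bilinear B" and f: "l2 leb01sq (case_prod f)"
    and g: "case_prod g \<in> borel_measurable leb01sq" "AE t in leb01. \<forall>\<theta>\<in>{0..1}. norm (g t \<theta>) \<le> C"
  shows "l2 leb01sq (\<lambda>(t, \<theta>). B (f t \<theta>) (g t \<theta>))"
proof -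
  have "AE p in leb01sq. (case p of (t, \<theta>) \<Rightarrow> norm (g t \<theta>)) \<le> (case p of (t, \<theta>) \<Rightarrow> C)"
    using g measurable_compose[OF g(1) borel_measurable_norm] by (intro AE_leb01sq_leI) (auto simp: case_prod_beta')
  then have "AE p in leb01sq. norm (case_prod g p) \<le> C"
    by eventually_elim (simp add: case_prod_beta')
  from l2_bilinear[OF B f g(1) this] show ?thesis by (simp add: case_prod_beta')
qed

text \<open>In each term of the Leibniz rule one factor keeps a derivative. If this is
  \<open>g\<close>, it is bounded by a constant; if it is \<open>f\<close>, it is bounded by a
  square integrable function of time, which is paired with the domination of \<open>g\<close> in
  \<theta>.\<close>

lemma sobA_bilinear_Suc:
  fixes B :: "'a::euclidean_space \<Rightarrow> 'b::euclidean_space \<Rightarrow> 'c::euclidean_space"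
  assumes B: "bounded_bilinear B" and f: "sobA (Suc k) f" and g: "sobB (Suc k) g"
  shows "sobA (Suc k) (\<lambda>t \<theta>. B (f t \<theta>) (g t \<theta>))"
proof -
  have g': "psob (ae_filter leb01) dom_l2 (Suc k) g"
    by (rule psob_weaken[OF g ae_le_principal_unit])
  show ?thesis
  proof (rule psob_bilinear_Suc[OF B _ _ _ f g'])
    fix f :: "real \<Rightarrow> real \<Rightarrow> 'a" and g :: "real \<Rightarrow> real \<Rightarrow> 'b"
    assume *: "l2 leb01sq (case_prod f)" "psob (ae_filter leb01) dom_l2 1 g"
    obtain C where "AE t in leb01. \<forall>\<theta>\<in>{0..1}. norm (g t \<theta>) \<le> C"
      using psob_dom_l2_bounded[of 0 g] *(2) by auto
    moreover have "case_prod g \<in> borel_measurable leb01sq"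
      using psob_imp_base[OF *(2)] by (simp add: dom_l2_def)
    ultimately show "l2 leb01sq (\<lambda>(t, \<theta>). B (f t \<theta>) (g t \<theta>))"
      using l2sq_bilinear[OF B *(1)] by blast
  next
    fix f :: "real \<Rightarrow> real \<Rightarrow> 'a" and g :: "real \<Rightarrow> real \<Rightarrow> 'b"
    assume *: "sobA 1 f" "dom_l2 g"
    then obtain f' where f': "l2 leb01sq (case_prod f)" "l2 leb01sq (case_prod f')" "AE t in leb01. has_prim (f t) (f' t)"
      by auto
    obtain h where "l2 leb01 h" "AE t in leb01. \<forall>\<theta>\<in>{0..1}. norm (f t \<theta>) \<le> h t"
      by (rule l2_sup_bound[OF f']) blast
    then show "l2 leb01sq (\<lambda>(t, \<theta>). B (f t \<theta>) (g t \<theta>))"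
      using l2_bilinear_time_space[OF B _ *(2)] f'(1) by (auto simp: l2_def)
  qed (rule l2sq_add)
qed

lemma sobA_add: "sobA k f \<Longrightarrow> sobA k g \<Longrightarrow> sobA k (\<lambda>t \<theta>. f t \<theta> + g t \<theta>)"
  by (rule psob_add) (auto intro: l2sq_add)

section \<open>Differentiation of the evolution equation in the space parameter\<close>

context contractive_bilinear
begin

text \<open>The spatial derivative of a solution solves the differentiated equation. The candidate \<open>V\<close> is
  constructed by Picard iteration; a Volterra estimate for \<open>Z = u - u(\<cdot>,0) - \<integral>V\<close> shows \<open>Z = 0\<close>.\<close>
lemma evolution_derivative:
  assumes E: "l2 leb01sq (case_prod E)" "l2 leb01sq (case_prod E')" "AE t in leb01. has_prim (E t) (E' t)"
    and F: "l2 leb01sq (case_prod F)" "l2 leb01sq (case_prod F')" "AE t in leb01. has_prim (F t) (F' t)"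
    and mu: "case_prod u \<in> borel_measurable leb01sq"
    and ub: "\<And>t \<theta>. t \<in> {0..1} \<Longrightarrow> \<theta> \<in> {0..1} \<Longrightarrow> norm (u t \<theta>) \<le> Cu"
    and u: "\<And>\<theta>. \<theta> \<in> {0..1} \<Longrightarrow> has_prim (\<lambda>t. u t \<theta>) (\<lambda>s. B (E s \<theta>) (u s \<theta>) + F s \<theta>)"
    and u0: "has_prim (u 0) v0" and v0: "l2 leb01 v0"
  obtains V C where "dom_l2 V" "\<And>t. t \<in> {0..1} \<Longrightarrow> has_prim (u t) (V t)" "\<And>\<theta>. V 0 \<theta> = v0 \<theta>"
    "\<And>t \<theta>. t \<in> {0..1} \<Longrightarrow> \<theta> \<in> {0..1} \<Longrightarrow>
       norm (V t \<theta>) \<le> C * (norm (v0 \<theta>) + (\<integral>s. norm (B (E' s \<theta>) (u s \<theta>) + F' s \<theta>) \<partial>leb01))"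
    "0 \<le> C"
    "\<And>\<theta>. \<theta> \<in> {0..1} \<Longrightarrow> integrable leb01 (\<lambda>s. B (E' s \<theta>) (u s \<theta>) + F' s \<theta>) \<Longrightarrow>
       has_prim (\<lambda>t. V t \<theta>) (\<lambda>s. B (E s \<theta>) (V s \<theta>) + (B (E' s \<theta>) (u s \<theta>) + F' s \<theta>))"
proof -
  obtain g where g: "l2 leb01 g" "\<And>t. 0 \<le> g t" "AE t in leb01. \<forall>\<theta>\<in>{0..1}. norm (E t \<theta>) \<le> g t"
    by (rule l2_sup_bound[OF E]) blast
  have gi: "integrable leb01 g" by (rule leb01.l2_imp_integrable[OF g(1)])
  note mE = l2_measurable[OF E(1)]
  define f0 where "f0 = (\<lambda>s \<theta>. B (E' s \<theta>) (u s \<theta>) + F' s \<theta>)"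
  have l2f0: "l2 leb01sq (case_prod f0)"
  proof -
    have "AE t in leb01. \<forall>\<theta>\<in>{0..1}. norm (u t \<theta>) \<le> Cu" by (rule AE_I2) (use ub in auto)
    from l2sq_add[OF l2sq_bilinear[OF bounded_bilinear_axioms E(2) mu this] F(2)]
    show ?thesis by (simp add: f0_def)
  qed
  note mf0 = l2_measurable[OF l2f0]
  \<comment> \<open>The differentiated source \<open>f0\<close> is integrable in time for almost
    every \<theta> only. It is cut off, measurably in \<theta>, on the remaining null set so that
    Picard's solution exists at every \<theta>.\<close>
  define good where "good \<theta> \<longleftrightarrow> (\<integral>\<^sup>+s. ennreal (norm (f0 s \<theta>)) \<partial>leb01) < \<infinity>" for \<theta>
  have good_iff: "good \<theta> \<longleftrightarrow> integrable leb01 (\<lambda>s. f0 s \<theta>)" if "\<theta> \<in> {0..1}" for \<theta>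
    unfolding good_def integrable_iff_bounded using section_measurable(2)[OF mf0 that] by blast
  have mgood: "Measurable.pred leb01 good"
  proof -
    have "(\<lambda>(\<theta>, s). f0 s \<theta>) \<in> borel_measurable leb01sq"
      using measurable_pair_swap[OF mf0] by (simp add: case_prod_beta')
    then have "(\<lambda>\<theta>. \<integral>\<^sup>+s. ennreal (norm (f0 s \<theta>)) \<partial>leb01) \<in> borel_measurable leb01"
      by (intro leb01.borel_measurable_nn_integral) (simp add: case_prod_beta')
    then show ?thesis unfolding good_def by measurable
  qed
  define f where "f = (\<lambda>s \<theta>. if good \<theta> then f0 s \<theta> else 0)"
  have mf: "case_prod f \<in> borel_measurable leb01sq"
  proof -
    have "Measurable.pred leb01sq (\<lambda>p. good (snd p))"
      by (rule measurable_compose[OF measurable_snd mgood])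
    moreover have "(\<lambda>p. f0 (fst p) (snd p)) \<in> borel_measurable leb01sq" using mf0 by (simp add: case_prod_beta')
    ultimately show ?thesis
      unfolding f_def case_prod_beta' by measurable
  qed
  have fi: "integrable leb01 (\<lambda>s. f s \<theta>)" if "\<theta> \<in> {0..1}" for \<theta>
    using good_iff[OF that] by (cases "good \<theta>") (auto simp: f_def)
  have fle: "(\<integral>s. norm (f s \<theta>) \<partial>leb01) \<le> (\<integral>s. norm (f0 s \<theta>) \<partial>leb01)" for \<theta>
    by (cases "good \<theta>") (auto simp: f_def)
  define V where "V = (\<lambda>t \<theta>. picard (\<lambda>s. E s \<theta>) (\<lambda>s. f s \<theta>) (v0 \<theta>) t)"
  define C where "C = 2 * exp (2 * integral\<^sup>L leb01 g)"
  have C0: "0 \<le> C" by (simp add: C_def)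
  have AEg: "AE s in leb01. norm (E s \<theta>) \<le> g s" if "\<theta> \<in> {0..1}" for \<theta>
    using g(3) by eventually_elim (use that in blast)
  note sol = picard_solution[OF section_measurable(2)[OF mE] gi g(2) AEg fi]
  have Vb: "norm (V t \<theta>) \<le> C * (norm (v0 \<theta>) + (\<integral>s. norm (f0 s \<theta>) \<partial>leb01))" if "t \<in> {0..1}" "\<theta> \<in> {0..1}" for t \<theta>
  proof -
    have "norm (V t \<theta>) \<le> C * (norm (v0 \<theta>) + (\<integral>s. norm (f s \<theta>) \<partial>leb01))"
      unfolding V_def C_def by (rule sol(1)) (use that in auto)
    also have "\<dots> \<le> C * (norm (v0 \<theta>) + (\<integral>s. norm (f0 s \<theta>) \<partial>leb01))"
      using fle C0 by (intro mult_left_mono add_left_mono) auto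
    finally show ?thesis .
  qed
  have Vprim: "has_prim (\<lambda>t. V t \<theta>) (\<lambda>s. B (E s \<theta>) (V s \<theta>) + f s \<theta>)" if "\<theta> \<in> {0..1}" for \<theta>
    unfolding V_def by (rule sol(2)) (use that in auto)
  have V0: "V 0 \<theta> = v0 \<theta>" for \<theta> by (simp add: V_def picard_0)
  have mV: "case_prod V \<in> borel_measurable leb01sq"
    unfolding V_def by (rule picard_measurable[OF mE mf l2_measurable[OF v0]])
  define b where "b \<theta> = C * (norm (v0 \<theta>) + (\<integral>s. norm (f0 s \<theta>) \<partial>leb01))" for \<theta>
  have lb: "l2 leb01 b"
    unfolding b_def using l2_scaleR[OF l2_add[OF l2_norm[OF v0] l2_integral_section_space[OF l2f0]], of C] by simp
  have bi: "integrable leb01 b" by (rule leb01.l2_imp_integrable[OF lb])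
  have domV: "dom_l2 V" unfolding dom_l2_def using mV lb Vb b_def by auto
  have Vi: "integrable leb01 (V t)" if "t \<in> {0..1}" for t
    by (rule leb01.l2_imp_integrable[OF dom_l2_section[OF domV that]])
  define H where "H = (\<lambda>s x. B (E s x) (V s x) + f0 s x)"
  have Hi: "integrable leb01sq (case_prod H)"
  proof -
    have "l2 leb01sq (\<lambda>(t, \<theta>). B (E t \<theta>) (V t \<theta>))"
      by (rule l2_bilinear_time_space[OF bounded_bilinear_axioms mE domV g(1) g(3)])
    from l2sq_add[OF this l2f0] show ?thesis unfolding H_def by (rule l2sq_integrable)
  qed
  \<comment> \<open>The function \<open>uu\<close> has derivative \<open>V t\<close> and agrees with
    \<open>u\<close> at \<theta> = 0; what has to vanish is the defect \<open>Z\<close>.\<close>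
  define uu where "uu t \<theta> = u t 0 + prim (V t) \<theta>" for t \<theta>
  define Z where "Z t \<theta> = u t \<theta> - uu t \<theta>" for t \<theta>
  have uuprim: "has_prim (uu t) (V t)" if "t \<in> {0..1}" for t
    unfolding uu_def by (rule has_prim_prim[OF Vi[OF that]])
  define C0 where "C0 = Cu + Cu + integral\<^sup>L leb01 b"
  have Zb: "norm (Z t \<theta>) \<le> C0" if "t \<in> {0..1}" "\<theta> \<in> {0..1}" for t \<theta>
  proof -
    have "norm (prim (V t) \<theta>) \<le> (\<integral>x. norm (V t x) \<partial>leb01)" by (rule norm_prim_le_integral[OF Vi[OF that(1)]])
    also have "\<dots> \<le> integral\<^sup>L leb01 b"
      using Vb that(1) Vi[OF that(1)] bi by (intro integral_mono) (auto simp: b_def)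
    finally have "norm (prim (V t) \<theta>) \<le> integral\<^sup>L leb01 b" .
    then show ?thesis
      unfolding Z_def uu_def C0_def
      using ub[OF that] ub[OF that(1), of 0] norm_triangle_ineq4[of "u t \<theta>" "u t 0 + prim (V t) \<theta>"]
        norm_triangle_ineq[of "u t 0" "prim (V t) \<theta>"] by auto
  qed
  have C00: "0 \<le> C0" using Zb[of 0 0] norm_ge_zero[of "Z 0 0"] by (simp del: norm_ge_zero)
  \<comment> \<open>Integration over \<theta> hides the null set on which the source was cut off,
    and the two integrals can then be exchanged.\<close>
  have VH: "prim (V t) \<theta> = prim v0 \<theta> + prim (\<lambda>s. prim (H s) \<theta>) t" if t: "t \<in> {0..1}" for t \<theta>
  proof -
    have mHt: "(\<lambda>x. prim (\<lambda>s. H s x) t) \<in> borel_measurable leb01"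
      using section_measurable(1)[OF measurable_prim_time t, of H] Hi by auto
    have Hti: "integrable leb01 (\<lambda>x. prim (\<lambda>s. H s x) t)"
    proof (rule Bochner_Integration.integrable_bound[OF _ mHt])
      have Hn: "integrable leb01sq (\<lambda>(s, x). norm (H s x))" using integrable_norm[OF Hi] by (simp add: case_prod_beta')
      show "integrable leb01 (\<lambda>x. \<integral>s. norm (H s x) \<partial>leb01)" by (rule leb01_pair.integrable_snd[OF Hn])
      show "AE x in leb01. norm (prim (\<lambda>s. H s x) t) \<le> norm (\<integral>s. norm (H s x) \<partial>leb01)"
        using leb01_pair.AE_integrable_snd[OF Hi] by eventually_elim (use norm_prim_le_integral in force)
    qed
    have "AE x in leb01. V t x = v0 x + prim (\<lambda>s. H s x) t"
      using l2_AE_section_space[OF l2f0] AE_space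
    proof eventually_elim
      case (elim x)
      then have x: "x \<in> {0..1}" by simp
      then have "good x" using good_iff elim(1) leb01.l2_imp_integrable by blast
      then have "f s x = f0 s x" for s by (simp add: f_def)
      then show ?case using has_primD[OF Vprim[OF x] t] V0 by (simp add: H_def)
    qed
    then have "prim (V t) \<theta> = prim (\<lambda>x. v0 x + prim (\<lambda>s. H s x) t) \<theta>"
      using Vi[OF t] mHt l2_measurable[OF v0] by (intro prim_cong_AE) auto
    also have "\<dots> = prim v0 \<theta> + prim (\<lambda>x. prim (\<lambda>s. H s x) t) \<theta>"
      by (rule prim_add[OF leb01.l2_imp_integrable[OF v0] Hti])
    also have "prim (\<lambda>x. prim (\<lambda>s. H s x) t) \<theta> = prim (\<lambda>s. prim (H s) \<theta>) t"
      by (rule prim_swap[OF Hi, symmetric])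
    finally show ?thesis .
  qed
  have pHi: "integrable leb01 (\<lambda>s. prim (H s) \<theta>)" if \<theta>: "\<theta> \<in> {0..1}" for \<theta>
  proof (rule Bochner_Integration.integrable_bound)
    have Hn: "integrable leb01sq (\<lambda>p. norm (case_prod H p))" using integrable_norm[OF Hi] .
    show "integrable leb01 (\<lambda>s. \<integral>x. norm (H s x) \<partial>leb01)" using leb01_pair.integrable_fst'[OF Hn] by simp
    show "(\<lambda>s. prim (H s) \<theta>) \<in> borel_measurable leb01"
      using section_measurable(2)[OF measurable_prim_space \<theta>, of H] Hi by auto
    show "AE s in leb01. norm (prim (H s) \<theta>) \<le> norm (\<integral>x. norm (H s x) \<partial>leb01)"
      using leb01_pair.AE_integrable_fst'[OF Hi] by eventually_elim (use norm_prim_le_integral in force)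
  qed
  define X where "X \<theta> s = (B (E s \<theta>) (u s \<theta>) + F s \<theta>) - (B (E s 0) (u s 0) + F s 0) - prim (H s) \<theta>" for \<theta> s
  have Xi: "integrable leb01 (X \<theta>)" if \<theta>: "\<theta> \<in> {0..1}" for \<theta>
    unfolding X_def using has_prim_integrable[OF u[OF \<theta>]] has_prim_integrable[OF u[of 0]] pHi[OF \<theta>] by simp
  have ZX: "Z t \<theta> = prim (X \<theta>) t" if t: "t \<in> {0..1}" and \<theta>: "\<theta> \<in> {0..1}" for t \<theta>
  proof -
    have i: "integrable leb01 (\<lambda>s. B (E s \<theta>) (u s \<theta>) + F s \<theta>)" "integrable leb01 (\<lambda>s. B (E s 0) (u s 0) + F s 0)"
      using has_prim_integrable[OF u[OF \<theta>]] has_prim_integrable[OF u[of 0]] by auto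
    have "prim (X \<theta>) t = prim (\<lambda>s. B (E s \<theta>) (u s \<theta>) + F s \<theta>) t - prim (\<lambda>s. B (E s 0) (u s 0) + F s 0) t
        - prim (\<lambda>s. prim (H s) \<theta>) t"
      unfolding X_def using i pHi[OF \<theta>] by (simp add: prim_diff)
    moreover have "u t \<theta> = u 0 \<theta> + prim (\<lambda>s. B (E s \<theta>) (u s \<theta>) + F s \<theta>) t" by (rule has_primD[OF u[OF \<theta>] t])
    moreover have "u t 0 = u 0 0 + prim (\<lambda>s. B (E s 0) (u s 0) + F s 0) t" by (rule has_primD[OF u t]) simp
    moreover have "u 0 \<theta> = u 0 0 + prim v0 \<theta>" by (rule has_primD[OF u0 \<theta>])
    ultimately show ?thesis unfolding Z_def uu_def VH[OF t] by simp
  qed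
  \<comment> \<open>The kernel of the Volterra inequality for \<open>Z\<close>: \<open>g\<close>
    bounds the pointwise term \<open>B (E s \<theta>) (Z s \<theta>)\<close>, and the space integral
    of |E'| bounds the nonlocal term.\<close>
  define a where "a s = g s + (\<integral>x. norm (E' s x) \<partial>leb01)" for s
  have ai: "integrable leb01 a"
    unfolding a_def using gi leb01.l2_imp_integrable[OF l2_integral_section[OF E(2)]] by simp
  have a0: "0 \<le> a s" for s unfolding a_def using g(2)[of s] by simp
  define w where "w t = exp (2 * prim a t)" for t
  have w1: "1 \<le> w t" for t unfolding w_def using prim_nonneg[of a t] a0 by auto
  have wi: "integrable leb01 (\<lambda>s. a s * w s)"
    unfolding w_def by (rule prim_exp_weight(1)[OF ai, of 0]) simp
  have wp: "t \<in> {0..1} \<Longrightarrow> prim (\<lambda>s. a s * w s) t \<le> w t / 2" for t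
    unfolding w_def by (rule prim_exp_weight(2)[OF ai])
  \<comment> \<open>Put u = uu + Z in the source. The product rule for \<open>B (E s) (uu s)\<close>
    absorbs every term without \<open>Z\<close>, so the time derivative of \<open>Z\<close> is
    linear in \<open>Z\<close> itself.\<close>
  have Xeq: "AE s in leb01. \<forall>\<theta>\<in>{0..1}. X \<theta> s = B (E s \<theta>) (Z s \<theta>) - prim (\<lambda>x. B (E' s x) (Z s x)) \<theta>
       \<and> integrable leb01 (\<lambda>x. B (E' s x) (Z s x))"
    using E(3) F(3) AE_space
  proof eventually_elim
    case (elim s)
    then have s: "s \<in> {0..1}" by simp
    have E'i: "integrable leb01 (E' s)" by (rule has_prim_integrable[OF elim(1)])
    have mus: "u s \<in> borel_measurable leb01" by (rule section_measurable(1)[OF mu s])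
    have cuu: "continuous_on {0..1} (uu s)" by (rule has_prim_continuous[OF uuprim[OF s]])
    have i1: "integrable leb01 (\<lambda>x. B (E' s x) (u s x))"
      by (rule integrable_bilinear_bounded[OF bounded_bilinear_axioms E'i mus ub[OF s]])
    have BE: "has_prim (\<lambda>x. B (E s x) (uu s x)) (\<lambda>x. B (E' s x) (uu s x) + B (E s x) (V s x))"
      by (rule has_prim_bilinear[OF bounded_bilinear_axioms elim(1) uuprim[OF s]])
    have mZ: "Z s \<in> borel_measurable leb01"
      unfolding Z_def using mus continuous_measurable_leb01[OF cuu] by simp
    have i2: "integrable leb01 (\<lambda>x. B (E' s x) (Z s x))"
      by (rule integrable_bilinear_bounded[OF bounded_bilinear_axioms E'i mZ Zb[OF s]])
    show ?case
    proof (intro ballI conjI i2)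
      fix \<theta> :: real assume \<theta>: "\<theta> \<in> {0..1}"
      have Heq: "H s x = (B (E' s x) (uu s x) + B (E s x) (V s x)) + (B (E' s x) (Z s x) + F' s x)" for x
        unfolding H_def f0_def Z_def by (simp add: diff_right)
      have "prim (H s) \<theta> = prim (\<lambda>x. B (E' s x) (uu s x) + B (E s x) (V s x)) \<theta> +
          (prim (\<lambda>x. B (E' s x) (Z s x)) \<theta> + prim (F' s) \<theta>)"
        unfolding Heq using has_prim_integrable[OF BE] i2 has_prim_integrable[OF elim(2)] by (simp add: prim_add)
      moreover have "B (E s \<theta>) (uu s \<theta>) = B (E s 0) (uu s 0) + prim (\<lambda>x. B (E' s x) (uu s x) + B (E s x) (V s x)) \<theta>"
        by (rule has_primD[OF BE \<theta>])
      moreover have "F s \<theta> = F s 0 + prim (F' s) \<theta>" by (rule has_primD[OF elim(2) \<theta>])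
      moreover have "uu s 0 = u s 0" by (simp add: uu_def)
      ultimately show "X \<theta> s = B (E s \<theta>) (Z s \<theta>) - prim (\<lambda>x. B (E' s x) (Z s x)) \<theta>"
        unfolding X_def Z_def diff_right by simp
    qed
  qed
  \<comment> \<open>Each use of the integral identity for \<open>Z\<close> gains a factor 1/2 in the
    weighted supremum, starting from the crude bound \<open>C0\<close>.\<close>
  have Zk: "norm (Z t \<theta>) \<le> C0 * (1/2) ^ k * w t" if "t \<in> {0..1}" "\<theta> \<in> {0..1}" for k t \<theta>
    using that
  proof (induction k arbitrary: t \<theta>)
    case 0
    have "norm (Z t \<theta>) \<le> C0 * 1" using Zb[OF 0] by simp
    also have "\<dots> \<le> C0 * w t" by (rule mult_left_mono[OF w1 C00])
    finally show ?case by simp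
  next
    case (Suc k)
    let ?M = "C0 * (1/2) ^ k"
    have "norm (Z t \<theta>) \<le> prim (\<lambda>s. norm (X \<theta> s)) t"
      unfolding ZX[OF Suc.prems] by (rule norm_prim_le[OF Xi[OF Suc.prems(2)]])
    also have "\<dots> \<le> prim (\<lambda>s. ?M * (a s * w s)) t"
    proof (rule prim_mono_AE)
      show "AE s in leb01. norm (X \<theta> s) \<le> ?M * (a s * w s)"
        using Xeq g(3) E(3) AE_space
      proof eventually_elim
        case (elim s)
        then have s: "s \<in> {0..1}" by simp
        note IH = Suc.IH[OF s]
        have Mw: "0 \<le> ?M * w s" using C00 w1[of s] by simp
        have "norm (B (E s \<theta>) (Z s \<theta>)) \<le> norm (E s \<theta>) * norm (Z s \<theta>)" by (rule norm_B)
        also have "\<dots> \<le> g s * (?M * w s)"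
          using elim(2) Suc.prems(2) IH[OF Suc.prems(2)] g(2)[of s] by (intro mult_mono) auto
        finally have 1: "norm (B (E s \<theta>) (Z s \<theta>)) \<le> g s * (?M * w s)" .
        have i2: "integrable leb01 (\<lambda>x. B (E' s x) (Z s x))" using elim(1) Suc.prems(2) by blast
        have "norm (prim (\<lambda>x. B (E' s x) (Z s x)) \<theta>) \<le> (\<integral>x. norm (B (E' s x) (Z s x)) \<partial>leb01)"
          by (rule norm_prim_le_integral[OF i2])
        also have "\<dots> \<le> (\<integral>x. norm (E' s x) * (?M * w s) \<partial>leb01)"
        proof (rule integral_mono)
          show "norm (B (E' s x) (Z s x)) \<le> norm (E' s x) * (?M * w s)" if "x \<in> space leb01" for x
            using norm_B[of "E' s x" "Z s x"] mult_left_mono[OF IH, of x "norm (E' s x)"] that by auto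
        qed (use i2 has_prim_integrable[OF elim(3)] in auto)
        also have "\<dots> = (\<integral>x. norm (E' s x) \<partial>leb01) * (?M * w s)" by simp
        finally have 2: "norm (prim (\<lambda>x. B (E' s x) (Z s x)) \<theta>) \<le> (\<integral>x. norm (E' s x) \<partial>leb01) * (?M * w s)" .
        have "X \<theta> s = B (E s \<theta>) (Z s \<theta>) - prim (\<lambda>x. B (E' s x) (Z s x)) \<theta>" using elim(1) Suc.prems(2) by blast
        then have "norm (X \<theta> s) \<le> g s * (?M * w s) + (\<integral>x. norm (E' s x) \<partial>leb01) * (?M * w s)"
          using 1 2 norm_triangle_ineq4[of "B (E s \<theta>) (Z s \<theta>)" "prim (\<lambda>x. B (E' s x) (Z s x)) \<theta>"] by simp
        also have "\<dots> = ?M * (a s * w s)" by (simp add: a_def algebra_simps)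
        finally show ?case .
      qed
    qed (use Xi[OF Suc.prems(2)] wi in auto)
    also have "\<dots> \<le> ?M * (w t / 2)"
      unfolding prim_cmult using wp[OF Suc.prems(1)] C00 by (intro mult_left_mono) auto
    finally show ?case by simp
  qed
  have Z0: "Z t \<theta> = 0" if "t \<in> {0..1}" "\<theta> \<in> {0..1}" for t \<theta>
  proof -
    have "(\<lambda>k. C0 * (1/2) ^ k * w t) \<longlonglongrightarrow> C0 * 0 * w t"
      by (intro tendsto_intros LIMSEQ_power_zero) simp
    then have "norm (Z t \<theta>) \<le> 0"
      using LIMSEQ_le_const[of "\<lambda>k. C0 * (1/2) ^ k * w t" 0 "norm (Z t \<theta>)"] Zk[OF that] by auto
    then show ?thesis by simp
  qed
  have "has_prim (u t) (V t)" if t: "t \<in> {0..1}" for t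
  proof -
    have "has_prim (u t) (V t) \<longleftrightarrow> has_prim (uu t) (V t)"
      by (rule has_prim_cong) (use Z0[OF t] in \<open>auto simp: Z_def\<close>)
    then show ?thesis using uuprim[OF t] by blast
  qed
  moreover have "has_prim (\<lambda>t. V t \<theta>) (\<lambda>s. B (E s \<theta>) (V s \<theta>) + f0 s \<theta>)"
    if "\<theta> \<in> {0..1}" "integrable leb01 (\<lambda>s. f0 s \<theta>)" for \<theta>
    using Vprim[OF that(1)] good_iff[OF that(1)] that(2) by (simp add: f_def)
  ultimately show ?thesis
    using that[of V C] domV V0 Vb C0 unfolding f0_def by blast
qed

text \<open>Induction on the order. The derivative \<open>V\<close> solves the same equation with
  source B(E', u) + F', which has one order less. The induction hypothesis is used twice: for
  \<open>u\<close>, to place this source in \<open>sobA m\<close>, and then for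
  \<open>V\<close>.\<close>

theorem evolution_regularity:
  assumes "sobA m E" "sobA m F" and "case_prod u \<in> borel_measurable leb01sq"
    and "\<And>t \<theta>. t \<in> {0..1} \<Longrightarrow> \<theta> \<in> {0..1} \<Longrightarrow> norm (u t \<theta>) \<le> Cu"
    and "\<And>\<theta>. \<theta> \<in> {0..1} \<Longrightarrow> has_prim (\<lambda>t. u t \<theta>) (\<lambda>s. B (E s \<theta>) (u s \<theta>) + F s \<theta>)"
    and "ssob m (u 0)"
  shows "sobB m u"
  using assms
proof (induction m arbitrary: F u Cu)
  case 0
  have "l2 leb01 (\<lambda>_. Cu)" by (rule l2_const) (rule leb01.finite_measure_axioms)
  then show ?case using 0 unfolding psob.simps dom_l2_def by blast
next
  case (Suc m)
  obtain E' where E': "sobA m E'" "AE t in leb01. has_prim (E t) (E' t)" "l2 leb01sq (case_prod E)"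
    using Suc.prems(1) by (rule psob_SucE)
  obtain F' where F': "sobA m F'" "AE t in leb01. has_prim (F t) (F' t)" "l2 leb01sq (case_prod F)"
    using Suc.prems(2) by (rule psob_SucE)
  obtain v0 where v0: "ssob m v0" "has_prim (u 0) v0" using Suc.prems(6) by auto
  have l2v0: "l2 leb01 v0" by (rule ssob_l2[OF v0(1)])
  have um: "sobB m u"
    if "ssob m (u 0)"
    using Suc.IH[OF psob_SucD[OF Suc.prems(1)] psob_SucD[OF Suc.prems(2)] Suc.prems(3,4,5) that] .
  obtain V C where V: "dom_l2 V" "\<And>t. t \<in> {0..1} \<Longrightarrow> has_prim (u t) (V t)" "\<And>\<theta>. V 0 \<theta> = v0 \<theta>"
    "\<And>t \<theta>. t \<in> {0..1} \<Longrightarrow> \<theta> \<in> {0..1} \<Longrightarrow>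
       norm (V t \<theta>) \<le> C * (norm (v0 \<theta>) + (\<integral>s. norm (B (E' s \<theta>) (u s \<theta>) + F' s \<theta>) \<partial>leb01))"
    "0 \<le> C"
    "\<And>\<theta>. \<theta> \<in> {0..1} \<Longrightarrow> integrable leb01 (\<lambda>s. B (E' s \<theta>) (u s \<theta>) + F' s \<theta>) \<Longrightarrow>
       has_prim (\<lambda>t. V t \<theta>) (\<lambda>s. B (E s \<theta>) (V s \<theta>) + (B (E' s \<theta>) (u s \<theta>) + F' s \<theta>))"
    using evolution_derivative[OF E'(3) psob_imp_base[OF E'(1)] E'(2) F'(3) psob_imp_base[OF F'(1)] F'(2)
        Suc.prems(3,4,5) v0(2) l2v0] by blast
  have "sobB m V"
  proof (cases m)
    \<comment> \<open>Here the new source is only square integrable on the square, so the equation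
      for \<open>V\<close> may fail at exceptional \<theta>; the domination of \<open>V\<close> is
      all that is claimed.\<close>
    case 0
    then show ?thesis using V(1) by simp
  next
    case m: (Suc k)
    have "ssob m (u 0)" by (rule ssob_SucD[OF Suc.prems(6)])
    have fhat: "sobA m (\<lambda>s \<theta>. B (E' s \<theta>) (u s \<theta>) + F' s \<theta>)"
      using sobA_add[OF sobA_bilinear_Suc[OF bounded_bilinear_axioms E'(1)[unfolded m] um[OF \<open>ssob m (u 0)\<close>, unfolded m]]
          F'(1)[unfolded m]] unfolding m .
    obtain f' where fhat': "sobA k f'" "AE s in leb01. has_prim (\<lambda>\<theta>. B (E' s \<theta>) (u s \<theta>) + F' s \<theta>) (f' s)"
        "l2 leb01sq (\<lambda>(s, \<theta>). B (E' s \<theta>) (u s \<theta>) + F' s \<theta>)"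
      using fhat[unfolded m] by (rule psob_SucE)
    note f' = fhat'(3) psob_imp_base[OF fhat'(1)] fhat'(2)
    obtain g where g: "l2 leb01 g"
      "AE s in leb01. \<forall>\<theta>\<in>{0..1}. norm (B (E' s \<theta>) (u s \<theta>) + F' s \<theta>) \<le> g s"
      by (rule l2_sup_bound[OF f']) blast
    have fi: "integrable leb01 (\<lambda>s. B (E' s \<theta>) (u s \<theta>) + F' s \<theta>)" if "\<theta> \<in> {0..1}" for \<theta>
      by (rule integrable_time_section[OF f' that])
    have "continuous_on {0..1} v0" using v0(1) m by (auto intro: has_prim_continuous)
    then obtain C1 where C1: "\<And>\<theta>. \<theta> \<in> {0..1} \<Longrightarrow> norm (v0 \<theta>) \<le> C1" using bounded_on_unit by blast
    have Vb: "norm (V t \<theta>) \<le> C * (C1 + integral\<^sup>L leb01 g)" if "t \<in> {0..1}" "\<theta> \<in> {0..1}" for t \<theta>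
    proof -
      have "AE s in leb01. norm (B (E' s \<theta>) (u s \<theta>) + F' s \<theta>) \<le> g s"
        using g(2) by eventually_elim (use that in blast)
      then have "(\<integral>s. norm (B (E' s \<theta>) (u s \<theta>) + F' s \<theta>) \<partial>leb01) \<le> integral\<^sup>L leb01 g"
        using fi[OF that(2)] leb01.l2_imp_integrable[OF g(1)] by (intro integral_mono_AE) auto
      then have "C * (norm (v0 \<theta>) + (\<integral>s. norm (B (E' s \<theta>) (u s \<theta>) + F' s \<theta>) \<partial>leb01)) \<le> C * (C1 + integral\<^sup>L leb01 g)"
        using C1[OF that(2)] V(5) by (intro mult_left_mono add_mono) auto
      then show ?thesis using V(4)[OF that] by linarith
    qed
    have "V 0 = v0" using V(3) by auto
    then show ?thesis
      using V(1) V(6)[OF _ fi] v0(1) psob_SucD[OF Suc.prems(1)]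
      by (intro Suc.IH[OF _ fhat _ Vb]) (auto simp: dom_l2_def simp del: psob.simps)
  qed
  moreover have "dom_l2 u"
  proof -
    have "l2 leb01 (\<lambda>_. Cu)" by (rule l2_const) (rule leb01.finite_measure_axioms)
    then show ?thesis using Suc.prems(3,4) unfolding dom_l2_def by blast
  qed
  ultimately show ?case
    using V(2) by (auto simp: eventually_principal)
qed

end

section \<open>Regularity of paths in arc length coordinates\<close>

text \<open>The pair \<open>(q, |q|)\<close> solves a linear equation with coefficient \<open>E 1\<close>.\<close>
definition lorentz :: "'a::euclidean_space \<Rightarrow> 'a \<times> real \<Rightarrow> 'a \<times> real" where
  "lorentz e u = (snd u *\<^sub>R e, e \<bullet> fst u)"

text \<open>The matrix of \<open>lorentz e\<close> has zero diagonal blocks and off-diagonal blocks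
  \<open>e\<close> and its transpose, an infinitesimal Lorentz boost, whose operator norm is |e|.
  This gives the constant 1 that \<open>contractive_bilinear\<close> asks for.\<close>

lemma norm_lorentz: "norm (lorentz e u) \<le> norm e * norm u"
proof -
  have "(e \<bullet> fst u)\<^sup>2 \<le> (norm e * norm (fst u))\<^sup>2"
    using Cauchy_Schwarz_ineq2[of e "fst u"] by (metis abs_ge_zero power2_abs power_mono)
  then have "(norm (snd u *\<^sub>R e))\<^sup>2 + (norm (e \<bullet> fst u))\<^sup>2 \<le> (norm e)\<^sup>2 * ((norm (fst u))\<^sup>2 + (norm (snd u))\<^sup>2)"
    by (simp add: power_mult_distrib algebra_simps)
  then have "norm (lorentz e u) \<le> sqrt ((norm e)\<^sup>2 * ((norm (fst u))\<^sup>2 + (norm (snd u))\<^sup>2))"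
    unfolding lorentz_def norm_Pair by (rule real_sqrt_le_mono)
  also have "\<dots> = norm e * norm u"
    by (simp add: real_sqrt_mult norm_prod_def)
  finally show ?thesis .
qed

lemma bounded_bilinear_lorentz: "bounded_bilinear lorentz"
proof
  show "\<exists>K. \<forall>e u. norm (lorentz e u) \<le> norm e * norm u * K"
    using norm_lorentz by (intro exI[of _ 1]) auto
qed (auto simp: lorentz_def algebra_simps inner_simps)

interpretation lorentz: contractive_bilinear lorentz
  by (intro contractive_bilinear.intro contractive_bilinear_axioms.intro bounded_bilinear_lorentz norm_lorentz)

lemma has_prim_Pair:
  assumes "has_prim f g" "has_prim f' g'"
  shows "has_prim (\<lambda>x. (f x, f' x)) (\<lambda>x. (g x, g' x))"
proof -
  have 1: "has_prim (\<lambda>x. (f x, 0)) (\<lambda>x. (g x, 0))"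
    by (rule has_prim_linear[OF _ assms(1)]) (intro bounded_linear_Pair bounded_linear_ident bounded_linear_zero)
  have 2: "has_prim (\<lambda>x. (0, f' x)) (\<lambda>x. (0, g' x))"
    by (rule has_prim_linear[OF _ assms(2)]) (intro bounded_linear_Pair bounded_linear_ident bounded_linear_zero)
  from has_prim_add[OF 1 2] show ?thesis by simp
qed

lemma has_prim_norm:
  fixes q q' :: "real \<Rightarrow> 'a::euclidean_space"
  assumes q: "has_prim q q'" and nz: "\<And>t. t \<in> {0..1} \<Longrightarrow> q t \<noteq> 0"
  shows "has_prim (\<lambda>t. norm (q t)) (\<lambda>s. inverse (norm (q s)) * (q s \<bullet> q' s))"
proof -
  have p: "has_prim (\<lambda>t. q t \<bullet> q t) (\<lambda>s. q' s \<bullet> q s + q s \<bullet> q' s)"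
    by (rule has_prim_bilinear[OF bounded_bilinear_inner q q])
  have pos: "0 < x" if "x \<in> (\<lambda>t. q t \<bullet> q t) ` {0..1}" for x
    using that nz by auto
  have der: "(sqrt has_real_derivative inverse (sqrt x) / 2) (at x)" if "x \<in> (\<lambda>t. q t \<bullet> q t) ` {0..1}" for x
    by (rule DERIV_real_sqrt) (rule pos[OF that])
  have cont: "continuous_on ((\<lambda>t. q t \<bullet> q t) ` {0..1}) (\<lambda>x. inverse (sqrt x) / 2)"
    using pos by (intro continuous_intros) force+
  have "has_prim (\<lambda>t. sqrt (q t \<bullet> q t)) (\<lambda>s. inverse (sqrt (q s \<bullet> q s)) / 2 * (q' s \<bullet> q s + q s \<bullet> q' s))"
    by (rule has_prim_chain[OF p der cont])
  then show ?thesis by (simp add: norm_eq_sqrt_inner inner_commute)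
qed

lemma ssob_Pair: "ssob k f \<Longrightarrow> ssob k g \<Longrightarrow> ssob k (\<lambda>x. (f x, g x))"
proof (induction k arbitrary: f g)
  case 0
  have 1: "l2 leb01 (\<lambda>x. (f x, 0))"
    using 0(1) by (simp add: l2_def borel_measurable_Pair)
  have 2: "l2 leb01 (\<lambda>x. (0, g x))"
    using 0(2) by (simp add: l2_def borel_measurable_Pair)
  from l2_add[OF 1 2] show ?case by simp
next
  case (Suc k)
  then show ?case by (metis ssob.simps(2) has_prim_Pair)
qed

lemma msob_imp_ssob: "msob k f \<Longrightarrow> AE t in leb01. ssob k (f t)"
proof (induction k arbitrary: f)
  case (Suc k)
  obtain g where g: "msob k g" "AE t in leb01. has_prim (f t) (g t)" using Suc.prems by (rule psob_SucE)
  show ?case using Suc.IH[OF g(1)] g(2) by eventually_elim auto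
qed (simp add: ae_l2_def)

lemma ssob_imp_msob: "ssob k f \<Longrightarrow> msob k (\<lambda>t. f)"
proof (induction k arbitrary: f)
  case 0
  then show ?case using measurable_snd_leb01sq[of f] by (simp add: ae_l2_def l2_def case_prod_beta')
next
  case (Suc k)
  have "ae_l2 (\<lambda>t. f)"
    using ssob_l2[OF Suc.prems] measurable_snd_leb01sq[of f] by (simp add: ae_l2_def l2_def case_prod_beta')
  moreover obtain g where "ssob k g" "has_prim f g" using Suc.prems by auto
  ultimately show ?case using Suc.IH[of g] by auto
qed

text \<open>Obtained from the time dependent statement by viewing \<open>q\<close> as constant in
  time.\<close>

lemma ssob_norm:
  assumes "ssob (Suc k) q" "\<And>\<theta>. \<theta> \<in> {0..1} \<Longrightarrow> q \<theta> \<noteq> 0"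
  shows "ssob (Suc k) (\<lambda>\<theta>. norm (q \<theta>))"
  using msob_imp_ssob[OF msob_norm[OF ssob_imp_msob[OF assms(1)]]] assms(2) by simp

lemma hn_chain_imp_ssob: "hn_chain n f D \<Longrightarrow> 1 \<le> n \<Longrightarrow> k \<le> n \<Longrightarrow> ssob (n - k) (D k)"
proof (induction "n - k" arbitrary: k)
  case 0
  then show ?case using hn_chain_l2[of n f D k] by simp
next
  case (Suc d)
  then have "ssob d (D (Suc k))" using Suc.hyps(1)[of "Suc k"] by (metis Suc_diff_Suc Suc_leI diff_Suc_1 zero_less_Suc zero_less_diff)
  moreover have "has_prim (D k) (D (Suc k))" using hn_chain_rel[OF Suc.prems(1), of k] Suc.hyps(2) by simp
  ultimately show ?case unfolding Suc.hyps(2)[symmetric] by auto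
qed

lemma ssob_imp_hn_chain: "ssob n f \<Longrightarrow> \<exists>D. hn_chain n f D \<and> D 0 = f"
proof (induction n arbitrary: f)
  case 0
  then show ?case by (intro exI[of _ "\<lambda>_. f"]) (simp add: hn_chain_iff l2_def)
next
  case (Suc n)
  obtain g where "ssob n g" "has_prim f g" using Suc.prems by auto
  with Suc.IH[of g] obtain D where g: "has_prim f g" "hn_chain n g D" "D 0 = g" by auto
  have "hn_chain (Suc n) f (case_nat f D)"
    unfolding hn_chain_iff
  proof (intro conjI allI impI ballI)
    fix k assume "k < Suc n"
    then show "has_prim (case k of 0 \<Rightarrow> f | Suc j \<Rightarrow> D j) (case Suc k of 0 \<Rightarrow> f | Suc j \<Rightarrow> D j)"
      using g by (cases k) (auto simp: hn_chain_iff)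
  qed (use g(2) in \<open>auto simp: hn_chain_iff\<close>)
  then show ?case by (intro exI[of _ "case_nat f D"]) simp
qed

lemma sobA_zero: "sobA k (\<lambda>t \<theta>. 0)"
proof (induction k)
  case (Suc k)
  have "has_prim (\<lambda>_. 0) (\<lambda>_. 0 :: 'a)" by (rule has_primI) (auto simp: prim_def)
  then show ?case using Suc by (auto simp: case_prod_beta')
qed (simp add: case_prod_beta')

text \<open>The two regularities feed each other. With k derivatives, u = (q, |q|) gives up to k + 1
  derivatives of each \<open>E i\<close>, since the derivative of \<open>E i\<close> is |q| times
  \<open>E (Suc i)\<close>. In turn k + 1 derivatives of \<open>E 1\<close> and of the initial value
  give k + 1 for u. The start, k = 0, is the uniform bound on \<open>q\<close>.\<close>

theorem arc_regularity:
  fixes q :: "real \<Rightarrow> real \<Rightarrow> 'a::euclidean_space"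
  assumes mq: "case_prod q \<in> borel_measurable leb01sq"
    and qb: "\<And>t \<theta>. t \<in> {0..1} \<Longrightarrow> \<theta> \<in> {0..1} \<Longrightarrow> norm (q t \<theta>) \<le> C"
    and nz: "\<And>t \<theta>. t \<in> {0..1} \<Longrightarrow> \<theta> \<in> {0..1} \<Longrightarrow> q t \<theta> \<noteq> 0"
    and evo: "\<And>\<theta>. \<theta> \<in> {0..1} \<Longrightarrow> has_prim (\<lambda>t. q t \<theta>) (\<lambda>t. norm (q t \<theta>) *\<^sub>R E 1 t \<theta>)"
    and El2: "\<And>i. i \<le> Suc m \<Longrightarrow> l2 leb01sq (case_prod (E i))"
    and rel: "\<And>i. i < Suc m \<Longrightarrow> AE t in leb01. has_prim (E i t) (\<lambda>x. norm (q t x) *\<^sub>R E (Suc i) t x)"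
    and q0: "ssob m (q 0)" "ssob m (\<lambda>\<theta>. norm (q 0 \<theta>))"
  shows "sobA (Suc m) (E 0)" and "t \<in> {0..1} \<Longrightarrow> ssob m (q t)"
proof -
  define u where "u = (\<lambda>t \<theta>. (q t \<theta>, norm (q t \<theta>)))"
  have mu: "case_prod u \<in> borel_measurable leb01sq"
    using borel_measurable_Pair[OF mq measurable_compose[OF mq borel_measurable_norm]]
    by (simp add: u_def case_prod_beta')
  have ub: "norm (u t \<theta>) \<le> C + C" if "t \<in> {0..1}" "\<theta> \<in> {0..1}" for t \<theta>
    using norm_Pair_le[of "q t \<theta>" "norm (q t \<theta>)"] qb[OF that] by (simp add: u_def)
  have uprim: "has_prim (\<lambda>t. u t \<theta>) (\<lambda>s. lorentz (E 1 s \<theta>) (u s \<theta>) + 0)" if \<theta>: "\<theta> \<in> {0..1}" for \<theta>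
  proof -
    have "has_prim (\<lambda>t. u t \<theta>) (\<lambda>t. (norm (q t \<theta>) *\<^sub>R E 1 t \<theta>, inverse (norm (q t \<theta>)) * (q t \<theta> \<bullet> (norm (q t \<theta>) *\<^sub>R E 1 t \<theta>))))"
      unfolding u_def by (intro has_prim_Pair evo[OF \<theta>] has_prim_norm) (use nz \<theta> in auto)
    moreover have "has_prim (\<lambda>t. u t \<theta>) (\<lambda>s. lorentz (E 1 s \<theta>) (u s \<theta>) + 0) \<longleftrightarrow>
       has_prim (\<lambda>t. u t \<theta>) (\<lambda>t. (norm (q t \<theta>) *\<^sub>R E 1 t \<theta>, inverse (norm (q t \<theta>)) * (q t \<theta> \<bullet> (norm (q t \<theta>) *\<^sub>R E 1 t \<theta>))))"
      by (rule has_prim_cong) (use nz[OF _ \<theta>] in \<open>auto simp: lorentz_def u_def inner_commute\<close>)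
    ultimately show ?thesis by blast
  qed
  have \<rho>: "sobB k (\<lambda>t \<theta>. norm (q t \<theta>))" if "sobB k u" for k
  proof -
    have "sobB k (\<lambda>t \<theta>. snd (u t \<theta>))"
    proof (rule psob_linear[OF bounded_linear_snd that])
      fix f :: "real \<Rightarrow> real \<Rightarrow> 'a \<times> real" assume f: "dom_l2 f"
      then obtain b where b: "l2 leb01 b" "\<forall>t\<in>{0..1}. \<forall>\<theta>\<in>{0..1}. norm (f t \<theta>) \<le> b \<theta>"
        unfolding dom_l2_def by blast
      have "norm (snd (f t \<theta>)) \<le> b \<theta>" if "t \<in> {0..1}" "\<theta> \<in> {0..1}" for t \<theta>
        using b(2) that norm_snd_le[of "snd (f t \<theta>)" "fst (f t \<theta>)"] by fastforce
      moreover have "(\<lambda>(t, \<theta>). snd (f t \<theta>)) \<in> borel_measurable leb01sq"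
      proof -
        have mf: "case_prod f \<in> leb01sq \<rightarrow>\<^sub>M borel \<Otimes>\<^sub>M borel"
          using f by (simp add: dom_l2_def borel_prod)
        from measurable_compose[OF mf measurable_snd] show ?thesis by (simp add: case_prod_beta')
      qed
      ultimately show "dom_l2 (\<lambda>t \<theta>. snd (f t \<theta>))" unfolding dom_l2_def using b(1) by blast
    qed
    then show ?thesis by (simp add: u_def)
  qed
  have EA: "sobA j (E i)" if "sobB k u" "j \<le> Suc k" "i + j \<le> Suc m" for i j k
    using that(2,3)
  proof (induction j arbitrary: i)
    case 0
    then show ?case using El2 by simp
  next
    case (Suc j)
    have "sobA j (E (Suc i))" by (rule Suc.IH) (use Suc.prems in auto)
    have "sobA j (\<lambda>t x. norm (q t x) *\<^sub>R E (Suc i) t x)"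
    proof (cases j)
      case 0
      have "AE t in leb01. \<forall>\<theta>\<in>{0..1}. norm (norm (q t \<theta>)) \<le> C" using qb by (intro AE_I2) auto
      moreover have "(\<lambda>(t, \<theta>). norm (q t \<theta>)) \<in> borel_measurable leb01sq"
        using measurable_compose[OF mq borel_measurable_norm] by (simp add: case_prod_beta')
      ultimately show ?thesis
        using l2sq_bilinear[OF bounded_bilinear.flip[OF bounded_bilinear_scaleR], of "E (Suc i)" "\<lambda>t x. norm (q t x)" C] El2[of "Suc i"] Suc.prems 0
        by simp
    next
      case j: (Suc j')
      have "sobB (Suc j') (\<lambda>t \<theta>. norm (q t \<theta>))"
        by (rule \<rho>, rule psob_antimono[OF that(1)]) (use j Suc.prems in auto)
      from sobA_bilinear_Suc[OF bounded_bilinear.flip[OF bounded_bilinear_scaleR] \<open>sobA j (E (Suc i))\<close>[unfolded j] this]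
      show ?thesis unfolding j .
    qed
    moreover have "AE t in leb01. has_prim (E i t) (\<lambda>x. norm (q t x) *\<^sub>R E (Suc i) t x)"
      using rel[of i] Suc.prems by simp
    moreover have "l2 leb01sq (case_prod (E i))" using El2 Suc.prems by simp
    ultimately show ?case by (intro psob_SucI)
  qed
  have uB: "sobB k u" if "k \<le> m" for k
    using that
  proof (induction k)
    case 0
    have "l2 leb01 (\<lambda>_. C + C)" by (rule l2_const) (rule leb01.finite_measure_axioms)
    then show ?case using mu ub unfolding psob.simps dom_l2_def by blast
  next
    case (Suc k)
    have "sobA (Suc k) (E 1)" by (rule EA[of k]) (use Suc in auto)
    moreover have "ssob (Suc k) (u 0)"
    proof -
      have "ssob j f" if "ssob m f" "j \<le> m" for j and f :: "real \<Rightarrow> 'a \<times> real"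
        using that by (induction m) (use ssob_SucD in \<open>auto simp: le_Suc_eq simp del: ssob.simps(2)\<close>)
      then show ?thesis using ssob_Pair[OF q0] Suc.prems unfolding u_def by blast
    qed
    ultimately show ?case
      by (intro lorentz.evolution_regularity[OF _ sobA_zero mu ub uprim])
  qed
  show "sobA (Suc m) (E 0)" by (rule EA[OF uB[of m]]) auto
  show "ssob m (q t)" if t: "t \<in> {0..1}"
  proof -
    have "ssob m (u t)" by (rule sobB_imp_ssob[OF uB t]) simp
    moreover have "ssob m (\<lambda>x. fst (f x))" if "ssob m f" for f :: "real \<Rightarrow> 'a \<times> real"
      using that
    proof (induction m arbitrary: f)
      case 0
      have "f \<in> leb01 \<rightarrow>\<^sub>M borel \<Otimes>\<^sub>M borel" using 0 by (simp add: l2_def borel_prod)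
      from measurable_compose[OF this measurable_fst] have "(\<lambda>x. fst (f x)) \<in> borel_measurable leb01" .
      moreover have "norm (fst p) \<le> 1 * norm p" for p :: "'a \<times> real"
        using norm_fst_le[of "fst p" "snd p"] by simp
      ultimately have "l2 leb01 (\<lambda>x. fst (f x))"
        by (intro l2_bound[OF 0[unfolded ssob.simps], where C=1] AE_I2)
      then show ?case by simp
    next
      case (Suc m)
      then show ?case by (metis ssob.simps(2) has_prim_linear[OF bounded_linear_fst])
    qed
    ultimately have "ssob m (\<lambda>x. fst (u t x))" by blast
    then show ?thesis by (simp add: u_def)
  qed
qed

section \<open>A priori estimates\<close>

lemma integrable_of_nn_integral_le:
  fixes f :: "'p \<Rightarrow> real"
  assumes "f \<in> borel_measurable M" "\<And>x. 0 \<le> f x" "(\<integral>\<^sup>+x. ennreal (f x) \<partial>M) \<le> ennreal r" "0 \<le> r"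
  shows "integrable M f" "integral\<^sup>L M f \<le> r"
proof -
  show i: "integrable M f"
    using assms by (intro integrableI_nonneg) (auto simp: top.not_eq_extremum intro: le_less_trans)
  have "ennreal (integral\<^sup>L M f) \<le> ennreal r"
    using nn_integral_eq_integral[OF i] assms by simp
  then show "integral\<^sup>L M f \<le> r" using assms(4) by simp
qed

lemma young: "0 < s \<Longrightarrow> y \<le> s / 2 + y\<^sup>2 / (2 * s)" for y s :: real
proof -
  assume s: "0 < s"
  have "0 \<le> (y - s)\<^sup>2 / (2 * s)" using s by simp
  also have "(y - s)\<^sup>2 / (2 * s) = s / 2 + y\<^sup>2 / (2 * s) - y"
    using s by (simp add: field_simps power2_eq_square)
  finally show ?thesis by simp
qed

text \<open>A scale invariant Sobolev inequality, in a form that avoids square roots: optimising in \<open>\<eta>\<close>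
  recovers the usual one.\<close>
lemma arc_sup_bound:
  fixes e e' q :: "real \<Rightarrow> 'a::euclidean_space"
  assumes q: "continuous_on {0..1} q" and e: "has_prim e (\<lambda>x. norm (q x) *\<^sub>R e' x)"
    and X: "integrable leb01 (\<lambda>x. (norm (e x))\<^sup>2 * norm (q x))"
    and Y: "integrable leb01 (\<lambda>x. (norm (e' x))\<^sup>2 * norm (q x))"
    and \<eta>: "0 < \<eta>" and \<theta>: "\<theta> \<in> {0..1}"
  defines "l \<equiv> \<integral>x. norm (q x) \<partial>leb01"
  assumes l: "0 < l"
  shows "norm (e \<theta>) \<le> \<eta> + (inverse l * (\<integral>x. (norm (e x))\<^sup>2 * norm (q x) \<partial>leb01) +
      l * (\<integral>x. (norm (e' x))\<^sup>2 * norm (q x) \<partial>leb01)) / (2 * \<eta>)"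
proof -
  let ?X = "\<integral>x. (norm (e x))\<^sup>2 * norm (q x) \<partial>leb01" and ?Y = "\<integral>x. (norm (e' x))\<^sup>2 * norm (q x) \<partial>leb01"
  define T where "T = (\<integral>x. norm (norm (q x) *\<^sub>R e' x) \<partial>leb01)"
  have i': "integrable leb01 (\<lambda>x. norm (norm (q x) *\<^sub>R e' x))"
    using has_prim_integrable[OF e] by (rule integrable_norm)
  have qi: "integrable leb01 (\<lambda>x. norm (q x))"
    using continuous_integrable_leb01[OF q] by (rule integrable_norm)
  \<comment> \<open>Young's inequality with parameter \<open>\<eta> / l\<close>: integrating the
    constant term against |q| produces the length \<open>l\<close>, which cancels.\<close>
  have T: "T \<le> \<eta> / 2 + l * ?Y / (2 * \<eta>)"
  proof -
    have "T \<le> (\<integral>x. norm (q x) * (\<eta> / l / 2) + (norm (e' x))\<^sup>2 * norm (q x) * (l / (2 * \<eta>)) \<partial>leb01)"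
      unfolding T_def
    proof (rule integral_mono[OF i'])
      fix x
      have "norm (e' x) \<le> (\<eta> / l) / 2 + (norm (e' x))\<^sup>2 / (2 * (\<eta> / l))"
        by (rule young) (use \<eta> l in simp)
      then have "norm (q x) * norm (e' x) \<le> norm (q x) * ((\<eta> / l) / 2 + (norm (e' x))\<^sup>2 / (2 * (\<eta> / l)))"
        by (rule mult_left_mono) simp
      then show "norm (norm (q x) *\<^sub>R e' x) \<le> norm (q x) * (\<eta> / l / 2) + (norm (e' x))\<^sup>2 * norm (q x) * (l / (2 * \<eta>))"
        by (simp add: algebra_simps)
    qed (use qi Y in simp)
    also have "\<dots> = l * (\<eta> / l / 2) + ?Y * (l / (2 * \<eta>))"
      using qi Y by (simp add: l_def)
    also have "\<dots> = \<eta> / 2 + l * ?Y / (2 * \<eta>)" using l by simp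
    finally show ?thesis .
  qed
  have *: "norm (e \<theta>) \<le> norm (e x) + T" if x: "x \<in> {0..1}" for x
  proof -
    have "norm (e b - e a) \<le> T" if "a \<in> {0..1}" "b \<in> {0..1}" "a \<le> b" for a b
    proof -
      have "norm (e b - e a) \<le> prim (\<lambda>x. norm (norm (q x) *\<^sub>R e' x)) b - prim (\<lambda>x. norm (norm (q x) *\<^sub>R e' x)) a"
        by (rule has_prim_norm_diff_le[OF e that])
      also have "\<dots> \<le> T"
        unfolding T_def
        using prim_le_integral[OF i', of b] prim_nonneg[of "\<lambda>x. norm (norm (q x) *\<^sub>R e' x)" a] by simp
      finally show ?thesis .
    qed
    from this[of x \<theta>] this[of \<theta> x] have "norm (e \<theta> - e x) \<le> T"
      using x \<theta> by (cases "x \<le> \<theta>") (auto simp: norm_minus_commute[of "e x"])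
    then show ?thesis using norm_triangle_ineq[of "e x" "e \<theta> - e x"] by simp
  qed
  \<comment> \<open>The bound |e(\<theta>)| \<le> |e(x)| + T is averaged over arc length, that is
    with the weight |q| of total mass \<open>l\<close>.\<close>
  have "l * norm (e \<theta>) = (\<integral>x. norm (q x) * norm (e \<theta>) \<partial>leb01)"
    using qi by (simp add: l_def)
  also have "\<dots> \<le> (\<integral>x. norm (q x) * (\<eta> / 2 + T) + (norm (e x))\<^sup>2 * norm (q x) * (1 / (2 * \<eta>)) \<partial>leb01)"
  proof (rule integral_mono)
    fix x assume "x \<in> space leb01"
    then have "norm (e \<theta>) \<le> norm (e x) + T" using * by simp
    also have "\<dots> \<le> \<eta> / 2 + (norm (e x))\<^sup>2 / (2 * \<eta>) + T"
      using young[OF \<eta>, of "norm (e x)"] by simp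
    finally have "norm (q x) * norm (e \<theta>) \<le> norm (q x) * (\<eta> / 2 + (norm (e x))\<^sup>2 / (2 * \<eta>) + T)"
      by (rule mult_left_mono) simp
    then show "norm (q x) * norm (e \<theta>) \<le> norm (q x) * (\<eta> / 2 + T) + (norm (e x))\<^sup>2 * norm (q x) * (1 / (2 * \<eta>))"
      by (simp add: algebra_simps)
  qed (use qi X in auto)
  also have "\<dots> = l * (\<eta> / 2 + T) + ?X * (1 / (2 * \<eta>))"
    using qi X by (simp add: l_def)
  also have "\<dots> = l * (\<eta> / 2 + T + inverse l * ?X / (2 * \<eta>))"
    using l by (simp add: distrib_left)
  finally have "norm (e \<theta>) \<le> \<eta> / 2 + T + inverse l * ?X / (2 * \<eta>)"
    using l by (rule mult_left_le_imp_le)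
  also have "\<dots> \<le> \<eta> + (inverse l * ?X + l * ?Y) / (2 * \<eta>)"
    using T by (simp add: add_divide_distrib)
  finally show ?thesis .
qed

text \<open>If x is at most M times the weight \<open>w\<close>, the integral inequality improves M
  to A + M/2. The fixed point of this map is 2A, so iteration from any bound gives 2A in the
  limit.\<close>

lemma gronwall_prim:
  fixes x e :: "real \<Rightarrow> real"
  assumes x: "continuous_on {0..1} x" "\<And>t. t \<in> {0..1} \<Longrightarrow> 0 \<le> x t"
    and e: "integrable leb01 e" "\<And>t. 0 \<le> e t" and A: "0 \<le> A"
    and le: "\<And>t. t \<in> {0..1} \<Longrightarrow> x t \<le> A + prim (\<lambda>s. e s * x s) t" and t: "t \<in> {0..1}"
  shows "x t \<le> 2 * A * exp (2 * integral\<^sup>L leb01 e)"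
proof -
  define w where "w t = exp (2 * prim e t)" for t
  have w1: "1 \<le> w t" for t unfolding w_def using prim_nonneg[of e t] e by auto
  have wi: "integrable leb01 (\<lambda>s. e s * w s)"
    unfolding w_def by (rule prim_exp_weight(1)[OF e(1), of 0]) simp
  have wp: "t \<in> {0..1} \<Longrightarrow> prim (\<lambda>s. e s * w s) t \<le> w t / 2" for t
    unfolding w_def by (rule prim_exp_weight(2)[OF e(1)])
  obtain C where C: "0 \<le> C" "\<And>t. t \<in> {0..1} \<Longrightarrow> norm (x t) \<le> C" using bounded_on_unit[OF x(1)] by blast
  have ex: "integrable leb01 (\<lambda>s. e s * x s)"
    by (rule integrable_bilinear_bounded[OF bounded_bilinear_mult e(1) continuous_measurable_leb01[OF x(1)] C(2)])
  have bnd: "x t \<le> (2 * A + C * (1/2) ^ k) * w t" if "t \<in> {0..1}" for k t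
    using that
  proof (induction k arbitrary: t)
    case 0
    have "x t \<le> C * w t" using C(2)[OF 0] C(1) mult_left_mono[OF w1[of t] C(1)] by simp
    moreover have "0 \<le> 2 * A * w t" using A w1[of t] by simp
    ultimately show ?case by (simp add: algebra_simps)
  next
    case (Suc k)
    let ?M = "2 * A + C * (1/2) ^ k"
    have M: "0 \<le> ?M" using A C by simp
    have "prim (\<lambda>s. e s * x s) t \<le> prim (\<lambda>s. ?M * (e s * w s)) t"
    proof (rule prim_mono_AE[OF ex])
      show "AE s in leb01. e s * x s \<le> ?M * (e s * w s)"
      proof (rule AE_I2)
        fix s assume "s \<in> space leb01"
        then have "e s * x s \<le> e s * (?M * w s)" by (intro mult_left_mono Suc.IH e(2)) simp
        then show "e s * x s \<le> ?M * (e s * w s)" by (simp add: mult_ac)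
      qed
    qed (use wi in simp)
    also have "\<dots> \<le> ?M * (w t / 2)"
      unfolding prim_cmult by (rule mult_left_mono[OF wp[OF Suc.prems] M])
    finally have "x t \<le> A + ?M * (w t / 2)" using le[OF Suc.prems] by linarith
    moreover have "A \<le> A * w t" using mult_left_mono[OF w1[of t] A] by simp
    moreover have "?M * (w t / 2) = A * w t + C * (1/2) ^ Suc k * w t" by (simp add: algebra_simps)
    ultimately show ?case by (simp add: algebra_simps)
  qed
  have "(\<lambda>k. (2 * A + C * (1/2) ^ k) * w t) \<longlonglongrightarrow> (2 * A + C * 0) * w t"
    by (intro tendsto_intros LIMSEQ_power_zero) simp
  then have "x t \<le> 2 * A * w t"
    using LIMSEQ_le_const[of "\<lambda>k. (2 * A + C * (1/2) ^ k) * w t" _ "x t"] bnd[OF t] by auto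
  also have "\<dots> \<le> 2 * A * exp (2 * integral\<^sup>L leb01 e)"
    unfolding w_def using A prim_le_integral[OF e(1), of t] e(2) by (intro mult_left_mono) auto
  finally show ?thesis .
qed

lemma powi_lower_bound:
  fixes x :: real
  assumes "0 < m" "m \<le> x" "x \<le> M"
  shows "min (m powi k) (M powi k) \<le> x powi k"
proof (cases "0 \<le> k")
  case True
  then have "m powi k \<le> x powi k" using assms by (intro power_int_mono) auto
  then show ?thesis by simp
next
  case False
  then have "M powi k \<le> x powi k" using assms by (intro power_int_antimono) auto
  then show ?thesis by simp
qed

text \<open>The constant of the scale invariant Sobolev inequality for \<open>E i\<close>: the
  energy density controls the squared norms of \<open>E i\<close> and \<open>E (Suc i)\<close> with
  factors 1/a(i) and 1/a(i+1), and 1/2 comes from Young's inequality.\<close>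

definition sob_const :: "(nat \<Rightarrow> real) \<Rightarrow> nat \<Rightarrow> real" where
  "sob_const a i = (1 / a i + 1 / a (Suc i)) / 2"

lemma arc_path_energy_measurable:
  assumes ap: "arc_path n c q E"
  shows "arc_energy n a q E \<in> borel_measurable leb01"
proof -
  have [measurable]: "case_prod q \<in> borel_measurable leb01sq" by (rule arc_pathD(1)[OF ap])
  have nq: "(\<lambda>p. norm (q (fst p) (snd p))) \<in> borel_measurable leb01sq"
    using measurable_compose[OF arc_pathD(1)[OF ap] borel_measurable_norm] by (simp add: case_prod_beta')
  have ml: "(\<lambda>t. (\<integral>\<theta>. norm (q t \<theta>) \<partial>leb01)) \<in> borel_measurable leb01"
    by (rule leb01.borel_measurable_lebesgue_integral) (use nq in \<open>simp add: case_prod_beta'\<close>)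
  have mp: "(\<lambda>t. (\<integral>\<theta>. norm (q t \<theta>) \<partial>leb01) powi k) \<in> borel_measurable leb01" for k
    using borel_measurable_power[OF ml, of "nat k"]
      borel_measurable_power[OF borel_measurable_inverse[OF ml], of "nat (- k)"]
    by (cases "0 \<le> k") (simp_all only: power_int_def if_True if_False)
  have mX: "(\<lambda>t. \<integral>\<^sup>+\<theta>. ennreal ((norm (E i t \<theta>))\<^sup>2 * norm (q t \<theta>)) \<partial>leb01) \<in> borel_measurable leb01" if "i \<le> n" for i
  proof (rule leb01.borel_measurable_nn_integral)
    have "(\<lambda>p. norm (E i (fst p) (snd p))) \<in> borel_measurable leb01sq"
      using measurable_compose[OF arc_pathD(2)[OF ap that] borel_measurable_norm] by (simp add: case_prod_beta')
    then show "(\<lambda>(t, \<theta>). ennreal ((norm (E i t \<theta>))\<^sup>2 * norm (q t \<theta>))) \<in> borel_measurable leb01sq"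
      using nq unfolding case_prod_beta' by measurable
  qed
  have "(\<lambda>t. \<Sum>i\<le>n. ennreal (a i * (\<integral>\<theta>. norm (q t \<theta>) \<partial>leb01) powi (2 * int i - 3)) *
    (\<integral>\<^sup>+\<theta>. ennreal ((norm (E i t \<theta>))\<^sup>2 * norm (q t \<theta>)) \<partial>leb01)) \<in> borel_measurable leb01"
  proof (rule borel_measurable_sum)
    fix i assume "i \<in> {..n}"
    then show "(\<lambda>t. ennreal (a i * (\<integral>\<theta>. norm (q t \<theta>) \<partial>leb01) powi (2 * int i - 3)) *
        (\<integral>\<^sup>+\<theta>. ennreal ((norm (E i t \<theta>))\<^sup>2 * norm (q t \<theta>)) \<partial>leb01)) \<in> borel_measurable leb01"
      using mX[of i] mp[of "2 * int i - 3"]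
      by (intro borel_measurable_times_ennreal measurable_compose[OF _ measurable_ennreal] borel_measurable_times) auto
  qed
  then show ?thesis unfolding arc_energy_def[abs_def] .
qed

text \<open>The bounds derived here depend on the parameters \<open>n\<close>, \<open>a\<close>,
  \<open>M\<close>, \<open>m0\<close>, \<open>M0\<close> but not on the individual path, apart from
  its initial values, and are therefore common to a whole minimising sequence.\<close>

locale arc_estimates =
  fixes n :: nat and a :: "nat \<Rightarrow> real" and c q :: "real \<Rightarrow> real \<Rightarrow> 'a::euclidean_space"
    and E :: "nat \<Rightarrow> real \<Rightarrow> real \<Rightarrow> 'a" and M m0 M0 :: real
  assumes n: "2 \<le> n" and a: "0 < a i" and ap: "arc_path n c q E"
    and energy: "(\<integral>\<^sup>+t. arc_energy n a q E t \<partial>leb01) \<le> ennreal M" and M: "0 \<le> M"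
    and m0: "0 < m0" "\<theta> \<in> {0..1} \<Longrightarrow> m0 \<le> norm (q 0 \<theta>)" and M0: "\<theta> \<in> {0..1} \<Longrightarrow> norm (q 0 \<theta>) \<le> M0"
begin

definition len :: "real \<Rightarrow> real" where "len t = (\<integral>\<theta>. norm (q t \<theta>) \<partial>leb01)"
definition G :: "real \<Rightarrow> real" where "G t = enn2real (arc_energy n a q E t)"
text \<open>The exponent bounds the time integral of the supremum of |E 1|: take \<eta> = 1 in
  \<open>E1_sup\<close> and integrate. The logarithm of |q| changes at a rate of at most |E 1|,
  whence the exponential factors here and in \<open>Mq\<close>.\<close>

definition mq :: real where "mq = m0 * exp (- (1 + sob_const a 1 * M))"
definition Mq :: real where "Mq = M0 * exp (1 + sob_const a 1 * M)"

lemma sob_const_pos: "0 < sob_const a i"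
  unfolding sob_const_def using a[of i] a[of "Suc i"] by (simp add: add_pos_pos)

lemma G_nonneg: "0 \<le> G t" by (simp add: G_def)

lemma measurable_arc_energy [measurable]: "arc_energy n a q E \<in> borel_measurable leb01"
  by (rule arc_path_energy_measurable[OF ap])

lemma G_AE: "AE t in leb01. arc_energy n a q E t = ennreal (G t)"
proof -
  have "(\<integral>\<^sup>+t. arc_energy n a q E t \<partial>leb01) \<noteq> \<infinity>" using energy by (auto simp: top_unique)
  then have "AE t in leb01. arc_energy n a q E t \<noteq> \<infinity>"
    by (intro nn_integral_PInf_AE) auto
  then show ?thesis unfolding G_def by eventually_elim (simp add: less_top)
qed

lemma G_integrable: "integrable leb01 G" and G_integral: "integral\<^sup>L leb01 G \<le> M"
proof -
  have m: "G \<in> borel_measurable leb01" unfolding G_def by measurable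
  have "(\<integral>\<^sup>+t. ennreal (G t) \<partial>leb01) = (\<integral>\<^sup>+t. arc_energy n a q E t \<partial>leb01)"
    using G_AE by (intro nn_integral_cong_AE) (auto elim!: eventually_mono)
  then have "(\<integral>\<^sup>+t. ennreal (G t) \<partial>leb01) \<le> ennreal M" using energy by simp
  from integrable_of_nn_integral_le[OF m G_nonneg this M]
  show "integrable leb01 G" "integral\<^sup>L leb01 G \<le> M" by auto
qed

lemma len_pos: "t \<in> {0..1} \<Longrightarrow> 0 < len t"
proof -
  assume t: "t \<in> {0..1}"
  have c: "continuous_on {0..1} (\<lambda>\<theta>. norm (q t \<theta>))"
    by (intro continuous_on_norm arc_pathD(3)[OF ap t])
  obtain x where x: "x \<in> {0..1}" "\<And>y. y \<in> {0..1} \<Longrightarrow> norm (q t x) \<le> norm (q t y)"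
    using continuous_attains_inf[OF _ _ c] by auto
  have "0 < norm (q t x)" using arc_pathD(5)[OF ap t x(1)] by simp
  also have "norm (q t x) = (\<integral>\<theta>. norm (q t x) \<partial>leb01)" by simp
  also have "\<dots> \<le> len t"
    unfolding len_def using x continuous_integrable_leb01[OF c] by (intro integral_mono) auto
  finally show ?thesis .
qed

section \<open>Pointwise bounds extracted from the energy density\<close>

lemma energy_component:
  assumes "i \<le> n"
  shows "AE t in leb01. integrable leb01 (\<lambda>\<theta>. (norm (E i t \<theta>))\<^sup>2 * norm (q t \<theta>)) \<and>
    a i * len t powi (2 * int i - 3) * (\<integral>\<theta>. (norm (E i t \<theta>))\<^sup>2 * norm (q t \<theta>) \<partial>leb01) \<le> G t"
  using G_AE AE_space
proof eventually_elim
  case (elim t)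
  then have t: "t \<in> {0..1}" by simp
  let ?X = "\<integral>\<^sup>+\<theta>. ennreal ((norm (E i t \<theta>))\<^sup>2 * norm (q t \<theta>)) \<partial>leb01"
  define \<kappa> where "\<kappa> = a i * len t powi (2 * int i - 3)"
  have \<kappa>: "0 < \<kappa>" unfolding \<kappa>_def using a len_pos[OF t] by simp
  have "ennreal \<kappa> * ?X \<le> arc_energy n a q E t"
    unfolding arc_energy_def \<kappa>_def len_def using assms
    by (intro member_le_sum[where f="\<lambda>i. ennreal (a i * (\<integral>\<theta>. norm (q t \<theta>) \<partial>leb01) powi (2 * int i - 3)) *
    (\<integral>\<^sup>+\<theta>. ennreal ((norm (E i t \<theta>))\<^sup>2 * norm (q t \<theta>)) \<partial>leb01)"]) auto
  then have le: "ennreal \<kappa> * ?X \<le> ennreal (G t)" using elim(1) by simp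
  have "?X = ennreal (1 / \<kappa>) * (ennreal \<kappa> * ?X)"
    using \<kappa> by (simp add: mult.assoc[symmetric] ennreal_mult[symmetric])
  also have "\<dots> \<le> ennreal (1 / \<kappa>) * ennreal (G t)" by (rule mult_left_mono[OF le]) simp
  also have "\<dots> = ennreal (G t / \<kappa>)" using \<kappa> G_nonneg by (simp add: ennreal_mult[symmetric])
  finally have X: "?X \<le> ennreal (G t / \<kappa>)" .
  have m: "(\<lambda>\<theta>. (norm (E i t \<theta>))\<^sup>2 * norm (q t \<theta>)) \<in> borel_measurable leb01"
    using section_measurable(1)[OF arc_pathD(1)[OF ap] t] section_measurable(1)[OF arc_pathD(2)[OF ap assms] t] by simp
  have "0 \<le> G t / \<kappa>" using \<kappa> G_nonneg by simp
  from integrable_of_nn_integral_le[OF m _ X this]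
  show ?case using \<kappa> unfolding \<kappa>_def[symmetric] by (simp add: pos_le_divide_eq mult.commute)
qed

text \<open>In the Sobolev inequality the norms of \<open>E i\<close> and \<open>E (Suc i)\<close>
  carry the inverse length and the length; both are the energy's own powers of the length times the
  common factor length^(2 - 2i). For i = 1 this factor is 1: scale invariance bounds
  \<open>E 1\<close> with no prior knowledge of the length, which is what keeps curves from
  collapsing or blowing up.\<close>

lemma E_sup:
  assumes "i < n"
  shows "AE t in leb01. \<forall>\<theta>\<in>{0..1}. \<forall>\<eta>>0. norm (E i t \<theta>) \<le> \<eta> + sob_const a i * len t powi (2 - 2 * int i) * G t / \<eta>"
proof -
  have i: "i \<le> n" "Suc i \<le> n" using assms by auto
  show ?thesis
    using arc_pathD(6)[OF ap assms] energy_component[OF i(1)] energy_component[OF i(2)] AE_space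
  proof eventually_elim
    case (elim t)
    then have t: "t \<in> {0..1}" by simp
    let ?X = "\<integral>\<theta>. (norm (E i t \<theta>))\<^sup>2 * norm (q t \<theta>) \<partial>leb01"
    let ?Y = "\<integral>\<theta>. (norm (E (Suc i) t \<theta>))\<^sup>2 * norm (q t \<theta>) \<partial>leb01"
    let ?l = "len t powi (2 - 2 * int i)"
    have lp: "0 < len t" by (rule len_pos[OF t])
    have lpi: "0 < ?l" using lp by simp
    have e1: "inverse (len t) = ?l * len t powi (2 * int i - 3)"
      using lp by (simp add: power_int_add[symmetric] power_int_minus)
    have e2: "len t = ?l * len t powi (2 * int (Suc i) - 3)"
      using lp by (simp add: power_int_add[symmetric])
    have "len t powi (2 * int i - 3) * ?X \<le> G t / a i"
      using elim(2) a[of i] by (simp add: field_simps)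
    then have b1: "inverse (len t) * ?X \<le> ?l * (G t / a i)"
      unfolding e1 mult.assoc by (rule mult_left_mono) (use lpi in simp)
    have "len t powi (2 * int (Suc i) - 3) * ?Y \<le> G t / a (Suc i)"
      using elim(3) a[of "Suc i"] by (simp add: field_simps)
    then have b2: "?l * (len t powi (2 * int (Suc i) - 3) * ?Y) \<le> ?l * (G t / a (Suc i))"
      by (rule mult_left_mono) (use lpi in simp)
    have b3: "len t * ?Y \<le> ?l * (G t / a (Suc i))"
      using b2[unfolded mult.assoc[symmetric] e2[symmetric]] .
    show ?case
    proof (intro ballI allI impI)
      fix \<theta> \<eta> :: real assume \<theta>: "\<theta> \<in> {0..1}" and \<eta>: "0 < \<eta>"
      have "norm (E i t \<theta>) \<le> \<eta> + (inverse (len t) * ?X + len t * ?Y) / (2 * \<eta>)"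
        unfolding len_def
        by (rule arc_sup_bound[OF arc_pathD(3)[OF ap t] elim(1) _ _ \<eta> \<theta>])
          (use elim lp in \<open>auto simp: len_def\<close>)
      also have "\<dots> \<le> \<eta> + (?l * (G t / a i) + ?l * (G t / a (Suc i))) / (2 * \<eta>)"
        using b1 b3 \<eta> by (intro add_left_mono divide_right_mono add_mono) auto
      also have "\<dots> = \<eta> + sob_const a i * ?l * G t / \<eta>"
        using \<eta> a[of i] a[of "Suc i"] by (simp add: sob_const_def field_simps)
      finally show "norm (E i t \<theta>) \<le> \<eta> + sob_const a i * ?l * G t / \<eta>" .
    qed
  qed
qed

lemma E1_sup: "AE t in leb01. \<forall>\<theta>\<in>{0..1}. \<forall>\<eta>>0. norm (E 1 t \<theta>) \<le> \<eta> + sob_const a 1 * G t / \<eta>"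
  using E_sup[of 1] n by simp

text \<open>The time derivative of \<open>ln (norm q)\<close> is the inner product of
  \<open>E 1\<close> with the unit tangent, hence at most |E 1| in absolute value. A two-sided bound
  on the logarithm gives both inequalities.\<close>

lemma q_bounds:
  assumes t: "t \<in> {0..1}" and \<theta>: "\<theta> \<in> {0..1}"
  shows "mq \<le> norm (q t \<theta>)" "norm (q t \<theta>) \<le> Mq"
proof -
  define f where "f s = inverse (norm (q s \<theta>)) * (q s \<theta> \<bullet> (norm (q s \<theta>) *\<^sub>R E 1 s \<theta>))" for s
  have nz: "q s \<theta> \<noteq> 0" if "s \<in> {0..1}" for s using arc_pathD(5)[OF ap that \<theta>] .
  have p: "has_prim (\<lambda>t. norm (q t \<theta>)) f"
    unfolding f_def by (rule has_prim_norm[OF arc_pathD(7)[OF ap \<theta>] nz])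
  have pos: "0 < x" if "x \<in> (\<lambda>t. norm (q t \<theta>)) ` {0..1}" for x using that nz by auto
  have h: "has_prim (\<lambda>t. ln (norm (q t \<theta>))) (\<lambda>s. inverse (norm (q s \<theta>)) * f s)"
  proof (rule has_prim_chain[OF p])
    show "(ln has_real_derivative inverse x) (at x)" if "x \<in> (\<lambda>t. norm (q t \<theta>)) ` {0..1}" for x
      using DERIV_ln[OF pos[OF that]] .
    show "continuous_on ((\<lambda>t. norm (q t \<theta>)) ` {0..1}) inverse"
      using pos by (intro continuous_on_inverse continuous_on_id) force
  qed
  note hi = has_prim_integrable[OF h]
  have "ln (norm (q t \<theta>)) - ln (norm (q 0 \<theta>)) = prim (\<lambda>s. inverse (norm (q s \<theta>)) * f s) t"
    using has_primD[OF h t] by simp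
  then have "\<bar>ln (norm (q t \<theta>)) - ln (norm (q 0 \<theta>))\<bar> \<le> (\<integral>s. norm (inverse (norm (q s \<theta>)) * f s) \<partial>leb01)"
    using norm_prim_le_integral[OF hi, of t] by simp
  also have "\<dots> \<le> (\<integral>s. 1 + sob_const a 1 * G s \<partial>leb01)"
  proof (rule integral_mono_AE)
    show "AE s in leb01. norm (inverse (norm (q s \<theta>)) * f s) \<le> 1 + sob_const a 1 * G s"
      using E1_sup AE_space
    proof eventually_elim
      case (elim s)
      then have s: "s \<in> {0..1}" by simp
      have "norm (inverse (norm (q s \<theta>)) * f s) = inverse (norm (q s \<theta>)) * \<bar>q s \<theta> \<bullet> E 1 s \<theta>\<bar>"
        using nz[OF s] by (simp add: f_def abs_mult)
      also have "\<dots> \<le> inverse (norm (q s \<theta>)) * (norm (q s \<theta>) * norm (E 1 s \<theta>))"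
        by (intro mult_left_mono Cauchy_Schwarz_ineq2) simp
      also have "\<dots> = norm (E 1 s \<theta>)" using nz[OF s] by simp
      also have "\<dots> \<le> 1 + sob_const a 1 * G s / 1" using elim(1) \<theta> zero_less_one by blast
      finally show ?case by simp
    qed
  qed (use hi G_integrable in auto)
  also have "\<dots> \<le> 1 + sob_const a 1 * M"
    using G_integrable G_integral sob_const_pos[of 1] by (simp add: leb01.prob_space)
  finally have L: "\<bar>ln (norm (q t \<theta>)) - ln (norm (q 0 \<theta>))\<bar> \<le> 1 + sob_const a 1 * M" .
  have q0: "0 < norm (q 0 \<theta>)" and qt: "0 < norm (q t \<theta>)" using nz[of 0] nz[OF t] by auto
  have "norm (q t \<theta>) = exp (ln (norm (q t \<theta>)))" using qt by simp
  also have "\<dots> \<le> exp (ln (norm (q 0 \<theta>)) + (1 + sob_const a 1 * M))" using L by simp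
  also have "\<dots> = norm (q 0 \<theta>) * exp (1 + sob_const a 1 * M)" using q0 by (simp only: exp_add exp_ln)
  also have "\<dots> \<le> Mq" unfolding Mq_def using M0[OF \<theta>] by simp
  finally show "norm (q t \<theta>) \<le> Mq" .
  have "mq \<le> norm (q 0 \<theta>) * exp (- (1 + sob_const a 1 * M))" unfolding mq_def using m0(2)[OF \<theta>] by simp
  also have "\<dots> = exp (ln (norm (q 0 \<theta>)) - (1 + sob_const a 1 * M))" using q0 by (simp only: exp_add exp_ln diff_conv_add_uminus)
  also have "\<dots> \<le> exp (ln (norm (q t \<theta>)))" using L by simp
  finally show "mq \<le> norm (q t \<theta>)" using qt by simp
qed

lemma mq_pos: "0 < mq" unfolding mq_def using m0(1) by simp

lemma Mq_pos: "0 < Mq"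
  using q_bounds[of 0 0] mq_pos by simp

lemma len_bounds: "t \<in> {0..1} \<Longrightarrow> mq \<le> len t" "t \<in> {0..1} \<Longrightarrow> len t \<le> Mq"
proof -
  assume t: "t \<in> {0..1}"
  have i: "integrable leb01 (\<lambda>\<theta>. norm (q t \<theta>))"
    by (intro continuous_integrable_leb01 continuous_on_norm arc_pathD(3)[OF ap t])
  have "(\<integral>\<theta>. mq \<partial>leb01) \<le> len t" unfolding len_def using q_bounds(1)[OF t] i by (intro integral_mono) auto
  then show "mq \<le> len t" by simp
  have "len t \<le> (\<integral>\<theta>. Mq \<partial>leb01)" unfolding len_def using q_bounds(2)[OF t] i by (intro integral_mono) auto
  then show "len t \<le> Mq" by simp
qed

text \<open>A lower bound for the factor a(i) length^(2i - 3) |q| in the energy. The exponent is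
  negative for i \<le> 1, so the minimum over both ends of the range of the length is taken.\<close>

definition energy_weight :: "nat \<Rightarrow> real" where
  "energy_weight i = a i * min (mq powi (2 * int i - 3)) (Mq powi (2 * int i - 3)) * mq"

lemma energy_weight_pos: "0 < energy_weight i"
  unfolding energy_weight_def using a mq_pos Mq_pos by simp

lemma E_space_l2:
  assumes "i \<le> n"
  shows "AE t in leb01. l2 leb01 (E i t) \<and> (\<integral>\<theta>. (norm (E i t \<theta>))\<^sup>2 \<partial>leb01) \<le> G t / energy_weight i"
  using energy_component[OF assms] AE_space
proof eventually_elim
  case (elim t)
  then have t: "t \<in> {0..1}" by simp
  have m: "E i t \<in> borel_measurable leb01" by (rule section_measurable(1)[OF arc_pathD(2)[OF ap assms] t])
  have le: "(norm (E i t \<theta>))\<^sup>2 \<le> (norm (E i t \<theta>))\<^sup>2 * norm (q t \<theta>) / mq" if "\<theta> \<in> {0..1}" for \<theta>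
    using mult_left_mono[OF q_bounds(1)[OF t that], of "(norm (E i t \<theta>))\<^sup>2"] mq_pos by (simp add: field_simps)
  have i: "integrable leb01 (\<lambda>\<theta>. (norm (E i t \<theta>))\<^sup>2 * norm (q t \<theta>) / mq)" using elim(1) by simp
  have l2: "l2 leb01 (E i t)"
    unfolding l2_def
  proof (rule conjI[OF m], rule Bochner_Integration.integrable_bound[OF i])
    show "AE \<theta> in leb01. norm ((norm (E i t \<theta>))\<^sup>2) \<le> norm ((norm (E i t \<theta>))\<^sup>2 * norm (q t \<theta>) / mq)"
      using le mq_pos by (intro AE_I2) auto
  qed (use m in simp)
  let ?X = "\<integral>\<theta>. (norm (E i t \<theta>))\<^sup>2 * norm (q t \<theta>) \<partial>leb01"
  have X0: "0 \<le> ?X" by simp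
  have "energy_weight i * (\<integral>\<theta>. (norm (E i t \<theta>))\<^sup>2 \<partial>leb01) \<le> energy_weight i * (?X / mq)"
  proof (rule mult_left_mono)
    have "(\<integral>\<theta>. (norm (E i t \<theta>))\<^sup>2 \<partial>leb01) \<le> (\<integral>\<theta>. (norm (E i t \<theta>))\<^sup>2 * norm (q t \<theta>) / mq \<partial>leb01)"
      using le l2 i by (intro integral_mono) (auto simp: l2_def)
    then show "(\<integral>\<theta>. (norm (E i t \<theta>))\<^sup>2 \<partial>leb01) \<le> ?X / mq" by simp
  qed (use energy_weight_pos[of i] in simp)
  also have "\<dots> = a i * min (mq powi (2 * int i - 3)) (Mq powi (2 * int i - 3)) * ?X"
    unfolding energy_weight_def using mq_pos by simp
  also have "\<dots> \<le> a i * len t powi (2 * int i - 3) * ?X"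
    using powi_lower_bound[OF mq_pos len_bounds[OF t], of "2 * int i - 3"] a[of i] X0
    by (intro mult_right_mono mult_left_mono) auto
  also have "\<dots> \<le> G t" using elim(1) by simp
  finally have "(\<integral>\<theta>. (norm (E i t \<theta>))\<^sup>2 \<partial>leb01) \<le> G t / energy_weight i"
    using energy_weight_pos[of i] by (simp add: pos_le_divide_eq mult.commute)
  with l2 show ?case by blast
qed

lemma E_l2:
  assumes "i \<le> n"
  shows "l2 leb01sq (case_prod (E i))" "(\<integral>p. (norm (case_prod (E i) p))\<^sup>2 \<partial>leb01sq) \<le> M / energy_weight i"
proof -
  have m: "case_prod (E i) \<in> borel_measurable leb01sq" by (rule arc_pathD(2)[OF ap assms])
  have m2: "(\<lambda>p. (norm (case_prod (E i) p))\<^sup>2) \<in> borel_measurable leb01sq"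
    using measurable_compose[OF m borel_measurable_norm] by simp
  have i: "integrable leb01sq (\<lambda>p. (norm (case_prod (E i) p))\<^sup>2)"
  proof (rule leb01_pair.Fubini_integrable[OF m2])
    show "integrable leb01 (\<lambda>t. \<integral>\<theta>. norm ((norm (case_prod (E i) (t, \<theta>)))\<^sup>2) \<partial>leb01)"
    proof (rule Bochner_Integration.integrable_bound)
      show "integrable leb01 (\<lambda>t. G t / energy_weight i)" using G_integrable by simp
      show "(\<lambda>t. \<integral>\<theta>. norm ((norm (case_prod (E i) (t, \<theta>)))\<^sup>2) \<partial>leb01) \<in> borel_measurable leb01"
        by (rule leb01.borel_measurable_lebesgue_integral) (use m2 in \<open>simp add: case_prod_beta'\<close>)
      show "AE t in leb01. norm (\<integral>\<theta>. norm ((norm (case_prod (E i) (t, \<theta>)))\<^sup>2) \<partial>leb01) \<le> norm (G t / energy_weight i)"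
        using E_space_l2[OF assms] by eventually_elim (use G_nonneg energy_weight_pos[of i] in simp)
    qed
    show "AE t in leb01. integrable leb01 (\<lambda>\<theta>. (norm (case_prod (E i) (t, \<theta>)))\<^sup>2)"
      using E_space_l2[OF assms] by eventually_elim (simp add: l2_def)
  qed
  then show "l2 leb01sq (case_prod (E i))" using m by (simp add: l2_def)
  have "(\<integral>p. (norm (case_prod (E i) p))\<^sup>2 \<partial>leb01sq) = (\<integral>t. \<integral>\<theta>. (norm (E i t \<theta>))\<^sup>2 \<partial>leb01 \<partial>leb01)"
    using leb01_pair.integral_fst'[OF i] by simp
  also have "\<dots> \<le> (\<integral>t. G t / energy_weight i \<partial>leb01)"
  proof (rule integral_mono_AE)
    show "integrable leb01 (\<lambda>t. \<integral>\<theta>. (norm (E i t \<theta>))\<^sup>2 \<partial>leb01)" using leb01_pair.integrable_fst'[OF i] by simp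
    show "AE t in leb01. (\<integral>\<theta>. (norm (E i t \<theta>))\<^sup>2 \<partial>leb01) \<le> G t / energy_weight i"
      using E_space_l2[OF assms] by eventually_elim simp
  qed (use G_integrable in simp)
  also have "\<dots> \<le> M / energy_weight i"
    using G_integral energy_weight_pos[of i] by (simp add: divide_right_mono)
  finally show "(\<integral>p. (norm (case_prod (E i) p))\<^sup>2 \<partial>leb01sq) \<le> M / energy_weight i" .
qed

text \<open>A Hoelder modulus of exponent 1/2 in a form without square roots: optimising \<eta>
  would give a multiple of the square root of t' - t.\<close>

lemma prim_E_le:
  assumes e: "has_prim x y" and K: "0 \<le> K" "0 \<le> K'" and \<eta>: "0 < \<eta>"
    and b: "AE t in leb01. norm (y t) \<le> K' * (\<eta> + K * G t / \<eta>)"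
    and t: "t \<in> {0..1}" "t' \<in> {0..1}" "t \<le> t'"
  shows "norm (x t' - x t) \<le> K' * (\<eta> * (t' - t) + K * M / \<eta>)"
proof -
  have i: "integrable leb01 (\<lambda>t. norm (y t))" using has_prim_integrable[OF e] by simp
  have Gi: "integrable leb01 (\<lambda>t. K' * (\<eta> + K * G t / \<eta>))" using G_integrable by simp
  have "norm (x t' - x t) \<le> prim (\<lambda>x. norm (y x)) t' - prim (\<lambda>x. norm (y x)) t"
    by (rule has_prim_norm_diff_le[OF e t])
  also have "\<dots> = seg (\<lambda>x. norm (y x)) t t'" using prim_diff_eq_seg[OF i] t by simp
  also have "\<dots> \<le> seg (\<lambda>t. K' * (\<eta> + K * G t / \<eta>)) t t'"
  proof -
    have "AE s in leb01. t < s \<longrightarrow> s \<le> t' \<longrightarrow> norm (norm (y s)) \<le> K' * (\<eta> + K * G s / \<eta>)"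
      using b by eventually_elim simp
    from norm_seg_le[OF i Gi this] show ?thesis by simp
  qed
  also have "\<dots> = K' * (\<eta> * (t' - t) + K * (prim G t' - prim G t) / \<eta>)"
    using Gi G_integrable t prim_cmult[of K' "\<lambda>t. \<eta> + K / \<eta> * G t"] prim_cmult[of "K / \<eta>" G]
      prim_add[of "\<lambda>_. \<eta>" "\<lambda>t. K / \<eta> * G t"] prim_const[of _ \<eta>]
    by (simp add: prim_diff_eq_seg[symmetric] algebra_simps diff_divide_distrib)
  also have "\<dots> \<le> K' * (\<eta> * (t' - t) + K * M / \<eta>)"
  proof -
    have "prim G t' - prim G t \<le> M"
      using prim_le_integral[OF G_integrable, of t'] prim_nonneg[of G t] G_nonneg G_integral by force
    then show ?thesis using K \<eta> by (intro mult_left_mono add_left_mono divide_right_mono) auto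
  qed
  finally show ?thesis .
qed

lemma q_time:
  assumes "t \<in> {0..1}" "t' \<in> {0..1}" "t \<le> t'" and \<theta>: "\<theta> \<in> {0..1}" and \<eta>: "0 < \<eta>"
  shows "norm (q t' \<theta> - q t \<theta>) \<le> Mq * (\<eta> * (t' - t) + sob_const a 1 * M / \<eta>)"
proof (rule prim_E_le[OF arc_pathD(7)[OF ap \<theta>] _ _ \<eta> _ assms(1-3)])
  show "AE t in leb01. norm (norm (q t \<theta>) *\<^sub>R E 1 t \<theta>) \<le> Mq * (\<eta> + sob_const a 1 * G t / \<eta>)"
    using E1_sup AE_space
  proof eventually_elim
    case (elim t)
    have "norm (q t \<theta>) * norm (E 1 t \<theta>) \<le> Mq * (\<eta> + sob_const a 1 * G t / \<eta>)"
      using q_bounds(2)[of t \<theta>] elim \<theta> \<eta> Mq_pos by (intro mult_mono) auto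
    then show ?case by simp
  qed
qed (use sob_const_pos[of 1] Mq_pos in auto)

text \<open>For i = 0 the length enters \<open>E_sup\<close> squared, hence the factor
  \<open>Mq\<^sup>2\<close>.\<close>

lemma c_time:
  assumes "t \<in> {0..1}" "t' \<in> {0..1}" "t \<le> t'" and \<theta>: "\<theta> \<in> {0..1}" and \<eta>: "0 < \<eta>"
  shows "norm (c t' \<theta> - c t \<theta>) \<le> 1 * (\<eta> * (t' - t) + (sob_const a 0 * Mq\<^sup>2) * M / \<eta>)"
proof (rule prim_E_le[OF arc_pathD(8)[OF ap \<theta>] _ _ \<eta> _ assms(1-3)])
  show "AE t in leb01. norm (E 0 t \<theta>) \<le> 1 * (\<eta> + (sob_const a 0 * Mq\<^sup>2) * G t / \<eta>)"
  proof -
    have "0 < n" using n by simp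
    from E_sup[OF this] show ?thesis
      using AE_space
    proof eventually_elim
      case (elim t)
      then have t: "t \<in> {0..1}" by simp
      have "norm (E 0 t \<theta>) \<le> \<eta> + sob_const a 0 * len t powi (2 - 2 * int 0) * G t / \<eta>"
        using elim(1) \<theta> \<eta> by blast
      also have "len t powi (2 - 2 * int 0) = (len t)\<^sup>2" by (simp add: power_int_def)
      also have "\<eta> + sob_const a 0 * (len t)\<^sup>2 * G t / \<eta> \<le> \<eta> + sob_const a 0 * Mq\<^sup>2 * G t / \<eta>"
        using len_bounds[OF t] mq_pos sob_const_pos[of 0] G_nonneg[of t] \<eta>
        by (intro add_left_mono divide_right_mono mult_right_mono mult_left_mono power_mono) auto
      finally show ?case by simp
    qed
  qed
qed (use sob_const_pos[of 0] in auto)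

lemma c_space:
  assumes t: "t \<in> {0..1}" and "\<theta> \<in> {0..1}" "\<theta>' \<in> {0..1}" "\<theta> \<le> \<theta>'"
  shows "norm (c t \<theta>' - c t \<theta>) \<le> Mq * (\<theta>' - \<theta>)"
proof -
  have i: "integrable leb01 (\<lambda>x. norm (q t x))"
    by (intro continuous_integrable_leb01 continuous_on_norm arc_pathD(3)[OF ap t])
  have "norm (c t \<theta>' - c t \<theta>) \<le> prim (\<lambda>x. norm (q t x)) \<theta>' - prim (\<lambda>x. norm (q t x)) \<theta>"
    by (rule has_prim_norm_diff_le[OF arc_pathD(4)[OF ap t] assms(2-4)])
  also have "\<dots> = seg (\<lambda>x. norm (q t x)) \<theta> \<theta>'" using prim_diff_eq_seg[OF i] assms by simp
  also have "\<dots> \<le> seg (\<lambda>x. Mq) \<theta> \<theta>'"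
  proof -
    have "AE x in leb01. \<theta> < x \<longrightarrow> x \<le> \<theta>' \<longrightarrow> norm (norm (q t x)) \<le> Mq"
      using q_bounds(2)[OF t] by (intro AE_I2) auto
    from norm_seg_le[OF i _ this] show ?thesis by simp
  qed
  also have "\<dots> = Mq * (\<theta>' - \<theta>)" using seg_const[of \<theta> \<theta>' Mq] assms by simp
  finally show ?thesis .
qed

text \<open>Only the square mean of \<open>E 2\<close> over space is controlled by the energy
  density, so the increment of \<open>E 1\<close> is again estimated with a free parameter
  \<eta>.\<close>

lemma E1_space:
  assumes "\<theta> \<in> {0..1}" "\<theta>' \<in> {0..1}" "\<theta> \<le> \<theta>'" and \<eta>: "0 < \<eta>"
  shows "AE t in leb01. norm (E 1 t \<theta>' - E 1 t \<theta>) \<le> Mq * (\<eta> * (\<theta>' - \<theta>) + G t / energy_weight 2 / \<eta>)"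
proof -
  have "AE t in leb01. has_prim (E 1 t) (\<lambda>x. norm (q t x) *\<^sub>R E 2 t x)"
    using arc_pathD(6)[OF ap, of 1] n by (simp add: numeral_2_eq_2)
  then show ?thesis
    using E_space_l2[of 2, OF n] AE_space
  proof eventually_elim
    case (elim t)
    then have t: "t \<in> {0..1}" by simp
    have i: "integrable leb01 (\<lambda>x. norm (norm (q t x) *\<^sub>R E 2 t x))"
      using has_prim_integrable[OF elim(1)] by (rule integrable_norm)
    have i2: "integrable leb01 (\<lambda>x. (norm (E 2 t x))\<^sup>2)" using elim(2) by (simp add: l2_def)
    have gi: "integrable leb01 (\<lambda>x. Mq * \<eta> + Mq / \<eta> * (norm (E 2 t x))\<^sup>2)" using i2 by simp
    have "norm (E 1 t \<theta>' - E 1 t \<theta>) \<le> prim (\<lambda>x. norm (norm (q t x) *\<^sub>R E 2 t x)) \<theta>' - prim (\<lambda>x. norm (norm (q t x) *\<^sub>R E 2 t x)) \<theta>"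
      by (rule has_prim_norm_diff_le[OF elim(1) assms(1-3)])
    also have "\<dots> = seg (\<lambda>x. norm (norm (q t x) *\<^sub>R E 2 t x)) \<theta> \<theta>'" using prim_diff_eq_seg[OF i] assms by simp
    also have "\<dots> \<le> seg (\<lambda>x. Mq * \<eta> + Mq / \<eta> * (norm (E 2 t x))\<^sup>2) \<theta> \<theta>'"
    proof -
      have "norm (norm (norm (q t x) *\<^sub>R E 2 t x)) \<le> Mq * \<eta> + Mq / \<eta> * (norm (E 2 t x))\<^sup>2" if "x \<in> {0..1}" for x
      proof -
        have "0 \<le> \<eta> / 2 + (norm (E 2 t x))\<^sup>2 / (2 * \<eta>)" using \<eta> by simp
        then have "norm (E 2 t x) \<le> \<eta> + (norm (E 2 t x))\<^sup>2 / \<eta>" using young[OF \<eta>, of "norm (E 2 t x)"]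
          by (simp add: field_simps)
        then have "norm (q t x) * norm (E 2 t x) \<le> Mq * (\<eta> + (norm (E 2 t x))\<^sup>2 / \<eta>)"
          using q_bounds(2)[OF t that] Mq_pos by (intro mult_mono) auto
        then show ?thesis by (simp add: algebra_simps)
      qed
      then have "AE x in leb01. \<theta> < x \<longrightarrow> x \<le> \<theta>' \<longrightarrow> norm (norm (norm (q t x) *\<^sub>R E 2 t x)) \<le> Mq * \<eta> + Mq / \<eta> * (norm (E 2 t x))\<^sup>2"
        by (intro AE_I2) auto
      from norm_seg_le[OF i gi this] show ?thesis by simp
    qed
    also have "\<dots> = (prim (\<lambda>x. Mq * \<eta>) \<theta>' - prim (\<lambda>x. Mq * \<eta>) \<theta>) +
        (prim (\<lambda>x. Mq / \<eta> * (norm (E 2 t x))\<^sup>2) \<theta>' - prim (\<lambda>x. Mq / \<eta> * (norm (E 2 t x))\<^sup>2) \<theta>)"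
    proof -
      have "prim (\<lambda>x. Mq * \<eta> + Mq / \<eta> * (norm (E 2 t x))\<^sup>2) y = prim (\<lambda>x. Mq * \<eta>) y + prim (\<lambda>x. Mq / \<eta> * (norm (E 2 t x))\<^sup>2) y" for y
        using i2 by (intro prim_add) auto
      then show ?thesis using prim_diff_eq_seg[OF gi, of \<theta> \<theta>'] assms by simp
    qed
    also have "\<dots> \<le> Mq * \<eta> * (\<theta>' - \<theta>) + Mq / \<eta> * (\<integral>x. (norm (E 2 t x))\<^sup>2 \<partial>leb01)"
    proof (rule add_mono)
      show "prim (\<lambda>x. Mq * \<eta>) \<theta>' - prim (\<lambda>x. Mq * \<eta>) \<theta> \<le> Mq * \<eta> * (\<theta>' - \<theta>)"
        using prim_const[of \<theta> "Mq * \<eta>"] prim_const[of \<theta>' "Mq * \<eta>"] assms by (simp add: algebra_simps)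
      have "prim (\<lambda>x. (norm (E 2 t x))\<^sup>2) \<theta>' - prim (\<lambda>x. (norm (E 2 t x))\<^sup>2) \<theta> \<le> (\<integral>x. (norm (E 2 t x))\<^sup>2 \<partial>leb01)"
        using prim_le_integral[OF i2, of \<theta>'] prim_nonneg[of "\<lambda>x. (norm (E 2 t x))\<^sup>2" \<theta>] by simp
      then show "prim (\<lambda>x. Mq / \<eta> * (norm (E 2 t x))\<^sup>2) \<theta>' - prim (\<lambda>x. Mq / \<eta> * (norm (E 2 t x))\<^sup>2) \<theta>
          \<le> Mq / \<eta> * (\<integral>x. (norm (E 2 t x))\<^sup>2 \<partial>leb01)"
        unfolding prim_cmult right_diff_distrib[symmetric] using Mq_pos \<eta> by (intro mult_left_mono) auto
    qed
    also have "\<dots> \<le> Mq * \<eta> * (\<theta>' - \<theta>) + Mq / \<eta> * (G t / energy_weight 2)"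
      using elim(2) Mq_pos \<eta> by (intro add_left_mono mult_left_mono) auto
    finally show ?case by (simp add: algebra_simps)
  qed
qed

text \<open>Continuity in \<theta> has to be propagated from time 0. The difference of two values of
  \<open>q\<close> satisfies a linear integral inequality whose coefficient bounds |E 1| and whose
  source is the increment of \<open>E 1\<close>; Gronwall's lemma bounds it by the initial
  difference plus the integrated source.\<close>

lemma q_space:
  assumes t: "t \<in> {0..1}" and \<theta>: "\<theta> \<in> {0..1}" "\<theta>' \<in> {0..1}" "\<theta> \<le> \<theta>'" and \<eta>: "0 < \<eta>"
  shows "norm (q t \<theta>' - q t \<theta>) \<le> 2 * (norm (q 0 \<theta>' - q 0 \<theta>) + Mq\<^sup>2 * (\<eta> * (\<theta>' - \<theta>) + M / energy_weight 2 / \<eta>))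
      * exp (2 * (1 + sob_const a 1 * M))"
proof -
  define e where "e s = 1 + sob_const a 1 * G s" for s
  have e: "integrable leb01 e" "0 \<le> e s" for s
    unfolding e_def using G_integrable G_nonneg[of s] sob_const_pos[of 1] by auto
  have eM: "integral\<^sup>L leb01 e \<le> 1 + sob_const a 1 * M"
    unfolding e_def using G_integrable G_integral sob_const_pos[of 1] by (simp add: leb01.prob_space)
  define D where "D s = Mq * (\<eta> * (\<theta>' - \<theta>) + G s / energy_weight 2 / \<eta>)" for s
  have D: "integrable leb01 D" "0 \<le> D s" for s
    unfolding D_def using G_integrable G_nonneg[of s] Mq_pos \<eta> \<theta> energy_weight_pos[of 2] by auto
  define x where "x s = norm (q s \<theta>' - q s \<theta>)" for s
  have h: "has_prim (\<lambda>s. q s \<theta>' - q s \<theta>) (\<lambda>s. norm (q s \<theta>') *\<^sub>R E 1 s \<theta>' - norm (q s \<theta>) *\<^sub>R E 1 s \<theta>)"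
  proof -
    have "has_prim (\<lambda>s. q s \<theta>' + - q s \<theta>) (\<lambda>s. norm (q s \<theta>') *\<^sub>R E 1 s \<theta>' + - (norm (q s \<theta>) *\<^sub>R E 1 s \<theta>))"
      by (intro has_prim_add has_prim_linear[OF bounded_linear_minus[OF bounded_linear_ident]] arc_pathD(7)[OF ap] \<theta>)
    then show ?thesis by simp
  qed
  have cx: "continuous_on {0..1} x"
    unfolding x_def by (intro continuous_on_norm has_prim_continuous[OF h])
  define A where "A = norm (q 0 \<theta>' - q 0 \<theta>) + Mq * (Mq * (\<eta> * (\<theta>' - \<theta>) + M / energy_weight 2 / \<eta>))"
  have A0: "0 \<le> A" unfolding A_def using Mq_pos \<eta> \<theta> M energy_weight_pos[of 2] by simp
  have exi: "integrable leb01 (\<lambda>s. e s * x s)"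
  proof -
    obtain C where C: "\<And>t. t \<in> {0..1} \<Longrightarrow> norm (x t) \<le> C" using bounded_on_unit[OF cx] by blast
    show ?thesis
      by (rule integrable_bilinear_bounded[OF bounded_bilinear_mult e(1) continuous_measurable_leb01[OF cx] C])
  qed
  have "x t \<le> A + prim (\<lambda>s. e s * x s) t" if t: "t \<in> {0..1}" for t
  proof -
    let ?h = "\<lambda>s. norm (q s \<theta>') *\<^sub>R E 1 s \<theta>' - norm (q s \<theta>) *\<^sub>R E 1 s \<theta>"
    have "x t \<le> norm (q 0 \<theta>' - q 0 \<theta>) + norm (prim ?h t)"
      unfolding x_def has_primD[OF h t] by (rule norm_triangle_ineq)
    also have "norm (prim ?h t) \<le> prim (\<lambda>s. norm (?h s)) t"
      by (rule norm_prim_le[OF has_prim_integrable[OF h]])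
    also have "\<dots> \<le> prim (\<lambda>s. e s * x s + Mq * D s) t"
    proof (rule prim_mono_AE)
      show "AE s in leb01. norm (?h s) \<le> e s * x s + Mq * D s"
        using E1_sup E1_space[OF \<theta> \<eta>] AE_space
      proof eventually_elim
        case (elim s)
        then have s: "s \<in> {0..1}" by simp
        \<comment> \<open>Split so that the first term is controlled by \<open>x s\<close> itself
          and the second by the increment of \<open>E 1\<close>.\<close>
        have eq: "?h s = (norm (q s \<theta>') - norm (q s \<theta>)) *\<^sub>R E 1 s \<theta>' + norm (q s \<theta>) *\<^sub>R (E 1 s \<theta>' - E 1 s \<theta>)"
          by (simp add: algebra_simps)
        have "norm (E 1 s \<theta>') \<le> 1 + sob_const a 1 * G s / 1" using elim(1) \<theta> zero_less_one by blast
        then have "\<bar>norm (q s \<theta>') - norm (q s \<theta>)\<bar> * norm (E 1 s \<theta>') \<le> x s * e s"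
          unfolding x_def e_def by (intro mult_mono norm_triangle_ineq3) auto
        moreover have "norm (q s \<theta>) * norm (E 1 s \<theta>' - E 1 s \<theta>) \<le> Mq * D s"
          using q_bounds(2)[OF s \<theta>(1)] elim(2) Mq_pos unfolding D_def by (intro mult_mono) auto
        ultimately show ?case
          unfolding eq by (intro order_trans[OF norm_triangle_ineq]) (simp add: mult.commute)
      qed
    qed (use has_prim_integrable[OF h] exi D in auto)
    also have "\<dots> = prim (\<lambda>s. e s * x s) t + Mq * prim D t"
      using exi D by (simp add: prim_add prim_cmult)
    also have "prim D t \<le> Mq * (\<eta> * (\<theta>' - \<theta>) + M / energy_weight 2 / \<eta>)"
    proof -
      have "prim D t \<le> integral\<^sup>L leb01 D" using prim_le_integral[OF D(1)] D(2) by auto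
      also have "\<dots> = Mq * (\<eta> * (\<theta>' - \<theta>) + integral\<^sup>L leb01 G / energy_weight 2 / \<eta>)"
        unfolding D_def using G_integrable by (simp add: leb01.prob_space)
      also have "\<dots> \<le> Mq * (\<eta> * (\<theta>' - \<theta>) + M / energy_weight 2 / \<eta>)"
        using G_integral Mq_pos \<eta> energy_weight_pos[of 2]
        by (intro mult_left_mono add_left_mono divide_right_mono) auto
      finally show ?thesis .
    qed
    finally show ?thesis unfolding A_def using Mq_pos by simp
  qed
  then have "x t \<le> 2 * A * exp (2 * integral\<^sup>L leb01 e)"
    by (intro gronwall_prim[OF cx _ e A0 _ t]) (auto simp: x_def)
  also have "\<dots> \<le> 2 * A * exp (2 * (1 + sob_const a 1 * M))"
    using eM A0 by (intro mult_left_mono) auto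
  finally show ?thesis unfolding x_def A_def by (simp add: power2_eq_square mult.assoc)
qed

end

section \<open>Strong convergence of convex combinations\<close>

text \<open>Riesz-Fischer. On a probability space a Cauchy sequence in mean square is Cauchy in
  mean, which gives an almost everywhere convergent subsequence; Fatou's lemma transfers the Cauchy
  estimate to its limit.\<close>

lemma (in prob_space) l2_complete:
  fixes X :: "nat \<Rightarrow> 'a \<Rightarrow> 'b::euclidean_space"
  assumes X: "\<And>m. l2 M (X m)"
    and cauchy: "\<And>e. 0 < e \<Longrightarrow> \<exists>N. \<forall>i\<ge>N. \<forall>j\<ge>N. (\<integral>x. (norm (X i x - X j x))\<^sup>2 \<partial>M) < e"
  obtains Y where "l2 M Y" "(\<lambda>m. \<integral>x. (norm (X m x - Y x))\<^sup>2 \<partial>M) \<longlonglongrightarrow> 0"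
proof -
  note mX = l2_measurable[OF X]
  obtain r where r: "strict_mono r" "AE x in M. Cauchy (\<lambda>i. X (r i) x)"
  proof (rule cauchy_L1_AE_cauchy_subseq)
    show "integrable M (X n)" for n by (rule l2_imp_integrable[OF X])
    fix e :: real assume e: "0 < e"
    then obtain N where N: "\<And>i j. N \<le> i \<Longrightarrow> N \<le> j \<Longrightarrow> (\<integral>x. (norm (X i x - X j x))\<^sup>2 \<partial>M) < e\<^sup>2"
      using cauchy[of "e\<^sup>2"] by auto
    have "(\<integral>x. norm (X i x - X j x) \<partial>M) < e" if "N \<le> i" "N \<le> j" for i j
    proof -
      have "(\<integral>x. norm (X i x - X j x) \<partial>M)\<^sup>2 < e\<^sup>2"
        using l2_norm_integral_le[OF l2_diff[OF X X], of i j] N[OF that] by linarith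
      then show ?thesis using e power2_less_imp_less[of _ e] by simp
    qed
    then show "\<exists>N. \<forall>i\<ge>N. \<forall>j\<ge>N. (\<integral>x. norm (X i x - X j x) \<partial>M) < e" by blast
  qed
  define Y where "Y x = lim (\<lambda>i. X (r i) x)" for x
  have mY: "Y \<in> borel_measurable M"
    unfolding Y_def by (rule borel_measurable_lim_metric) (rule mX)
  have lim: "AE x in M. (\<lambda>i. X (r i) x) \<longlonglongrightarrow> Y x"
    using r(2) unfolding Y_def by eventually_elim (simp add: Cauchy_convergent_iff convergent_LIMSEQ_iff)
  have key: "integrable M (\<lambda>x. (norm (X m x - Y x))\<^sup>2) \<and> (\<integral>x. (norm (X m x - Y x))\<^sup>2 \<partial>M) \<le> e"
    if e: "0 < e" and N: "\<And>i j. N \<le> i \<Longrightarrow> N \<le> j \<Longrightarrow> (\<integral>x. (norm (X i x - X j x))\<^sup>2 \<partial>M) < e" and m: "N \<le> m" for e N m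
  proof -
    have mm: "(\<lambda>x. (norm (X m x - Y x))\<^sup>2) \<in> borel_measurable M" using mX[of m] mY by measurable
    have mi: "(\<lambda>x. ennreal ((norm (X m x - X (r i) x))\<^sup>2)) \<in> borel_measurable M" for i
      using mX[of m] mX[of "r i"] by measurable
    have "(\<integral>\<^sup>+x. ennreal ((norm (X m x - Y x))\<^sup>2) \<partial>M) = (\<integral>\<^sup>+x. liminf (\<lambda>i. ennreal ((norm (X m x - X (r i) x))\<^sup>2)) \<partial>M)"
    proof (rule nn_integral_cong_AE)
      show "AE x in M. ennreal ((norm (X m x - Y x))\<^sup>2) = liminf (\<lambda>i. ennreal ((norm (X m x - X (r i) x))\<^sup>2))"
        using lim
      proof eventually_elim
        case (elim x)
        have "(\<lambda>i. ennreal ((norm (X m x - X (r i) x))\<^sup>2)) \<longlonglongrightarrow> ennreal ((norm (X m x - Y x))\<^sup>2)"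
          by (intro tendsto_intros elim)
        then show ?case by (intro lim_imp_Liminf[symmetric]) auto
      qed
    qed
    also have "\<dots> \<le> liminf (\<lambda>i. \<integral>\<^sup>+x. ennreal ((norm (X m x - X (r i) x))\<^sup>2) \<partial>M)"
      by (rule nn_integral_liminf) (rule mi)
    also have "\<dots> \<le> ennreal e"
    proof -
      have "eventually (\<lambda>i. (\<integral>\<^sup>+x. ennreal ((norm (X m x - X (r i) x))\<^sup>2) \<partial>M) \<le> ennreal e) sequentially"
      proof (rule eventually_sequentiallyI)
        fix i assume "N \<le> i"
        then have ri: "N \<le> r i" using seq_suble[OF r(1), of i] by linarith
        have "(\<integral>\<^sup>+x. ennreal ((norm (X m x - X (r i) x))\<^sup>2) \<partial>M) = ennreal (\<integral>x. (norm (X m x - X (r i) x))\<^sup>2 \<partial>M)"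
          using l2_diff[OF X X, of m "r i"] by (intro nn_integral_eq_integral) (auto simp: l2_def)
        then show "(\<integral>\<^sup>+x. ennreal ((norm (X m x - X (r i) x))\<^sup>2) \<partial>M) \<le> ennreal e"
          using N[OF m ri] by (simp add: ennreal_leI)
      qed
      then have "liminf (\<lambda>i. \<integral>\<^sup>+x. ennreal ((norm (X m x - X (r i) x))\<^sup>2) \<partial>M) \<le> liminf (\<lambda>i::nat. ennreal e)"
        by (rule Liminf_mono)
      then show ?thesis by (simp add: Liminf_const)
    qed
    finally show ?thesis using integrable_of_nn_integral_le[OF mm, of e] e by simp
  qed
  have l2Y: "l2 M Y"
  proof -
    obtain N where "\<And>i j. N \<le> i \<Longrightarrow> N \<le> j \<Longrightarrow> (\<integral>x. (norm (X i x - X j x))\<^sup>2 \<partial>M) < 1"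
      using cauchy[of 1] by auto
    from key[OF zero_less_one this, of N N] have "l2 M (\<lambda>x. X N x - Y x)"
      unfolding l2_def using mX[of N] mY by auto
    from l2_diff[OF X[of N] this] show ?thesis by simp
  qed
  have "(\<lambda>m. \<integral>x. (norm (X m x - Y x))\<^sup>2 \<partial>M) \<longlonglongrightarrow> 0"
  proof (rule LIMSEQ_I)
    fix e :: real assume e: "0 < e"
    then have e2: "0 < e / 2" by simp
    from cauchy[OF this] obtain N where N: "\<And>i j. N \<le> i \<Longrightarrow> N \<le> j \<Longrightarrow> (\<integral>x. (norm (X i x - X j x))\<^sup>2 \<partial>M) < e / 2"
      by auto
    have "norm ((\<integral>x. (norm (X m x - Y x))\<^sup>2 \<partial>M) - 0) < e" if "N \<le> m" for m
      using key[OF e2 N that] e by simp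
    then show "\<exists>N. \<forall>m\<ge>N. norm ((\<integral>x. (norm (X m x - Y x))\<^sup>2 \<partial>M) - 0) < e" by blast
  qed
  with l2Y show ?thesis by (rule that)
qed

text \<open>A convex combination of members of the tail from \<open>j\<close> on. Restricting to
  tails lets uniform convergence of the members pass to the combinations, see
  \<open>cvx_norm_le\<close>; zero weights beyond \<open>N\<close> let two combinations be written
  with a common upper limit.\<close>

definition cvx :: "nat \<Rightarrow> nat \<Rightarrow> (nat \<Rightarrow> real) \<Rightarrow> bool" where
  "cvx j N lam \<longleftrightarrow> (\<forall>i. 0 \<le> lam i) \<and> (\<forall>i. lam i \<noteq> 0 \<longrightarrow> j \<le> i \<and> i \<le> N) \<and> (\<Sum>i\<le>N. lam i) = 1"

lemma cvx_extend:
  fixes x :: "nat \<Rightarrow> 'b::real_vector"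
  assumes "cvx j N lam" "N \<le> N'"
  shows "(\<Sum>i\<le>N'. lam i *\<^sub>R x i) = (\<Sum>i\<le>N. lam i *\<^sub>R x i)"
proof (rule sum.mono_neutral_right)
  have "lam i = 0" if "N < i" for i using assms(1) that unfolding cvx_def by (meson not_le)
  then show "\<forall>i\<in>{..N'} - {..N}. lam i *\<^sub>R x i = 0"
    by (intro ballI) (simp add: not_le)
qed (use assms(2) in auto)

lemma cvx_average:
  assumes "cvx j N lam" "cvx j' N' lam'" "j \<le> j'"
  shows "cvx j (max N N') (\<lambda>i. (lam i + lam' i) / 2)"
proof -
  have "(\<Sum>i\<le>max N N'. lam i) = 1" "(\<Sum>i\<le>max N N'. lam' i) = 1"
    using cvx_extend[OF assms(1), of "max N N'" "\<lambda>_. 1::real"] cvx_extend[OF assms(2), of "max N N'" "\<lambda>_. 1::real"] assms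
    by (auto simp: cvx_def)
  then have "(\<Sum>i\<le>max N N'. (lam i + lam' i) / 2) = 1"
    by (simp add: sum_divide_distrib[symmetric] sum.distrib)
  then show ?thesis
    using assms unfolding cvx_def by (auto simp: add_nonneg_eq_0_iff)
qed

lemma parallelogram: "(norm (x - y))\<^sup>2 = 2 * (norm x)\<^sup>2 + 2 * (norm y)\<^sup>2 - 4 * (norm ((1/2) *\<^sub>R (x + y)))\<^sup>2"
  for x y :: "'a::real_inner"
proof -
  have "(norm ((1/2) *\<^sub>R (x + y)))\<^sup>2 = (norm (x + y))\<^sup>2 / 4"
    unfolding norm_scaleR power_mult_distrib by (simp add: power2_eq_square)
  then show ?thesis
    by (simp add: power2_norm_eq_inner inner_simps inner_commute)
qed

text \<open>Take nearly norm-minimal elements of the convex hulls of the tails and apply the parallelogram law.\<close>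
lemma convex_combinations_cauchy:
  fixes X :: "nat \<Rightarrow> 'k \<Rightarrow> 'p \<Rightarrow> 'a::euclidean_space"
  assumes I: "finite I" and X: "\<And>i k. k \<in> I \<Longrightarrow> l2 M (X i k)"
    and C: "\<And>i. (\<Sum>k\<in>I. \<integral>x. (norm (X i k x))\<^sup>2 \<partial>M) \<le> C"
  obtains N lam where "\<And>m. cvx m (N m) (lam m)"
    "\<And>e. 0 < e \<Longrightarrow> \<exists>m0. \<forall>m\<ge>m0. \<forall>m'\<ge>m0. \<forall>k\<in>I.
       (\<integral>x. (norm ((\<Sum>i\<le>N m. lam m i *\<^sub>R X i k x) - (\<Sum>i\<le>N m'. lam m' i *\<^sub>R X i k x)))\<^sup>2 \<partial>M) < e"
proof -
  define G where "G N lam k x = (\<Sum>i\<le>N. lam i *\<^sub>R X i k x)" for N lam k x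
  define Q where "Q N lam = (\<Sum>k\<in>I. \<integral>x. (norm (G N lam k x))\<^sup>2 \<partial>M)" for N lam
  have l2G: "l2 M (G N lam k)" if "k \<in> I" for N lam k
    unfolding G_def using that by (intro l2_sum l2_scaleR X) auto
  have Q0: "0 \<le> Q N lam" for N lam unfolding Q_def by (intro sum_nonneg) simp
  define S where "S j = {Q N lam | N lam. cvx j N lam}" for j
  \<comment> \<open>The infimum over ever smaller hulls increases with \<open>j\<close> and stays
    below \<open>C\<close>, hence converges. This is what makes nearly minimal elements of different
    tails close to each other.\<close>
  define V where "V j = Inf (S j)" for j
  have bdd: "bdd_below (S j)" for j by (rule bdd_belowI[of _ 0]) (auto simp: S_def Q0)
  have single: "Q j (\<lambda>i. if i = j then 1 else 0) \<le> C" "cvx j j (\<lambda>i. if i = j then 1 else 0)" for j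
  proof -
    have "G j (\<lambda>i. if i = j then 1 else 0) k x = X j k x" for k x
    proof -
      have "G j (\<lambda>i. if i = j then 1 else 0) k x = (\<Sum>i\<le>j. if i = j then X i k x else 0)"
        unfolding G_def by (rule sum.cong) auto
      then show ?thesis by simp
    qed
    then show "Q j (\<lambda>i. if i = j then 1 else 0) \<le> C" unfolding Q_def using C by simp
  qed (auto simp: cvx_def)
  have ne: "S j \<noteq> {}" for j using single(2)[of j] unfolding S_def by blast
  have VC: "V j \<le> C" for j
  proof -
    have "Q j (\<lambda>i. if i = j then 1 else 0) \<in> S j" using single(2)[of j] unfolding S_def by blast
    from cInf_lower[OF this bdd] show ?thesis unfolding V_def using single(1)[of j] by linarith
  qed
  have Vmono: "V j \<le> V j'" if "j \<le> j'" for j j'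
    unfolding V_def
  proof (rule cInf_superset_mono[OF ne bdd])
    have "cvx j N lam" if "cvx j' N lam" for N lam
      using that \<open>j \<le> j'\<close> unfolding cvx_def by fastforce
    then show "S j' \<subseteq> S j" unfolding S_def by blast
  qed
  have "convergent V"
  proof (rule Bseq_monoseq_convergent)
    have "0 \<le> V j" for j unfolding V_def by (rule cInf_greatest[OF ne]) (auto simp: S_def Q0)
    then show "Bseq V" using VC by (intro BseqI'[of _ C]) auto
    show "monoseq V" unfolding monoseq_def using Vmono by blast
  qed
  then have cV: "Cauchy V" by (rule convergent_Cauchy)
  have "\<forall>m. \<exists>p. cvx m (fst p) (snd p) \<and> Q (fst p) (snd p) < V m + 1 / (real m + 1)"
  proof
    fix m
    have "\<exists>z\<in>S m. z < V m + 1 / (real m + 1)"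
      by (rule cInf_lessD[OF ne]) (simp add: V_def)
    then show "\<exists>p. cvx m (fst p) (snd p) \<and> Q (fst p) (snd p) < V m + 1 / (real m + 1)"
      unfolding S_def by fastforce
  qed
  then obtain p where p: "\<And>m. cvx m (fst (p m)) (snd (p m))"
     "\<And>m. Q (fst (p m)) (snd (p m)) < V m + 1 / (real m + 1)" by metis
  define N where "N m = fst (p m)" for m
  define lam where "lam m = snd (p m)" for m
  \<comment> \<open>The midpoint of the two chosen elements lies in the hull of the earlier tail, so
    its size is at least \<open>V m\<close>; the parallelogram law bounds the distance by what the
    two elements exceed this.\<close>
  have diff: "(\<Sum>k\<in>I. \<integral>x. (norm (G (N m) (lam m) k x - G (N m') (lam m') k x))\<^sup>2 \<partial>M)
      \<le> 2 * (V m' - V m) + 4 / (real m + 1)" if mm: "m \<le> m'" for m m'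
  proof -
    define K where "K = max (N m) (N m')"
    have av: "cvx m K (\<lambda>i. (lam m i + lam m' i) / 2)"
      unfolding K_def N_def lam_def by (rule cvx_average[OF p(1) p(1) mm])
    have avG: "G K (\<lambda>i. (lam m i + lam m' i) / 2) k x = (1/2) *\<^sub>R (G (N m) (lam m) k x + G (N m') (lam m') k x)" for k x
    proof -
      have "G (N m) (lam m) k x = (\<Sum>i\<le>K. lam m i *\<^sub>R X i k x)" "G (N m') (lam m') k x = (\<Sum>i\<le>K. lam m' i *\<^sub>R X i k x)"
        unfolding G_def N_def lam_def K_def by (auto intro!: cvx_extend[symmetric] p(1))
      then show ?thesis
        unfolding G_def by (simp add: scaleR_sum_right sum.distrib[symmetric] scaleR_add_left[symmetric])
    qed
    have "V m \<le> Q K (\<lambda>i. (lam m i + lam m' i) / 2)"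
      unfolding V_def by (rule cInf_lower[OF _ bdd]) (use av in \<open>auto simp: S_def\<close>)
    also have "\<dots> = (\<Sum>k\<in>I. \<integral>x. (norm ((1/2) *\<^sub>R (G (N m) (lam m) k x + G (N m') (lam m') k x)))\<^sup>2 \<partial>M)"
      unfolding Q_def avG ..
    finally have Vle: "V m \<le> (\<Sum>k\<in>I. \<integral>x. (norm ((1/2) *\<^sub>R (G (N m) (lam m) k x + G (N m') (lam m') k x)))\<^sup>2 \<partial>M)" .
    have "(\<Sum>k\<in>I. \<integral>x. (norm (G (N m) (lam m) k x - G (N m') (lam m') k x))\<^sup>2 \<partial>M)
      = (\<Sum>k\<in>I. 2 * (\<integral>x. (norm (G (N m) (lam m) k x))\<^sup>2 \<partial>M) + 2 * (\<integral>x. (norm (G (N m') (lam m') k x))\<^sup>2 \<partial>M)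
          - 4 * (\<integral>x. (norm ((1/2) *\<^sub>R (G (N m) (lam m) k x + G (N m') (lam m') k x)))\<^sup>2 \<partial>M))"
    proof (rule sum.cong[OF refl])
      fix k assume k: "k \<in> I"
      note i = l2_integrable_norm2[OF l2G[OF k, of "N m" "lam m"]] l2_integrable_norm2[OF l2G[OF k, of "N m'" "lam m'"]]
        l2_integrable_norm2[OF l2_scaleR[OF l2_add[OF l2G[OF k, of "N m" "lam m"] l2G[OF k, of "N m'" "lam m'"]], of "1/2"]]
      show "(\<integral>x. (norm (G (N m) (lam m) k x - G (N m') (lam m') k x))\<^sup>2 \<partial>M) =
        2 * (\<integral>x. (norm (G (N m) (lam m) k x))\<^sup>2 \<partial>M) + 2 * (\<integral>x. (norm (G (N m') (lam m') k x))\<^sup>2 \<partial>M)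
          - 4 * (\<integral>x. (norm ((1/2) *\<^sub>R (G (N m) (lam m) k x + G (N m') (lam m') k x)))\<^sup>2 \<partial>M)"
        unfolding parallelogram
        by (subst Bochner_Integration.integral_diff, use i in simp, use i in simp,
            subst Bochner_Integration.integral_add, use i in simp, use i in simp) simp
    qed
    also have "\<dots> = 2 * Q (N m) (lam m) + 2 * Q (N m') (lam m')
        - 4 * (\<Sum>k\<in>I. \<integral>x. (norm ((1/2) *\<^sub>R (G (N m) (lam m) k x + G (N m') (lam m') k x)))\<^sup>2 \<partial>M)"
      unfolding Q_def by (simp only: sum_subtractf sum.distrib sum_distrib_left)
    also have "\<dots> \<le> 2 * (V m + 1 / (real m + 1)) + 2 * (V m' + 1 / (real m' + 1)) - 4 * V m"
      using p(2)[of m] p(2)[of m'] Vle unfolding N_def lam_def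
      by (intro diff_mono add_mono mult_left_mono) auto
    also have "\<dots> \<le> 2 * (V m' - V m) + 4 / (real m + 1)"
    proof -
      have "1 / (real m' + 1) \<le> 1 / (real m + 1)" using mm by (intro divide_left_mono) auto
      then show ?thesis by simp
    qed
    finally show ?thesis .
  qed
  have small: "\<exists>m0. \<forall>m\<ge>m0. \<forall>m'\<ge>m0. \<forall>k\<in>I.
       (\<integral>x. (norm (G (N m) (lam m) k x - G (N m') (lam m') k x))\<^sup>2 \<partial>M) < e" if e: "0 < e" for e
  proof -
    obtain m1 where m1: "\<And>i j. m1 \<le> i \<Longrightarrow> m1 \<le> j \<Longrightarrow> norm (V i - V j) < e / 4"
      using CauchyD[OF cV, of "e/4"] e by auto
    obtain m2 :: nat where m2: "8 / e < real m2" using reals_Archimedean2 by blast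
    have one: "(\<integral>x. (norm (G (N m) (lam m) k x - G (N m') (lam m') k x))\<^sup>2 \<partial>M) < e"
      if "max m1 m2 \<le> m" "m \<le> m'" "k \<in> I" for m m' k
    proof -
      have "(\<integral>x. (norm (G (N m) (lam m) k x - G (N m') (lam m') k x))\<^sup>2 \<partial>M) \<le>
          (\<Sum>k\<in>I. \<integral>x. (norm (G (N m) (lam m) k x - G (N m') (lam m') k x))\<^sup>2 \<partial>M)"
        using that(3) I by (intro member_le_sum) auto
      also have "\<dots> \<le> 2 * (V m' - V m) + 4 / (real m + 1)" by (rule diff[OF that(2)])
      also have "\<dots> < e"
      proof -
        have "norm (V m' - V m) < e / 4" by (rule m1) (use that in auto)
        then have "V m' - V m < e / 4" using abs_ge_self[of "V m' - V m"] unfolding real_norm_def by linarith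
        moreover have "4 / (real m + 1) < e / 2"
        proof -
          have "8 / e < real m + 1" using m2 that by auto
          then show ?thesis using e by (simp add: field_simps)
        qed
        ultimately show ?thesis by simp
      qed
      finally show ?thesis .
    qed
    show ?thesis
    proof (intro exI[of _ "max m1 m2"] allI impI ballI)
      fix m m' k assume *: "max m1 m2 \<le> m" "max m1 m2 \<le> m'" "k \<in> I"
      show "(\<integral>x. (norm (G (N m) (lam m) k x - G (N m') (lam m') k x))\<^sup>2 \<partial>M) < e"
      proof (cases "m \<le> m'")
        case True
        then show ?thesis using one * by blast
      next
        case False
        then show ?thesis using one[of m' m k] * by (simp add: norm_minus_commute)
      qed
    qed
  qed
  show ?thesis
  proof (rule that[of N lam])
    show "cvx m (N m) (lam m)" for m unfolding N_def lam_def by (rule p(1))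
    show "\<exists>m0. \<forall>m\<ge>m0. \<forall>m'\<ge>m0. \<forall>k\<in>I.
       (\<integral>x. (norm ((\<Sum>i\<le>N m. lam m i *\<^sub>R X i k x) - (\<Sum>i\<le>N m'. lam m' i *\<^sub>R X i k x)))\<^sup>2 \<partial>M) < e" if "0 < e" for e
      using small[OF that] unfolding G_def .
  qed
qed

lemma cvx_norm_le:
  fixes x :: "nat \<Rightarrow> 'a::real_normed_vector"
  assumes "cvx j N lam" "\<And>i. j \<le> i \<Longrightarrow> norm (x i - y) \<le> e"
  shows "norm ((\<Sum>i\<le>N. lam i *\<^sub>R x i) - y) \<le> e"
proof -
  have s: "(\<Sum>i\<le>N. lam i) = 1" and l: "0 \<le> lam i" "lam i \<noteq> 0 \<Longrightarrow> j \<le> i" for i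
    using assms(1) by (auto simp: cvx_def)
  have "(\<Sum>i\<le>N. lam i *\<^sub>R x i) - y = (\<Sum>i\<le>N. lam i *\<^sub>R (x i - y))"
    using s by (simp add: scaleR_diff_right sum_subtractf scaleR_sum_left[symmetric])
  also have "norm \<dots> \<le> (\<Sum>i\<le>N. lam i * e)"
  proof (rule sum_norm_le)
    fix i
    show "norm (lam i *\<^sub>R (x i - y)) \<le> lam i * e"
      using assms(2)[of i] l[of i] by (cases "lam i = 0") (auto intro: mult_left_mono)
  qed
  also have "\<dots> = e" using s by (simp add: sum_distrib_right[symmetric])
  finally show ?thesis .
qed

lemma cvx_sum_le:
  fixes x :: "nat \<Rightarrow> real"
  assumes "cvx j N lam" "\<And>i. j \<le> i \<Longrightarrow> x i \<le> e"
  shows "(\<Sum>i\<le>N. lam i * x i) \<le> e"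
proof -
  have s: "(\<Sum>i\<le>N. lam i) = 1" and l: "0 \<le> lam i" "lam i \<noteq> 0 \<Longrightarrow> j \<le> i" for i
    using assms(1) by (auto simp: cvx_def)
  have "(\<Sum>i\<le>N. lam i * x i) \<le> (\<Sum>i\<le>N. lam i * e)"
  proof (rule sum_mono)
    fix i show "lam i * x i \<le> lam i * e"
      using assms(2)[of i] l[of i] by (cases "lam i = 0") (auto intro: mult_left_mono)
  qed
  also have "\<dots> = e" using s by (simp add: sum_distrib_right[symmetric])
  finally show ?thesis .
qed

section \<open>Equicontinuity\<close>

text \<open>First \<eta> is taken large enough to make A B / \<eta> at most e/2, then
  \<open>d\<close> small enough to do the same for A \<eta> x. The summands 1 in their definitions
  cover the cases where A or B is 0.\<close>

lemma small_modulus: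
  fixes A B e :: real
  assumes "0 \<le> A" "0 \<le> B" "0 < e"
  obtains \<eta> d where "0 < \<eta>" "0 < d" "\<And>x. 0 \<le> x \<Longrightarrow> x < d \<Longrightarrow> A * (\<eta> * x + B / \<eta>) \<le> e"
proof -
  define \<eta> where "\<eta> = 2 * (A * B + 1) / e"
  define d where "d = e / (2 * (A * \<eta> + 1))"
  have AB: "0 \<le> A * B" using assms by simp
  have \<eta>: "0 < \<eta>" unfolding \<eta>_def using AB assms(3) by (intro divide_pos_pos mult_pos_pos) linarith+
  have A\<eta>: "0 \<le> A * \<eta>" using assms \<eta> by simp
  have d: "0 < d" unfolding d_def using A\<eta> assms by simp
  have "A * (\<eta> * x + B / \<eta>) \<le> e" if x: "0 \<le> x" "x < d" for x
  proof -
    have "A * \<eta> * x \<le> A * \<eta> * d" using x A\<eta> by (intro mult_left_mono) auto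
    also have "\<dots> \<le> (A * \<eta> + 1) * d" using d by simp
    also have "\<dots> = e / 2" unfolding d_def using A\<eta> by (simp add: field_simps)
    finally have 1: "A * \<eta> * x \<le> e / 2" .
    have "A * B / \<eta> \<le> (A * B + 1) / \<eta>" using \<eta> by (simp add: divide_right_mono)
    also have "\<dots> = e / 2"
    proof -
      have "x / (2 * x / e) = e / 2" if "0 < x" for x :: real using that assms(3) by (simp add: field_simps)
      from this[of "A * B + 1"] show ?thesis unfolding \<eta>_def using AB by linarith
    qed
    finally have 2: "A * B / \<eta> \<le> e / 2" .
    have "A * (\<eta> * x + B / \<eta>) = A * \<eta> * x + A * B / \<eta>" by (simp add: algebra_simps)
    then show ?thesis using 1 2 by linarith
  qed
  with \<eta> d show ?thesis by (rule that)
qed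

lemma arc_equicontinuous:
  fixes c q :: "nat \<Rightarrow> real \<Rightarrow> real \<Rightarrow> 'a::euclidean_space"
  assumes est: "\<And>j. arc_estimates n a (c j) (q j) (E j) M m0 M0"
    and q0: "\<And>j \<theta>. \<theta> \<in> {0..1} \<Longrightarrow> q j 0 \<theta> = q0 \<theta>" and cont: "continuous_on {0..1} q0" and e: "0 < e"
  obtains d where "0 < d" "\<And>j t t' \<theta> \<theta>'. t \<in> {0..1} \<Longrightarrow> t' \<in> {0..1} \<Longrightarrow> \<theta> \<in> {0..1} \<Longrightarrow> \<theta>' \<in> {0..1} \<Longrightarrow>
     \<bar>t - t'\<bar> < d \<Longrightarrow> \<bar>\<theta> - \<theta>'\<bar> < d \<Longrightarrow> norm (q j t \<theta> - q j t' \<theta>') \<le> e \<and> norm (c j t \<theta> - c j t' \<theta>') \<le> e"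
proof -
  interpret e0: arc_estimates n a "c 0" "q 0" "E 0" M m0 M0 by (rule est)
  define Mq where "Mq = e0.Mq"
  define ew where "ew = e0.energy_weight 2"
  define X where "X = exp (2 * (1 + sob_const a 1 * M))"
  have Mq: "0 < Mq" and ew: "0 < ew" unfolding Mq_def ew_def by (rule e0.Mq_pos e0.energy_weight_pos)+
  note pos = e0.sob_const_pos[of 0] e0.sob_const_pos[of 1] e0.M
  \<comment> \<open>As locale constants \<open>Mq\<close> and \<open>energy_weight\<close> take the
    parameters but not the path, so one modulus serves for every \<open>j\<close>.\<close>
  have Mqj: "arc_estimates.Mq a M M0 = Mq" for j
    unfolding Mq_def ..
  have ewj: "arc_estimates.energy_weight a M m0 M0 2 = ew" unfolding ew_def ..
  obtain \<eta>1 d1 where 1: "0 < \<eta>1" "0 < d1" "\<And>x. 0 \<le> x \<Longrightarrow> x < d1 \<Longrightarrow> Mq * (\<eta>1 * x + sob_const a 1 * M / \<eta>1) \<le> e / 2"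
    using small_modulus[of Mq "sob_const a 1 * M" "e/2"] Mq pos e by auto
  obtain \<eta>2 d2 where 2: "0 < \<eta>2" "0 < d2" "\<And>x. 0 \<le> x \<Longrightarrow> x < d2 \<Longrightarrow> 1 * (\<eta>2 * x + (sob_const a 0 * Mq\<^sup>2) * M / \<eta>2) \<le> e / 2"
    using small_modulus[of 1 "(sob_const a 0 * Mq\<^sup>2) * M" "e/2"] pos e by auto
  obtain \<eta>3 d3 where 3: "0 < \<eta>3" "0 < d3" "\<And>x. 0 \<le> x \<Longrightarrow> x < d3 \<Longrightarrow> (2 * Mq\<^sup>2 * X) * (\<eta>3 * x + M / ew / \<eta>3) \<le> e / 4"
    using small_modulus[of "2 * Mq\<^sup>2 * X" "M / ew" "e/4"] pos e ew by (auto simp: X_def)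
  have X0: "0 < X" by (simp add: X_def)
  \<comment> \<open>In \<open>q_space\<close> the initial difference is multiplied by 2 X, so the
    bound e / (8 X) leaves e / 4 for it.\<close>
  obtain d4 where 4: "0 < d4" "\<And>x y. x \<in> {0..1} \<Longrightarrow> y \<in> {0..1} \<Longrightarrow> \<bar>x - y\<bar> < d4 \<Longrightarrow> norm (q0 x - q0 y) \<le> e / (8 * X)"
    using uniformly_continuous_unit[OF cont, of "e / (8 * X)"] e X0 by auto
  define d where "d = min (min d1 d2) (min (min d3 d4) (e / (2 * Mq)))"
  have d: "0 < d" "d \<le> d1" "d \<le> d2" "d \<le> d3" "d \<le> d4" "d \<le> e / (2 * Mq)"
    unfolding d_def using 1 2 3 4 e Mq by auto
  have qt: "norm (q j t' \<theta> - q j t \<theta>) \<le> e / 2" and ct: "norm (c j t' \<theta> - c j t \<theta>) \<le> e / 2"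
    if "t \<in> {0..1}" "t' \<in> {0..1}" "t \<le> t'" "\<theta> \<in> {0..1}" "t' - t < d" for j t t' \<theta>
  proof -
    interpret ej: arc_estimates n a "c j" "q j" "E j" M m0 M0 by (rule est)
    show "norm (q j t' \<theta> - q j t \<theta>) \<le> e / 2"
      by (rule order_trans[OF ej.q_time[OF that(1-4) 1(1), unfolded Mqj] 1(3)]) (use that d in auto)
    show "norm (c j t' \<theta> - c j t \<theta>) \<le> e / 2"
      by (rule order_trans[OF ej.c_time[OF that(1-4) 2(1), unfolded Mqj] 2(3)]) (use that d in auto)
  qed
  have qs: "norm (q j t \<theta>' - q j t \<theta>) \<le> e / 2" and cs: "norm (c j t \<theta>' - c j t \<theta>) \<le> e / 2"
    if "t \<in> {0..1}" "\<theta> \<in> {0..1}" "\<theta>' \<in> {0..1}" "\<theta> \<le> \<theta>'" "\<theta>' - \<theta> < d" for j t \<theta> \<theta>'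
  proof -
    interpret ej: arc_estimates n a "c j" "q j" "E j" M m0 M0 by (rule est)
    have "norm (q j t \<theta>' - q j t \<theta>) \<le> 2 * (norm (q0 \<theta>' - q0 \<theta>) + Mq\<^sup>2 * (\<eta>3 * (\<theta>' - \<theta>) + M / ew / \<eta>3)) * X"
      using ej.q_space[OF that(1-4) 3(1)] q0[OF that(2), of j] q0[OF that(3), of j] unfolding Mqj ewj X_def by simp
    also have "\<dots> = 2 * X * norm (q0 \<theta>' - q0 \<theta>) + (2 * Mq\<^sup>2 * X) * (\<eta>3 * (\<theta>' - \<theta>) + M / ew / \<eta>3)"
      by (simp add: algebra_simps)
    also have "\<dots> \<le> 2 * X * (e / (8 * X)) + e / 4"
      using 4(2)[OF that(3,2)] 3(3)[of "\<theta>' - \<theta>"] that d X0 by (intro add_mono mult_left_mono) auto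
    also have "\<dots> = e / 2" using X0 by simp
    finally show "norm (q j t \<theta>' - q j t \<theta>) \<le> e / 2" .
    have "norm (c j t \<theta>' - c j t \<theta>) \<le> Mq * (\<theta>' - \<theta>)" using ej.c_space[OF that(1-4)] unfolding Mqj .
    also have "\<dots> \<le> Mq * (e / (2 * Mq))" using that d Mq by (intro mult_left_mono) auto
    also have "\<dots> = e / 2" using Mq by simp
    finally show "norm (c j t \<theta>' - c j t \<theta>) \<le> e / 2" .
  qed
  show ?thesis
  proof (rule that[OF d(1)])
    fix j t t' \<theta> \<theta>' assume *: "t \<in> {0..1}" "t' \<in> {0..1}" "\<theta> \<in> {0..1}" "\<theta>' \<in> {0..1}"
      and dd: "\<bar>t - t'\<bar> < d" "\<bar>\<theta> - \<theta>'\<bar> < d"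
    have t1: "norm (q j t \<theta> - q j t' \<theta>) \<le> e / 2 \<and> norm (c j t \<theta> - c j t' \<theta>) \<le> e / 2"
      using qt[of t t' \<theta> j] qt[of t' t \<theta> j] ct[of t t' \<theta> j] ct[of t' t \<theta> j] * dd
      by (cases "t \<le> t'") (auto simp: norm_minus_commute[of "q j t \<theta>"] norm_minus_commute[of "c j t \<theta>"])
    have t2: "norm (q j t' \<theta> - q j t' \<theta>') \<le> e / 2 \<and> norm (c j t' \<theta> - c j t' \<theta>') \<le> e / 2"
      using qs[of t' \<theta> \<theta>' j] qs[of t' \<theta>' \<theta> j] cs[of t' \<theta> \<theta>' j] cs[of t' \<theta>' \<theta> j] * dd
      by (cases "\<theta> \<le> \<theta>'") (auto simp: norm_minus_commute[of "q j t' \<theta>"] norm_minus_commute[of "c j t' \<theta>"])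
    have "norm (q j t \<theta> - q j t' \<theta>') \<le> norm (q j t \<theta> - q j t' \<theta>) + norm (q j t' \<theta> - q j t' \<theta>')"
      "norm (c j t \<theta> - c j t' \<theta>') \<le> norm (c j t \<theta> - c j t' \<theta>) + norm (c j t' \<theta> - c j t' \<theta>')"
      by (rule norm_diff_triangle_ineq[of _ 0 0, simplified] norm_diff_triangle_le[OF order_refl order_refl])+
    then show "norm (q j t \<theta> - q j t' \<theta>') \<le> e \<and> norm (c j t \<theta> - c j t' \<theta>') \<le> e"
      using t1 t2 by linarith
  qed
qed

text \<open>Continuity of the limits in \<theta> is recorded along with the convergence, because
  later arguments work at one fixed time and need it there.\<close>

definition arc_converges :: "(nat \<Rightarrow> real \<Rightarrow> real \<Rightarrow> 'a::euclidean_space) \<Rightarrow> (nat \<Rightarrow> real \<Rightarrow> real \<Rightarrow> 'a) \<Rightarrow>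
    (real \<Rightarrow> real \<Rightarrow> 'a) \<Rightarrow> (real \<Rightarrow> real \<Rightarrow> 'a) \<Rightarrow> bool" where
  "arc_converges c q c' q' \<longleftrightarrow> (\<forall>e>0. \<exists>N. \<forall>j\<ge>N. \<forall>t\<in>{0..1}. \<forall>\<theta>\<in>{0..1}.
      norm (c j t \<theta> - c' t \<theta>) \<le> e \<and> norm (q j t \<theta> - q' t \<theta>) \<le> e) \<and>
      (\<forall>t\<in>{0..1}. continuous_on {0..1} (q' t) \<and> continuous_on {0..1} (c' t))"

lemma arc_converges_pointwise:
  assumes "arc_converges c q cl ql" "t \<in> {0..1}" "\<theta> \<in> {0..1}"
  shows "(\<lambda>j. q j t \<theta>) \<longlonglongrightarrow> ql t \<theta>" "(\<lambda>j. c j t \<theta>) \<longlonglongrightarrow> cl t \<theta>"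
proof -
  have 1: "\<exists>J. \<forall>j\<ge>J. norm (q j t \<theta> - ql t \<theta>) < e \<and> norm (c j t \<theta> - cl t \<theta>) < e" if e: "0 < e" for e
  proof -
    have e2: "0 < e / 2" using e by simp
    obtain J where "\<forall>j\<ge>J. norm (c j t \<theta> - cl t \<theta>) \<le> e / 2 \<and> norm (q j t \<theta> - ql t \<theta>) \<le> e / 2"
      using assms e2 unfolding arc_converges_def by blast
    then show ?thesis using e by (intro exI[of _ J]) force
  qed
  show "(\<lambda>j. q j t \<theta>) \<longlonglongrightarrow> ql t \<theta>" "(\<lambda>j. c j t \<theta>) \<longlonglongrightarrow> cl t \<theta>"
    by (rule LIMSEQ_I, use 1 in blast)+
qed

lemma arc_converges_subseq:
  assumes "arc_converges c q c' q'" "strict_mono r"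
  shows "arc_converges (\<lambda>j. c (r j)) (\<lambda>j. q (r j)) c' q'"
  using assms(1) seq_suble[OF assms(2)] unfolding arc_converges_def by (meson order_trans)

text \<open>Arzela-Ascoli is applied to the pair (c, q) as one map on the square, so a single
  subsequence serves for both.\<close>

lemma arc_subsequence:
  fixes c q :: "nat \<Rightarrow> real \<Rightarrow> real \<Rightarrow> 'a::euclidean_space"
  assumes est: "\<And>j. arc_estimates n a (c j) (q j) (E j) M m0 M0"
    and q0: "\<And>j \<theta>. \<theta> \<in> {0..1} \<Longrightarrow> q j 0 \<theta> = q0 \<theta>" and cont: "continuous_on {0..1} q0"
    and c0: "\<And>j \<theta>. \<theta> \<in> {0..1} \<Longrightarrow> c j 0 \<theta> = c0 \<theta>"
  obtains r c' q' where "strict_mono (r :: nat \<Rightarrow> nat)" "arc_converges (\<lambda>j. c (r j)) (\<lambda>j. q (r j)) c' q'"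
proof -
  interpret e0: arc_estimates n a "c 0" "q 0" "E 0" M m0 M0 by (rule est)
  define F where "F j p = (c j (fst p) (snd p), q j (fst p) (snd p))" for j p
  let ?S = "{0..1} \<times> {0..1} :: (real \<times> real) set"
  obtain C0 where C0: "\<And>\<theta>. \<theta> \<in> {0..1} \<Longrightarrow> norm (c0 \<theta>) \<le> C0"
  proof -
    have "continuous_on {0..1} (c 0 0)"
      by (rule has_prim_continuous[OF arc_pathD(4)[OF e0.ap]]) simp
    then obtain C where "\<And>\<theta>. \<theta> \<in> {0..1} \<Longrightarrow> norm (c 0 0 \<theta>) \<le> C" by (rule bounded_on_unit) blast
    then show ?thesis using c0[of _ 0] by (intro that[of C]) metis
  qed
  \<comment> \<open>The middle summand is the estimate \<open>c_time\<close> with \<eta> = 1 over a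
    time of at most 1; it bounds the drift away from the initial curve.\<close>
  define K where "K = C0 + (1 + (sob_const a 0 * e0.Mq\<^sup>2) * M) + e0.Mq"
  have "\<exists>g r. continuous_on ?S g \<and> strict_mono (r :: nat \<Rightarrow> nat) \<and>
    (\<forall>e>0. \<exists>N. \<forall>n x. n \<ge> N \<and> x \<in> ?S \<longrightarrow> norm (F (r n) x - g x) < e)"
  proof (rule Arzela_Ascoli[of ?S F K])
    show "compact ?S" by (intro compact_Times) auto
    show "norm (F j p) \<le> K" if pS: "p \<in> ?S" for j p
    proof -
      interpret ej: arc_estimates n a "c j" "q j" "E j" M m0 M0 by (rule est)
      obtain t \<theta> where p: "p = (t, \<theta>)" "t \<in> {0..1}" "\<theta> \<in> {0..1}" using pS by auto
      have "norm (c j t \<theta> - c j 0 \<theta>) \<le> 1 * (1 * (t - 0) + (sob_const a 0 * ej.Mq\<^sup>2) * M / 1)"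
        by (rule ej.c_time) (use p in auto)
      then have "norm (c j t \<theta> - c j 0 \<theta>) \<le> 1 + (sob_const a 0 * ej.Mq\<^sup>2) * M" using p by simp
      then have "norm (c j t \<theta>) \<le> C0 + (1 + (sob_const a 0 * ej.Mq\<^sup>2) * M)"
        using C0[OF p(3)] c0[OF p(3), of j] norm_triangle_sub[of "c j t \<theta>" "c j 0 \<theta>"] by simp
      then show ?thesis
        using ej.q_bounds(2)[OF p(2,3)] norm_Pair_le[of "c j t \<theta>" "q j t \<theta>"] unfolding F_def K_def p by simp
    qed
    show "\<exists>d>0. \<forall>j y. y \<in> ?S \<and> norm (x - y) < d \<longrightarrow> norm (F j x - F j y) < e" if x: "x \<in> ?S" and e: "0 < e" for x e
    proof -
      have e3: "0 < e / 3" using e by simp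
      obtain d where d: "0 < d" "\<And>j t t' \<theta> \<theta>'. t \<in> {0..1} \<Longrightarrow> t' \<in> {0..1} \<Longrightarrow> \<theta> \<in> {0..1} \<Longrightarrow> \<theta>' \<in> {0..1} \<Longrightarrow>
         \<bar>t - t'\<bar> < d \<Longrightarrow> \<bar>\<theta> - \<theta>'\<bar> < d \<Longrightarrow> norm (q j t \<theta> - q j t' \<theta>') \<le> e / 3 \<and> norm (c j t \<theta> - c j t' \<theta>') \<le> e / 3"
        by (rule arc_equicontinuous[where c = c and q = q and E = E, OF est q0 cont e3]) blast+
      show ?thesis
      proof (intro exI[of _ d] conjI allI impI d(1))
        fix j y assume y: "y \<in> ?S \<and> norm (x - y) < d"
        have "norm (fst (x - y)) \<le> norm (x - y)" "norm (snd (x - y)) \<le> norm (x - y)"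
          using norm_fst_le[of "fst (x - y)" "snd (x - y)"] norm_snd_le[of "snd (x - y)" "fst (x - y)"]
          by (simp_all only: prod.collapse)
        then have "\<bar>fst x - fst y\<bar> < d" "\<bar>snd x - snd y\<bar> < d"
          using conjunct2[OF y] unfolding fst_diff snd_diff real_norm_def by linarith+
        then have "norm (q j (fst x) (snd x) - q j (fst y) (snd y)) \<le> e / 3 \<and>
            norm (c j (fst x) (snd x) - c j (fst y) (snd y)) \<le> e / 3"
          using x y by (intro d(2)) auto
        moreover have "norm (F j x - F j y) \<le> norm (c j (fst x) (snd x) - c j (fst y) (snd y)) +
            norm (q j (fst x) (snd x) - q j (fst y) (snd y))"
          unfolding F_def diff_Pair by (rule norm_Pair_le)
        ultimately show "norm (F j x - F j y) < e" using e by linarith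
      qed
    qed
  qed blast
  then obtain g r where g: "continuous_on ?S g" and r: "strict_mono (r :: nat \<Rightarrow> nat)"
    and lim: "\<And>e. 0 < e \<Longrightarrow> \<exists>N. \<forall>n x. n \<ge> N \<and> x \<in> ?S \<longrightarrow> norm (F (r n) x - g x) < e"
    by blast
  define c' where "c' t \<theta> = fst (g (t, \<theta>))" for t \<theta>
  define q' where "q' t \<theta> = snd (g (t, \<theta>))" for t \<theta>
  have "arc_converges (\<lambda>j. c (r j)) (\<lambda>j. q (r j)) c' q'"
    unfolding arc_converges_def
  proof (intro conjI allI impI ballI)
    fix e :: real assume "0 < e"
    then obtain N where N: "\<forall>n x. n \<ge> N \<and> x \<in> ?S \<longrightarrow> norm (F (r n) x - g x) < e" using lim by blast
    show "\<exists>N. \<forall>j\<ge>N. \<forall>t\<in>{0..1}. \<forall>\<theta>\<in>{0..1}. norm (c (r j) t \<theta> - c' t \<theta>) \<le> e \<and> norm (q (r j) t \<theta> - q' t \<theta>) \<le> e"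
    proof (intro exI[of _ N] allI impI ballI)
      fix j t \<theta> assume "N \<le> j" "t \<in> {0..1::real}" "\<theta> \<in> {0..1::real}"
      then have *: "norm (F (r j) (t, \<theta>) - g (t, \<theta>)) < e" using N by auto
      have "norm (fst (F (r j) (t, \<theta>) - g (t, \<theta>))) \<le> norm (F (r j) (t, \<theta>) - g (t, \<theta>))"
        "norm (snd (F (r j) (t, \<theta>) - g (t, \<theta>))) \<le> norm (F (r j) (t, \<theta>) - g (t, \<theta>))"
        using norm_fst_le[of "fst (F (r j) (t, \<theta>) - g (t, \<theta>))" "snd (F (r j) (t, \<theta>) - g (t, \<theta>))"]
          norm_snd_le[of "snd (F (r j) (t, \<theta>) - g (t, \<theta>))" "fst (F (r j) (t, \<theta>) - g (t, \<theta>))"]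
        by (simp_all only: prod.collapse)
      then have "norm (fst (F (r j) (t, \<theta>) - g (t, \<theta>))) \<le> e" "norm (snd (F (r j) (t, \<theta>) - g (t, \<theta>))) \<le> e"
        using * by linarith+
      then show "norm (c (r j) t \<theta> - c' t \<theta>) \<le> e \<and> norm (q (r j) t \<theta> - q' t \<theta>) \<le> e"
        by (simp add: c'_def q'_def F_def)
    qed
  next
    fix t :: real assume t: "t \<in> {0..1}"
    have gt: "continuous_on {0..1} (\<lambda>\<theta>. g (t, \<theta>))"
      by (rule continuous_on_compose2[OF g]) (use t in \<open>auto intro!: continuous_intros\<close>)
    show "continuous_on {0..1} (q' t)" unfolding q'_def by (rule continuous_on_snd[OF gt])
    show "continuous_on {0..1} (c' t)" unfolding c'_def by (rule continuous_on_fst[OF gt])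
  qed
  with r show ?thesis by (rule that)
qed

section \<open>Passing to the limit in the evolution equation\<close>

text \<open>Convergence in mean on the square identifies the limit equation for almost every
  \<theta>. Both sides are continuous in \<theta>, the integral by dominated convergence with
  \<open>b\<close>, so the equation holds at every \<theta>.\<close>

lemma evolution_limit:
  fixes X :: "real \<Rightarrow> real \<Rightarrow> 'a::euclidean_space"
  assumes X: "integrable leb01sq (case_prod X)" and Xc: "AE s in leb01. continuous_on {0..1} (X s)"
    and b: "integrable leb01 b" "AE s in leb01. \<forall>\<theta>\<in>{0..1}. norm (X s \<theta>) \<le> b s"
    and zc: "\<And>t. t \<in> {0..1} \<Longrightarrow> continuous_on {0..1} (z t)"
    and Xm: "\<And>m. integrable leb01sq (case_prod (Xm m))"
    and lim: "(\<lambda>m. \<integral>p. norm (case_prod (Xm m) p - case_prod X p) \<partial>leb01sq) \<longlonglongrightarrow> 0"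
    and zm: "\<And>m t \<theta>. t \<in> {0..1} \<Longrightarrow> \<theta> \<in> {0..1} \<Longrightarrow> zm m t \<theta> = z 0 \<theta> + prim (\<lambda>s. Xm m s \<theta>) t"
    and zlim: "\<And>e. 0 < e \<Longrightarrow> \<exists>N. \<forall>m\<ge>N. \<forall>t\<in>{0..1}. \<forall>\<theta>\<in>{0..1}. norm (zm m t \<theta> - z t \<theta>) \<le> e"
    and \<theta>: "\<theta> \<in> {0..1}"
  shows "has_prim (\<lambda>t. z t \<theta>) (\<lambda>s. X s \<theta>)"
proof (rule has_primI)
  have mX: "case_prod X \<in> borel_measurable leb01sq" using X by auto
  have sec: "(\<lambda>s. X s \<theta>) \<in> borel_measurable leb01" if "\<theta> \<in> {0..1}" for \<theta>
    by (rule section_measurable(2)[OF mX that])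
  have bX: "AE s in leb01. norm (X s \<theta>) \<le> b s" if "\<theta> \<in> {0..1}" for \<theta>
    using b(2) by eventually_elim (use that in blast)
  show "integrable leb01 (\<lambda>s. X s \<theta>)"
    by (rule Bochner_Integration.integrable_bound[OF b(1) sec[OF \<theta>]]) (use bX[OF \<theta>] in \<open>auto elim!: eventually_mono\<close>)
  fix t :: real assume t: "t \<in> {0..1}"
  define P where "P \<theta> = prim (\<lambda>s. X s \<theta>) t" for \<theta>
  have cP: "continuous_on {0..1} P"
    unfolding continuous_on_sequentially
  proof (intro allI ballI impI)
    fix x a assume a: "a \<in> {0..1::real}" and x: "(\<forall>n. x n \<in> {0..1}) \<and> x \<longlonglongrightarrow> a"
    show "(P \<circ> x) \<longlonglongrightarrow> P a"
      unfolding P_def comp_def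
    proof (rule prim_dominated_convergence[OF _ _ b(1)])
      show "AE s in leb01. (\<lambda>n. X s (x n)) \<longlonglongrightarrow> X s a"
        using Xc
      proof eventually_elim
        case (elim s)
        then show ?case using x a unfolding continuous_on_sequentially comp_def by blast
      qed
    qed (use sec bX x a in auto)
  qed
  define D where "D \<theta> = z t \<theta> - (z 0 \<theta> + P \<theta>)" for \<theta>
  have cD: "continuous_on {0..1} D"
    unfolding D_def by (intro continuous_on_diff continuous_on_add zc t cP) simp
  note Di = continuous_integrable_leb01[OF cD]
  have le: "(\<integral>\<theta>. norm (D \<theta>) \<partial>leb01) \<le> e" if e: "0 < e" for e
  proof -
    obtain N1 where N1: "\<And>m t \<theta>. N1 \<le> m \<Longrightarrow> t \<in> {0..1} \<Longrightarrow> \<theta> \<in> {0..1} \<Longrightarrow> norm (zm m t \<theta> - z t \<theta>) \<le> e / 2"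
      using zlim[OF half_gt_zero[OF e]] by blast
    obtain N2 where N2: "\<And>m. N2 \<le> m \<Longrightarrow> norm ((\<integral>p. norm (case_prod (Xm m) p - case_prod X p) \<partial>leb01sq) - 0) < e / 2"
      using LIMSEQ_D[OF lim, of "e/2"] e by auto
    define m where "m = max N1 N2"
    have di: "integrable leb01sq (\<lambda>(s, \<theta>). Xm m s \<theta> - X s \<theta>)"
      using Bochner_Integration.integrable_diff[OF Xm[of m] X] by (simp add: case_prod_beta')
    have din: "integrable leb01sq (\<lambda>(s, \<theta>). norm (Xm m s \<theta> - X s \<theta>))"
      using integrable_norm[OF di] by (simp add: case_prod_beta')
    have "(\<integral>\<theta>. norm (D \<theta>) \<partial>leb01) \<le> (\<integral>\<theta>. e / 2 + (\<integral>s. norm (Xm m s \<theta> - X s \<theta>) \<partial>leb01) \<partial>leb01)"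
    proof (rule integral_mono_AE)
      show "integrable leb01 (\<lambda>\<theta>. e / 2 + (\<integral>s. norm (Xm m s \<theta> - X s \<theta>) \<partial>leb01))"
        using leb01_pair.integrable_snd[OF din] by simp
      show "AE \<theta> in leb01. norm (D \<theta>) \<le> e / 2 + (\<integral>s. norm (Xm m s \<theta> - X s \<theta>) \<partial>leb01)"
        using leb01_pair.AE_integrable_snd[OF Xm[of m]] leb01_pair.AE_integrable_snd[OF X] AE_space
      proof eventually_elim
        case (elim \<theta>)
        then have \<theta>: "\<theta> \<in> {0..1}" by simp
        have i: "integrable leb01 (\<lambda>s. Xm m s \<theta> - X s \<theta>)" using elim by simp
        have "D \<theta> = (z t \<theta> - zm m t \<theta>) + prim (\<lambda>s. Xm m s \<theta> - X s \<theta>) t"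
          unfolding D_def P_def zm[OF t \<theta>] using elim by (simp add: prim_diff)
        also have "norm \<dots> \<le> e / 2 + (\<integral>s. norm (Xm m s \<theta> - X s \<theta>) \<partial>leb01)"
          using N1[of m t \<theta>] t \<theta> norm_prim_le_integral[OF i, of t]
          by (intro norm_triangle_le add_mono) (auto simp: m_def norm_minus_commute)
        finally show ?case .
      qed
    qed (use Di in simp)
    also have "\<dots> = e / 2 + (\<integral>\<theta>. \<integral>s. norm (Xm m s \<theta> - X s \<theta>) \<partial>leb01 \<partial>leb01)"
      using leb01_pair.integrable_snd[OF din] by (simp add: leb01.prob_space)
    also have "(\<integral>\<theta>. \<integral>s. norm (Xm m s \<theta> - X s \<theta>) \<partial>leb01 \<partial>leb01) = (\<integral>p. norm (case_prod (Xm m) p - case_prod X p) \<partial>leb01sq)"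
      using leb01_pair.integral_snd[OF din] by (simp add: case_prod_beta')
    also have "e / 2 + \<dots> \<le> e" using N2[of m] by (auto simp: m_def)
    finally show ?thesis .
  qed
  have "(\<integral>\<theta>. norm (D \<theta>) \<partial>leb01) = 0"
  proof (rule antisym)
    show "(\<integral>\<theta>. norm (D \<theta>) \<partial>leb01) \<le> 0" by (rule field_le_epsilon) (use le in simp)
  qed simp
  then have "AE \<theta> in leb01. D \<theta> = 0" using integral_nonneg_eq_0_iff_AE[OF integrable_norm[OF Di]] by simp
  from AE_eq_continuous_imp_eq[OF this cD continuous_on_const \<theta>] show "z t \<theta> = z 0 \<theta> + prim (\<lambda>s. X s \<theta>) t"
    by (simp add: D_def P_def)
qed

section \<open>The limit of a minimising sequence\<close>

lemma has_prim_sum_scaleR: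
  assumes "\<And>j. j \<in> I \<Longrightarrow> has_prim (f j) (g j)"
  shows "has_prim (\<lambda>x. \<Sum>j\<in>I. lam j *\<^sub>R f j x) (\<lambda>x. \<Sum>j\<in>I. lam j *\<^sub>R g j x)"
proof (rule has_primI)
  have gi: "integrable leb01 (\<lambda>x. lam j *\<^sub>R g j x)" if "j \<in> I" for j
    using has_prim_integrable[OF assms[OF that]] by simp
  then show "integrable leb01 (\<lambda>x. \<Sum>j\<in>I. lam j *\<^sub>R g j x)" by (rule Bochner_Integration.integrable_sum)
  fix x :: real assume x: "x \<in> {0..1}"
  have "prim (\<lambda>x. \<Sum>j\<in>I. lam j *\<^sub>R g j x) x = (\<Sum>j\<in>I. lam j *\<^sub>R prim (g j) x)"
    by (subst prim_sum[OF gi]) (simp_all add: prim_scaleR)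
  moreover have "(\<Sum>j\<in>I. lam j *\<^sub>R f j x) = (\<Sum>j\<in>I. lam j *\<^sub>R (f j 0 + prim (g j) x))"
    by (rule sum.cong[OF refl], subst has_primD[OF assms x], assumption, rule refl)
  ultimately show "(\<Sum>j\<in>I. lam j *\<^sub>R f j x) = (\<Sum>j\<in>I. lam j *\<^sub>R f j 0) + prim (\<lambda>x. \<Sum>j\<in>I. lam j *\<^sub>R g j x) x"
    by (simp add: scaleR_add_right sum.distrib)
qed

text \<open>Used to pass to limits: unlike \<open>X t 0\<close>, the mean of \<open>X t\<close> is continuous in \<open>L\<^sup>1\<close>.\<close>
definition avg_prim :: "(real \<Rightarrow> real \<Rightarrow> 'a::euclidean_space) \<Rightarrow> (real \<Rightarrow> real \<Rightarrow> 'a) \<Rightarrow> real \<Rightarrow> real \<Rightarrow> 'a" where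
  "avg_prim X Z t \<theta> = (\<integral>x. X t x - prim (Z t) x \<partial>leb01) + prim (Z t) \<theta>"

lemma avg_prim_eq:
  assumes "has_prim (X t) (Z t)" "\<theta> \<in> {0..1}"
  shows "avg_prim X Z t \<theta> = X t \<theta>"
proof -
  have "(\<integral>x. X t x - prim (Z t) x \<partial>leb01) = (\<integral>x. X t 0 \<partial>leb01)"
  proof (rule Bochner_Integration.integral_cong[OF refl])
    show "X t x - prim (Z t) x = X t 0" if "x \<in> space leb01" for x
      using has_primD[OF assms(1), of x] that unfolding diff_eq_eq by simp
  qed
  then have "avg_prim X Z t \<theta> = X t 0 + prim (Z t) \<theta>" unfolding avg_prim_def by simp
  then show ?thesis using has_primD[OF assms] by argo
qed

lemma avg_prim_measurable:
  assumes X: "case_prod X \<in> borel_measurable leb01sq" and Z: "case_prod Z \<in> borel_measurable leb01sq"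
  shows "case_prod (avg_prim X Z) \<in> borel_measurable leb01sq"
proof -
  note mp = measurable_prim_space[OF Z]
  have "(\<lambda>(t, x). X t x - prim (Z t) x) \<in> borel_measurable leb01sq"
    using borel_measurable_diff[OF X mp] by (simp add: case_prod_beta')
  then have "(\<lambda>t. \<integral>x. X t x - prim (Z t) x \<partial>leb01) \<in> borel_measurable leb01"
    by (rule leb01.borel_measurable_lebesgue_integral)
  from borel_measurable_add[OF measurable_fst_leb01sq[OF this] mp]
  show ?thesis by (simp add: avg_prim_def case_prod_beta')
qed

lemma norm_avg_prim_le:
  assumes X: "integrable leb01 (X t)" and Z: "integrable leb01 (Z t)"
  shows "norm (avg_prim X Z t \<theta>) \<le> (\<integral>x. norm (X t x) \<partial>leb01) + 2 * (\<integral>x. norm (Z t x) \<partial>leb01)"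
proof -
  have p: "integrable leb01 (prim (Z t))"
    by (rule continuous_integrable_leb01[OF continuous_on_prim[OF Z]])
  have pn: "norm (prim (Z t) x) \<le> (\<integral>x. norm (Z t x) \<partial>leb01)" for x by (rule norm_prim_le_integral[OF Z])
  have "norm (\<integral>x. X t x - prim (Z t) x \<partial>leb01) \<le> (\<integral>x. norm (X t x - prim (Z t) x) \<partial>leb01)"
    by (rule integral_norm_bound)
  also have "\<dots> \<le> (\<integral>x. norm (X t x) + (\<integral>x. norm (Z t x) \<partial>leb01) \<partial>leb01)"
    using X p pn by (intro integral_mono) (auto intro: order_trans[OF norm_triangle_ineq4] add_left_mono)
  also have "\<dots> = (\<integral>x. norm (X t x) \<partial>leb01) + (\<integral>x. norm (Z t x) \<partial>leb01)"
    using X by (simp add: leb01.prob_space)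
  finally show ?thesis
    unfolding avg_prim_def using pn[of \<theta>] by (intro order_trans[OF norm_triangle_ineq]) simp
qed

lemma avg_prim_diff:
  assumes "integrable leb01 (X t)" "integrable leb01 (X' t)" "integrable leb01 (Z t)" "integrable leb01 (Z' t)"
  shows "avg_prim (\<lambda>t x. X t x - X' t x) (\<lambda>t x. Z t x - Z' t x) t \<theta> = avg_prim X Z t \<theta> - avg_prim X' Z' t \<theta>"
proof -
  have p: "integrable leb01 (prim (Z t))" "integrable leb01 (prim (Z' t))"
    using assms by (auto intro: continuous_integrable_leb01 continuous_on_prim)
  have pd: "prim (\<lambda>x. Z t x - Z' t x) x = prim (Z t) x - prim (Z' t) x" for x by (rule prim_diff[OF assms(3,4)])
  have "(\<integral>x. (X t x - X' t x) - (prim (Z t) x - prim (Z' t) x) \<partial>leb01) =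
      (\<integral>x. X t x - prim (Z t) x \<partial>leb01) - (\<integral>x. X' t x - prim (Z' t) x \<partial>leb01)"
    using assms p by simp
  then show ?thesis unfolding avg_prim_def pd by simp
qed

lemma l2_conv_imp_L1_conv:
  fixes X :: "nat \<Rightarrow> real \<times> real \<Rightarrow> 'a::euclidean_space"
  assumes "\<And>m. l2 leb01sq (X m)" "l2 leb01sq Y" "(\<lambda>m. \<integral>p. (norm (X m p - Y p))\<^sup>2 \<partial>leb01sq) \<longlonglongrightarrow> 0"
  shows "(\<lambda>m. \<integral>p. norm (X m p - Y p) \<partial>leb01sq) \<longlonglongrightarrow> 0"
proof -
  have "(\<lambda>m. (\<integral>p. norm (X m p - Y p) \<partial>leb01sq)\<^sup>2) \<longlonglongrightarrow> 0"
  proof (rule tendsto_sandwich[OF _ _ tendsto_const assms(3)])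
    show "\<forall>\<^sub>F m in sequentially. (\<integral>p. norm (X m p - Y p) \<partial>leb01sq)\<^sup>2 \<le> (\<integral>p. (norm (X m p - Y p))\<^sup>2 \<partial>leb01sq)"
      by (intro always_eventually allI leb01_pair.P.l2_norm_integral_le l2_diff assms)
  qed simp
  from tendsto_real_sqrt[OF this] show ?thesis by simp
qed

subsection \<open>The energy as an integral over time and space\<close>

definition arc_weight :: "(nat \<Rightarrow> real) \<Rightarrow> (real \<Rightarrow> real \<Rightarrow> 'a::euclidean_space) \<Rightarrow> nat \<Rightarrow> real \<times> real \<Rightarrow> real" where
  "arc_weight a q i p = a i * (\<integral>\<theta>. norm (q (fst p) \<theta>) \<partial>leb01) powi (2 * int i - 3) * norm (q (fst p) (snd p))"

lemma length_bounds:
  fixes q :: "real \<Rightarrow> 'a::euclidean_space"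
  assumes "q \<in> borel_measurable leb01" "\<And>\<theta>. \<theta> \<in> {0..1} \<Longrightarrow> m \<le> norm (q \<theta>)" "\<And>\<theta>. \<theta> \<in> {0..1} \<Longrightarrow> norm (q \<theta>) \<le> M"
  shows "m \<le> (\<integral>\<theta>. norm (q \<theta>) \<partial>leb01)" "(\<integral>\<theta>. norm (q \<theta>) \<partial>leb01) \<le> M"
proof -
  have i: "integrable leb01 (\<lambda>\<theta>. norm (q \<theta>))"
    using bounded_integrable_leb01[OF assms(1,3)] by (rule integrable_norm)
  have "(\<integral>\<theta>. m \<partial>leb01) \<le> (\<integral>\<theta>. norm (q \<theta>) \<partial>leb01)" using assms(2) i by (intro integral_mono) auto
  then show "m \<le> (\<integral>\<theta>. norm (q \<theta>) \<partial>leb01)" by simp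
  have "(\<integral>\<theta>. norm (q \<theta>) \<partial>leb01) \<le> (\<integral>\<theta>. M \<partial>leb01)" using assms(3) i by (intro integral_mono) auto
  then show "(\<integral>\<theta>. norm (q \<theta>) \<partial>leb01) \<le> M" by simp
qed

context
  fixes a :: "nat \<Rightarrow> real" and q :: "real \<Rightarrow> real \<Rightarrow> 'a::euclidean_space" and mq Mq :: real
  assumes a: "\<And>i. 0 < a i" and mq: "0 < mq" and m: "case_prod q \<in> borel_measurable leb01sq"
    and b: "\<And>t \<theta>. t \<in> {0..1} \<Longrightarrow> \<theta> \<in> {0..1} \<Longrightarrow> mq \<le> norm (q t \<theta>)"
      "\<And>t \<theta>. t \<in> {0..1} \<Longrightarrow> \<theta> \<in> {0..1} \<Longrightarrow> norm (q t \<theta>) \<le> Mq"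
begin

lemma arc_weight_measurable: "arc_weight a q i \<in> borel_measurable leb01sq"
proof -
  have nq: "(\<lambda>p. norm (q (fst p) (snd p))) \<in> borel_measurable leb01sq"
    using measurable_compose[OF m borel_measurable_norm] by (simp add: case_prod_beta')
  have ml: "(\<lambda>t. \<integral>\<theta>. norm (q t \<theta>) \<partial>leb01) \<in> borel_measurable leb01"
    by (rule leb01.borel_measurable_lebesgue_integral) (use nq in \<open>simp add: case_prod_beta'\<close>)
  have "(\<lambda>t. (\<integral>\<theta>. norm (q t \<theta>) \<partial>leb01) powi k) \<in> borel_measurable leb01" for k
    using borel_measurable_power[OF ml, of "nat k"]
      borel_measurable_power[OF borel_measurable_inverse[OF ml], of "nat (- k)"]
    by (cases "0 \<le> k") (simp_all only: power_int_def if_True if_False)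
  from measurable_fst_leb01sq[OF this] show ?thesis
    unfolding arc_weight_def[abs_def] using nq by (intro borel_measurable_times) auto
qed

lemma arc_weight_bounds:
  obtains W where "0 < W" "\<And>p. p \<in> space leb01sq \<Longrightarrow> 0 \<le> arc_weight a q i p \<and> arc_weight a q i p \<le> W"
proof -
  have Mq: "0 < Mq" using b[of 0 0] mq by simp
  let ?k = "2 * int i - 3"
  have up: "x powi ?k \<le> max (mq powi ?k) (Mq powi ?k)" if "mq \<le> x" "x \<le> Mq" for x
  proof (cases "0 \<le> ?k")
    case True
    then have "x powi ?k \<le> Mq powi ?k" using that mq by (intro power_int_mono) auto
    then show ?thesis by simp
  next
    case False
    then have "x powi ?k \<le> mq powi ?k" using that mq by (intro power_int_antimono) auto
    then show ?thesis by simp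
  qed
  show ?thesis
  proof (rule that[of "a i * max (mq powi ?k) (Mq powi ?k) * Mq"])
    show "0 < a i * max (mq powi ?k) (Mq powi ?k) * Mq" using a mq Mq by (simp add: less_max_iff_disj)
    fix p assume "p \<in> space leb01sq"
    then obtain t \<theta> where p: "p = (t, \<theta>)" "t \<in> {0..1}" "\<theta> \<in> {0..1}" by (auto simp: space_pair_measure)
    note l = length_bounds[OF section_measurable(1)[OF m p(2)] b(1)[OF p(2)] b(2)[OF p(2)]]
    have "a i * (\<integral>\<theta>. norm (q t \<theta>) \<partial>leb01) powi ?k \<le> a i * max (mq powi ?k) (Mq powi ?k)"
      using up[OF l] a[of i] by (intro mult_left_mono) auto
    moreover have "0 \<le> a i * (\<integral>\<theta>. norm (q t \<theta>) \<partial>leb01) powi ?k" using a[of i] l mq by simp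
    ultimately show "0 \<le> arc_weight a q i p \<and> arc_weight a q i p \<le> a i * max (mq powi ?k) (Mq powi ?k) * Mq"
      using b(2)[OF p(2,3)] unfolding arc_weight_def p(1) fst_conv snd_conv
      by (meson mult_mono mult_nonneg_nonneg norm_ge_zero order_trans)
  qed
qed

lemma arc_weight_integrable:
  assumes "l2 leb01sq X"
  shows "integrable leb01sq (\<lambda>p. arc_weight a q i p * (norm (X p))\<^sup>2)"
proof -
  obtain W where W: "0 < W" "\<And>p. p \<in> space leb01sq \<Longrightarrow> 0 \<le> arc_weight a q i p \<and> arc_weight a q i p \<le> W"
    using arc_weight_bounds[of i] by blast
  show ?thesis
  proof (rule Bochner_Integration.integrable_bound)
    show "integrable leb01sq (\<lambda>p. W * (norm (X p))\<^sup>2)" using assms by (simp add: l2_def)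
    show "(\<lambda>p. arc_weight a q i p * (norm (X p))\<^sup>2) \<in> borel_measurable leb01sq"
      using arc_weight_measurable measurable_compose[OF l2_measurable[OF assms] borel_measurable_norm]
      by (intro borel_measurable_times borel_measurable_power) auto
    show "AE p in leb01sq. norm (arc_weight a q i p * (norm (X p))\<^sup>2) \<le> norm (W * (norm (X p))\<^sup>2)"
      using W by (intro AE_I2) (auto simp: abs_mult intro!: mult_right_mono)
  qed
qed

lemma arc_energy_integral:
  assumes E: "\<And>i. i \<le> n \<Longrightarrow> l2 leb01sq (case_prod (E i))"
  shows "(\<integral>\<^sup>+t. arc_energy n a q E t \<partial>leb01) =
    ennreal (\<Sum>i\<le>n. \<integral>p. arc_weight a q i p * (norm (case_prod (E i) p))\<^sup>2 \<partial>leb01sq)"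
proof -
  have meas: "(\<lambda>p. ennreal (arc_weight a q i p * (norm (case_prod (E i) p))\<^sup>2)) \<in> borel_measurable leb01sq" if "i \<le> n" for i
    using arc_weight_integrable[OF E[OF that], of i] by measurable
  have inner: "ennreal (a i * (\<integral>\<theta>. norm (q t \<theta>) \<partial>leb01) powi (2 * int i - 3)) *
        (\<integral>\<^sup>+\<theta>. ennreal ((norm (E i t \<theta>))\<^sup>2 * norm (q t \<theta>)) \<partial>leb01)
      = (\<integral>\<^sup>+\<theta>. ennreal (arc_weight a q i (t, \<theta>) * (norm (case_prod (E i) (t, \<theta>)))\<^sup>2) \<partial>leb01)"
    if "i \<le> n" "t \<in> {0..1}" for i t
  proof -
    have "0 \<le> (\<integral>\<theta>. norm (q t \<theta>) \<partial>leb01)" by simp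
    then have 0: "0 \<le> a i * (\<integral>\<theta>. norm (q t \<theta>) \<partial>leb01) powi (2 * int i - 3)"
      using a[of i] by simp
    have m': "(\<lambda>\<theta>. ennreal ((norm (E i t \<theta>))\<^sup>2 * norm (q t \<theta>))) \<in> borel_measurable leb01"
      using section_measurable(1)[OF m that(2)] section_measurable(1)[OF l2_measurable[OF E[OF that(1)]] that(2)] by simp
    show ?thesis
      unfolding nn_integral_cmult[OF m', symmetric]
      by (rule nn_integral_cong) (use 0 in \<open>simp add: arc_weight_def ennreal_mult[symmetric] mult_ac\<close>)
  qed
  have "(\<integral>\<^sup>+t. arc_energy n a q E t \<partial>leb01) =
      (\<integral>\<^sup>+t. (\<Sum>i\<le>n. \<integral>\<^sup>+\<theta>. ennreal (arc_weight a q i (t, \<theta>) * (norm (case_prod (E i) (t, \<theta>)))\<^sup>2) \<partial>leb01) \<partial>leb01)"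
    unfolding arc_energy_def by (intro nn_integral_cong sum.cong inner) auto
  also have "\<dots> = (\<Sum>i\<le>n. \<integral>\<^sup>+t. \<integral>\<^sup>+\<theta>. ennreal (arc_weight a q i (t, \<theta>) * (norm (case_prod (E i) (t, \<theta>)))\<^sup>2) \<partial>leb01 \<partial>leb01)"
    by (rule nn_integral_sum) (intro leb01.borel_measurable_nn_integral_fst meas, simp)
  also have "\<dots> = (\<Sum>i\<le>n. ennreal (\<integral>p. arc_weight a q i p * (norm (case_prod (E i) p))\<^sup>2 \<partial>leb01sq))"
  proof (rule sum.cong[OF refl])
    fix i assume "i \<in> {..n}"
    then have i: "i \<le> n" by simp
    have "(\<integral>\<^sup>+t. \<integral>\<^sup>+\<theta>. ennreal (arc_weight a q i (t, \<theta>) * (norm (case_prod (E i) (t, \<theta>)))\<^sup>2) \<partial>leb01 \<partial>leb01)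
        = (\<integral>\<^sup>+p. ennreal (arc_weight a q i p * (norm (case_prod (E i) p))\<^sup>2) \<partial>leb01sq)"
      by (rule leb01.nn_integral_fst[OF meas[OF i]])
    also have "\<dots> = ennreal (\<integral>p. arc_weight a q i p * (norm (case_prod (E i) p))\<^sup>2 \<partial>leb01sq)"
    proof (rule nn_integral_eq_integral[OF arc_weight_integrable[OF E[OF i]]])
      obtain W where "\<And>p. p \<in> space leb01sq \<Longrightarrow> 0 \<le> arc_weight a q i p \<and> arc_weight a q i p \<le> W"
        using arc_weight_bounds[of i] by blast
      then show "AE p in leb01sq. 0 \<le> arc_weight a q i p * (norm (case_prod (E i) p))\<^sup>2"
        by (intro AE_I2) auto
    qed
    finally show "(\<integral>\<^sup>+t. \<integral>\<^sup>+\<theta>. ennreal (arc_weight a q i (t, \<theta>) * (norm (case_prod (E i) (t, \<theta>)))\<^sup>2) \<partial>leb01 \<partial>leb01)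
        = ennreal (\<integral>p. arc_weight a q i p * (norm (case_prod (E i) p))\<^sup>2 \<partial>leb01sq)" .
  qed
  also have "\<dots> = ennreal (\<Sum>i\<le>n. \<integral>p. arc_weight a q i p * (norm (case_prod (E i) p))\<^sup>2 \<partial>leb01sq)"
  proof (rule sum_ennreal)
    fix i assume "i \<in> {..n}"
    obtain W where "\<And>p. p \<in> space leb01sq \<Longrightarrow> 0 \<le> arc_weight a q i p \<and> arc_weight a q i p \<le> W"
      using arc_weight_bounds[of i] by blast
    then show "0 \<le> (\<integral>p. arc_weight a q i p * (norm (case_prod (E i) p))\<^sup>2 \<partial>leb01sq)"
      by (intro integral_nonneg_AE AE_I2) auto
  qed
  finally show ?thesis .
qed

end

text \<open>One component of a shape graph with its uniform limit (cl, ql) and the strong limits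
  \<open>Y i\<close> of averaged derivatives. The weights \<open>lam\<close> and cut-offs
  \<open>N\<close> are parameters because all components have to share them.\<close>

locale arc_limit =
  fixes n :: nat and a :: "nat \<Rightarrow> real" and c q :: "nat \<Rightarrow> real \<Rightarrow> real \<Rightarrow> 'a::euclidean_space"
    and E :: "nat \<Rightarrow> nat \<Rightarrow> real \<Rightarrow> real \<Rightarrow> 'a" and M m0 M0 :: real and c0 q0 :: "real \<Rightarrow> 'a"
    and cl ql :: "real \<Rightarrow> real \<Rightarrow> 'a" and N :: "nat \<Rightarrow> nat" and lam :: "nat \<Rightarrow> nat \<Rightarrow> real"
    and Y :: "nat \<Rightarrow> real \<Rightarrow> real \<Rightarrow> 'a"
  assumes est: "arc_estimates n a (c j) (q j) (E j) M m0 M0"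
    and q0: "\<theta> \<in> {0..1} \<Longrightarrow> q j 0 \<theta> = q0 \<theta>" and c0: "\<theta> \<in> {0..1} \<Longrightarrow> c j 0 \<theta> = c0 \<theta>"
    and conv: "arc_converges c q cl ql" and cvx: "cvx m (N m) (lam m)"
    and Y: "i \<le> n \<Longrightarrow> l2 leb01sq (case_prod (Y i))"
    and Ylim: "i \<le> n \<Longrightarrow> (\<lambda>m. \<integral>p. (norm ((\<Sum>j\<le>N m. lam m j *\<^sub>R case_prod (E j i) p) - case_prod (Y i) p))\<^sup>2 \<partial>leb01sq) \<longlonglongrightarrow> 0"
begin

sublocale e: arc_estimates n a "c j" "q j" "E j" M m0 M0 for j by (rule est)

abbreviation "mq \<equiv> arc_estimates.mq a M m0"
abbreviation "Mq \<equiv> arc_estimates.Mq a M M0"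

lemma close:
  assumes "0 < e"
  obtains J where "\<And>j t \<theta>. J \<le> j \<Longrightarrow> t \<in> {0..1} \<Longrightarrow> \<theta> \<in> {0..1} \<Longrightarrow>
     norm (c j t \<theta> - cl t \<theta>) \<le> e \<and> norm (q j t \<theta> - ql t \<theta>) \<le> e"
  using conv assms unfolding arc_converges_def by blast

lemmas ptlim = arc_converges_pointwise[OF conv]

section \<open>Uniform limits of the curves and of their derivatives\<close>

lemma ql_bounds:
  assumes "t \<in> {0..1}" "\<theta> \<in> {0..1}"
  shows "mq \<le> norm (ql t \<theta>)" "norm (ql t \<theta>) \<le> Mq"
proof -
  have l: "(\<lambda>j. norm (q j t \<theta>)) \<longlonglongrightarrow> norm (ql t \<theta>)" by (intro tendsto_norm ptlim assms)
  show "mq \<le> norm (ql t \<theta>)"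
    by (rule LIMSEQ_le_const[OF l]) (use e.q_bounds(1)[OF assms] in blast)
  show "norm (ql t \<theta>) \<le> Mq"
    by (rule LIMSEQ_le_const2[OF l]) (use e.q_bounds(2)[OF assms] in blast)
qed

lemma mq_pos: "0 < mq" and Mq_pos: "0 < Mq" by (rule e.mq_pos e.Mq_pos)+

lemma ql_nonzero: "t \<in> {0..1} \<Longrightarrow> \<theta> \<in> {0..1} \<Longrightarrow> ql t \<theta> \<noteq> 0"
  using ql_bounds(1)[of t \<theta>] mq_pos by auto

lemma ql_measurable: "case_prod ql \<in> borel_measurable leb01sq"
proof (rule borel_measurable_LIMSEQ_metric)
  show "case_prod (q j) \<in> borel_measurable leb01sq" for j by (rule arc_pathD(1)[OF e.ap])
  show "(\<lambda>j. case_prod (q j) p) \<longlonglongrightarrow> case_prod ql p" if "p \<in> space leb01sq" for p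
    using that ptlim(1) by (auto simp: space_pair_measure)
qed

lemma ql_continuous: "t \<in> {0..1} \<Longrightarrow> continuous_on {0..1} (ql t)"
  and cl_continuous: "t \<in> {0..1} \<Longrightarrow> continuous_on {0..1} (cl t)"
  using conv unfolding arc_converges_def by blast+

lemma limit_initial: "\<theta> \<in> {0..1} \<Longrightarrow> ql 0 \<theta> = q0 \<theta>" "\<theta> \<in> {0..1} \<Longrightarrow> cl 0 \<theta> = c0 \<theta>"
proof -
  assume \<theta>: "\<theta> \<in> {0..1}"
  have "(\<lambda>j. q0 \<theta>) \<longlonglongrightarrow> ql 0 \<theta>" using ptlim(1)[of 0 \<theta>] \<theta> q0[OF \<theta>] by simp
  then show "ql 0 \<theta> = q0 \<theta>" by (simp add: LIMSEQ_const_iff)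
  have "(\<lambda>j. c0 \<theta>) \<longlonglongrightarrow> cl 0 \<theta>" using ptlim(2)[of 0 \<theta>] \<theta> c0[OF \<theta>] by simp
  then show "cl 0 \<theta> = c0 \<theta>" by (simp add: LIMSEQ_const_iff)
qed

lemma limit_prim:
  assumes t: "t \<in> {0..1}"
  shows "has_prim (cl t) (ql t)"
proof (rule has_primI)
  show "integrable leb01 (ql t)" by (rule continuous_integrable_leb01[OF ql_continuous[OF t]])
  fix \<theta> :: real assume \<theta>: "\<theta> \<in> {0..1}"
  have "(\<lambda>j. prim (q j t) \<theta>) \<longlonglongrightarrow> prim (ql t) \<theta>"
  proof (rule prim_dominated_convergence[where w="\<lambda>_. Mq"])
    show "q j t \<in> borel_measurable leb01" for j by (rule section_measurable(1)[OF arc_pathD(1)[OF e.ap] t])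
    show "ql t \<in> borel_measurable leb01" by (rule section_measurable(1)[OF ql_measurable t])
    show "AE x in leb01. (\<lambda>j. q j t x) \<longlonglongrightarrow> ql t x" using ptlim(1)[OF t] by (intro AE_I2) auto
    show "AE x in leb01. norm (q j t x) \<le> Mq" for j using e.q_bounds(2)[OF t] by (intro AE_I2) auto
  qed simp
  then have "(\<lambda>j. c j t 0 + prim (q j t) \<theta>) \<longlonglongrightarrow> cl t 0 + prim (ql t) \<theta>"
    by (intro tendsto_add ptlim(2) t) auto
  moreover have "c j t 0 + prim (q j t) \<theta> = c j t \<theta>" for j
    using has_primD[OF arc_pathD(4)[OF e.ap t] \<theta>, of j] by simp
  ultimately show "cl t \<theta> = cl t 0 + prim (ql t) \<theta>"
    using LIMSEQ_unique[OF ptlim(2)[OF t \<theta>]] by simp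
qed

section \<open>Strong limits of the convex combinations\<close>

definition Gm :: "nat \<Rightarrow> nat \<Rightarrow> real \<Rightarrow> real \<Rightarrow> 'a" where
  "Gm m i t \<theta> = (\<Sum>j\<le>N m. lam m j *\<^sub>R E j i t \<theta>)"

text \<open>The products |q j| E j i are the right-hand sides of the relations in space and of the
  evolution of \<open>q\<close> in time. Their averages have to converge to |ql| Y i, although
  averaging does not commute with the product.\<close>

definition Hm :: "nat \<Rightarrow> nat \<Rightarrow> real \<Rightarrow> real \<Rightarrow> 'a" where
  "Hm m i t \<theta> = (\<Sum>j\<le>N m. lam m j *\<^sub>R (norm (q j t \<theta>) *\<^sub>R E j i t \<theta>))"

definition rY :: "nat \<Rightarrow> real \<Rightarrow> real \<Rightarrow> 'a" where
  "rY i t \<theta> = norm (ql t \<theta>) *\<^sub>R Y i t \<theta>"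

lemma l2_rho:
  assumes r: "case_prod r \<in> borel_measurable leb01sq" "\<And>t \<theta>. t \<in> {0..1} \<Longrightarrow> \<theta> \<in> {0..1} \<Longrightarrow> norm (r t \<theta>) \<le> Mq"
    and X: "l2 leb01sq (case_prod X)"
  shows "l2 leb01sq (\<lambda>(t, \<theta>). norm (r t \<theta> :: 'a) *\<^sub>R (X t \<theta> :: 'a))"
proof -
  have "(\<lambda>(t, \<theta>). norm (r t \<theta>)) \<in> borel_measurable leb01sq"
    using measurable_compose[OF r(1) borel_measurable_norm] by (simp add: case_prod_beta')
  moreover have "AE t in leb01. \<forall>\<theta>\<in>{0..1}. norm (norm (r t \<theta>)) \<le> Mq" using r(2) by (intro AE_I2) auto
  ultimately show ?thesis
    by (rule l2sq_bilinear[OF bounded_bilinear.flip[OF bounded_bilinear_scaleR] X])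
qed

lemma l2_Gm: "i \<le> n \<Longrightarrow> l2 leb01sq (case_prod (Gm m i))"
  using l2_sum[of "{..N m}" leb01sq "\<lambda>j p. lam m j *\<^sub>R case_prod (E j i) p"] e.E_l2(1)[of i]
  by (simp add: Gm_def[abs_def] case_prod_beta' l2_scaleR)

lemma l2_rho_E: "i \<le> n \<Longrightarrow> l2 leb01sq (\<lambda>(t, \<theta>). norm (q j t \<theta>) *\<^sub>R E j i t \<theta>)"
  by (rule l2_rho[OF arc_pathD(1)[OF e.ap] e.q_bounds(2) e.E_l2(1)])

lemma l2_Hm: "i \<le> n \<Longrightarrow> l2 leb01sq (case_prod (Hm m i))"
  using l2_sum[of "{..N m}" leb01sq "\<lambda>j p. lam m j *\<^sub>R (case p of (t, \<theta>) \<Rightarrow> norm (q j t \<theta>) *\<^sub>R E j i t \<theta>)"] l2_rho_E[of i]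
  by (simp add: Hm_def[abs_def] case_prod_beta' l2_scaleR del: scaleR_scaleR)

lemma l2_rY: "i \<le> n \<Longrightarrow> l2 leb01sq (case_prod (rY i))"
  unfolding rY_def[abs_def] by (rule l2_rho[OF ql_measurable ql_bounds(2) Y])

lemma Gm_L2: "i \<le> n \<Longrightarrow> (\<lambda>m. \<integral>p. (norm (case_prod (Gm m i) p - case_prod (Y i) p))\<^sup>2 \<partial>leb01sq) \<longlonglongrightarrow> 0"
  using Ylim[of i] by (simp add: Gm_def case_prod_beta')

lemma Gm_L1: "i \<le> n \<Longrightarrow> (\<lambda>m. \<integral>p. norm (case_prod (Gm m i) p - case_prod (Y i) p) \<partial>leb01sq) \<longlonglongrightarrow> 0"
  by (rule l2_conv_imp_L1_conv[OF l2_Gm Y Gm_L2])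

lemma E_L1_bound:
  assumes "i \<le> n"
  shows "(\<integral>p. norm (case_prod (E j i) p) \<partial>leb01sq) \<le> 1 + M / arc_estimates.energy_weight a M m0 M0 i"
proof -
  have "(\<integral>p. norm (case_prod (E j i) p) \<partial>leb01sq) \<le> (\<integral>p. 1 + (norm (case_prod (E j i) p))\<^sup>2 \<partial>leb01sq)"
  proof (rule integral_mono)
    show "norm (case_prod (E j i) p) \<le> 1 + (norm (case_prod (E j i) p))\<^sup>2" for p
      using zero_le_power2[of "norm (case_prod (E j i) p) - 1/2"] by (simp add: power2_eq_square algebra_simps)
    show "integrable leb01sq (\<lambda>p. norm (case_prod (E j i) p))"
      by (rule integrable_norm[OF l2sq_integrable[OF e.E_l2(1)[OF assms]]])
  qed (use e.E_l2(1)[OF assms] in \<open>simp add: l2_def\<close>)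
  also have "\<dots> = 1 + (\<integral>p. (norm (case_prod (E j i) p))\<^sup>2 \<partial>leb01sq)"
    using e.E_l2(1)[OF assms, of j] by (simp add: l2_def leb01_pair.P.prob_space)
  finally show ?thesis using e.E_l2(2)[OF assms, of j] by simp
qed

text \<open>The average of |q j| E j i is the average of (|q j| - |ql|) E j i plus |ql| times the
  average of \<open>E j i\<close>. The first part is small because only indices j \<ge> m occur and
  the \<open>E j i\<close> are bounded in mean, the second is close to its limit because
  \<open>Gm\<close> converges.\<close>

lemma Hm_L1:
  assumes i: "i \<le> n"
  shows "(\<lambda>m. \<integral>p. norm (case_prod (Hm m i) p - case_prod (rY i) p) \<partial>leb01sq) \<longlonglongrightarrow> 0"
proof (rule LIMSEQ_I)
  fix r :: real assume r: "0 < r"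
  define C where "C = 1 + M / arc_estimates.energy_weight a M m0 M0 i"
  have C: "0 < C" unfolding C_def using e.M e.energy_weight_pos[of i] by (simp add: add_pos_nonneg)
  \<comment> \<open>The uniform distance allowed between \<open>q j\<close> and \<open>ql\<close>,
    chosen so that the first part contributes at most s C = r / 2.\<close>
  define s where "s = r / (2 * C)"
  have s: "0 < s" unfolding s_def using r C by simp
  obtain N1 where N1: "\<And>j t \<theta>. N1 \<le> j \<Longrightarrow> t \<in> {0..1} \<Longrightarrow> \<theta> \<in> {0..1} \<Longrightarrow>
     norm (c j t \<theta> - cl t \<theta>) \<le> s \<and> norm (q j t \<theta> - ql t \<theta>) \<le> s"
    using close[OF s] by blast
  have "0 < r / (2 * Mq)" using r Mq_pos by simp
  from LIMSEQ_D[OF Gm_L1[OF i] this] obtain N2 where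
    N2: "\<And>m. N2 \<le> m \<Longrightarrow> (\<integral>p. norm (case_prod (Gm m i) p - case_prod (Y i) p) \<partial>leb01sq) < r / (2 * Mq)" by auto
  have "(\<integral>p. norm (case_prod (Hm m i) p - case_prod (rY i) p) \<partial>leb01sq) < r" if m: "max N1 N2 \<le> m" for m
  proof -
    let ?A = "\<lambda>p. \<Sum>j\<le>N m. lam m j * (s * norm (case_prod (E j i) p))"
    let ?B = "\<lambda>p. Mq * norm (case_prod (Gm m i) p - case_prod (Y i) p)"
    have lam0: "0 \<le> lam m j" and lamj: "lam m j \<noteq> 0 \<Longrightarrow> m \<le> j" for j
      using cvx[of m] by (auto simp: cvx_def)
    have Ai: "integrable leb01sq ?A"
      using integrable_norm[OF l2sq_integrable[OF e.E_l2(1)[OF i]]] by simp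
    have Bi: "integrable leb01sq ?B"
      using integrable_norm[OF l2sq_integrable[OF l2_diff[OF l2_Gm[OF i] Y[OF i]]]] by simp
    have "(\<integral>p. norm (case_prod (Hm m i) p - case_prod (rY i) p) \<partial>leb01sq) \<le> (\<integral>p. ?A p + ?B p \<partial>leb01sq)"
    proof (rule integral_mono)
      show "integrable leb01sq (\<lambda>p. norm (case_prod (Hm m i) p - case_prod (rY i) p))"
        by (rule integrable_norm[OF l2sq_integrable[OF l2_diff[OF l2_Hm[OF i] l2_rY[OF i]]]])
      fix p assume "p \<in> space leb01sq"
      then obtain t \<theta> where p: "p = (t, \<theta>)" "t \<in> {0..1}" "\<theta> \<in> {0..1}" by (auto simp: space_pair_measure)
      have eq: "case_prod (Hm m i) p - case_prod (rY i) p =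
          (\<Sum>j\<le>N m. lam m j *\<^sub>R ((norm (q j t \<theta>) - norm (ql t \<theta>)) *\<^sub>R E j i t \<theta>)) +
          norm (ql t \<theta>) *\<^sub>R (Gm m i t \<theta> - Y i t \<theta>)"
      proof -
        have "norm (ql t \<theta>) *\<^sub>R (\<Sum>j\<le>N m. lam m j *\<^sub>R E j i t \<theta>) = (\<Sum>j\<le>N m. lam m j *\<^sub>R (norm (ql t \<theta>) *\<^sub>R E j i t \<theta>))"
          unfolding scaleR_sum_right by (rule sum.cong[OF refl], rule scaleR_left_commute)
        then show ?thesis
          unfolding p prod.case Hm_def rY_def Gm_def scaleR_diff_right scaleR_diff_left sum_subtractf by simp
      qed
      show "norm (case_prod (Hm m i) p - case_prod (rY i) p) \<le> ?A p + ?B p"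
        unfolding eq
      proof (rule norm_triangle_le[OF add_mono])
        show "norm (\<Sum>j\<le>N m. lam m j *\<^sub>R ((norm (q j t \<theta>) - norm (ql t \<theta>)) *\<^sub>R E j i t \<theta>)) \<le> ?A p"
        proof (rule sum_norm_le)
          fix j
          show "norm (lam m j *\<^sub>R ((norm (q j t \<theta>) - norm (ql t \<theta>)) *\<^sub>R E j i t \<theta>)) \<le> lam m j * (s * norm (case_prod (E j i) p))"
          proof (cases "lam m j = 0")
            case False
            then have "N1 \<le> j" using lamj m by fastforce
            then have "\<bar>norm (q j t \<theta>) - norm (ql t \<theta>)\<bar> \<le> s"
              using N1[OF _ p(2,3), of j] norm_triangle_ineq3[of "q j t \<theta>" "ql t \<theta>"] by linarith
            then have "\<bar>norm (q j t \<theta>) - norm (ql t \<theta>)\<bar> * norm (E j i t \<theta>) \<le> s * norm (E j i t \<theta>)"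
              by (rule mult_right_mono) simp
            then show ?thesis using lam0[of j] unfolding p prod.case norm_scaleR abs_of_nonneg[OF lam0] by (rule mult_left_mono)
          qed simp
        qed
        show "norm (norm (ql t \<theta>) *\<^sub>R (Gm m i t \<theta> - Y i t \<theta>)) \<le> ?B p"
          unfolding p using ql_bounds(2)[OF p(2,3)] by (simp add: mult_right_mono)
      qed
    qed (rule Bochner_Integration.integrable_add[OF Ai Bi])
    also have "\<dots> = (\<Sum>j\<le>N m. lam m j * (s * (\<integral>p. norm (case_prod (E j i) p) \<partial>leb01sq))) +
        Mq * (\<integral>p. norm (case_prod (Gm m i) p - case_prod (Y i) p) \<partial>leb01sq)"
    proof -
      have "(\<integral>p. ?A p \<partial>leb01sq) = (\<Sum>j\<le>N m. \<integral>p. lam m j * (s * norm (case_prod (E j i) p)) \<partial>leb01sq)"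
        by (rule Bochner_Integration.integral_sum) (intro integrable_mult_right integrable_norm l2sq_integrable e.E_l2(1) i)
      then show ?thesis unfolding Bochner_Integration.integral_add[OF Ai Bi] by simp
    qed
    finally have "(\<integral>p. norm (case_prod (Hm m i) p - case_prod (rY i) p) \<partial>leb01sq) \<le>
        (\<Sum>j\<le>N m. lam m j * (s * (\<integral>p. norm (case_prod (E j i) p) \<partial>leb01sq))) +
        Mq * (\<integral>p. norm (case_prod (Gm m i) p - case_prod (Y i) p) \<partial>leb01sq)" .
    moreover have "(\<Sum>j\<le>N m. lam m j * (s * (\<integral>p. norm (case_prod (E j i) p) \<partial>leb01sq))) \<le> s * C"
      by (rule cvx_sum_le[OF cvx]) (use E_L1_bound[OF i] s in \<open>auto simp: C_def intro!: mult_left_mono\<close>)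
    moreover have "s * C = r / 2" unfolding s_def using C by simp
    moreover have "Mq * (\<integral>p. norm (case_prod (Gm m i) p - case_prod (Y i) p) \<partial>leb01sq) < Mq * (r / (2 * Mq))"
      using N2[of m] m Mq_pos by (intro mult_strict_left_mono) auto
    moreover have "Mq * (r / (2 * Mq)) = r / 2" using Mq_pos by simp
    ultimately show ?thesis by linarith
  qed
  then show "\<exists>no. \<forall>m\<ge>no. norm ((\<integral>p. norm (case_prod (Hm m i) p - case_prod (rY i) p) \<partial>leb01sq) - 0) < r"
    by (intro exI[of _ "max N1 N2"]) simp
qed

text \<open>The limit \<open>Y i\<close> is determined up to null sets only. Below the top order it
  is replaced by the representative that is a primitive of \<open>rY (Suc i)\<close> in \<theta>,
  normalised by the mean; at order n there is no further derivative to integrate.\<close>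

definition El :: "nat \<Rightarrow> real \<Rightarrow> real \<Rightarrow> 'a" where
  "El i = (if i < n then avg_prim (Y i) (rY (Suc i)) else Y i)"

lemma El_measurable: "i \<le> n \<Longrightarrow> case_prod (El i) \<in> borel_measurable leb01sq"
  unfolding El_def using avg_prim_measurable[OF l2_measurable[OF Y[of i]] l2_measurable[OF l2_rY[of "Suc i"]]] l2_measurable[OF Y[of i]]
  by (cases "i < n") auto

lemma Gm_prim: "i < n \<Longrightarrow> AE t in leb01. has_prim (Gm m i t) (Hm m (Suc i) t)"
proof -
  assume i: "i < n"
  have "AE t in leb01. \<forall>j\<in>{..N m}. has_prim (E j i t) (\<lambda>x. norm (q j t x) *\<^sub>R E j (Suc i) t x)"
    using arc_pathD(6)[OF e.ap i] by (intro AE_finite_allI) auto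
  then show ?thesis
    unfolding Gm_def[abs_def] Hm_def[abs_def] by eventually_elim (rule has_prim_sum_scaleR, blast)
qed

text \<open>The operation \<open>avg_prim\<close> is continuous in mean and reproduces f from every
  pair with \<open>has_prim f g\<close>, in particular \<open>Gm m i\<close> from itself and
  \<open>Hm m (Suc i)\<close>. In the limit it therefore reproduces \<open>Y i\<close>.\<close>

lemma El_eq_Y:
  assumes i: "i \<le> n"
  shows "AE p in leb01sq. case_prod (El i) p = case_prod (Y i) p"
proof (cases "i < n")
  case True
  let ?A = "\<lambda>m. \<integral>p. norm (case_prod (Gm m i) p - case_prod (Y i) p) \<partial>leb01sq"
  let ?B = "\<lambda>m. \<integral>p. norm (case_prod (Hm m (Suc i)) p - case_prod (rY (Suc i)) p) \<partial>leb01sq"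
  have Si: "Suc i \<le> n" using True by simp
  have mD: "(\<lambda>p. norm (case_prod (El i) p - case_prod (Y i) p)) \<in> borel_measurable leb01sq"
    using measurable_compose[OF borel_measurable_diff[OF El_measurable[OF i] l2_measurable[OF Y[OF i]]] borel_measurable_norm] .
  have key: "integrable leb01sq (\<lambda>p. norm (case_prod (El i) p - case_prod (Y i) p)) \<and>
     (\<integral>p. norm (case_prod (El i) p - case_prod (Y i) p) \<partial>leb01sq) \<le> 2 * ?A m + 2 * ?B m" for m
  proof -
    define X where "X t x = Gm m i t x - Y i t x" for t x
    define Z where "Z t x = Hm m (Suc i) t x - rY (Suc i) t x" for t x
    have Xi: "integrable leb01sq (\<lambda>(t, x). norm (X t x))"
      using integrable_norm[OF l2sq_integrable[OF l2_diff[OF l2_Gm[OF i] Y[OF i]]]] by (simp add: X_def case_prod_beta')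
    have Zi: "integrable leb01sq (\<lambda>(t, x). norm (Z t x))"
      using integrable_norm[OF l2sq_integrable[OF l2_diff[OF l2_Hm[OF Si] l2_rY[OF Si]]]] by (simp add: Z_def case_prod_beta')
    define b where "b t = (\<integral>x. norm (X t x) \<partial>leb01) + 2 * (\<integral>x. norm (Z t x) \<partial>leb01)" for t
    have bi: "integrable leb01 b"
      unfolding b_def using leb01_pair.integrable_fst'[OF Xi] leb01_pair.integrable_fst'[OF Zi] by simp
    have bint: "integral\<^sup>L leb01 b = ?A m + 2 * ?B m"
      unfolding b_def using leb01_pair.integrable_fst'[OF Xi] leb01_pair.integrable_fst'[OF Zi]
        leb01_pair.integral_fst'[OF Xi] leb01_pair.integral_fst'[OF Zi]
      by (simp add: X_def Z_def case_prod_beta')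
    have b1: "integrable leb01 (\<lambda>x::real. 1::real)" by simp
    have ae: "AE t in leb01. \<forall>\<theta>\<in>{0..1}. norm (El i t \<theta> - Y i t \<theta>) \<le> norm (X t \<theta>) + b t"
      using Gm_prim[OF True, of m] l2_AE_section[OF l2_Gm[OF i, of m]] l2_AE_section[OF Y[OF i]]
        l2_AE_section[OF l2_Hm[OF Si, of m]] l2_AE_section[OF l2_rY[OF Si]]
    proof eventually_elim
      case (elim t)
      note int = elim(2-5)[THEN leb01.l2_imp_integrable]
      show ?case
      proof
        fix \<theta> :: real assume \<theta>: "\<theta> \<in> {0..1}"
        have "avg_prim X Z t \<theta> = avg_prim (Gm m i) (Hm m (Suc i)) t \<theta> - avg_prim (Y i) (rY (Suc i)) t \<theta>"
          unfolding X_def[abs_def] Z_def[abs_def]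
          by (rule avg_prim_diff[of "Gm m i" t "Y i" "Hm m (Suc i)" "rY (Suc i)", OF int])
        also have "\<dots> = Gm m i t \<theta> - El i t \<theta>"
          using avg_prim_eq[of "Gm m i" t "Hm m (Suc i)", OF elim(1) \<theta>] True by (simp add: El_def)
        finally have "El i t \<theta> - Y i t \<theta> = X t \<theta> - avg_prim X Z t \<theta>" by (simp add: X_def)
        then have "norm (El i t \<theta> - Y i t \<theta>) \<le> norm (X t \<theta>) + norm (avg_prim X Z t \<theta>)"
          by (simp add: norm_triangle_ineq4)
        also have "norm (avg_prim X Z t \<theta>) \<le> b t"
          unfolding b_def by (rule norm_avg_prim_le) (use int in \<open>auto simp: X_def[abs_def] Z_def[abs_def]\<close>)
        finally show "norm (El i t \<theta> - Y i t \<theta>) \<le> norm (X t \<theta>) + b t" by simp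
      qed
    qed
    have bsq: "integrable leb01sq (\<lambda>(t, x). b t * 1)" by (rule integrable_product_leb01sq[OF bi b1])
    have Xb: "integrable leb01sq (\<lambda>(t, \<theta>). norm (X t \<theta>) + b t)"
      using Bochner_Integration.integrable_add[OF Xi bsq] by (simp add: case_prod_beta')
    have "AE p in leb01sq. (case p of (t, \<theta>) \<Rightarrow> norm (El i t \<theta> - Y i t \<theta>)) \<le> (case p of (t, \<theta>) \<Rightarrow> norm (X t \<theta>) + b t)"
      by (rule AE_leb01sq_leI[OF _ _ ae]) (use mD Xb in \<open>auto simp: case_prod_beta'\<close>)
    then have ae2: "AE p in leb01sq. norm (case_prod (El i) p - case_prod (Y i) p) \<le> (case p of (t, \<theta>) \<Rightarrow> norm (X t \<theta>) + b t)"
      by (simp add: case_prod_beta')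
    have int: "integrable leb01sq (\<lambda>p. norm (case_prod (El i) p - case_prod (Y i) p))"
      by (rule Bochner_Integration.integrable_bound[OF Xb mD]) (use ae2 in \<open>auto elim!: eventually_mono\<close>)
    have "(\<integral>p. norm (case_prod (El i) p - case_prod (Y i) p) \<partial>leb01sq) \<le> (\<integral>p. (case p of (t, \<theta>) \<Rightarrow> norm (X t \<theta>) + b t) \<partial>leb01sq)"
      by (rule integral_mono_AE[OF int Xb ae2])
    also have "\<dots> = (\<integral>p. (case p of (t, x) \<Rightarrow> norm (X t x)) \<partial>leb01sq) + (\<integral>p. (case p of (t, x) \<Rightarrow> b t * 1) \<partial>leb01sq)"
      using Bochner_Integration.integral_add[OF Xi bsq] by (simp add: case_prod_beta')
    also have "(\<integral>p. (case p of (t, x) \<Rightarrow> b t * 1) \<partial>leb01sq) = integral\<^sup>L leb01 b"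
      using leb01_pair.integral_fst'[OF bsq] by simp
    also have "(\<integral>p. (case p of (t, x) \<Rightarrow> norm (X t x)) \<partial>leb01sq) = ?A m" by (simp add: X_def case_prod_beta')
    finally show ?thesis using int bint by simp
  qed
  have "(\<lambda>m. 2 * ?A m + 2 * ?B m) \<longlonglongrightarrow> 2 * 0 + 2 * 0"
    by (intro tendsto_intros Gm_L1 Hm_L1 i Si)
  then have "(\<integral>p. norm (case_prod (El i) p - case_prod (Y i) p) \<partial>leb01sq) \<le> 0"
    using LIMSEQ_le_const[of "\<lambda>m. 2 * ?A m + 2 * ?B m" 0] key by auto
  then have "(\<integral>p. norm (case_prod (El i) p - case_prod (Y i) p) \<partial>leb01sq) = 0"
    by (intro antisym) auto
  then show ?thesis
    using integral_nonneg_eq_0_iff_AE[of leb01sq "\<lambda>p. norm (case_prod (El i) p - case_prod (Y i) p)"] key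
    by (simp add: case_prod_beta')
next
  case False
  then show ?thesis by (simp add: El_def)
qed

lemma El_l2: "i \<le> n \<Longrightarrow> l2 leb01sq (case_prod (El i))"
  by (rule l2_bound[OF Y El_measurable, where C=1]) (auto intro: eventually_mono[OF El_eq_Y])

lemma l2_rho_El: "i \<le> n \<Longrightarrow> l2 leb01sq (\<lambda>(t, \<theta>). norm (ql t \<theta>) *\<^sub>R El i t \<theta>)"
  by (rule l2_rho[OF ql_measurable ql_bounds(2) El_l2])

lemma El_prim:
  assumes i: "i < n"
  shows "AE t in leb01. has_prim (El i t) (\<lambda>x. norm (ql t x) *\<^sub>R El (Suc i) t x)"
proof -
  have Si: "Suc i \<le> n" using i by simp
  have "AE t in leb01. AE x in leb01. El (Suc i) t x = Y (Suc i) t x"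
    using leb01_pair.AE_pair[OF El_eq_Y[OF Si]] by simp
  then show ?thesis
    using l2_AE_section[OF l2_rY[OF Si]] l2_AE_section[OF l2_rho_El[OF Si]]
  proof eventually_elim
    case (elim t)
    have "has_prim (El i t) (rY (Suc i) t)"
      using has_prim_prim[OF leb01.l2_imp_integrable[OF elim(2)]] i by (simp add: El_def avg_prim_def[abs_def])
    then show ?case
    proof (rule has_prim_cong_AE)
      show "AE x in leb01. norm (ql t x) *\<^sub>R El (Suc i) t x = rY (Suc i) t x"
        using elim(1) by eventually_elim (simp add: rY_def)
    qed (use l2_measurable[OF elim(3)] in auto)
  qed
qed

lemma El_dom:
  assumes i: "i < n"
  obtains b where "integrable leb01 b" "AE s in leb01. \<forall>\<theta>\<in>{0..1}. norm (El i s \<theta>) \<le> b s"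
proof -
  have Si: "Suc i \<le> n" "i \<le> n" using i by auto
  obtain b where "l2 leb01 b" "AE s in leb01. \<forall>\<theta>\<in>{0..1}. norm (El i s \<theta>) \<le> b s"
    using l2_sup_bound[OF El_l2[OF Si(2)] l2_rho_El[OF Si(1)] El_prim[OF i]] by blast
  then show ?thesis using that leb01.l2_imp_integrable by blast
qed

section \<open>The evolution equations of the limit\<close>

lemma combination_limit:
  assumes "0 < e"
  shows "\<exists>N'. \<forall>m\<ge>N'. \<forall>t\<in>{0..1}. \<forall>\<theta>\<in>{0..1}. norm ((\<Sum>j\<le>N m. lam m j *\<^sub>R q j t \<theta>) - ql t \<theta>) \<le> e \<and>
     norm ((\<Sum>j\<le>N m. lam m j *\<^sub>R c j t \<theta>) - cl t \<theta>) \<le> e"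
proof -
  obtain N' where N': "\<And>j t \<theta>. N' \<le> j \<Longrightarrow> t \<in> {0..1} \<Longrightarrow> \<theta> \<in> {0..1} \<Longrightarrow>
     norm (c j t \<theta> - cl t \<theta>) \<le> e \<and> norm (q j t \<theta> - ql t \<theta>) \<le> e"
    using close[OF assms] by blast
  show ?thesis
    by (intro exI[of _ N'] allI impI ballI conjI cvx_norm_le[OF cvx]) (use N' in \<open>auto intro: order_trans\<close>)
qed

lemma lam_sum: "(\<Sum>j\<le>N m. lam m j) = 1"
  using cvx[of m] by (simp add: cvx_def)

text \<open>At fixed \<theta> the equations for the \<open>q j\<close> are averaged with the weights
  \<open>lam m\<close>. The initial value is unaffected because all \<open>q j 0\<close> agree and
  the weights sum to 1; the averaged right-hand side is \<open>Hm m 1\<close>, so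
  \<open>evolution_limit\<close> applies.\<close>

lemma limit_q_evolution:
  assumes \<theta>: "\<theta> \<in> {0..1}" and n: "2 \<le> n"
  shows "has_prim (\<lambda>t. ql t \<theta>) (\<lambda>s. norm (ql s \<theta>) *\<^sub>R El 1 s \<theta>)"
proof -
  have n1: "1 \<le> n" "1 < n" using n by auto
  obtain b where b: "integrable leb01 b" "AE s in leb01. \<forall>\<theta>\<in>{0..1}. norm (El 1 s \<theta>) \<le> b s"
    using El_dom[OF n1(2)] by blast
  show ?thesis
  proof (rule evolution_limit[where Xm = "\<lambda>m. Hm m 1" and zm = "\<lambda>m t \<theta>. \<Sum>j\<le>N m. lam m j *\<^sub>R q j t \<theta>"
        and b = "\<lambda>s. Mq * b s" and X = "\<lambda>s \<theta>. norm (ql s \<theta>) *\<^sub>R El 1 s \<theta>"])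
    show "integrable leb01sq (\<lambda>(s, \<theta>). norm (ql s \<theta>) *\<^sub>R El 1 s \<theta>)"
      by (rule l2sq_integrable[OF l2_rho_El[OF n1(1)]])
    show "AE s in leb01. continuous_on {0..1} (\<lambda>\<theta>. norm (ql s \<theta>) *\<^sub>R El 1 s \<theta>)"
      using El_prim[OF n1(2)] AE_space
      by eventually_elim (auto intro!: continuous_on_scaleR continuous_on_norm ql_continuous intro: has_prim_continuous)
    show "integrable leb01 (\<lambda>s. Mq * b s)" using b by simp
    show "AE s in leb01. \<forall>\<theta>\<in>{0..1}. norm (norm (ql s \<theta>) *\<^sub>R El 1 s \<theta>) \<le> Mq * b s"
      using b(2) AE_space
    proof eventually_elim
      case (elim s)
      show ?case
      proof
        fix \<theta> :: real assume \<theta>: "\<theta> \<in> {0..1}"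
        have "norm (ql s \<theta>) * norm (El 1 s \<theta>) \<le> Mq * b s"
          using ql_bounds(2)[of s \<theta>] elim \<theta> Mq_pos by (intro mult_mono) auto
        then show "norm (norm (ql s \<theta>) *\<^sub>R El 1 s \<theta>) \<le> Mq * b s" by simp
      qed
    qed
    show "integrable leb01sq (case_prod (Hm m 1))" for m by (rule l2sq_integrable[OF l2_Hm[OF n1(1)]])
    have "AE p in leb01sq. (case p of (s, \<theta>) \<Rightarrow> norm (ql s \<theta>) *\<^sub>R El 1 s \<theta>) = case_prod (rY 1) p"
      using El_eq_Y[OF n1(1)] by eventually_elim (simp add: rY_def case_prod_beta')
    then have "(\<integral>p. norm (case_prod (Hm m 1) p - (case p of (s, \<theta>) \<Rightarrow> norm (ql s \<theta>) *\<^sub>R El 1 s \<theta>)) \<partial>leb01sq) =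
        (\<integral>p. norm (case_prod (Hm m 1) p - case_prod (rY 1) p) \<partial>leb01sq)" for m
      using l2_measurable[OF l2_diff[OF l2_Hm[OF n1(1), of m] l2_rY[OF n1(1)]]]
        l2_measurable[OF l2_diff[OF l2_Hm[OF n1(1), of m] l2_rho_El[OF n1(1)]]]
      by (intro integral_cong_AE measurable_compose[OF _ borel_measurable_norm]) (auto elim!: eventually_mono)
    then show "(\<lambda>m. \<integral>p. norm (case_prod (Hm m 1) p - (case p of (s, \<theta>) \<Rightarrow> norm (ql s \<theta>) *\<^sub>R El 1 s \<theta>)) \<partial>leb01sq) \<longlonglongrightarrow> 0"
      using Hm_L1[OF n1(1)] by simp
    show "(\<Sum>j\<le>N m. lam m j *\<^sub>R q j t \<theta>) = ql 0 \<theta> + prim (\<lambda>s. Hm m 1 s \<theta>) t"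
      if "t \<in> {0..1}" "\<theta> \<in> {0..1}" for m t \<theta>
    proof -
      have "has_prim (\<lambda>t. \<Sum>j\<le>N m. lam m j *\<^sub>R q j t \<theta>) (\<lambda>s. Hm m 1 s \<theta>)"
        unfolding Hm_def by (rule has_prim_sum_scaleR[OF arc_pathD(7)[OF e.ap that(2)]])
      from has_primD[OF this that(1)] show ?thesis
        by (simp add: q0[OF that(2)] limit_initial(1)[OF that(2)] scaleR_sum_left[symmetric] lam_sum)
    qed
    show "\<exists>N'. \<forall>m\<ge>N'. \<forall>t\<in>{0..1}. \<forall>\<theta>\<in>{0..1}. norm ((\<Sum>j\<le>N m. lam m j *\<^sub>R q j t \<theta>) - ql t \<theta>) \<le> e" if "0 < e" for e
      using combination_limit[OF that] by blast
  qed (use ql_continuous \<theta> in auto)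
qed

lemma limit_c_evolution:
  assumes \<theta>: "\<theta> \<in> {0..1}" and n: "2 \<le> n"
  shows "has_prim (\<lambda>t. cl t \<theta>) (\<lambda>s. El 0 s \<theta>)"
proof -
  have n1: "0 \<le> n" "0 < n" using n by auto
  obtain b where b: "integrable leb01 b" "AE s in leb01. \<forall>\<theta>\<in>{0..1}. norm (El 0 s \<theta>) \<le> b s"
    using El_dom[OF n1(2)] by blast
  show ?thesis
  proof (rule evolution_limit[where Xm = "\<lambda>m. Gm m 0" and zm = "\<lambda>m t \<theta>. \<Sum>j\<le>N m. lam m j *\<^sub>R c j t \<theta>"
        and b = b and X = "El 0"])
    show "integrable leb01sq (case_prod (El 0))" by (rule l2sq_integrable[OF El_l2[OF n1(1)]])
    show "AE s in leb01. continuous_on {0..1} (El 0 s)"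
      using El_prim[OF n1(2)] by eventually_elim (rule has_prim_continuous)
    show "integrable leb01sq (case_prod (Gm m 0))" for m by (rule l2sq_integrable[OF l2_Gm[OF n1(1)]])
    have "(\<integral>p. norm (case_prod (Gm m 0) p - case_prod (El 0) p) \<partial>leb01sq) =
        (\<integral>p. norm (case_prod (Gm m 0) p - case_prod (Y 0) p) \<partial>leb01sq)" for m
      using l2_measurable[OF l2_diff[OF l2_Gm[OF n1(1), of m] Y[OF n1(1)]]]
        l2_measurable[OF l2_diff[OF l2_Gm[OF n1(1), of m] El_l2[OF n1(1)]]]
      by (intro integral_cong_AE measurable_compose[OF _ borel_measurable_norm]) (auto intro: eventually_mono[OF El_eq_Y[OF n1(1)]])
    then show "(\<lambda>m. \<integral>p. norm (case_prod (Gm m 0) p - case_prod (El 0) p) \<partial>leb01sq) \<longlonglongrightarrow> 0"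
      using Gm_L1[OF n1(1)] by simp
    show "(\<Sum>j\<le>N m. lam m j *\<^sub>R c j t \<theta>) = cl 0 \<theta> + prim (\<lambda>s. Gm m 0 s \<theta>) t"
      if "t \<in> {0..1}" "\<theta> \<in> {0..1}" for m t \<theta>
    proof -
      have "has_prim (\<lambda>t. \<Sum>j\<le>N m. lam m j *\<^sub>R c j t \<theta>) (\<lambda>s. Gm m 0 s \<theta>)"
        unfolding Gm_def by (rule has_prim_sum_scaleR[OF arc_pathD(8)[OF e.ap that(2)]])
      from has_primD[OF this that(1)] show ?thesis
        by (simp add: c0[OF that(2)] limit_initial(2)[OF that(2)] scaleR_sum_left[symmetric] lam_sum)
    qed
    show "\<exists>N'. \<forall>m\<ge>N'. \<forall>t\<in>{0..1}. \<forall>\<theta>\<in>{0..1}. norm ((\<Sum>j\<le>N m. lam m j *\<^sub>R c j t \<theta>) - cl t \<theta>) \<le> e" if "0 < e" for e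
      using combination_limit[OF that] by blast
  qed (use cl_continuous \<theta> b in auto)
qed

theorem limit_arc_path: "arc_path n cl ql El"
proof -
  have n: "2 \<le> n" by (rule e.n)
  show ?thesis
    unfolding arc_path_def
  proof (intro conjI allI impI)
    show "\<forall>t\<in>{0..1}. continuous_on {0..1} (ql t) \<and> has_prim (cl t) (ql t)" using ql_continuous limit_prim by blast
    show "\<forall>t\<in>{0..1}. \<forall>\<theta>\<in>{0..1}. ql t \<theta> \<noteq> 0" using ql_nonzero by blast
    show "\<forall>\<theta>\<in>{0..1}. has_prim (\<lambda>t. ql t \<theta>) (\<lambda>t. norm (ql t \<theta>) *\<^sub>R El 1 t \<theta>) \<and> has_prim (\<lambda>t. cl t \<theta>) (\<lambda>t. El 0 t \<theta>)"
      using limit_q_evolution[OF _ n] limit_c_evolution[OF _ n] by blast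
  qed (use ql_measurable El_measurable El_prim in blast)+
qed

end

subsection \<open>Lower semicontinuity of the energy\<close>

text \<open>Comparability of x and y in both directions covers positive and negative exponents
  alike.\<close>

lemma powi_le_ratio:
  fixes x y u :: real
  assumes x: "0 < x" and y: "0 < y" and xy: "x \<le> u * y" "y \<le> u * x" and u: "1 \<le> u" and k: "nat \<bar>k\<bar> \<le> N"
  shows "x powi k \<le> u ^ N * y powi k"
proof -
  have uk: "u ^ nat \<bar>k\<bar> * y powi k \<le> u ^ N * y powi k"
    using y u k by (intro mult_right_mono power_increasing) auto
  show ?thesis
  proof (cases "0 \<le> k")
    case True
    have "x ^ nat k \<le> (u * y) ^ nat k" using xy(1) x by (intro power_mono) auto
    then have "x powi k \<le> u ^ nat \<bar>k\<bar> * y powi k" using True by (simp add: power_int_def power_mult_distrib)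
    with uk show ?thesis by linarith
  next
    case False
    have "inverse x \<le> u * inverse y" using xy(2) x y by (simp add: field_simps)
    then have "inverse x ^ nat (- k) \<le> (u * inverse y) ^ nat (- k)" using x by (intro power_mono) auto
    then have "x powi k \<le> u ^ nat \<bar>k\<bar> * y powi k" using False by (simp add: power_int_def power_mult_distrib)
    with uk show ?thesis by linarith
  qed
qed

text \<open>The factor 1 + e of the main term can be sent to 1 at the end, while the large factor 1
  + 1/e multiplies a distance that tends to 0 for fixed e.\<close>

lemma norm_sq_le_weighted:
  fixes x y :: "'a::euclidean_space"
  assumes e: "0 < e"
  shows "(norm y)\<^sup>2 \<le> (1 + e) * (norm x)\<^sup>2 + (1 + 1 / e) * (norm (x - y))\<^sup>2"
proof -
  let ?a = "norm x" and ?b = "norm (x - y)"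
  have "norm y \<le> ?a + ?b" using norm_triangle_sub[of y x] by (simp add: norm_minus_commute)
  then have "(norm y)\<^sup>2 \<le> (?a + ?b)\<^sup>2" by (intro power_mono) auto
  also have "\<dots> = ?a\<^sup>2 + ?b\<^sup>2 + 2 * ?a * ?b" by (simp add: power2_sum)
  also have "2 * ?a * ?b \<le> e * ?a\<^sup>2 + ?b\<^sup>2 / e"
  proof -
    have "0 \<le> (e * ?a - ?b)\<^sup>2 / e" using e by simp
    also have "\<dots> = e * ?a\<^sup>2 + ?b\<^sup>2 / e - 2 * ?a * ?b"
      using e by (simp add: power2_eq_square field_simps)
    finally show ?thesis by simp
  qed
  finally show ?thesis by (simp add: algebra_simps)
qed

text \<open>Jensen's inequality for the square, again from nonnegativity of a variance, now with
  respect to the weights \<open>lam\<close>.\<close>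

lemma cvx_norm_sq_le:
  fixes x :: "nat \<Rightarrow> 'a::euclidean_space"
  assumes "cvx j N lam"
  shows "(norm (\<Sum>i\<le>N. lam i *\<^sub>R x i))\<^sup>2 \<le> (\<Sum>i\<le>N. lam i * (norm (x i))\<^sup>2)"
proof -
  let ?R = "\<Sum>i\<le>N. lam i * norm (x i)"
  have s: "(\<Sum>i\<le>N. lam i) = 1" and l: "0 \<le> lam i" for i using assms by (auto simp: cvx_def)
  have "norm (\<Sum>i\<le>N. lam i *\<^sub>R x i) \<le> ?R"
    using l by (intro sum_norm_le) simp
  then have 1: "(norm (\<Sum>i\<le>N. lam i *\<^sub>R x i))\<^sup>2 \<le> ?R\<^sup>2" by (intro power_mono) auto
  have "0 \<le> (\<Sum>i\<le>N. lam i * (norm (x i) - ?R)\<^sup>2)" using l by (intro sum_nonneg) simp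
  also have "\<dots> = (\<Sum>i\<le>N. lam i * (norm (x i))\<^sup>2 - 2 * ?R * (lam i * norm (x i)) + ?R\<^sup>2 * lam i)"
    by (intro sum.cong) (simp_all add: power2_eq_square algebra_simps)
  also have "\<dots> = (\<Sum>i\<le>N. lam i * (norm (x i))\<^sup>2) - 2 * ?R * ?R + ?R\<^sup>2 * 1"
    unfolding sum.distrib sum_subtractf sum_distrib_left[symmetric] s ..
  finally show ?thesis using 1 by (simp add: power2_eq_square)
qed

definition total_energy :: "nat \<Rightarrow> (nat \<Rightarrow> real) \<Rightarrow> (real \<Rightarrow> real \<Rightarrow> 'a::euclidean_space) \<Rightarrow>
    (nat \<Rightarrow> real \<Rightarrow> real \<Rightarrow> 'a) \<Rightarrow> real" where
  "total_energy n a q E = (\<Sum>i\<le>n. \<integral>p. arc_weight a q i p * (norm (case_prod (E i) p))\<^sup>2 \<partial>leb01sq)"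

lemma total_energy_nonneg:
  assumes "\<And>i. 0 < a i"
  shows "0 \<le> total_energy n a q E"
  unfolding total_energy_def arc_weight_def
  using less_imp_le[OF assms] by (intro sum_nonneg integral_nonneg_AE AE_I2 mult_nonneg_nonneg zero_le_power_int) auto

context arc_estimates
begin

lemma nn_integral_energy: "(\<integral>\<^sup>+t. arc_energy n a q E t \<partial>leb01) = ennreal (total_energy n a q E)"
  unfolding total_energy_def
  by (rule arc_energy_integral[OF a mq_pos arc_pathD(1)[OF ap] q_bounds(1) q_bounds(2) E_l2(1)])

end

context arc_limit
begin

lemma weight_close:
  assumes e: "0 < e"
  obtains J where "\<And>j p i. J \<le> j \<Longrightarrow> p \<in> space leb01sq \<Longrightarrow> i \<le> n \<Longrightarrow>
    arc_weight a ql i p \<le> (1 + e) * arc_weight a (q j) i p"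
proof -
  \<comment> \<open>The exponent counts the factors \<open>u\<close> lost: at most |2i - 3| \<le> 2n
    + 3 of them for the power of the length, and one for the speed |q|.\<close>
  define D where "D = 2 * n + 4"
  define u where "u = root D (1 + e)"
  have D: "0 < D" unfolding D_def by simp
  have u: "u ^ D = 1 + e" unfolding u_def using e D by (simp add: real_root_pow_pos2)
  have u1: "1 < u" unfolding u_def using e D by simp
  \<comment> \<open>Speeds are at least \<open>mq\<close>, so an absolute error of (u - 1) mq is a
    relative error of at most u - 1.\<close>
  define s where "s = (u - 1) * mq"
  have s: "0 < s" unfolding s_def using u1 mq_pos by simp
  obtain J where J: "\<And>j t \<theta>. J \<le> j \<Longrightarrow> t \<in> {0..1} \<Longrightarrow> \<theta> \<in> {0..1} \<Longrightarrow>
     norm (c j t \<theta> - cl t \<theta>) \<le> s \<and> norm (q j t \<theta> - ql t \<theta>) \<le> s"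
    by (rule close[OF s]) blast
  have ratio: "norm (ql t \<theta>) \<le> u * norm (q j t \<theta>) \<and> norm (q j t \<theta>) \<le> u * norm (ql t \<theta>)"
    if j: "J \<le> j" and t: "t \<in> {0..1}" "\<theta> \<in> {0..1}" for j t \<theta>
  proof -
    have d: "\<bar>norm (q j t \<theta>) - norm (ql t \<theta>)\<bar> \<le> s"
      using J[OF j t] norm_triangle_ineq3[of "q j t \<theta>" "ql t \<theta>"] by linarith
    have "s \<le> (u - 1) * norm (q j t \<theta>)" "s \<le> (u - 1) * norm (ql t \<theta>)"
      unfolding s_def using u1 e.q_bounds(1)[OF t, of j] ql_bounds(1)[OF t] by (intro mult_left_mono; simp)+
    then show ?thesis using d unfolding left_diff_distrib mult_1 by (intro conjI) linarith+
  qed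
  show ?thesis
  proof (rule that[of J])
    fix j p i assume j: "J \<le> j" and p: "p \<in> space leb01sq" and i: "i \<le> n"
    obtain t \<theta> where p: "p = (t, \<theta>)" "t \<in> {0..1}" "\<theta> \<in> {0..1}" using p by (auto simp: space_pair_measure)
    let ?L = "\<integral>\<theta>. norm (ql t \<theta>) \<partial>leb01" and ?Lj = "\<integral>\<theta>. norm (q j t \<theta>) \<partial>leb01"
    have int: "integrable leb01 (\<lambda>\<theta>. norm (ql t \<theta>))" "integrable leb01 (\<lambda>\<theta>. norm (q j t \<theta>))"
      using ql_continuous[OF p(2)] arc_pathD(3)[OF e.ap p(2), of j]
      by (auto intro: continuous_integrable_leb01 integrable_norm)
    have "?L \<le> (\<integral>\<theta>. u * norm (q j t \<theta>) \<partial>leb01)" "?Lj \<le> (\<integral>\<theta>. u * norm (ql t \<theta>) \<partial>leb01)"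
      using int ratio[OF j p(2)] by (intro integral_mono; simp)+
    then have L: "?L \<le> u * ?Lj" "?Lj \<le> u * ?L" by simp_all
    have Lpos: "0 < ?L" "0 < ?Lj"
      using length_bounds(1)[OF section_measurable(1)[OF ql_measurable p(2)] ql_bounds(1)[OF p(2)] ql_bounds(2)[OF p(2)]]
        length_bounds(1)[OF section_measurable(1)[OF arc_pathD(1)[OF e.ap[of j]] p(2)] e.q_bounds(1)[OF p(2)] e.q_bounds(2)[OF p(2)]]
        mq_pos by auto
    have "?L powi (2 * int i - 3) \<le> u ^ (2 * n + 3) * ?Lj powi (2 * int i - 3)"
      by (rule powi_le_ratio[OF Lpos L]) (use u1 i in auto)
    then have "?L powi (2 * int i - 3) * norm (ql t \<theta>) \<le>
        (u ^ (2 * n + 3) * ?Lj powi (2 * int i - 3)) * (u * norm (q j t \<theta>))"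
      using ratio[OF j p(2,3)] Lpos u1 by (intro mult_mono) auto
    also have "\<dots> = u ^ D * (?Lj powi (2 * int i - 3) * norm (q j t \<theta>))"
      unfolding D_def by (simp add: eval_nat_numeral)
    finally have "a i * (?L powi (2 * int i - 3) * norm (ql t \<theta>)) \<le>
        a i * (u ^ D * (?Lj powi (2 * int i - 3) * norm (q j t \<theta>)))"
      using e.a[of i] by (intro mult_left_mono) auto
    then show "arc_weight a ql i p \<le> (1 + e) * arc_weight a (q j) i p"
      unfolding arc_weight_def p u by (simp add: mult_ac)
  qed
qed

text \<open>One factor 1 + e pays for replacing \<open>El i\<close> by the average
  \<open>Gm m i\<close>, the other for replacing the weight of the limit by those of the members;
  convexity of the square comes in between. The last term tends to 0 with growing m by
  \<open>Gm_L2\<close>.\<close>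

lemma component_energy_lsc:
  assumes e: "0 < e" and i: "i \<le> n" and m: "\<And>j p. m \<le> j \<Longrightarrow> p \<in> space leb01sq \<Longrightarrow>
      arc_weight a ql i p \<le> (1 + e) * arc_weight a (q j) i p"
    and W: "\<And>p. p \<in> space leb01sq \<Longrightarrow> 0 \<le> arc_weight a ql i p \<and> arc_weight a ql i p \<le> W"
  shows "(\<integral>p. arc_weight a ql i p * (norm (case_prod (El i) p))\<^sup>2 \<partial>leb01sq) \<le>
    (1 + e)\<^sup>2 * (\<Sum>j\<le>N m. lam m j * (\<integral>p. arc_weight a (q j) i p * (norm (case_prod (E j i) p))\<^sup>2 \<partial>leb01sq)) +
    (1 + 1 / e) * W * (\<integral>p. (norm (case_prod (Gm m i) p - case_prod (Y i) p))\<^sup>2 \<partial>leb01sq)"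
proof -
  let ?A = "\<lambda>p. \<Sum>j\<le>N m. lam m j * (arc_weight a (q j) i p * (norm (case_prod (E j i) p))\<^sup>2)"
  let ?B = "\<lambda>p. (norm (case_prod (Gm m i) p - case_prod (Y i) p))\<^sup>2"
  have wE: "integrable leb01sq (\<lambda>p. arc_weight a (q j) i p * (norm (case_prod (E j i) p))\<^sup>2)" for j
    by (rule arc_weight_integrable[OF e.a mq_pos arc_pathD(1)[OF e.ap] e.q_bounds(1) e.q_bounds(2) e.E_l2(1)[OF i]])
  have Ai: "integrable leb01sq ?A"
    by (intro Bochner_Integration.integrable_sum integrable_mult_right wE)
  have Bi: "integrable leb01sq ?B" using l2_diff[OF l2_Gm[OF i] Y[OF i]] unfolding l2_def by blast
  have wl: "integrable leb01sq (\<lambda>p. arc_weight a ql i p * (norm (case_prod (El i) p))\<^sup>2)"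
    by (rule arc_weight_integrable[OF e.a mq_pos ql_measurable ql_bounds(1) ql_bounds(2) El_l2[OF i]])
  have lam: "0 \<le> lam m j" "lam m j \<noteq> 0 \<Longrightarrow> m \<le> j" for j using cvx[of m] by (auto simp: cvx_def)
  have ABi: "integrable leb01sq (\<lambda>p. (1 + e)\<^sup>2 * ?A p + (1 + 1 / e) * W * ?B p)"
    by (intro Bochner_Integration.integrable_add integrable_mult_right Ai Bi)
  have ae: "AE p in leb01sq. arc_weight a ql i p * (norm (case_prod (El i) p))\<^sup>2 \<le> (1 + e)\<^sup>2 * ?A p + (1 + 1 / e) * W * ?B p"
    using El_eq_Y[OF i] AE_space
  proof eventually_elim
    case (elim p)
    let ?w = "arc_weight a ql i p"
    note Wp = W[OF elim(2)]
    have G: "case_prod (Gm m i) p = (\<Sum>j\<le>N m. lam m j *\<^sub>R case_prod (E j i) p)"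
      by (simp add: Gm_def case_prod_beta')
    have "?w * (norm (case_prod (El i) p))\<^sup>2 \<le>
        ?w * ((1 + e) * (norm (case_prod (Gm m i) p))\<^sup>2 + (1 + 1 / e) * ?B p)"
      unfolding elim(1) using Wp by (intro mult_left_mono norm_sq_le_weighted e) auto
    also have "\<dots> = (1 + e) * (?w * (norm (case_prod (Gm m i) p))\<^sup>2) + (1 + 1 / e) * (?w * ?B p)"
      by (simp only: distrib_left mult_ac)
    also have "\<dots> \<le> (1 + e) * ((1 + e) * ?A p) + (1 + 1 / e) * (W * ?B p)"
    proof (intro add_mono mult_left_mono)
      have "?w * (norm (case_prod (Gm m i) p))\<^sup>2 \<le> ?w * (\<Sum>j\<le>N m. lam m j * (norm (case_prod (E j i) p))\<^sup>2)"
        unfolding G using Wp by (intro mult_left_mono cvx_norm_sq_le[OF cvx]) auto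
      also have "\<dots> = (\<Sum>j\<le>N m. lam m j * (?w * (norm (case_prod (E j i) p))\<^sup>2))"
        unfolding sum_distrib_left by (simp only: mult_ac)
      also have "\<dots> \<le> (\<Sum>j\<le>N m. lam m j * ((1 + e) * (arc_weight a (q j) i p * (norm (case_prod (E j i) p))\<^sup>2)))"
      proof (rule sum_mono)
        fix j
        show "lam m j * (?w * (norm (case_prod (E j i) p))\<^sup>2) \<le>
            lam m j * ((1 + e) * (arc_weight a (q j) i p * (norm (case_prod (E j i) p))\<^sup>2))"
        proof (cases "lam m j = 0")
          case False
          have "?w * (norm (case_prod (E j i) p))\<^sup>2 \<le> ((1 + e) * arc_weight a (q j) i p) * (norm (case_prod (E j i) p))\<^sup>2"
            by (intro mult_right_mono m[OF lam(2)[OF False] elim(2)]) simp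
          then show ?thesis using lam(1)[of j] unfolding mult.assoc by (rule mult_left_mono)
        qed simp
      qed
      also have "\<dots> = (1 + e) * ?A p" unfolding sum_distrib_left by (simp only: mult_ac)
      finally show "?w * (norm (case_prod (Gm m i) p))\<^sup>2 \<le> (1 + e) * ?A p" .
    qed (use Wp e in \<open>auto intro: mult_right_mono\<close>)
    also have "\<dots> = (1 + e)\<^sup>2 * ?A p + (1 + 1 / e) * W * ?B p"
      by (simp only: power2_eq_square mult.assoc)
    finally show ?case .
  qed
  have "(\<integral>p. arc_weight a ql i p * (norm (case_prod (El i) p))\<^sup>2 \<partial>leb01sq) \<le>
     (\<integral>p. (1 + e)\<^sup>2 * ?A p + (1 + 1 / e) * W * ?B p \<partial>leb01sq)"
    by (rule integral_mono_AE[OF wl ABi ae])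
  also have "\<dots> = (\<integral>p. (1 + e)\<^sup>2 * ?A p \<partial>leb01sq) + (\<integral>p. (1 + 1 / e) * W * ?B p \<partial>leb01sq)"
    by (rule Bochner_Integration.integral_add) (intro integrable_mult_right Ai Bi)+
  also have "\<dots> = (1 + e)\<^sup>2 * (\<integral>p. ?A p \<partial>leb01sq) + (1 + 1 / e) * W * (\<integral>p. ?B p \<partial>leb01sq)"
    by (simp only: integral_mult_right_zero)
  also have "(\<integral>p. ?A p \<partial>leb01sq) = (\<Sum>j\<le>N m. \<integral>p. lam m j * (arc_weight a (q j) i p * (norm (case_prod (E j i) p))\<^sup>2) \<partial>leb01sq)"
    by (rule Bochner_Integration.integral_sum) (intro integrable_mult_right wE)
  finally show ?thesis by (simp only: integral_mult_right_zero)
qed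

lemma limit_energy:
  "(\<integral>\<^sup>+t. arc_energy n a ql El t \<partial>leb01) = ennreal (total_energy n a ql El)"
  unfolding total_energy_def
  by (rule arc_energy_integral[OF e.a mq_pos ql_measurable ql_bounds(1) ql_bounds(2) El_l2])

text \<open>The bound is an average of energies with the weights \<open>lam m\<close>, which are the
  same for every component. Along a minimising sequence only the sum of the component energies is
  arranged to converge, so the components have to be added before the limit is taken.\<close>

lemma energy_lsc:
  assumes e: "0 < e"
  shows "\<exists>m0. \<forall>m\<ge>m0. total_energy n a ql El \<le> (1 + e)\<^sup>2 * (\<Sum>j\<le>N m. lam m j * total_energy n a (q j) (E j)) + e"
proof -
  obtain J where J: "\<And>j p i. J \<le> j \<Longrightarrow> p \<in> space leb01sq \<Longrightarrow> i \<le> n \<Longrightarrow>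
    arc_weight a ql i p \<le> (1 + e) * arc_weight a (q j) i p"
    by (rule weight_close[OF e]) blast
  have "\<exists>W. \<forall>p\<in>space leb01sq. 0 \<le> arc_weight a ql i p \<and> arc_weight a ql i p \<le> W" for i
    by (rule arc_weight_bounds[where a = a and i = i, OF e.a mq_pos ql_measurable ql_bounds(1) ql_bounds(2)]) blast+
  then obtain W where W: "\<And>i p. p \<in> space leb01sq \<Longrightarrow> 0 \<le> arc_weight a ql i p \<and> arc_weight a ql i p \<le> W i" by metis
  let ?r = "\<lambda>m. \<Sum>i\<le>n. (1 + 1 / e) * W i * (\<integral>p. (norm (case_prod (Gm m i) p - case_prod (Y i) p))\<^sup>2 \<partial>leb01sq)"
  have "?r \<longlonglongrightarrow> (\<Sum>i\<le>n. (1 + 1 / e) * W i * 0)"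
    by (intro tendsto_sum tendsto_mult tendsto_const Gm_L2) simp
  then have "?r \<longlonglongrightarrow> 0" by simp
  from LIMSEQ_D[OF this e] obtain m1 where m1: "\<And>m. m1 \<le> m \<Longrightarrow> ?r m < e" by fastforce
  have "total_energy n a ql El \<le> (1 + e)\<^sup>2 * (\<Sum>j\<le>N m. lam m j * total_energy n a (q j) (E j)) + e"
    if m: "max J m1 \<le> m" for m
  proof -
    have "total_energy n a ql El \<le> (\<Sum>i\<le>n. (1 + e)\<^sup>2 * (\<Sum>j\<le>N m. lam m j * (\<integral>p. arc_weight a (q j) i p * (norm (case_prod (E j i) p))\<^sup>2 \<partial>leb01sq)) +
        (1 + 1 / e) * W i * (\<integral>p. (norm (case_prod (Gm m i) p - case_prod (Y i) p))\<^sup>2 \<partial>leb01sq))"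
      unfolding total_energy_def
    proof (rule sum_mono)
      fix i assume "i \<in> {..n}"
      then show "(\<integral>p. arc_weight a ql i p * (norm (case_prod (El i) p))\<^sup>2 \<partial>leb01sq) \<le>
        (1 + e)\<^sup>2 * (\<Sum>j\<le>N m. lam m j * (\<integral>p. arc_weight a (q j) i p * (norm (case_prod (E j i) p))\<^sup>2 \<partial>leb01sq)) +
        (1 + 1 / e) * W i * (\<integral>p. (norm (case_prod (Gm m i) p - case_prod (Y i) p))\<^sup>2 \<partial>leb01sq)"
        using J W m by (intro component_energy_lsc[OF e]) auto
    qed
    also have "\<dots> = (1 + e)\<^sup>2 * (\<Sum>i\<le>n. \<Sum>j\<le>N m. lam m j * (\<integral>p. arc_weight a (q j) i p * (norm (case_prod (E j i) p))\<^sup>2 \<partial>leb01sq)) + ?r m"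
      by (simp only: sum.distrib sum_distrib_left)
    also have "(\<Sum>i\<le>n. \<Sum>j\<le>N m. lam m j * (\<integral>p. arc_weight a (q j) i p * (norm (case_prod (E j i) p))\<^sup>2 \<partial>leb01sq)) =
        (\<Sum>j\<le>N m. lam m j * total_energy n a (q j) (E j))"
      unfolding total_energy_def sum_distrib_left by (rule sum.swap)
    finally show ?thesis using m1[of m] m by linarith
  qed
  then show ?thesis by blast
qed

end

section \<open>Paths of shape graphs and paths in arc length coordinates\<close>

lemma hn_chain_imp_imm:
  assumes D: "hn_chain n f D" and n: "2 \<le> n" and g: "has_prim f g" "continuous_on {0..1} g"
    and nz: "\<And>\<theta>. \<theta> \<in> {0..1} \<Longrightarrow> g \<theta> \<noteq> 0"
  shows "imm n f"
proof -
  have "continuous_on {0..1} (D 1)"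
    using has_prim_continuous[OF hn_chain_rel[OF D, of 1]] n by simp
  moreover have "has_prim f (D 1)"
  proof -
    have "has_prim f (D 1) \<longleftrightarrow> has_prim (D 0) (D 1)"
      by (rule has_prim_cong) (simp_all add: hn_chain_0[OF D])
    then show ?thesis using hn_chain_rel[OF D, of 0] n by simp
  qed
  ultimately have "D 1 \<theta> = g \<theta>" if "\<theta> \<in> {0..1}" for \<theta>
    using dtheta_eq[OF _ _ that] g by metis
  then show ?thesis unfolding imm_def using D nz by metis
qed

text \<open>The way back from the limit to admissible paths: H^n regularity is known at time 0 only,
  and \<open>arc_regularity\<close> transports it to all times and to the velocity.\<close>

lemma arc_path_admissible:
  fixes q :: "real \<Rightarrow> real \<Rightarrow> 'a::euclidean_space"
  assumes ap: "arc_path n c q E" and n: "2 \<le> n" and E: "\<And>i. i \<le> n \<Longrightarrow> l2 leb01sq (case_prod (E i))"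
    and C: "\<And>t \<theta>. t \<in> {0..1} \<Longrightarrow> \<theta> \<in> {0..1} \<Longrightarrow> norm (q t \<theta>) \<le> C" and c0: "imm n (c 0)"
  shows "\<exists>W. chain_path n c W \<and> W 0 = E 0" and "\<And>t. t \<in> {0..1} \<Longrightarrow> imm n (c t)"
proof -
  obtain k where k: "n = Suc (Suc k)" using n by (metis add_2_eq_Suc le_Suc_ex)
  obtain D where D: "hn_chain n (c 0) D" "\<And>\<theta>. \<theta> \<in> {0..1} \<Longrightarrow> dtheta (c 0) \<theta> = D 1 \<theta>"
    by (rule imm_dtheta[OF c0 n]) blast
  have "ssob (Suc k) (D 1)" using hn_chain_imp_ssob[OF D(1), of 1] k by simp
  then obtain g where g: "ssob k g" "has_prim (D 1) g" by auto
  have "has_prim (q 0) g \<longleftrightarrow> has_prim (D 1) g"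
    by (rule has_prim_cong) (use arc_path_dtheta[OF ap] D(2) in auto)
  then have q0: "ssob (Suc k) (q 0)" using g by auto
  have nq0: "ssob (Suc k) (\<lambda>\<theta>. norm (q 0 \<theta>))"
    by (rule ssob_norm[OF q0]) (use arc_pathD(5)[OF ap] in auto)
  note reg = arc_regularity[OF arc_pathD(1)[OF ap] C arc_pathD(5)[OF ap] arc_pathD(7)[OF ap]
      E[unfolded k] arc_pathD(6)[OF ap, unfolded k] q0 nq0]
  have "sobA n (E 0)" using reg(1) unfolding k by blast
  then obtain W where W: "W 0 = E 0" "\<And>i. i \<le> n \<Longrightarrow> l2 leb01sq (case_prod (W i))"
    "\<And>i. i < n \<Longrightarrow> AE t in leb01. has_prim (W i t) (W (Suc i) t)" by (rule psob_chain) blast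
  have "chain_path n c W"
    unfolding chain_path_def
  proof (intro conjI allI impI ballI)
    fix t \<theta> :: real assume "t \<in> {0..1}" "\<theta> \<in> {0..1}"
    then show "c t \<theta> = c 0 \<theta> + prim (\<lambda>s. W 0 s \<theta>) t"
      unfolding W(1) using has_primD[OF arc_pathD(8)[OF ap]] by blast
  qed (use W in auto)
  then show "\<exists>W. chain_path n c W \<and> W 0 = E 0" using W(1) by blast
  fix t :: real assume t: "t \<in> {0..1}"
  have "ssob (Suc k) (q t)" using reg(2) t by blast
  then have "ssob n (c t)" using arc_pathD(4)[OF ap t] unfolding k by auto
  then obtain D' where "hn_chain n (c t) D'" using ssob_imp_hn_chain by blast
  then show "imm n (c t)"
    by (rule hn_chain_imp_imm[OF _ n arc_pathD(4)[OF ap t] arc_pathD(3)[OF ap t] arc_pathD(5)[OF ap t]])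
qed

lemma h1_path_imp_arc_path:
  assumes f: "h1_path n f" and imm: "\<And>t. t \<in> {0..1} \<Longrightarrow> imm n (f t)" and n: "2 \<le> n"
  shows "\<exists>q E. arc_path n f q E \<and> (AE t in leb01. metricG n a (f t) (path_vel n f t) = arc_energy n a q E t)"
proof -
  have n1: "1 \<le> n" using n by simp
  obtain W where "h1_with n f W" using f unfolding h1_path_def by blast
  then have W: "chain_path n f W" by (rule h1_with_imp_chain_path[OF _ n1])
  obtain q E where q: "arc_path n f q E" "E 0 = W 0"
    by (rule chain_path_imp_arc_path[OF W n imm])
  with arc_path_metricG[OF q(1) W n1, of a] show ?thesis by auto
qed

lemma path_energy_eq:
  assumes ap: "\<And>k. k \<in> {1..K} \<Longrightarrow> arc_path n (c k) (q k) (E k)"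
    and ae: "\<And>k. k \<in> {1..K} \<Longrightarrow> AE t in leb01. metricG n a (c k t) (path_vel n (c k) t) = arc_energy n a (q k) (E k) t"
  shows "path_energy n a K c = (\<Sum>k\<in>{1..K}. \<integral>\<^sup>+t. arc_energy n a (q k) (E k) t \<partial>leb01)"
proof -
  have "AE t in leb01. \<forall>k\<in>{1..K}. metricG n a (c k t) (path_vel n (c k) t) = arc_energy n a (q k) (E k) t"
    using ae by (intro AE_finite_allI) auto
  then have "AE t in leb01. (\<Sum>k\<in>{1..K}. metricG n a (c k t) (path_vel n (c k) t)) = (\<Sum>k\<in>{1..K}. arc_energy n a (q k) (E k) t)"
    by eventually_elim (rule sum.cong[OF refl], blast)
  then have "(\<integral>\<^sup>+t. (\<Sum>k\<in>{1..K}. metricG n a (c k t) (path_vel n (c k) t)) \<partial>leb01) =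
      (\<integral>\<^sup>+t. (\<Sum>k\<in>{1..K}. arc_energy n a (q k) (E k) t) \<partial>leb01)"
    by (rule nn_integral_cong_AE)
  also have "\<dots> = (\<Sum>k\<in>{1..K}. \<integral>\<^sup>+t. arc_energy n a (q k) (E k) t \<partial>leb01)"
    by (rule nn_integral_sum) (rule arc_path_energy_measurable[OF ap])
  finally show ?thesis unfolding path_energy_def nn_integral_leb01 .
qed

section \<open>The varifold norm\<close>

lemma closed_VS: "closed (VS :: ('a::euclidean_space \<times> 'a) set)"
  unfolding VS_def by (intro closed_Times) auto

lemma rkhs_norm_nonneg:
  assumes "in_rkhs ker \<omega>"
  shows "0 \<le> rkhs_norm ker \<omega>"
proof -
  obtain C where "rkhs_bound ker \<omega> C" using assms unfolding in_rkhs_def by blast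
  then have "\<bar>C\<bar> \<in> {C. 0 \<le> C \<and> rkhs_bound ker \<omega> C}" unfolding rkhs_bound_def by simp
  then have "{C. 0 \<le> C \<and> rkhs_bound ker \<omega> C} \<noteq> {}" by blast
  then show ?thesis unfolding rkhs_norm_def by (rule cInf_greatest) simp
qed

text \<open>Keeps the unit ball nonempty, so that suprema over it make sense, and as a test function
  shows that varifold distances are nonnegative.\<close>

lemma zero_in_rkhs: "in_rkhs ker (\<lambda>_. 0)" "rkhs_norm ker (\<lambda>_. 0) \<le> 1"
proof -
  have 0: "rkhs_bound ker (\<lambda>_. 0) 0" by (simp add: rkhs_bound_def)
  then show "in_rkhs ker (\<lambda>_. 0)" unfolding in_rkhs_def by blast
  have "rkhs_norm ker (\<lambda>_. 0) \<le> 0"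
    unfolding rkhs_norm_def by (rule cInf_lower) (use 0 in \<open>auto intro!: bdd_belowI[of _ 0]\<close>)
  then show "rkhs_norm ker (\<lambda>_. 0) \<le> 1" by simp
qed

text \<open>In one application \<open>g\<close> is the norm of a differential on a varying tangent
  space, whose continuity is not evident. It is controlled by the continuous \<open>f\<close> on a
  ball and by the decay outside.\<close>

lemma vanishing_imp_bounded:
  fixes f :: "'b::euclidean_space \<Rightarrow> real"
  assumes S: "closed S" and f: "continuous_on S f" and R: "\<And>p. p \<in> S \<Longrightarrow> R \<le> norm p \<Longrightarrow> g p \<le> 1"
    and gf: "\<And>p. p \<in> S \<Longrightarrow> g p \<le> f p"
  shows "\<exists>B. \<forall>p\<in>S. g p \<le> B"
proof -
  have "compact (f ` (S \<inter> cball 0 R))"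
    by (intro compact_continuous_image continuous_on_subset[OF f] closed_Int_compact S) auto
  then obtain B where B: "\<And>p. p \<in> S \<Longrightarrow> p \<in> cball 0 R \<Longrightarrow> norm (f p) \<le> B"
    unfolding compact_eq_bounded_closed bounded_iff by blast
  show ?thesis
  proof (intro exI[of _ "max 1 B"] ballI)
    fix p assume p: "p \<in> S"
    show "g p \<le> max 1 B"
    proof (cases "R \<le> norm p")
      case False
      then have "norm (f p) \<le> B" using B[OF p] by simp
      then show ?thesis using gf[OF p] by simp
    qed (use R[OF p] in simp)
  qed
qed

text \<open>A supremum of reals dominates its set only if the set is bounded above, so both suprema
  in \<open>norm_1inf\<close> must be shown finite before the embedding yields anything. Boundedness
  comes from decay at infinity.\<close>

lemma C01_norm_bound:
  fixes \<omega> :: "'a::euclidean_space \<times> 'a \<Rightarrow> real"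
  assumes "C01_with \<omega> D"
  shows "continuous_on VS \<omega>" and "p \<in> VS \<Longrightarrow> \<bar>\<omega> p\<bar> \<le> norm_1inf \<omega> D"
proof -
  have d: "\<And>p. p \<in> VS \<Longrightarrow> (\<omega> has_derivative blinfun_apply (D p)) (at p within VS)" and Dc: "continuous_on VS D"
    using assms unfolding C01_with_def by auto
  show c: "continuous_on VS \<omega>" by (rule has_derivative_continuous_on[OF d])
  obtain R where R: "\<And>p. p \<in> VS \<Longrightarrow> R \<le> norm p \<Longrightarrow>
      \<bar>\<omega> p\<bar> \<le> 1 \<and> (\<forall>v\<in>tangent_VS p. norm v \<le> 1 \<longrightarrow> \<bar>blinfun_apply (D p) v\<bar> \<le> 1)"
    using assms unfolding C01_with_def by (meson zero_less_one)
  let ?T = "{\<bar>blinfun_apply (D p) v\<bar> | p v. p \<in> VS \<and> v \<in> tangent_VS p \<and> norm v \<le> 1}"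
  have "\<exists>B. \<forall>p\<in>VS. \<bar>\<omega> p\<bar> \<le> B"
    by (rule vanishing_imp_bounded[OF closed_VS continuous_on_rabs[OF c], where R = R]) (use R in auto)
  then have b1: "bdd_above ((\<lambda>p. \<bar>\<omega> p\<bar>) ` VS)" by (auto simp: bdd_above_def)
  define g where "g p = (SUP v\<in>{v\<in>tangent_VS p. norm v \<le> 1}. \<bar>blinfun_apply (D p) v\<bar>)" for p
  have Dv: "\<bar>blinfun_apply (D p) v\<bar> \<le> norm (D p)" if "norm v \<le> 1" for p v
  proof -
    have "norm (blinfun_apply (D p) v) \<le> norm (D p) * norm v" by (rule norm_blinfun)
    also have "\<dots> \<le> norm (D p) * 1" using that by (intro mult_left_mono) auto
    finally show ?thesis by simp
  qed
  have 0: "0 \<in> {v\<in>tangent_VS p. norm v \<le> 1}" for p :: "'a \<times> 'a" by (simp add: tangent_VS_def)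
  have bdd: "bdd_above ((\<lambda>v. \<bar>blinfun_apply (D p) v\<bar>) ` {v\<in>tangent_VS p. norm v \<le> 1})" for p
    by (rule bdd_aboveI2[where M = "norm (D p)"], rule Dv) simp
  have "\<exists>B. \<forall>p\<in>VS. g p \<le> B"
  proof (rule vanishing_imp_bounded[OF closed_VS continuous_on_norm[OF Dc], where R = R])
    fix p :: "'a \<times> 'a" assume p: "p \<in> VS"
    show "g p \<le> norm (D p)" unfolding g_def using 0 by (intro cSUP_least Dv) blast+
    show "g p \<le> 1" if "R \<le> norm p" unfolding g_def using 0 R[OF p that] by (intro cSUP_least) blast+
  qed
  then obtain B where B: "\<And>p. p \<in> VS \<Longrightarrow> g p \<le> B" by blast
  have b2: "bdd_above ?T"
  proof (rule bdd_aboveI)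
    fix y assume "y \<in> ?T"
    then obtain p v where y: "y = \<bar>blinfun_apply (D p) v\<bar>" "p \<in> VS" "v \<in> {v\<in>tangent_VS p. norm v \<le> 1}" by auto
    have "y \<le> g p" unfolding y(1) g_def by (rule cSUP_upper[OF y(3) bdd])
    then show "y \<le> B" using B[OF y(2)] by simp
  qed
  show "\<bar>\<omega> p\<bar> \<le> norm_1inf \<omega> D" if p: "p \<in> VS"
  proof -
    have "\<bar>\<omega> p\<bar> \<le> Sup ((\<lambda>p. \<bar>\<omega> p\<bar>) ` VS)" by (rule cSUP_upper[OF p b1])
    \<comment> \<open>The zero vector is tangent, which makes the second supremum nonnegative, so
      the first alone is at most the norm.\<close>
    moreover have "\<bar>blinfun_apply (D p) 0\<bar> \<in> ?T" using p 0[of p] by blast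
    then have "\<bar>blinfun_apply (D p) 0\<bar> \<le> Sup ?T" by (rule cSup_upper[OF _ b2])
    then have "0 \<le> Sup ?T" by (rule order_trans[OF abs_ge_zero])
    ultimately show ?thesis unfolding norm_1inf_def by linarith
  qed
qed

lemma rkhs_unit_ball:
  assumes "rkhs_embeds_C01 ker"
  obtains B where "0 \<le> B" "\<And>\<omega>. in_rkhs ker \<omega> \<Longrightarrow> continuous_on VS \<omega>"
    "\<And>\<omega> p. in_rkhs ker \<omega> \<Longrightarrow> rkhs_norm ker \<omega> \<le> 1 \<Longrightarrow> p \<in> VS \<Longrightarrow> \<bar>\<omega> p\<bar> \<le> B"
proof -
  obtain C where C: "\<And>\<omega>. in_rkhs ker \<omega> \<Longrightarrow> \<exists>D. C01_with \<omega> D \<and> norm_1inf \<omega> D \<le> C * rkhs_norm ker \<omega>"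
    using assms unfolding rkhs_embeds_C01_def by blast
  show ?thesis
  \<comment> \<open>The constant of the embedding carries no sign condition, so its absolute value
    serves as the bound.\<close>
  proof (rule that[of "\<bar>C\<bar>"])
    fix \<omega> assume \<omega>: "in_rkhs ker \<omega>"
    then obtain D where D: "C01_with \<omega> D" "norm_1inf \<omega> D \<le> C * rkhs_norm ker \<omega>" using C by blast
    show "continuous_on VS \<omega>" by (rule C01_norm_bound(1)[OF D(1)])
    fix p :: "'a \<times> 'a" assume n: "rkhs_norm ker \<omega> \<le> 1" and p: "p \<in> VS"
    have "C * rkhs_norm ker \<omega> \<le> \<bar>C\<bar> * 1"
      using rkhs_norm_nonneg[OF \<omega>] n by (intro mult_mono) auto
    then show "\<bar>\<omega> p\<bar> \<le> \<bar>C\<bar>" using C01_norm_bound(2)[OF D(1) p] D(2) by simp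
  qed simp
qed

section \<open>Varifold pairings of regular curves\<close>

definition regular_curve :: "(real \<Rightarrow> 'a::euclidean_space) \<Rightarrow> bool" where
  "regular_curve f \<longleftrightarrow> continuous_on {0..1} f \<and> continuous_on {0..1} (dtheta f) \<and> (\<forall>\<theta>\<in>{0..1}. dtheta f \<theta> \<noteq> 0)"

lemma imm_imp_regular_curve:
  assumes "imm n f" "2 \<le> n"
  shows "regular_curve f"
proof (rule imm_dtheta[OF assms])
  assume "\<And>\<theta>. \<theta> \<in> {0..1} \<Longrightarrow> dtheta f \<theta> \<noteq> 0" "continuous_on {0..1} (dtheta f)" "has_prim f (dtheta f)"
  then show ?thesis unfolding regular_curve_def using has_prim_continuous by blast
qed

definition varifold_integrand :: "('a::euclidean_space \<times> 'a \<Rightarrow> real) \<Rightarrow> (real \<Rightarrow> 'a) \<Rightarrow> real \<Rightarrow> real" where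
  "varifold_integrand \<omega> f \<theta> = \<omega> (f \<theta>, dtheta f \<theta> /\<^sub>R norm (dtheta f \<theta>)) * norm (dtheta f \<theta>)"

lemma varifold_pair_eq: "varifold_pair K c \<omega> = (\<Sum>k\<in>{1..K}. \<integral>\<theta>. varifold_integrand \<omega> (c k) \<theta> \<partial>leb01)"
  unfolding varifold_pair_def varifold_integrand_def set_lebesgue_integral_eq_leb01 ..

lemma unit_tangent_VS: "v \<noteq> 0 \<Longrightarrow> (x, v /\<^sub>R norm v) \<in> VS"
  by (simp add: VS_def)

lemma varifold_integrand_integrable:
  assumes \<omega>: "continuous_on VS \<omega>" and f: "regular_curve f"
  shows "integrable leb01 (varifold_integrand \<omega> f)"
proof (rule continuous_integrable_leb01)
  have f: "continuous_on {0..1} f" "continuous_on {0..1} (dtheta f)" "\<And>\<theta>. \<theta> \<in> {0..1} \<Longrightarrow> dtheta f \<theta> \<noteq> 0"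
    using f unfolding regular_curve_def by auto
  have "continuous_on {0..1} (\<lambda>\<theta>. (f \<theta>, dtheta f \<theta> /\<^sub>R norm (dtheta f \<theta>)))"
    using f by (intro continuous_on_Pair continuous_on_scaleR continuous_on_inverse continuous_on_norm) auto
  moreover have "(\<lambda>\<theta>. (f \<theta>, dtheta f \<theta> /\<^sub>R norm (dtheta f \<theta>))) ` {0..1} \<subseteq> VS"
    using unit_tangent_VS f(3) by blast
  ultimately show "continuous_on {0..1} (varifold_integrand \<omega> f)"
    unfolding varifold_integrand_def[abs_def]
    by (intro continuous_on_mult continuous_on_norm f continuous_on_compose2[OF \<omega>])
qed

lemma varifold_pair_bound:
  assumes \<omega>: "continuous_on VS \<omega>" "\<And>p. p \<in> VS \<Longrightarrow> \<bar>\<omega> p\<bar> \<le> B" and f: "\<And>k. k \<in> {1..K} \<Longrightarrow> regular_curve (c k)"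
  shows "\<bar>varifold_pair K c \<omega>\<bar> \<le> (\<Sum>k\<in>{1..K}. B * (\<integral>\<theta>. norm (dtheta (c k) \<theta>) \<partial>leb01))"
  unfolding varifold_pair_eq
proof (rule order_trans[OF sum_abs sum_mono])
  fix k assume k: "k \<in> {1..K}"
  have r: "continuous_on {0..1} (dtheta (c k))" "\<And>\<theta>. \<theta> \<in> {0..1} \<Longrightarrow> dtheta (c k) \<theta> \<noteq> 0"
    using f[OF k] unfolding regular_curve_def by auto
  note int = varifold_integrand_integrable[OF \<omega>(1) f[OF k]]
  have dint: "integrable leb01 (\<lambda>\<theta>. norm (dtheta (c k) \<theta>))"
    by (rule integrable_norm[OF continuous_integrable_leb01[OF r(1)]])
  have "\<bar>\<integral>\<theta>. varifold_integrand \<omega> (c k) \<theta> \<partial>leb01\<bar> \<le> (\<integral>\<theta>. \<bar>varifold_integrand \<omega> (c k) \<theta>\<bar> \<partial>leb01)"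
    by (rule integral_abs_bound)
  also have "\<dots> \<le> (\<integral>\<theta>. B * norm (dtheta (c k) \<theta>) \<partial>leb01)"
  proof (rule integral_mono)
    show "integrable leb01 (\<lambda>\<theta>. \<bar>varifold_integrand \<omega> (c k) \<theta>\<bar>)" using integrable_norm[OF int] by simp
    show "integrable leb01 (\<lambda>\<theta>. B * norm (dtheta (c k) \<theta>))" by (rule integrable_mult_right[OF dint])
    fix \<theta> assume "\<theta> \<in> space leb01"
    then have "\<bar>\<omega> (c k \<theta>, dtheta (c k) \<theta> /\<^sub>R norm (dtheta (c k) \<theta>))\<bar> \<le> B"
      by (intro \<omega>(2) unit_tangent_VS r(2)) simp
    then show "\<bar>varifold_integrand \<omega> (c k) \<theta>\<bar> \<le> B * norm (dtheta (c k) \<theta>)"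
      unfolding varifold_integrand_def abs_mult by (simp add: mult_right_mono)
  qed
  finally show "\<bar>\<integral>\<theta>. varifold_integrand \<omega> (c k) \<theta> \<partial>leb01\<bar> \<le> B * (\<integral>\<theta>. norm (dtheta (c k) \<theta>) \<partial>leb01)"
    by simp
qed

lemma varifold_pair_tendsto:
  assumes \<omega>: "continuous_on VS \<omega>" "\<And>p. p \<in> VS \<Longrightarrow> \<bar>\<omega> p\<bar> \<le> B"
    and f: "\<And>j k. k \<in> {1..K} \<Longrightarrow> regular_curve (f j k)" and g: "\<And>k. k \<in> {1..K} \<Longrightarrow> regular_curve (g k)"
    and lim: "\<And>k \<theta>. k \<in> {1..K} \<Longrightarrow> \<theta> \<in> {0..1} \<Longrightarrow> (\<lambda>j. f j k \<theta>) \<longlonglongrightarrow> g k \<theta>"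
      "\<And>k \<theta>. k \<in> {1..K} \<Longrightarrow> \<theta> \<in> {0..1} \<Longrightarrow> (\<lambda>j. dtheta (f j k) \<theta>) \<longlonglongrightarrow> dtheta (g k) \<theta>"
    and Q: "\<And>j k \<theta>. k \<in> {1..K} \<Longrightarrow> \<theta> \<in> {0..1} \<Longrightarrow> norm (dtheta (f j k) \<theta>) \<le> Q k"
  shows "(\<lambda>j. varifold_pair K (f j) \<omega>) \<longlonglongrightarrow> varifold_pair K g \<omega>"
  unfolding varifold_pair_eq
proof (rule tendsto_sum)
  fix k assume k: "k \<in> {1..K}"
  have nz: "dtheta (f j k) \<theta> \<noteq> 0" "dtheta (g k) \<theta> \<noteq> 0" if "\<theta> \<in> {0..1}" for j \<theta>
    using f[OF k] g[OF k] that unfolding regular_curve_def by auto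
  show "(\<lambda>j. \<integral>\<theta>. varifold_integrand \<omega> (f j k) \<theta> \<partial>leb01) \<longlonglongrightarrow> (\<integral>\<theta>. varifold_integrand \<omega> (g k) \<theta> \<partial>leb01)"
  proof (rule integral_dominated_convergence[where w = "\<lambda>_. B * Q k"])
    show "varifold_integrand \<omega> (g k) \<in> borel_measurable leb01"
      by (rule borel_measurable_integrable[OF varifold_integrand_integrable[OF \<omega>(1) g[OF k]]])
    show "varifold_integrand \<omega> (f j k) \<in> borel_measurable leb01" for j
      by (rule borel_measurable_integrable[OF varifold_integrand_integrable[OF \<omega>(1) f[OF k]]])
    show "AE \<theta> in leb01. (\<lambda>j. varifold_integrand \<omega> (f j k) \<theta>) \<longlonglongrightarrow> varifold_integrand \<omega> (g k) \<theta>"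
    proof (rule AE_I2)
      fix \<theta> assume "\<theta> \<in> space leb01"
      then have \<theta>: "\<theta> \<in> {0..1}" by simp
      have "(\<lambda>j. (f j k \<theta>, dtheta (f j k) \<theta> /\<^sub>R norm (dtheta (f j k) \<theta>))) \<longlonglongrightarrow> (g k \<theta>, dtheta (g k) \<theta> /\<^sub>R norm (dtheta (g k) \<theta>))"
        using nz(2)[OF \<theta>] by (intro tendsto_Pair tendsto_scaleR tendsto_inverse tendsto_norm lim k \<theta>) auto
      then have "(\<lambda>j. \<omega> (f j k \<theta>, dtheta (f j k) \<theta> /\<^sub>R norm (dtheta (f j k) \<theta>))) \<longlonglongrightarrow> \<omega> (g k \<theta>, dtheta (g k) \<theta> /\<^sub>R norm (dtheta (g k) \<theta>))"
        by (rule continuous_on_tendsto_compose[OF \<omega>(1)]) (use nz[OF \<theta>] in \<open>auto intro!: unit_tangent_VS always_eventually\<close>)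
      then show "(\<lambda>j. varifold_integrand \<omega> (f j k) \<theta>) \<longlonglongrightarrow> varifold_integrand \<omega> (g k) \<theta>"
        unfolding varifold_integrand_def by (intro tendsto_mult tendsto_norm lim k \<theta>)
    qed
    show "AE \<theta> in leb01. norm (varifold_integrand \<omega> (f j k) \<theta>) \<le> B * Q k" for j
    proof (rule AE_I2)
      fix \<theta> assume "\<theta> \<in> space leb01"
      then have \<theta>: "\<theta> \<in> {0..1}" by simp
      have "\<bar>\<omega> (f j k \<theta>, dtheta (f j k) \<theta> /\<^sub>R norm (dtheta (f j k) \<theta>))\<bar> \<le> B"
        by (intro \<omega>(2) unit_tangent_VS nz(1)[OF \<theta>])
      then have "\<bar>\<omega> (f j k \<theta>, dtheta (f j k) \<theta> /\<^sub>R norm (dtheta (f j k) \<theta>))\<bar> * norm (dtheta (f j k) \<theta>) \<le> B * Q k"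
        by (intro mult_mono Q k \<theta>) auto
      then show "norm (varifold_integrand \<omega> (f j k) \<theta>) \<le> B * Q k"
        unfolding varifold_integrand_def by (simp add: abs_mult)
    qed
  qed simp
qed

abbreviation varifold_distance where
  "varifold_distance ker K c K1 c1 \<equiv> varifold_norm ker (\<lambda>\<omega>. varifold_pair K c \<omega> - varifold_pair K1 c1 \<omega>)"

text \<open>The pairings with the unit ball are bounded by the total length times the uniform bound
  \<open>B\<close> from the embedding. This makes the real supremum meaningful, and then each test
  function lies below it.\<close>

lemma varifold_distance_upper:
  fixes c c1 :: "nat \<Rightarrow> real \<Rightarrow> 'a::euclidean_space"
  assumes emb: "rkhs_embeds_C01 ker" and c: "\<And>k. k \<in> {1..K} \<Longrightarrow> regular_curve (c k)"
    and c1: "\<And>k. k \<in> {1..K1} \<Longrightarrow> regular_curve (c1 k)"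
    and \<omega>: "in_rkhs ker \<omega>" "rkhs_norm ker \<omega> \<le> 1"
  shows "varifold_pair K c \<omega> - varifold_pair K1 c1 \<omega> \<le> varifold_distance ker K c K1 c1"
proof -
  obtain B where B: "\<And>\<omega>. in_rkhs ker \<omega> \<Longrightarrow> continuous_on VS \<omega>"
    "\<And>\<omega> p. in_rkhs ker \<omega> \<Longrightarrow> rkhs_norm ker \<omega> \<le> 1 \<Longrightarrow> p \<in> VS \<Longrightarrow> \<bar>\<omega> p\<bar> \<le> B"
    by (rule rkhs_unit_ball[OF emb]) blast
  show ?thesis
    unfolding varifold_norm_def
  proof (rule cSup_upper)
    show "bdd_above {varifold_pair K c \<omega> - varifold_pair K1 c1 \<omega> |\<omega>. in_rkhs ker \<omega> \<and> rkhs_norm ker \<omega> \<le> 1}"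
    proof (rule bdd_aboveI)
      fix y assume "y \<in> {varifold_pair K c \<omega> - varifold_pair K1 c1 \<omega> |\<omega>. in_rkhs ker \<omega> \<and> rkhs_norm ker \<omega> \<le> 1}"
      then obtain \<omega> where y: "y = varifold_pair K c \<omega> - varifold_pair K1 c1 \<omega>" and \<omega>: "in_rkhs ker \<omega>" "rkhs_norm ker \<omega> \<le> 1"
        by blast
      show "y \<le> (\<Sum>k\<in>{1..K}. B * (\<integral>\<theta>. norm (dtheta (c k) \<theta>) \<partial>leb01)) + (\<Sum>k\<in>{1..K1}. B * (\<integral>\<theta>. norm (dtheta (c1 k) \<theta>) \<partial>leb01))"
      proof -
        have "\<bar>varifold_pair K c \<omega>\<bar> \<le> (\<Sum>k\<in>{1..K}. B * (\<integral>\<theta>. norm (dtheta (c k) \<theta>) \<partial>leb01))"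
          by (rule varifold_pair_bound[OF B(1)[OF \<omega>(1)] B(2)[OF \<omega>]]) (auto intro: c)
        moreover have "\<bar>varifold_pair K1 c1 \<omega>\<bar> \<le> (\<Sum>k\<in>{1..K1}. B * (\<integral>\<theta>. norm (dtheta (c1 k) \<theta>) \<partial>leb01))"
          by (rule varifold_pair_bound[OF B(1)[OF \<omega>(1)] B(2)[OF \<omega>]]) (auto intro: c1)
        ultimately show ?thesis unfolding y by linarith
      qed
    qed
  qed (use \<omega> in blast)
qed

lemma varifold_distance_nonneg:
  fixes c c1 :: "nat \<Rightarrow> real \<Rightarrow> 'a::euclidean_space"
  assumes emb: "rkhs_embeds_C01 ker" and c: "\<And>k. k \<in> {1..K} \<Longrightarrow> regular_curve (c k)"
    and c1: "\<And>k. k \<in> {1..K1} \<Longrightarrow> regular_curve (c1 k)"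
  shows "0 \<le> varifold_distance ker K c K1 c1"
  using varifold_distance_upper[OF assms zero_in_rkhs] by (simp add: varifold_pair_eq varifold_integrand_def)

text \<open>For each fixed test function the pairing converges, and along the sequence it lies below
  the distances; the supremum over test functions is taken last.\<close>

lemma varifold_distance_lsc:
  fixes f :: "nat \<Rightarrow> nat \<Rightarrow> real \<Rightarrow> 'a::euclidean_space"
  assumes emb: "rkhs_embeds_C01 ker"
    and f: "\<And>j k. k \<in> {1..K} \<Longrightarrow> regular_curve (f j k)" and g: "\<And>k. k \<in> {1..K} \<Longrightarrow> regular_curve (g k)"
    and c1: "\<And>k. k \<in> {1..K1} \<Longrightarrow> regular_curve (c1 k)"
    and lim: "\<And>k \<theta>. k \<in> {1..K} \<Longrightarrow> \<theta> \<in> {0..1} \<Longrightarrow> (\<lambda>j. f j k \<theta>) \<longlonglongrightarrow> g k \<theta>"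
      "\<And>k \<theta>. k \<in> {1..K} \<Longrightarrow> \<theta> \<in> {0..1} \<Longrightarrow> (\<lambda>j. dtheta (f j k) \<theta>) \<longlonglongrightarrow> dtheta (g k) \<theta>"
    and Q: "\<And>j k \<theta>. k \<in> {1..K} \<Longrightarrow> \<theta> \<in> {0..1} \<Longrightarrow> norm (dtheta (f j k) \<theta>) \<le> Q k"
    and v: "(\<lambda>j. varifold_distance ker K (f j) K1 c1) \<longlonglongrightarrow> v"
  shows "varifold_distance ker K g K1 c1 \<le> v"
proof -
  obtain B where B: "\<And>\<omega>. in_rkhs ker \<omega> \<Longrightarrow> continuous_on VS \<omega>"
    "\<And>\<omega> p. in_rkhs ker \<omega> \<Longrightarrow> rkhs_norm ker \<omega> \<le> 1 \<Longrightarrow> p \<in> VS \<Longrightarrow> \<bar>\<omega> p\<bar> \<le> B"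
    by (rule rkhs_unit_ball[OF emb]) blast
  show ?thesis
    unfolding varifold_norm_def[of ker "\<lambda>\<omega>. varifold_pair K g \<omega> - varifold_pair K1 c1 \<omega>"]
  proof (rule cSup_least)
    show "{varifold_pair K g \<omega> - varifold_pair K1 c1 \<omega> |\<omega>. in_rkhs ker \<omega> \<and> rkhs_norm ker \<omega> \<le> 1} \<noteq> {}"
      using zero_in_rkhs[of ker] by blast
    fix y assume "y \<in> {varifold_pair K g \<omega> - varifold_pair K1 c1 \<omega> |\<omega>. in_rkhs ker \<omega> \<and> rkhs_norm ker \<omega> \<le> 1}"
    then obtain \<omega> where y: "y = varifold_pair K g \<omega> - varifold_pair K1 c1 \<omega>" and \<omega>: "in_rkhs ker \<omega>" "rkhs_norm ker \<omega> \<le> 1"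
      by blast
    have "(\<lambda>j. varifold_pair K (f j) \<omega> - varifold_pair K1 c1 \<omega>) \<longlonglongrightarrow> y"
      unfolding y by (intro tendsto_diff tendsto_const varifold_pair_tendsto[OF B(1)[OF \<omega>(1)] B(2)[OF \<omega>] f g lim Q])
    then show "y \<le> v"
      by (rule LIMSEQ_le[OF _ v]) (intro exI allI impI varifold_distance_upper[OF emb f c1 \<omega>])
  qed
qed

section \<open>Existence of a minimiser\<close>

text \<open>Extraction one index at a time; stability of \<open>P\<close> under further subsequences
  preserves what was obtained before.\<close>

lemma finite_subsequence:
  fixes P :: "'k \<Rightarrow> (nat \<Rightarrow> nat) \<Rightarrow> bool"
  assumes "finite I"
    and sub: "\<And>k s r. k \<in> I \<Longrightarrow> P k s \<Longrightarrow> strict_mono r \<Longrightarrow> P k (s \<circ> r)"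
    and ex: "\<And>k s. k \<in> I \<Longrightarrow> strict_mono s \<Longrightarrow> \<exists>r. strict_mono (r :: nat \<Rightarrow> nat) \<and> P k (s \<circ> r)"
  shows "\<exists>s. strict_mono s \<and> (\<forall>k\<in>I. P k s)"
  using assms
proof (induction I rule: finite_induct)
  case empty
  show ?case by (intro exI[of _ id]) (simp add: strict_mono_id)
next
  case (insert k I)
  have "\<exists>s. strict_mono s \<and> (\<forall>k\<in>I. P k s)"
    by (rule insert.IH) (rule insert.prems(1)[OF insertI2] insert.prems(2)[OF insertI2]; assumption)+
  then obtain s where s: "strict_mono s" "\<forall>k\<in>I. P k s" by blast
  obtain r where r: "strict_mono r" "P k (s \<circ> r)" using insert.prems(2)[of k s] s(1) by blast
  have "\<forall>k'\<in>insert k I. P k' (s \<circ> r)" using r s(2) insert.prems(1)[of _ s r] by blast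
  then show ?case using strict_mono_o[OF s(1) r(1)] by blast
qed

lemma le_of_energy_lsc:
  fixes x e R :: real
  assumes "\<And>\<epsilon>. 0 < \<epsilon> \<Longrightarrow> x \<le> (1 + \<epsilon>)\<^sup>2 * (e + \<epsilon>) + R * \<epsilon>"
  shows "x \<le> e"
proof -
  have "(\<lambda>i. inverse (real (Suc i))) \<longlonglongrightarrow> 0" by (rule LIMSEQ_inverse_real_of_nat)
  then have "(\<lambda>i. (1 + inverse (real (Suc i)))\<^sup>2 * (e + inverse (real (Suc i))) + R * inverse (real (Suc i))) \<longlonglongrightarrow>
      (1 + 0)\<^sup>2 * (e + 0) + R * 0"
    by (intro tendsto_intros)
  then have "x \<le> (1 + 0)\<^sup>2 * (e + 0) + R * 0"
    by (rule LIMSEQ_le_const) (use assms in auto)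
  then show ?thesis by simp
qed

text \<open>The convex combinations are chosen once for all components and all arc length derivatives, so that
  the limit energies of the components add up.\<close>
theorem graph_path_limit:
  fixes x q :: "nat \<Rightarrow> nat \<Rightarrow> real \<Rightarrow> real \<Rightarrow> 'a::euclidean_space"
  assumes fin: "finite I" and n: "2 \<le> n"
    and est: "\<And>j k. k \<in> I \<Longrightarrow> arc_estimates n a (x j k) (q j k) (E j k) M (m0 k) (M0 k)"
    and x0: "\<And>j k \<theta>. k \<in> I \<Longrightarrow> \<theta> \<in> {0..1} \<Longrightarrow> x j k 0 \<theta> = c0 k \<theta>" and imm: "\<And>k. k \<in> I \<Longrightarrow> imm n (c0 k)"
    and q0: "\<And>j k \<theta>. k \<in> I \<Longrightarrow> \<theta> \<in> {0..1} \<Longrightarrow> q j k 0 \<theta> = dtheta (c0 k) \<theta>"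
    and e: "(\<lambda>j. \<Sum>k\<in>I. total_energy n a (q j k) (E j k)) \<longlonglongrightarrow> e"
  shows "\<exists>r cl ql El. strict_mono (r :: nat \<Rightarrow> nat) \<and>
    (\<forall>k\<in>I. arc_converges (\<lambda>j. x (r j) k) (\<lambda>j. q (r j) k) (cl k) (ql k) \<and> arc_path n (cl k) (ql k) (El k) \<and>
       (\<exists>W. chain_path n (cl k) W \<and> W 0 = El k 0) \<and> (\<forall>t\<in>{0..1}. imm n (cl k t)) \<and>
       (\<forall>\<theta>\<in>{0..1}. cl k 0 \<theta> = c0 k \<theta>) \<and>
       (\<integral>\<^sup>+t. arc_energy n a (ql k) (El k) t \<partial>leb01) = ennreal (total_energy n a (ql k) (El k))) \<and>
    (\<Sum>k\<in>I. total_energy n a (ql k) (El k)) \<le> e"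
proof -
  have "\<exists>s. strict_mono s \<and> (\<forall>k\<in>I. \<exists>cl ql. arc_converges (\<lambda>j. x (s j) k) (\<lambda>j. q (s j) k) cl ql)"
  proof (rule finite_subsequence[OF fin])
    fix k s r assume "k \<in> I" "strict_mono (r :: nat \<Rightarrow> nat)"
      "\<exists>cl ql. arc_converges (\<lambda>j. x (s j) k) (\<lambda>j. q (s j) k) cl ql"
    then show "\<exists>cl ql. arc_converges (\<lambda>j. x ((s \<circ> r) j) k) (\<lambda>j. q ((s \<circ> r) j) k) cl ql"
      using arc_converges_subseq[of "\<lambda>j. x (s j) k" "\<lambda>j. q (s j) k" _ _ r] by (auto simp: o_def)
  next
    fix k s assume k: "k \<in> I" and s: "strict_mono (s :: nat \<Rightarrow> nat)"
    have cont: "continuous_on {0..1} (dtheta (c0 k))" by (rule imm_dtheta[OF imm[OF k] n])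
    obtain r c' q' where "strict_mono (r :: nat \<Rightarrow> nat)"
      "arc_converges (\<lambda>j. x (s (r j)) k) (\<lambda>j. q (s (r j)) k) c' q'"
      by (rule arc_subsequence[where c = "\<lambda>j. x (s j) k" and q = "\<lambda>j. q (s j) k" and E = "\<lambda>j. E (s j) k"
          and ?q0.0 = "dtheta (c0 k)" and ?c0.0 = "c0 k", OF est[OF k] q0[OF k] cont x0[OF k]]) blast+
    then show "\<exists>r. strict_mono r \<and> (\<exists>cl ql. arc_converges (\<lambda>j. x ((s \<circ> r) j) k) (\<lambda>j. q ((s \<circ> r) j) k) cl ql)"
      by (auto simp: o_def)
  qed
  then obtain r where r: "strict_mono r" and "\<forall>k\<in>I. \<exists>cl ql. arc_converges (\<lambda>j. x (r j) k) (\<lambda>j. q (r j) k) cl ql"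
    by blast
  then obtain cl ql where conv: "\<And>k. k \<in> I \<Longrightarrow> arc_converges (\<lambda>j. x (r j) k) (\<lambda>j. q (r j) k) (cl k) (ql k)"
    by metis
  \<comment> \<open>Indexing by pairs (component, order) makes the compactness lemma produce one
    family of weights for all of them.\<close>
  define X where "X j kl = case_prod (E (r j) (fst kl) (snd kl))" for j kl
  define C where "C = (\<Sum>kl\<in>I \<times> {..n}. M / arc_estimates.energy_weight a M (m0 (fst kl)) (M0 (fst kl)) (snd kl))"
  have Xl2: "l2 leb01sq (X j kl)" if "kl \<in> I \<times> {..n}" for j kl
    unfolding X_def using arc_estimates.E_l2(1)[OF est] that by auto
  have XC: "(\<Sum>kl\<in>I \<times> {..n}. \<integral>p. (norm (X j kl p))\<^sup>2 \<partial>leb01sq) \<le> C" for j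
    unfolding C_def X_def by (intro sum_mono arc_estimates.E_l2(2)[OF est]) auto
  have fin': "finite (I \<times> {..n})" using fin by simp
  obtain N lam where cvx: "\<And>m. cvx m (N m) (lam m)" and cauchy: "\<And>e. 0 < e \<Longrightarrow> \<exists>m0. \<forall>m\<ge>m0. \<forall>m'\<ge>m0. \<forall>k\<in>I \<times> {..n}.
       (\<integral>p. (norm ((\<Sum>i\<le>N m. lam m i *\<^sub>R X i k p) - (\<Sum>i\<le>N m'. lam m' i *\<^sub>R X i k p)))\<^sup>2 \<partial>leb01sq) < e"
    by (rule convex_combinations_cauchy[where X = X, OF fin' Xl2 XC]) blast+
  have ex: "\<exists>Y. l2 leb01sq Y \<and> (\<lambda>m. \<integral>p. (norm ((\<Sum>j\<le>N m. lam m j *\<^sub>R X j kl p) - Y p))\<^sup>2 \<partial>leb01sq) \<longlonglongrightarrow> 0"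
    if kl: "kl \<in> I \<times> {..n}" for kl
  proof -
    have 1: "l2 leb01sq (\<lambda>p. \<Sum>j\<le>N m. lam m j *\<^sub>R X j kl p)" for m
      by (intro l2_sum l2_scaleR Xl2 kl)
    have 2: "\<exists>J. \<forall>i\<ge>J. \<forall>j\<ge>J. (\<integral>p. (norm ((\<Sum>l\<le>N i. lam i l *\<^sub>R X l kl p) - (\<Sum>l\<le>N j. lam j l *\<^sub>R X l kl p)))\<^sup>2 \<partial>leb01sq) < e"
      if "0 < e" for e using cauchy[OF that] kl by blast
    obtain Y where "l2 leb01sq Y" "(\<lambda>m. \<integral>p. (norm ((\<Sum>j\<le>N m. lam m j *\<^sub>R X j kl p) - Y p))\<^sup>2 \<partial>leb01sq) \<longlonglongrightarrow> 0"
      by (rule leb01_pair.P.l2_complete[where X = "\<lambda>m p. \<Sum>j\<le>N m. lam m j *\<^sub>R X j kl p", OF 1 2])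
    then show ?thesis by blast
  qed
  have "\<exists>Y. \<forall>kl\<in>I \<times> {..n}. l2 leb01sq (Y kl) \<and>
      (\<lambda>m. \<integral>p. (norm ((\<Sum>j\<le>N m. lam m j *\<^sub>R X j kl p) - Y kl p))\<^sup>2 \<partial>leb01sq) \<longlonglongrightarrow> 0"
    by (rule bchoice) (intro ballI ex)
  then obtain Y where Y': "\<forall>kl\<in>I \<times> {..n}. l2 leb01sq (Y kl) \<and>
      (\<lambda>m. \<integral>p. (norm ((\<Sum>j\<le>N m. lam m j *\<^sub>R X j kl p) - Y kl p))\<^sup>2 \<partial>leb01sq) \<longlonglongrightarrow> 0"
    by (rule exE)
  note Y = conjunct1[OF bspec[OF Y']] conjunct2[OF bspec[OF Y']]
  have lim: "arc_limit n a (\<lambda>j. x (r j) k) (\<lambda>j. q (r j) k) (\<lambda>j. E (r j) k) M (m0 k) (M0 k) (c0 k) (dtheta (c0 k))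
      (cl k) (ql k) N lam (\<lambda>i. curry (Y (k, i)))" if k: "k \<in> I" for k
  proof (rule arc_limit.intro)
    show "arc_estimates n a (x (r j) k) (q (r j) k) (E (r j) k) M (m0 k) (M0 k)" for j by (rule est[OF k])
    show "arc_converges (\<lambda>j. x (r j) k) (\<lambda>j. q (r j) k) (cl k) (ql k)" by (rule conv[OF k])
    show "l2 leb01sq (case_prod (curry (Y (k, i))))" if "i \<le> n" for i using Y(1)[of "(k, i)"] k that by simp
    show "(\<lambda>m. \<integral>p. (norm ((\<Sum>j\<le>N m. lam m j *\<^sub>R case_prod (E (r j) k i) p) - case_prod (curry (Y (k, i))) p))\<^sup>2 \<partial>leb01sq) \<longlonglongrightarrow> 0"
      if "i \<le> n" for i using Y(2)[of "(k, i)"] k that by (simp add: X_def)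
  qed (rule x0[OF k] q0[OF k] cvx; assumption?)+
  define El where "El k = arc_limit.El n (ql k) (\<lambda>i. curry (Y (k, i)))" for k
  have props: "arc_path n (cl k) (ql k) (El k) \<and> (\<exists>W. chain_path n (cl k) W \<and> W 0 = El k 0) \<and>
      (\<forall>t\<in>{0..1}. imm n (cl k t)) \<and> (\<forall>\<theta>\<in>{0..1}. cl k 0 \<theta> = c0 k \<theta>) \<and>
      (\<integral>\<^sup>+t. arc_energy n a (ql k) (El k) t \<partial>leb01) = ennreal (total_energy n a (ql k) (El k))" if k: "k \<in> I" for k
  proof -
    note L = lim[OF k]
    have ap: "arc_path n (cl k) (ql k) (El k)" unfolding El_def by (rule arc_limit.limit_arc_path[OF L])
    have El2: "l2 leb01sq (case_prod (El k i))" if "i \<le> n" for i unfolding El_def by (rule arc_limit.El_l2[OF L that])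
    have c0: "cl k 0 \<theta> = c0 k \<theta>" if "\<theta> \<in> {0..1}" for \<theta> by (rule arc_limit.limit_initial(2)[OF L that])
    obtain D where "hn_chain n (c0 k) D" "\<forall>\<theta>\<in>{0..1}. D 1 \<theta> \<noteq> 0" using imm[OF k] unfolding imm_def by blast
    then have i0: "imm n (cl k 0)" unfolding imm_def hn_chain_def using c0 by auto
    have C: "norm (ql k t \<theta>) \<le> arc_estimates.Mq a M (M0 k)" if "t \<in> {0..1}" "\<theta> \<in> {0..1}" for t \<theta>
      by (rule arc_limit.ql_bounds(2)[OF L that])
    show ?thesis
    proof (intro conjI ballI ap c0)
      show "\<exists>W. chain_path n (cl k) W \<and> W 0 = El k 0" by (rule arc_path_admissible(1)[OF ap n El2 C i0])
      show "imm n (cl k t)" if "t \<in> {0..1}" for t by (rule arc_path_admissible(2)[OF ap n El2 C i0 that])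
      show "(\<integral>\<^sup>+t. arc_energy n a (ql k) (El k) t \<partial>leb01) = ennreal (total_energy n a (ql k) (El k))"
        unfolding El_def by (rule arc_limit.limit_energy[OF L])
    qed
  qed
  have "(\<Sum>k\<in>I. total_energy n a (ql k) (El k)) \<le> (1 + \<epsilon>)\<^sup>2 * (e + \<epsilon>) + real (card I) * \<epsilon>" if \<epsilon>: "0 < \<epsilon>" for \<epsilon>
  proof -
    have "\<forall>k\<in>I. \<exists>m0. \<forall>m\<ge>m0. total_energy n a (ql k) (El k) \<le>
        (1 + \<epsilon>)\<^sup>2 * (\<Sum>j\<le>N m. lam m j * total_energy n a (q (r j) k) (E (r j) k)) + \<epsilon>"
    proof
      fix k assume "k \<in> I"
      from arc_limit.energy_lsc[OF lim[OF this] \<epsilon>]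
      show "\<exists>m0. \<forall>m\<ge>m0. total_energy n a (ql k) (El k) \<le>
        (1 + \<epsilon>)\<^sup>2 * (\<Sum>j\<le>N m. lam m j * total_energy n a (q (r j) k) (E (r j) k)) + \<epsilon>"
        unfolding El_def .
    qed
    from bchoice[OF this] obtain mk where mk: "\<forall>k\<in>I. \<forall>m\<ge>mk k. total_energy n a (ql k) (El k) \<le>
        (1 + \<epsilon>)\<^sup>2 * (\<Sum>j\<le>N m. lam m j * total_energy n a (q (r j) k) (E (r j) k)) + \<epsilon>" by (rule exE)
    have "(\<lambda>j. \<Sum>k\<in>I. total_energy n a (q (r j) k) (E (r j) k)) \<longlonglongrightarrow> e"
      using LIMSEQ_subseq_LIMSEQ[OF e r] by (simp add: o_def)
    from LIMSEQ_D[OF this \<epsilon>] obtain J where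
      J: "\<And>j. J \<le> j \<Longrightarrow> (\<Sum>k\<in>I. total_energy n a (q (r j) k) (E (r j) k)) \<le> e + \<epsilon>" by fastforce
    \<comment> \<open>The sum of the finitely many thresholds is at least each of them, and adding
      \<open>J\<close> keeps all total energies in the tail at most e + \<epsilon>.\<close>
    define m where "m = J + (\<Sum>k\<in>I. mk k)"
    have mkm: "mk k \<le> m" if "k \<in> I" for k
      unfolding m_def using member_le_sum[of k I mk] that fin by simp
    have "(\<Sum>k\<in>I. total_energy n a (ql k) (El k)) \<le>
        (\<Sum>k\<in>I. (1 + \<epsilon>)\<^sup>2 * (\<Sum>j\<le>N m. lam m j * total_energy n a (q (r j) k) (E (r j) k)) + \<epsilon>)"
      by (rule sum_mono) (use mk mkm in blast)
    also have "\<dots> = (1 + \<epsilon>)\<^sup>2 * (\<Sum>k\<in>I. \<Sum>j\<le>N m. lam m j * total_energy n a (q (r j) k) (E (r j) k)) + real (card I) * \<epsilon>"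
      unfolding sum.distrib sum_distrib_left[symmetric] by simp
    also have "(\<Sum>k\<in>I. \<Sum>j\<le>N m. lam m j * total_energy n a (q (r j) k) (E (r j) k)) =
        (\<Sum>j\<le>N m. lam m j * (\<Sum>k\<in>I. total_energy n a (q (r j) k) (E (r j) k)))"
      unfolding sum_distrib_left by (rule sum.swap)
    finally have 1: "(\<Sum>k\<in>I. total_energy n a (ql k) (El k)) \<le> (1 + \<epsilon>)\<^sup>2 *
        (\<Sum>j\<le>N m. lam m j * (\<Sum>k\<in>I. total_energy n a (q (r j) k) (E (r j) k))) + real (card I) * \<epsilon>" .
    have "(\<Sum>j\<le>N m. lam m j * (\<Sum>k\<in>I. total_energy n a (q (r j) k) (E (r j) k))) \<le> e + \<epsilon>"
      by (rule cvx_sum_le[OF cvx]) (use J in \<open>simp add: m_def\<close>)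
    then have "(1 + \<epsilon>)\<^sup>2 * (\<Sum>j\<le>N m. lam m j * (\<Sum>k\<in>I. total_energy n a (q (r j) k) (E (r j) k))) \<le> (1 + \<epsilon>)\<^sup>2 * (e + \<epsilon>)"
      by (intro mult_left_mono) auto
    with 1 show ?thesis by linarith
  qed
  then have "(\<Sum>k\<in>I. total_energy n a (ql k) (El k)) \<le> e" by (rule le_of_energy_lsc)
  then show ?thesis using r conv props by blast
qed

lemma imm_dtheta_bounds:
  fixes f :: "real \<Rightarrow> 'a::euclidean_space"
  assumes "imm n f" "2 \<le> n"
  shows "\<exists>b. 0 < fst b \<and> (\<forall>\<theta>\<in>{0..1}. fst b \<le> norm (dtheta f \<theta>) \<and> norm (dtheta f \<theta>) \<le> snd b)"
proof -
  have r: "continuous_on {0..1} (dtheta f)" "\<And>\<theta>. \<theta> \<in> {0..1} \<Longrightarrow> dtheta f \<theta> \<noteq> 0"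
    using imm_imp_regular_curve[OF assms] unfolding regular_curve_def by auto
  obtain B where B: "\<And>\<theta>. \<theta> \<in> {0..1} \<Longrightarrow> norm (dtheta f \<theta>) \<le> B" by (rule bounded_on_unit[OF r(1)]) blast
  obtain x where x: "x \<in> {0..1::real}" "\<And>y. y \<in> {0..1} \<Longrightarrow> norm (dtheta f x) \<le> norm (dtheta f y)"
    using continuous_attains_inf[OF _ _ continuous_on_norm[OF r(1)]] by auto
  show ?thesis by (rule exI[of _ "(norm (dtheta f x), B)"]) (use x B r(2)[OF x(1)] in simp)
qed

lemma dtheta_cong:
  assumes "imm n f" "2 \<le> n" "\<And>x. x \<in> {0..1} \<Longrightarrow> g x = f x" "\<theta> \<in> {0..1}"
  shows "dtheta g \<theta> = dtheta f \<theta>"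
proof (rule imm_dtheta[OF assms(1,2)])
  assume d: "continuous_on {0..1} (dtheta f)" "has_prim f (dtheta f)"
  have "has_prim g (dtheta f) \<longleftrightarrow> has_prim f (dtheta f)" by (rule has_prim_cong[OF assms(3) refl])
  then show ?thesis using dtheta_eq[OF _ d(1) assms(4)] d(2) by blast
qed

text \<open>Makes the set of admissible paths nonempty, which settles the case of an infinite
  infimum.\<close>

lemma constant_path:
  assumes "graph n K A c0"
  shows "(\<lambda>k t. c0 k) \<in> h1_graph_paths n K A"
proof -
  have "has_prim (\<lambda>_. 0) (\<lambda>_. 0 :: 'a)" by (rule has_primI) (auto simp: prim_def)
  then have "chain_path n (\<lambda>t. c0 k) (\<lambda>_ _ _. 0)" for k
    by (auto simp: chain_path_def l2_def case_prod_beta' prim_def)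
  then have "h1_path n (\<lambda>t. c0 k)" for k
    using chain_path_imp_h1_with unfolding h1_path_def by blast
  then show ?thesis using assms unfolding h1_graph_paths_def by simp
qed

theorem theorem3p1:
  fixes n K K1 :: nat
    and A A1 :: "nat \<Rightarrow> nat \<Rightarrow> bool"
    and c0 c1 :: "nat \<Rightarrow> real \<Rightarrow> 'a::euclidean_space"
    and a :: "nat \<Rightarrow> real"
    and ker :: "'a \<times> 'a \<Rightarrow> 'a \<times> 'a \<Rightarrow> real"
    and lam :: real
  assumes "n \<ge> 2"
    and "K \<ge> 1" and "graph n K A c0"
    and "K1 \<ge> 1" and "graph n K1 A1 c1"
    and "\<forall>i. a i > 0"
    and "pos_def_kernel ker" and "rkhs_embeds_C01 ker"
    and "lam > 0"
  shows "\<exists>c \<in> {c \<in> h1_graph_paths n K A. \<forall>k\<in>{1..K}. \<forall>\<theta>\<in>{0..1}. c k 0 \<theta> = c0 k \<theta>}.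
           matching_functional n a ker lam K K1 c1 c =
           (INF c' \<in> {c \<in> h1_graph_paths n K A. \<forall>k\<in>{1..K}. \<forall>\<theta>\<in>{0..1}. c k 0 \<theta> = c0 k \<theta>}.
              matching_functional n a ker lam K K1 c1 c')"
proof -
  let ?S = "{c \<in> h1_graph_paths n K A. \<forall>k\<in>{1..K}. \<forall>\<theta>\<in>{0..1}. c k 0 \<theta> = c0 k \<theta>}"
  let ?F = "matching_functional n a ker lam K K1 c1"
  note n = assms(1) and graph0 = assms(3) and emb = assms(8) and lam = assms(9)
  have a: "0 < a i" for i using assms(6) by blast
  have n1: "1 \<le> n" using n by simp
  define V :: "(nat \<Rightarrow> real \<Rightarrow> real \<Rightarrow> 'a) \<Rightarrow> real" where "V x = varifold_distance ker K (\<lambda>k. x k 1) K1 c1" for x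
  have F: "?F x = path_energy n a K x + ennreal (lam * (V x)\<^sup>2)" for x
    unfolding matching_functional_def V_def ..
  have immS: "imm n (x k t)" if "x \<in> ?S" "k \<in> {1..K}" "t \<in> {0..1}" for x k t
    using that unfolding h1_graph_paths_def graph_def by blast
  have imm0: "imm n (c0 k)" if "k \<in> {1..K}" for k using graph0 that unfolding graph_def by blast
  have reg1: "regular_curve (c1 k)" if "k \<in> {1..K1}" for k
    using assms(5) that unfolding graph_def by (intro imm_imp_regular_curve[OF _ n]) blast
  have regS: "regular_curve (x k 1)" if "x \<in> ?S" "k \<in> {1..K}" for x k
    by (rule imm_imp_regular_curve[OF immS[OF that] n]) simp
  show ?thesis
  proof (cases "(INF x\<in>?S. ?F x) = top")
    case True
    \<comment> \<open>The functional takes values in \<open>ennreal\<close>; if its infimum is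
      infinite, every admissible path attains it, for example the constant one.\<close>
    have "(\<lambda>k t. c0 k) \<in> ?S" using constant_path[OF graph0] by simp
    moreover from INF_lower[OF this, of ?F] True have "?F (\<lambda>k t. c0 k) = top" by (simp add: top_unique)
    ultimately show ?thesis using True by (intro bexI[of _ "\<lambda>k t. c0 k"]) auto
  next
    case False
    define i where "i = enn2real (INF x\<in>?S. ?F x)"
    have i: "(INF x\<in>?S. ?F x) = ennreal i" "0 \<le> i" unfolding i_def using False
      by (simp_all only: less_top ennreal_enn2real enn2real_nonneg)
    have "\<exists>x. x \<in> ?S \<and> ?F x < ennreal (i + 1 / real (Suc j))" for j
    proof -
      have "(INF x\<in>?S. ?F x) < ennreal (i + 1 / real (Suc j))"
        unfolding i(1) using i(2) by (intro ennreal_lessI) (simp_all add: add_nonneg_pos)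
      then show ?thesis unfolding INF_less_iff by blast
    qed
    then have "\<forall>j. \<exists>x. x \<in> ?S \<and> ?F x < ennreal (i + 1 / real (Suc j))" by blast
    from choice[OF this] obtain x where x: "\<And>j. x j \<in> ?S" "\<And>j. ?F (x j) < ennreal (i + 1 / real (Suc j))" by blast
    define M where "M = i + 1"
    have M: "0 \<le> M" unfolding M_def using i(2) by simp
    \<comment> \<open>Arc length coordinates are chosen for all members of the sequence and all
      components at once, hence the choice over pairs.\<close>
    have "\<forall>jk. \<exists>qE. snd jk \<in> {1..K} \<longrightarrow> arc_path n (x (fst jk) (snd jk)) (fst qE) (snd qE) \<and>
        (AE t in leb01. metricG n a (x (fst jk) (snd jk) t) (path_vel n (x (fst jk) (snd jk)) t) = arc_energy n a (fst qE) (snd qE) t)"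
    proof
      fix jk :: "nat \<times> nat"
      show "\<exists>qE. snd jk \<in> {1..K} \<longrightarrow> arc_path n (x (fst jk) (snd jk)) (fst qE) (snd qE) \<and>
        (AE t in leb01. metricG n a (x (fst jk) (snd jk) t) (path_vel n (x (fst jk) (snd jk)) t) = arc_energy n a (fst qE) (snd qE) t)"
      proof (cases "snd jk \<in> {1..K}")
        case True
        have "h1_path n (x (fst jk) (snd jk))" using x(1)[of "fst jk"] True unfolding h1_graph_paths_def by blast
        from h1_path_imp_arc_path[OF this immS[OF x(1) True] n, of a] show ?thesis by auto
      qed blast
    qed
    from choice[OF this] obtain QE where QE: "\<forall>jk. snd jk \<in> {1..K} \<longrightarrow> arc_path n (x (fst jk) (snd jk)) (fst (QE jk)) (snd (QE jk)) \<and>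
        (AE t in leb01. metricG n a (x (fst jk) (snd jk) t) (path_vel n (x (fst jk) (snd jk)) t) = arc_energy n a (fst (QE jk)) (snd (QE jk)) t)"
      by (rule exE)
    define q where "q j k = fst (QE (j, k))" for j k
    define E where "E j k = snd (QE (j, k))" for j k
    have ap: "arc_path n (x j k) (q j k) (E j k)"
      and ae: "AE t in leb01. metricG n a (x j k t) (path_vel n (x j k) t) = arc_energy n a (q j k) (E j k) t"
      if "k \<in> {1..K}" for j k
      using QE[rule_format, of "(j, k)"] that unfolding q_def E_def by auto
    have pe: "path_energy n a K (x j) = (\<Sum>k\<in>{1..K}. \<integral>\<^sup>+t. arc_energy n a (q j k) (E j k) t \<partial>leb01)" for j
      by (rule path_energy_eq[OF ap ae])
    have FM: "?F (x j) \<le> ennreal M" for j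
    proof -
      have "?F (x j) \<le> ennreal (i + 1 / real (Suc j))" using x(2)[of j] by simp
      also have "\<dots> \<le> ennreal M" unfolding M_def by (intro ennreal_leI add_left_mono) simp
      finally show ?thesis .
    qed
    have energyM: "(\<integral>\<^sup>+t. arc_energy n a (q j k) (E j k) t \<partial>leb01) \<le> ennreal M" if "k \<in> {1..K}" for j k
    proof -
      have "(\<integral>\<^sup>+t. arc_energy n a (q j k) (E j k) t \<partial>leb01) \<le> path_energy n a K (x j)"
        unfolding pe by (rule member_le_sum[OF that]) simp_all
      also have "\<dots> \<le> ?F (x j)" unfolding F by simp
      finally show ?thesis using FM[of j] by (rule order_trans)
    qed
    have x0: "x j k 0 \<theta> = c0 k \<theta>" if "k \<in> {1..K}" "\<theta> \<in> {0..1}" for j k \<theta> using x(1)[of j] that by blast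
    have q0: "q j k 0 \<theta> = dtheta (c0 k) \<theta>" if k: "k \<in> {1..K}" and \<theta>: "\<theta> \<in> {0..1}" for j k \<theta>
      using arc_path_dtheta[OF ap[OF k, where j = j] _ \<theta>, of 0] dtheta_cong[OF imm0[OF k] n x0[OF k, where j = j] \<theta>] by simp
    have "\<forall>k\<in>{1..K}. \<exists>b. 0 < fst b \<and> (\<forall>\<theta>\<in>{0..1}. fst b \<le> norm (dtheta (c0 k) \<theta>) \<and> norm (dtheta (c0 k) \<theta>) \<le> snd b)"
      using imm_dtheta_bounds[OF imm0 n] by blast
    from bchoice[OF this] obtain b where b: "\<forall>k\<in>{1..K}. 0 < fst (b k) \<and>
        (\<forall>\<theta>\<in>{0..1}. fst (b k) \<le> norm (dtheta (c0 k) \<theta>) \<and> norm (dtheta (c0 k) \<theta>) \<le> snd (b k))"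
      by (rule exE)
    have est: "arc_estimates n a (x j k) (q j k) (E j k) M (fst (b k)) (snd (b k))" if k: "k \<in> {1..K}" for j k
    proof (rule arc_estimates.intro)
      show "fst (b k) \<le> norm (q j k 0 \<theta>)" "norm (q j k 0 \<theta>) \<le> snd (b k)" if "\<theta> \<in> {0..1}" for \<theta>
        using b k q0[OF k that] that by auto
    qed (use n a ap[OF k] energyM[OF k] M b k in auto)
    define e where "e j = (\<Sum>k\<in>{1..K}. total_energy n a (q j k) (E j k))" for j
    have e0: "0 \<le> e j" for j unfolding e_def by (intro sum_nonneg total_energy_nonneg a)
    have pe_e: "path_energy n a K (x j) = ennreal (e j)" for j
    proof -
      have "path_energy n a K (x j) = (\<Sum>k\<in>{1..K}. ennreal (total_energy n a (q j k) (E j k)))"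
        unfolding pe by (rule sum.cong[OF refl arc_estimates.nn_integral_energy[OF est]])
      also have "\<dots> = ennreal (e j)" unfolding e_def by (rule sum_ennreal) (rule total_energy_nonneg[OF a])
      finally show ?thesis .
    qed
    have V0: "0 \<le> V y" if "y \<in> ?S" for y
      unfolding V_def by (rule varifold_distance_nonneg[OF emb regS[OF that] reg1])
    have Fe: "?F (x j) = ennreal (e j + lam * (V (x j))\<^sup>2)" for j
      unfolding F pe_e using e0[of j] lam by (simp add: ennreal_plus)
    have lower: "i \<le> e j + lam * (V (x j))\<^sup>2" for j
    proof -
      have "ennreal i \<le> ?F (x j)" unfolding i(1)[symmetric] by (rule INF_lower[OF x(1)])
      then show ?thesis unfolding Fe using e0[of j] lam by (subst (asm) ennreal_le_iff) auto
    qed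
    have upper: "e j + lam * (V (x j))\<^sup>2 \<le> i + 1 / real (Suc j)" for j
    proof -
      have "ennreal (e j + lam * (V (x j))\<^sup>2) \<le> ennreal (i + 1 / real (Suc j))"
        using x(2)[of j] unfolding Fe by simp
      then show ?thesis using i(2) by (subst (asm) ennreal_le_iff) auto
    qed
    have upM: "e j + lam * (V (x j))\<^sup>2 \<le> M" for j
      using FM[of j] M unfolding Fe by (subst (asm) ennreal_le_iff) auto
    \<comment> \<open>Energy and varifold distance are bounded separately. Compactness of the box
      gives a subsequence along which each of them converges, so that the two semicontinuity results
      can be applied one by one and added.\<close>
    have box: "(e j, V (x j)) \<in> {0..M} \<times> {0..sqrt (M / lam)}" for j
    proof -
      have "lam * (V (x j))\<^sup>2 \<le> M" using upM[of j] e0[of j] by linarith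
      then have "(V (x j))\<^sup>2 \<le> M / lam" using lam by (simp add: field_simps)
      then have "V (x j) \<le> sqrt (M / lam)" by (rule real_le_rsqrt)
      moreover have "e j \<le> M" using upM[of j] lam by (smt (verit) mult_nonneg_nonneg zero_le_power2)
      ultimately show ?thesis using e0[of j] V0[OF x(1)] by simp
    qed
    have sc: "seq_compact ({0..M} \<times> {0..sqrt (M / lam)})"
      by (intro compact_imp_seq_compact compact_Times compact_Icc)
    obtain ev s where "ev \<in> {0..M} \<times> {0..sqrt (M / lam)}" and s: "strict_mono (s :: nat \<Rightarrow> nat)"
      and evlim: "((\<lambda>j. (e j, V (x j))) \<circ> s) \<longlonglongrightarrow> ev"
      by (rule seq_compactE[OF sc allI[OF box]])
    have elim: "(\<lambda>j. e (s j)) \<longlonglongrightarrow> fst ev" and vlim: "(\<lambda>j. V (x (s j))) \<longlonglongrightarrow> snd ev"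
      using tendsto_fst[OF evlim] tendsto_snd[OF evlim] by (simp_all add: o_def)
    have "(\<lambda>j. e (s j) + lam * (V (x (s j)))\<^sup>2) \<longlonglongrightarrow> fst ev + lam * (snd ev)\<^sup>2"
      by (intro tendsto_intros elim vlim)
    moreover have "(\<lambda>j. i + 1 / real (Suc (s j))) \<longlonglongrightarrow> i + 0"
    proof (rule tendsto_add[OF tendsto_const])
      have "((\<lambda>j. 1 / real (Suc j)) \<circ> s) \<longlonglongrightarrow> 0"
        by (rule LIMSEQ_subseq_LIMSEQ[OF _ s]) (use LIMSEQ_inverse_real_of_nat in \<open>simp add: inverse_eq_divide\<close>)
      then show "(\<lambda>j. 1 / real (Suc (s j))) \<longlonglongrightarrow> 0" by (simp add: o_def)
    qed
    ultimately have evi: "fst ev + lam * (snd ev)\<^sup>2 \<le> i"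
      using upper by (intro LIMSEQ_le[of "\<lambda>j. e (s j) + lam * (V (x (s j)))\<^sup>2" _ "\<lambda>j. i + 1 / real (Suc (s j))"]) auto
    have fin: "finite {1..K}" by simp
    have elim': "(\<lambda>j. \<Sum>k\<in>{1..K}. total_energy n a (q (s j) k) (E (s j) k)) \<longlonglongrightarrow> fst ev"
      using elim unfolding e_def .
    have est': "arc_estimates n a (x (s j) k) (q (s j) k) (E (s j) k) M (fst (b k)) (snd (b k))" if "k \<in> {1..K}" for j k
      by (rule est[OF that])
    from graph_path_limit[where x = "\<lambda>j. x (s j)" and q = "\<lambda>j. q (s j)" and E = "\<lambda>j. E (s j)" and I = "{1..K}" and ?c0.0 = c0
        and ?m0.0 = "\<lambda>k. fst (b k)" and ?M0.0 = "\<lambda>k. snd (b k)", OF fin n est' x0 imm0 q0 elim']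
    obtain r cl ql El where r: "strict_mono (r :: nat \<Rightarrow> nat)" and
      lim: "\<forall>k\<in>{1..K}. arc_converges (\<lambda>j. x (s (r j)) k) (\<lambda>j. q (s (r j)) k) (cl k) (ql k) \<and> arc_path n (cl k) (ql k) (El k) \<and>
       (\<exists>W. chain_path n (cl k) W \<and> W 0 = El k 0) \<and> (\<forall>t\<in>{0..1}. imm n (cl k t)) \<and>
       (\<forall>\<theta>\<in>{0..1}. cl k 0 \<theta> = c0 k \<theta>) \<and>
       (\<integral>\<^sup>+t. arc_energy n a (ql k) (El k) t \<partial>leb01) = ennreal (total_energy n a (ql k) (El k))" and
      le: "(\<Sum>k\<in>{1..K}. total_energy n a (ql k) (El k)) \<le> fst ev"
      by auto
    have conv: "arc_converges (\<lambda>j. x (s (r j)) k) (\<lambda>j. q (s (r j)) k) (cl k) (ql k)"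
      and apl: "arc_path n (cl k) (ql k) (El k)" and Wl: "\<exists>W. chain_path n (cl k) W \<and> W 0 = El k 0"
      and imml: "t \<in> {0..1} \<Longrightarrow> imm n (cl k t)" and cl0: "\<theta> \<in> {0..1} \<Longrightarrow> cl k 0 \<theta> = c0 k \<theta>"
      and enl: "(\<integral>\<^sup>+t. arc_energy n a (ql k) (El k) t \<partial>leb01) = ennreal (total_energy n a (ql k) (El k))"
      if "k \<in> {1..K}" for k t \<theta>
      using lim[rule_format, OF that] by blast+
    have ptlim: "(\<lambda>j. x (s (r j)) k t \<theta>) \<longlonglongrightarrow> cl k t \<theta>" if "k \<in> {1..K}" "t \<in> {0..1}" "\<theta> \<in> {0..1}" for k t \<theta>
      by (rule arc_converges_pointwise(2)[OF conv[OF that(1)] that(2,3)])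
    \<comment> \<open>The incidence conditions of the graph are equalities between endpoint values,
      so they survive pointwise convergence.\<close>
    have endpoints: "cl k t \<theta> = cl l t \<theta>'"
      if "k \<in> {1..K}" "l \<in> {1..K}" "t \<in> {0..1}" "\<theta> \<in> {0..1}" "\<theta>' \<in> {0..1}" "\<And>j. x j k t \<theta> = x j l t \<theta>'" for k l t \<theta> \<theta>'
    proof -
      have "(\<lambda>j. x (s (r j)) k t \<theta>) \<longlonglongrightarrow> cl l t \<theta>'" using ptlim[OF that(2,3,5)] that(6) by simp
      then show ?thesis by (rule LIMSEQ_unique[OF ptlim[OF that(1,3,4)]])
    qed
    have clS: "cl \<in> ?S"
    proof -
      have "h1_path n (cl k)" if "k \<in> {1..K}" for k
        using Wl[OF that] chain_path_imp_h1_with unfolding h1_path_def by blast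
      moreover have "graph n K A (\<lambda>k. cl k t)" if t: "t \<in> {0..1}" for t
        unfolding graph_def
      proof (intro conjI ballI impI)
        fix k assume "k \<in> {1..K}"
        then show "imm n (cl k t)" using imml t by blast
      next
        fix k l assume k: "k \<in> {1..K}" and l: "l \<in> {1..K}"
        have g: "graph n K A (\<lambda>k. x j k t)" for j using x(1)[of j] t unfolding h1_graph_paths_def by blast
        show "A (2*k-1) (2*l-1) \<Longrightarrow> cl k t 0 = cl l t 0"
          by (rule endpoints[OF k l t]) (use g k l in \<open>auto simp: graph_def\<close>)
        show "A (2*k) (2*l) \<Longrightarrow> cl k t 1 = cl l t 1"
          by (rule endpoints[OF k l t]) (use g k l in \<open>auto simp: graph_def\<close>)
        show "A (2*k-1) (2*l) \<Longrightarrow> cl k t 0 = cl l t 1"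
          by (rule endpoints[OF k l t]) (use g k l in \<open>auto simp: graph_def\<close>)
      qed
      ultimately show ?thesis using cl0 unfolding h1_graph_paths_def by blast
    qed
    have "path_energy n a K cl = (\<Sum>k\<in>{1..K}. \<integral>\<^sup>+t. arc_energy n a (ql k) (El k) t \<partial>leb01)"
    proof (rule path_energy_eq[OF apl])
      fix k assume k: "k \<in> {1..K}"
      obtain W where W: "chain_path n (cl k) W" "W 0 = El k 0" using Wl[OF k] by blast
      show "AE t in leb01. metricG n a (cl k t) (path_vel n (cl k) t) = arc_energy n a (ql k) (El k) t"
        by (rule arc_path_metricG[OF apl[OF k] W(1) n1]) (simp add: W(2))
    qed
    also have "\<dots> = (\<Sum>k\<in>{1..K}. ennreal (total_energy n a (ql k) (El k)))" by (rule sum.cong[OF refl enl])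
    also have "\<dots> = ennreal (\<Sum>k\<in>{1..K}. total_energy n a (ql k) (El k))"
      by (rule sum_ennreal) (rule total_energy_nonneg[OF a])
    also have "\<dots> \<le> ennreal (fst ev)" by (rule ennreal_leI[OF le])
    finally have E_le: "path_energy n a K cl \<le> ennreal (fst ev)" .
    have V_le: "V cl \<le> snd ev"
      unfolding V_def
    proof (rule varifold_distance_lsc[where f = "\<lambda>j k. x (s (r j)) k 1" and Q = "\<lambda>k. arc_estimates.Mq a M (snd (b k))",
          OF emb regS[OF x(1)] regS[OF clS] reg1])
      fix k \<theta> assume k: "k \<in> {1..K}" and \<theta>: "\<theta> \<in> {0..1::real}"
      have one: "(1::real) \<in> {0..1}" by simp
      show "(\<lambda>j. x (s (r j)) k 1 \<theta>) \<longlonglongrightarrow> cl k 1 \<theta>" by (rule ptlim[OF k one \<theta>])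
      show "(\<lambda>j. dtheta (x (s (r j)) k 1) \<theta>) \<longlonglongrightarrow> dtheta (cl k 1) \<theta>"
        unfolding arc_path_dtheta[OF ap[OF k] one \<theta>] arc_path_dtheta[OF apl[OF k] one \<theta>]
        by (rule arc_converges_pointwise(1)[OF conv[OF k] one \<theta>])
      show "norm (dtheta (x (s (r j)) k 1) \<theta>) \<le> arc_estimates.Mq a M (snd (b k))" for j
        unfolding arc_path_dtheta[OF ap[OF k] one \<theta>] by (rule arc_estimates.q_bounds(2)[OF est[OF k] one \<theta>])
    next
      show "(\<lambda>j. varifold_distance ker K (\<lambda>k. x (s (r j)) k 1) K1 c1) \<longlonglongrightarrow> snd ev"
        using LIMSEQ_subseq_LIMSEQ[OF vlim r] unfolding V_def by (simp add: o_def)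
    qed
    \<comment> \<open>Squaring preserves the inequality because the distance attained by the limit
      is nonnegative.\<close>
    have "(V cl)\<^sup>2 \<le> (snd ev)\<^sup>2" using V_le V0[OF clS] by (rule power_mono)
    then have Vsq: "lam * (V cl)\<^sup>2 \<le> lam * (snd ev)\<^sup>2" using lam by (intro mult_left_mono) auto
    have ev0: "0 \<le> fst ev" by (rule LIMSEQ_le_const[OF elim]) (use e0 in blast)
    have "?F cl \<le> ennreal (fst ev) + ennreal (lam * (snd ev)\<^sup>2)"
      unfolding F by (intro add_mono E_le ennreal_leI Vsq)
    also have "\<dots> = ennreal (fst ev + lam * (snd ev)\<^sup>2)" using ev0 lam by (simp add: ennreal_plus)
    also have "\<dots> \<le> (INF x\<in>?S. ?F x)" unfolding i(1) by (rule ennreal_leI[OF evi])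
    finally have "?F cl = (INF x\<in>?S. ?F x)" by (intro antisym INF_lower[OF clS])
    then show ?thesis using clS by (rule bexI)
  qed
qed

end
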